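(* Let $\kappa>0$. Then the coupled boundary value problem $$ \left\{ \begin{aligned} & \Delta p + \kappa^2 p = 0,\quad \Delta q - \kappa^2 q = 0 && \text{in } \Omega,\\ & p-q = 0,\quad \partial_\nu p -\partial_\nu q = 0 && \text{on } \partial D,\\ & \partial_r p = T_1 p -g_1,\quad \partial_r q = T_2 q && \text{on } \Gamma_R \end{aligned} \right. $$ for the pair of unknown functions $(p,q)\in H^1(\Omega)\times H^1(\Omega)$ has at most one solution.
   Context: All functions are complex-valued. $D\subset\mathbb R^2$ is a bounded open set (the cavity) with Lipschitz continuous boundary $\partial D$, and $\nu$ is the unit normal vector on $\partial D$. For $R>0$, $B_R=\{\boldsymbol x\in\mathbb R^2:|\boldsymbol x|<R\}$ and $\Gamma_R=\{\boldsymbol x\in\mathbb R^2:|\boldsymbol x|=R\}$; $R$ is chosen so large that $\overline D\subset B_R$. Put $\Omega=B_R\setminus\overline D$. Both $\mathbb R^2\setminus\overline D$ and $\Omega$ are domains (connected open sets). $(r,\theta)$ are polar coordinates centered at the origin, and $\partial_r$ is the radial derivative. The Dirichlet-to-Neumann operators $T_1,T_2$ on $\Gamma_R$ are defined, for $\phi(R,\theta)=\sum_{n\in\mathbb Z}\phi^{(n)}(R)e^{\mathrm i n\theta}$ with $\phi^{(n)}(R)=\frac1{2\pi}\int_0^{2\pi}\phi(R,\theta)e^{-\mathrm i n\theta}\,d\theta$, by $$T_1\phi=\frac1R\sum_{n\in\mathbb Z}h_n(\kappa R)\phi^{(n)}(R)e^{\mathrm i n\theta},\qquad T_2\phi=\frac1R\sum_{n\in\mathbb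 Z}k_n(\kappa R)\phi^{(n)}(R)e^{\mathrm i n\theta},$$ where $$h_n(z)=z\,\frac{H_n^{(1)\prime}(z)}{H_n^{(1)}(z)},\qquad k_n(z)=z\,\frac{K_n'(z)}{K_n(z)},$$ $H_n^{(1)}$ is the Hankel function of the first kind of order $n$, and $K_n$ is the modified Bessel function (of the second kind) of order $n$. They are understood as operators $H^{1/2}(\Gamma_R)\to H^{-1/2}(\Gamma_R)$. The datum is $g_1=\partial_r u^{\rm inc}-T_1u^{\rm inc}$ on $\Gamma_R$, where $u^{\rm inc}(\boldsymbol x)=e^{\mathrm i\kappa\boldsymbol x\cdot\boldsymbol d}$ with $\boldsymbol d=(\cos\alpha,\sin\alpha)$, $\alpha\in[0,2\pi)$. Solutions are understood in the usual $H^1$ sense: the equations in $\Omega$ hold in the sense of distributions, the boundary values of $p,q$ are traces in $H^{1/2}$, and the normal derivatives are the weak normal derivatives in $H^{-1/2}(\partial D)$ and $H^{-1/2}(\Gamma_R)$. *)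

theory Defs
  imports "HOL-Analysis.Analysis"
begin

section \<open>Lipschitz boundaries and arc length\<close>

text \<open>Near each boundary point the set is, in suitable orthonormal coordinates, the part of
  a ball lying strictly above the graph of a Lipschitz function.\<close>

definition lipschitz_boundary :: "(real^2) set \<Rightarrow> bool" where
  "lipschitz_boundary D \<longleftrightarrow>
     (\<forall>x\<in>frontier D. \<exists>r>0. \<exists>e1 e2 \<gamma> L.
        norm e1 = 1 \<and> norm e2 = 1 \<and> e1 \<bullet> e2 = 0 \<and> L-lipschitz_on UNIV \<gamma> \<and>
        D \<inter> ball x r = {y \<in> ball x r. \<gamma> (y \<bullet> e1) < y \<bullet> e2})"

definition hausdorff1_pre :: "real \<Rightarrow> (real^2) set \<Rightarrow> ennreal" where
  "hausdorff1_pre \<delta> A =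
     (INF C\<in>{C :: nat \<Rightarrow> (real^2) set.
               A \<subseteq> (\<Union>i. C i) \<and> (\<forall>i. bounded (C i) \<and> diameter (C i) \<le> \<delta>)}.
        \<Sum>i. ennreal (diameter (C i)))"

text \<open>One-dimensional Hausdorff measure on the Borel sets of the plane.  The set function is a
  metric outer measure, hence countably additive on Borel sets, so that \<open>measure_of\<close>
  does not degenerate.\<close>

definition hausdorff1 :: "(real^2) measure" where
  "hausdorff1 = measure_of UNIV (sets borel) (\<lambda>A. SUP \<delta>\<in>{0<..}. hausdorff1_pre \<delta> A)"

definition arclength :: "(real^2) set \<Rightarrow> (real^2) measure" where
  "arclength \<Gamma> = restrict_space hausdorff1 \<Gamma>"

definition polar :: "real \<Rightarrow> real \<Rightarrow> real^2" where
  "polar R \<theta> = vector [R * cos \<theta>, R * sin \<theta>]"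

text \<open>Arc length on the circle of radius \<open>R\<close>, that is \<open>ds = R d\<theta>\<close>.\<close>

definition circle_measure :: "real \<Rightarrow> (real^2) measure" where
  "circle_measure R = scale_measure (ennreal R)
     (distr (restrict_space lborel {0..<2*pi}) (restrict_space borel (sphere 0 R)) (polar R))"


section \<open>Smooth functions and test functions\<close>

definition grad :: "(real^2 \<Rightarrow> complex) \<Rightarrow> real^2 \<Rightarrow> complex^2" where
  "grad f x = (\<chi> j. frechet_derivative f (at x) (axis j 1))"

primrec Ck :: "nat \<Rightarrow> (real^2 \<Rightarrow> complex) \<Rightarrow> bool" where
  "Ck 0 f \<longleftrightarrow> continuous_on UNIV f"
| "Ck (Suc k) f \<longleftrightarrow>
     (\<forall>x. f differentiable (at x)) \<and> (\<forall>j. Ck k (\<lambda>x. grad f x $ j))"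

definition smooth :: "(real^2 \<Rightarrow> complex) \<Rightarrow> bool" where
  "smooth f \<longleftrightarrow> (\<forall>k. Ck k f)"

definition laplacian :: "(real^2 \<Rightarrow> complex) \<Rightarrow> real^2 \<Rightarrow> complex" where
  "laplacian f x = (\<Sum>j\<in>UNIV. grad (\<lambda>y. grad f y $ j) x $ j)"

definition test_functions :: "(real^2) set \<Rightarrow> (real^2 \<Rightarrow> complex) set" where
  "test_functions \<Omega> =
     {\<phi>. smooth \<phi> \<and> compact (closure {x. \<phi> x \<noteq> 0}) \<and> closure {x. \<phi> x \<noteq> 0} \<subseteq> \<Omega>}"


section \<open>Sobolev spaces, traces and weak normal derivatives\<close>

definition L2 :: "'a measure \<Rightarrow> ('a \<Rightarrow> 'b::euclidean_space) set" where
  "L2 M = {f \<in> borel_measurable M. (\<integral>\<^sup>+x. ennreal ((norm (f x))\<^sup>2) \<partial>M) < \<infinity>}"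

definition has_L2_gradient ::
    "(real^2) set \<Rightarrow> (real^2 \<Rightarrow> complex) \<Rightarrow> (real^2 \<Rightarrow> complex^2) \<Rightarrow> bool" where
  "has_L2_gradient \<Omega> u v \<longleftrightarrow> v \<in> L2 (lebesgue_on \<Omega>) \<and>
     (\<forall>\<phi>\<in>test_functions \<Omega>. \<forall>j.
        (LINT x|lebesgue_on \<Omega>. u x * grad \<phi> x $ j) = - (LINT x|lebesgue_on \<Omega>. v x $ j * \<phi> x))"

definition H1 :: "(real^2) set \<Rightarrow> (real^2 \<Rightarrow> complex) set" where
  "H1 \<Omega> = {u \<in> L2 (lebesgue_on \<Omega>). \<exists>v. has_L2_gradient \<Omega> u v}"

text \<open>\<open>\<Delta>u = f\<close> in the sense of distributions on \<open>\<Omega>\<close>, with \<open>f\<close> square integrable.\<close>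

definition has_L2_laplacian ::
    "(real^2) set \<Rightarrow> (real^2 \<Rightarrow> complex) \<Rightarrow> (real^2 \<Rightarrow> complex) \<Rightarrow> bool" where
  "has_L2_laplacian \<Omega> u f \<longleftrightarrow> f \<in> L2 (lebesgue_on \<Omega>) \<and>
     (\<forall>\<phi>\<in>test_functions \<Omega>.
        (LINT x|lebesgue_on \<Omega>. u x * laplacian \<phi> x) = (LINT x|lebesgue_on \<Omega>. f x * \<phi> x))"

text \<open>In what follows \<open>\<sigma>\<close> is the arc length measure of a (part of a) boundary curve
  \<open>\<Gamma>\<close>; the spaces on \<open>\<Gamma>\<close> depend on \<open>\<Gamma>\<close> only through \<open>\<sigma>\<close>.
  The fractional space is the Sobolev-Slobodeckij space; on a curve the exponent of
  \<open>|x - y|\<close> is \<open>1 + 2 * (1/2) = 2\<close>.\<close>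

definition Hhalf_sqnorm :: "(real^2) measure \<Rightarrow> (real^2 \<Rightarrow> complex) \<Rightarrow> ennreal" where
  "Hhalf_sqnorm \<sigma> g =
     (\<integral>\<^sup>+x. ennreal ((norm (g x))\<^sup>2) \<partial>\<sigma>) +
     (\<integral>\<^sup>+x. \<integral>\<^sup>+y. ennreal ((norm (g x - g y))\<^sup>2 / (norm (x - y))\<^sup>2) \<partial>\<sigma> \<partial>\<sigma>)"

definition Hhalf :: "(real^2) measure \<Rightarrow> (real^2 \<Rightarrow> complex) set" where
  "Hhalf \<sigma> = {g \<in> borel_measurable \<sigma>. Hhalf_sqnorm \<sigma> g < \<infinity>}"

text \<open>The dual of \<open>Hhalf \<sigma>\<close>.  Duality pairings are bilinear (no complex conjugation) and
  extend \<open>(f, g) \<mapsto> \<integral> f g d\<sigma>\<close>.  Functionals are only relevant on \<open>Hhalf \<sigma>\<close>;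
  boundedness forces them to respect equality almost everywhere.\<close>

definition Hmhalf :: "(real^2) measure \<Rightarrow> ((real^2 \<Rightarrow> complex) \<Rightarrow> complex) set" where
  "Hmhalf \<sigma> = {l.
     (\<forall>g\<in>Hhalf \<sigma>. \<forall>h\<in>Hhalf \<sigma>. l (\<lambda>x. g x + h x) = l g + l h) \<and>
     (\<forall>g\<in>Hhalf \<sigma>. \<forall>c. l (\<lambda>x. c * g x) = c * l g) \<and>
     (\<exists>C. \<forall>g\<in>Hhalf \<sigma>. norm (l g) \<le> C * sqrt (enn2real (Hhalf_sqnorm \<sigma> g)))}"

text \<open>The trace is the continuous extension of the restriction map from functions smooth up to
  the boundary: \<open>g\<close> is the trace of \<open>u\<close> if some smooth functions on the plane converge
  to \<open>u\<close> in \<open>H1 \<Omega>\<close> while their restrictions converge to \<open>g\<close> in \<open>L2 \<sigma>\<close>.\<close>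

definition has_trace ::
    "(real^2) set \<Rightarrow> (real^2) measure \<Rightarrow> (real^2 \<Rightarrow> complex) \<Rightarrow> (real^2 \<Rightarrow> complex) \<Rightarrow> bool" where
  "has_trace \<Omega> \<sigma> u g \<longleftrightarrow> u \<in> H1 \<Omega> \<and> g \<in> Hhalf \<sigma> \<and>
     (\<exists>v w. has_L2_gradient \<Omega> u v \<and> (\<forall>k::nat. smooth (w k)) \<and>
        (\<lambda>k. \<integral>\<^sup>+x. ennreal ((norm (w k x - u x))\<^sup>2) \<partial>lebesgue_on \<Omega>) \<longlonglongrightarrow> 0 \<and>
        (\<lambda>k. \<integral>\<^sup>+x. ennreal ((norm (grad (w k) x - v x))\<^sup>2) \<partial>lebesgue_on \<Omega>) \<longlonglongrightarrow> 0 \<and>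
        (\<lambda>k. \<integral>\<^sup>+x. ennreal ((norm (w k x - g x))\<^sup>2) \<partial>\<sigma>) \<longlonglongrightarrow> 0)"

text \<open>The weak normal derivative of \<open>u\<close>, for the unit normal pointing out of \<open>\<Omega>\<close>, on the
  part of the boundary carrying \<open>\<sigma>\<close>; \<open>\<sigma>'\<close> is the arc length of the remaining part.
  It is given by Green's formula
  \<open>\<langle>\<partial>u, tr \<phi>\<rangle> = \<integral> (\<nabla>u \<cdot> \<nabla>\<phi> + \<Delta>u \<phi>)\<close>
  for all \<open>\<phi>\<close> in \<open>H1 \<Omega>\<close> whose trace vanishes on the remaining part.\<close>

definition has_weak_normal_derivative ::
    "(real^2) set \<Rightarrow> (real^2) measure \<Rightarrow> (real^2) measure \<Rightarrow> (real^2 \<Rightarrow> complex) \<Rightarrow>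
     ((real^2 \<Rightarrow> complex) \<Rightarrow> complex) \<Rightarrow> bool" where
  "has_weak_normal_derivative \<Omega> \<sigma> \<sigma>' u l \<longleftrightarrow> u \<in> H1 \<Omega> \<and> l \<in> Hmhalf \<sigma> \<and>
     (\<exists>v f. has_L2_gradient \<Omega> u v \<and> has_L2_laplacian \<Omega> u f \<and>
        (\<forall>\<phi> w g. has_trace \<Omega> \<sigma> \<phi> g \<and> has_trace \<Omega> \<sigma>' \<phi> (\<lambda>_. 0) \<and> has_L2_gradient \<Omega> \<phi> w \<longrightarrow>
           l g = (LINT x|lebesgue_on \<Omega>. (\<Sum>j\<in>UNIV. v x $ j * w x $ j) + f x * \<phi> x)))"


section \<open>Bessel functions of integer order and positive argument\<close>

text \<open>Bessel's and Schlaefli's integrals for \<open>J\<^sub>n\<close> and \<open>Y\<^sub>n\<close>, and the integral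
  \<open>K\<^sub>n(z) = \<integral>\<^sub>0\<^sup>\<infinity> exp (- z cosh t) cosh (n t) dt\<close>
  (DLMF 10.9.2, 10.9.7, 10.32.9).  They are valid for all integers \<open>n\<close>, of either sign,
  and \<open>z > 0\<close>.\<close>

definition bessel_J :: "int \<Rightarrow> real \<Rightarrow> real" where
  "bessel_J n z = (1/pi) * (LINT \<theta>:{0..pi}|lborel. cos (of_int n * \<theta> - z * sin \<theta>))"

definition bessel_Y :: "int \<Rightarrow> real \<Rightarrow> real" where
  "bessel_Y n z =
     (1/pi) * (LINT \<theta>:{0..pi}|lborel. sin (z * sin \<theta> - of_int n * \<theta>)) -
     (1/pi) * (LINT t:{0..}|lborel.
        (exp (of_int n * t) + (-1) powi n * exp (- of_int n * t)) * exp (- z * sinh t))"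

definition hankel1 :: "int \<Rightarrow> real \<Rightarrow> complex" where
  "hankel1 n z = of_real (bessel_J n z) + \<i> * of_real (bessel_Y n z)"

definition bessel_K :: "int \<Rightarrow> real \<Rightarrow> real" where
  "bessel_K n z = (LINT t:{0..}|lborel. exp (- z * cosh t) * cosh (of_int n * t))"

definition h_symbol :: "int \<Rightarrow> real \<Rightarrow> complex" where
  "h_symbol n z = of_real z * vector_derivative (hankel1 n) (at z) / hankel1 n z"

definition k_symbol :: "int \<Rightarrow> real \<Rightarrow> complex" where
  "k_symbol n z = of_real (z * deriv (bessel_K n) z / bessel_K n z)"


section \<open>Dirichlet-to-Neumann operators on the circle\<close>

definition fourier_coeff :: "real \<Rightarrow> (real^2 \<Rightarrow> complex) \<Rightarrow> int \<Rightarrow> complex" where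
  "fourier_coeff R \<phi> n =
     1 / (2*pi) * (LINT \<theta>:{0..2*pi}|lborel. \<phi> (polar R \<theta>) * cis (- of_int n * \<theta>))"

text \<open>The functional \<open>(1/R) \<Sum>\<^sub>n s\<^sub>n \<phi>\<^sup>(\<^sup>n\<^sup>) exp (i n \<theta>)\<close> applied to \<open>\<psi>\<close>;
  the exponentials act by integration against \<open>ds = R d\<theta>\<close>.\<close>

definition dtn :: "(int \<Rightarrow> complex) \<Rightarrow> real \<Rightarrow> (real^2 \<Rightarrow> complex) \<Rightarrow> (real^2 \<Rightarrow> complex) \<Rightarrow> complex" where
  "dtn s R \<phi> \<psi> =
     1 / R * (\<Sum>\<^sub>\<infinity>n. s n * fourier_coeff R \<phi> n *
               (R * (LINT \<theta>:{0..2*pi}|lborel. cis (of_int n * \<theta>) * \<psi> (polar R \<theta>))))"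

definition T1 :: "real \<Rightarrow> real \<Rightarrow> (real^2 \<Rightarrow> complex) \<Rightarrow> (real^2 \<Rightarrow> complex) \<Rightarrow> complex" where
  "T1 \<kappa> R = dtn (\<lambda>n. h_symbol n (\<kappa> * R)) R"

definition T2 :: "real \<Rightarrow> real \<Rightarrow> (real^2 \<Rightarrow> complex) \<Rightarrow> (real^2 \<Rightarrow> complex) \<Rightarrow> complex" where
  "T2 \<kappa> R = dtn (\<lambda>n. k_symbol n (\<kappa> * R)) R"


section \<open>The coupled boundary value problem\<close>

definition u_inc :: "real \<Rightarrow> real \<Rightarrow> real^2 \<Rightarrow> complex" where
  "u_inc \<kappa> \<alpha> x = exp (\<i> * of_real (\<kappa> * (x \<bullet> vector [cos \<alpha>, sin \<alpha>])))"

definition radial_derivative :: "(real^2 \<Rightarrow> complex) \<Rightarrow> real^2 \<Rightarrow> complex" where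
  "radial_derivative u x = frechet_derivative u (at x) (sgn x)"

definition g1 :: "real \<Rightarrow> real \<Rightarrow> real \<Rightarrow> (real^2 \<Rightarrow> complex) \<Rightarrow> complex" where
  "g1 \<kappa> \<alpha> R \<psi> =
     (LINT x|circle_measure R. radial_derivative (u_inc \<kappa> \<alpha>) x * \<psi> x) - T1 \<kappa> R (u_inc \<kappa> \<alpha>) \<psi>"

text \<open>The normal derivatives below are taken outward from \<open>\<Omega>\<close>.  On the circle this is the
  radial derivative; on \<open>frontier D\<close> the condition is unaffected by the orientation of the
  normal.\<close>

definition coupled_solution ::
    "(real^2) set \<Rightarrow> real \<Rightarrow> real \<Rightarrow> real \<Rightarrow> (real^2 \<Rightarrow> complex) \<Rightarrow> (real^2 \<Rightarrow> complex) \<Rightarrow> bool" where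
  "coupled_solution D R \<kappa> \<alpha> p q \<longleftrightarrow>
     (let \<Omega> = ball 0 R - closure D;
          \<sigma>D = arclength (frontier D);
          \<sigma>R = circle_measure R
      in
        p \<in> H1 \<Omega> \<and> q \<in> H1 \<Omega> \<and>
        has_L2_laplacian \<Omega> p (\<lambda>x. - of_real (\<kappa>\<^sup>2) * p x) \<and>
        has_L2_laplacian \<Omega> q (\<lambda>x. of_real (\<kappa>\<^sup>2) * q x) \<and>
        (\<exists>p0 q0. has_trace \<Omega> \<sigma>D p p0 \<and> has_trace \<Omega> \<sigma>D q q0 \<and>
           (AE x in \<sigma>D. p0 x - q0 x = 0)) \<and>
        (\<exists>l m. has_weak_normal_derivative \<Omega> \<sigma>D \<sigma>R p l \<and>
           has_weak_normal_derivative \<Omega> \<sigma>D \<sigma>R q m \<and>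
           (\<forall>\<psi>\<in>Hhalf \<sigma>D. l \<psi> - m \<psi> = 0)) \<and>
        (\<exists>p0 l. has_trace \<Omega> \<sigma>R p p0 \<and> has_weak_normal_derivative \<Omega> \<sigma>R \<sigma>D p l \<and>
           (\<forall>\<psi>\<in>Hhalf \<sigma>R. l \<psi> = T1 \<kappa> R p0 \<psi> - g1 \<kappa> \<alpha> R \<psi>)) \<and>
        (\<exists>q0 m. has_trace \<Omega> \<sigma>R q q0 \<and> has_weak_normal_derivative \<Omega> \<sigma>R \<sigma>D q m \<and>
           (\<forall>\<psi>\<in>Hhalf \<sigma>R. m \<psi> = T2 \<kappa> R q0 \<psi>)))"

end

theory Submission
  imports Defs
begin

text \<open>Let \<open>(p\<^sub>1, q\<^sub>1)\<close> and \<open>(p\<^sub>2, q\<^sub>2)\<close> be two solutions and \<open>p\<close>, \<open>q\<close> their differences.  Green's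
  formula for \<open>p\<close> and for \<open>q\<close> on the annular domain gives
  \<open>\<integral> |\<nabla>p|\<^sup>2 - \<kappa>\<^sup>2 |p|\<^sup>2 = \<langle>T\<^sub>1 p, p\<rangle> + M\<close> and \<open>\<integral> |\<nabla>q|\<^sup>2 + \<kappa>\<^sup>2 |q|\<^sup>2 = \<langle>T\<^sub>2 q, q\<rangle> + M\<close> with the
  \<^emph>\<open>same\<close> contribution \<open>M\<close> of the cavity boundary, because \<open>p\<close> and \<open>q\<close> have common Cauchy data there.
  The symbol of \<open>T\<^sub>2\<close> is real, so the second identity makes \<open>M\<close> real, and the imaginary part of
  the first one becomes \<open>\<Sum>\<^sub>n Im h\<^sub>n |p\<^sup>(\<^sup>n\<^sup>)|\<^sup>2 = 0\<close>.  Each \<open>Im h\<^sub>n\<close> is positive, being the Wronskian of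
  \<open>J\<^sub>n\<close> and \<open>Y\<^sub>n\<close> up to a positive factor (\<open>h_symbol_Im_pos\<close>, \<open>wronskian_value\<close>).  Hence all Fourier
  coefficients of the trace of \<open>p\<close> on the circle vanish, and so does its normal derivative
  \<open>T\<^sub>1 p\<close>: the extension of \<open>p\<close> by zero solves the Helmholtz equation in the whole exterior of the
  cavity (\<open>zero_extension_weak_helmholtz\<close>) and vanishes by unique continuation
  (\<open>weak_unique_continuation\<close>).  Now \<open>p = 0\<close> gives \<open>M = 0\<close>, and the second identity equates a
  nonnegative energy of \<open>q\<close> with \<open>\<langle>T\<^sub>2 q, q\<rangle> \<le> 0\<close>, as \<open>K\<^sub>n\<close> is positive and decreasing; so
  \<open>q = 0\<close>.

  Green's formula is used in polarized form, for the \<open>i\<close>-th solution paired with the conjugate of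
  the \<open>j\<close>-th one; the datum \<open>g\<^sub>1\<close> cancels from the alternating sum of the four identities.  Splitting
  the Dirichlet-to-Neumann forms in this way takes convergence of the Fourier series involved.  It
  comes from the linear growth of \<open>h\<^sub>n\<close> and \<open>k\<^sub>n\<close> (\<open>h_symbol_bound\<close>, \<open>k_symbol_bound\<close>) together with
  the estimate of \<open>\<Sum>\<^sub>n |n| |g\<^sup>(\<^sup>n\<^sup>)|\<^sup>2\<close> by the Slobodeckij norm (\<open>Hhalf_coefficients_summable\<close>).

  The Bessel functions enter through their integral representations.  Differentiation under the
  integral sign and one integration by parts give the recurrences of \<open>J\<^sub>n\<close> and \<open>Y\<^sub>n\<close>; these bound
  \<open>h\<^sub>n\<close> and, with the behaviour of the functions of order zero and one at the origin, determine
  the Wronskian.  Another integration by parts bounds \<open>k\<^sub>n\<close>.  Unique continuation rests on Bessel's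
  equation in the form of an ordinary differential equation for the angular Fourier modes: a
  smooth solution on a ball that vanishes near the centre has modes with zero Cauchy data at a
  positive radius (\<open>helmholtz_classical_continuation\<close>).  Pairing with translated test functions
  reduces distributional solutions to smooth ones.\<close>

section \<open>The algebra of smooth functions\<close>

lemma grad_eq:
  assumes "(f has_derivative f') (at x)"
  shows "grad f x $ j = f' (axis j 1)"
  using frechet_derivative_at[OF assms] by (simp add: grad_def)

lemma plane_axis_expansion: "h = (\<Sum>j\<in>UNIV. (h $ j) *\<^sub>R axis j 1)" for h :: "real^2"
  by (simp add: vec_eq_iff axis_def if_distrib cong: if_cong)

lemma has_derivative_grad:
  assumes "f differentiable (at x)"
  shows "(f has_derivative (\<lambda>h. \<Sum>j\<in>UNIV. (h $ j) *\<^sub>R grad f x $ j)) (at x)"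
proof -
  obtain f' where f': "(f has_derivative f') (at x)"
    using assms by (auto simp: differentiable_def)
  then interpret f': bounded_linear f' by (rule has_derivative_bounded_linear)
  have "f' h = (\<Sum>j\<in>UNIV. (h $ j) *\<^sub>R grad f x $ j)" for h
    by (subst plane_axis_expansion[of h]) (simp add: f'.sum f'.scaleR grad_eq[OF f'])
  then have "f' = (\<lambda>h. \<Sum>j\<in>UNIV. (h $ j) *\<^sub>R grad f x $ j)" by (rule ext)
  with f' show ?thesis by simp
qed

lemma Ck_imp_continuous: "Ck k f \<Longrightarrow> continuous_on UNIV f"
  by (cases k) (auto simp: differentiable_imp_continuous_within continuous_at_imp_continuous_on)

lemma Ck_Suc_imp_Ck: "Ck (Suc k) f \<Longrightarrow> Ck k f"
proof (induction k arbitrary: f)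
  case 0
  then show ?case using Ck_imp_continuous[of "Suc 0" f] by simp
qed auto

lemma Ck_SucI:
  assumes "\<And>x. (f has_derivative f' x) (at x)" and "\<And>j. Ck k (\<lambda>x. f' x (axis j 1))"
  shows "Ck (Suc k) f"
  using assms by (auto simp: differentiable_def grad_eq[OF assms(1)])

lemma Ck_const: "Ck k (\<lambda>x. c)"
proof (induction k arbitrary: c)
  case (Suc k)
  show ?case by (rule Ck_SucI[where f'="\<lambda>x h. 0"]) (use Suc in auto)
qed simp

lemma Ck_add: "Ck k f \<Longrightarrow> Ck k g \<Longrightarrow> Ck k (\<lambda>x. f x + g x)"
proof (induction k arbitrary: f g)
  case (Suc k)
  have "Ck k (\<lambda>x. grad f x $ j + grad g x $ j)" for j
    using Suc by auto
  moreover have "grad (\<lambda>x. f x + g x) x $ j = grad f x $ j + grad g x $ j" for x j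
    using Suc.prems grad_eq[OF has_derivative_add[OF has_derivative_grad has_derivative_grad], of f x g j]
    by (simp add: axis_def if_distrib if_distribR cong: if_cong)
  ultimately show ?case using Suc.prems by simp
qed (auto intro: continuous_intros)

lemma grad_mult:
  assumes "f differentiable (at x)" "g differentiable (at x)"
  shows "grad (\<lambda>x. f x * g x) x $ j = f x * grad g x $ j + grad f x $ j * g x"
  using grad_eq[OF has_derivative_mult[OF has_derivative_grad[OF assms(1)]
        has_derivative_grad[OF assms(2)]], of j]
  by (simp add: axis_def if_distrib if_distribR cong: if_cong)

lemma Ck_mult: "Ck k f \<Longrightarrow> Ck k g \<Longrightarrow> Ck k (\<lambda>x. f x * g x)"
proof (induction k arbitrary: f g)
  case (Suc k)
  have "Ck k f" "Ck k g" using Suc.prems by (auto intro: Ck_Suc_imp_Ck simp del: Ck.simps)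
  then have "Ck k (\<lambda>x. f x * grad g x $ j + grad f x $ j * g x)" for j
    using Suc by (intro Ck_add Suc.IH) auto
  moreover have "grad (\<lambda>x. f x * g x) x $ j = f x * grad g x $ j + grad f x $ j * g x" for x j
    using Suc.prems by (intro grad_mult) auto
  ultimately show ?case using Suc.prems by simp
qed (auto intro: continuous_intros)

lemma grad_cnj:
  assumes "f differentiable (at x)"
  shows "grad (\<lambda>x. cnj (f x)) x $ j = cnj (grad f x $ j)"
  using grad_eq[OF has_derivative_cnj[OF has_derivative_grad[OF assms]], of j]
  by (simp add: axis_def if_distrib if_distribR cong: if_cong)

lemma differentiable_cnj: "f differentiable (at x) \<Longrightarrow> (\<lambda>x. cnj (f x)) differentiable (at x)"
  unfolding differentiable_def using has_derivative_cnj by blast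

lemma Ck_cnj: "Ck k f \<Longrightarrow> Ck k (\<lambda>x. cnj (f x))"
proof (induction k arbitrary: f)
  case (Suc k)
  then show ?case by (simp add: grad_cnj differentiable_cnj)
qed (auto intro: continuous_intros)

lemma grad_translate: "grad (\<lambda>y. f (y - z)) x = grad f (x - z)"
proof (cases "f differentiable (at (x - z))")
  case True
  have "((\<lambda>y. f (y - z)) has_derivative (\<lambda>h. \<Sum>j\<in>UNIV. (h $ j) *\<^sub>R grad f (x - z) $ j)) (at x)"
  proof (rule has_derivative_compose[of "\<lambda>y. y - z" "\<lambda>h. h" x UNIV])
    show "((\<lambda>y. y - z) has_derivative (\<lambda>h. h)) (at x)"
      by (auto intro!: derivative_eq_intros)
    show "(f has_derivative (\<lambda>h. \<Sum>j\<in>UNIV. (h $ j) *\<^sub>R grad f (x - z) $ j)) (at (x - z))"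
      by (rule has_derivative_grad[OF True])
  qed
  from grad_eq[OF this] show ?thesis
    by (simp add: vec_eq_iff axis_def if_distrib if_distribR cong: if_cong)
next
  case False
  have eq: "((\<lambda>y. f (y - z)) has_derivative f') (at x) \<longleftrightarrow> (f has_derivative f') (at (x - z))" for f'
  proof
    assume "(f has_derivative f') (at (x - z))"
    then show "((\<lambda>y. f (y - z)) has_derivative f') (at x)"
      by (intro has_derivative_compose[of "\<lambda>y. y - z" "\<lambda>h. h" x UNIV f f'])
         (auto intro!: derivative_eq_intros)
  next
    assume *: "((\<lambda>y. f (y - z)) has_derivative f') (at x)"
    have "((\<lambda>w. f (w + z - z)) has_derivative f') (at (x - z))"
    proof (rule has_derivative_compose[of "\<lambda>w. w + z" "\<lambda>h. h" "x - z" UNIV "\<lambda>y. f (y - z)" f'])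
      show "((\<lambda>w. w + z) has_derivative (\<lambda>h. h)) (at (x - z))"
        by (auto intro!: derivative_eq_intros)
      show "((\<lambda>y. f (y - z)) has_derivative f') (at (x - z + z))" using * by simp
    qed
    then show "(f has_derivative f') (at (x - z))" by simp
  qed
  show ?thesis by (simp add: grad_def frechet_derivative_def eq)
qed

lemma differentiable_translate:
  "f differentiable (at (x - z)) \<Longrightarrow> (\<lambda>y. f (y - z)) differentiable (at x)" for f :: "real^2 \<Rightarrow> complex"
proof -
  assume "f differentiable (at (x - z))"
  then obtain D where "(f has_derivative D) (at (x - z))" by (auto simp: differentiable_def)
  then have "((\<lambda>y. f (y - z)) has_derivative D) (at x)"
    by (intro has_derivative_compose[of "\<lambda>y. y - z" "\<lambda>h. h" x UNIV f D])
       (auto intro!: derivative_eq_intros)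
  then show ?thesis by (auto simp: differentiable_def)
qed

lemma Ck_translate: "Ck k f \<Longrightarrow> Ck k (\<lambda>y. f (y - z))"
proof (induction k arbitrary: f)
  case 0
  then show ?case by (auto intro!: continuous_on_compose2[of UNIV f] continuous_intros)
next
  case (Suc k)
  have "Ck k (\<lambda>x. grad f x $ j)" for j using Suc.prems by simp
  then have "Ck k (\<lambda>x. grad f (x - z) $ j)" for j by (rule Suc.IH)
  then show ?case using Suc.prems by (simp add: grad_translate differentiable_translate)
qed

lemma smooth_const: "smooth (\<lambda>x. c)"
  and smooth_add: "smooth f \<Longrightarrow> smooth g \<Longrightarrow> smooth (\<lambda>x. f x + g x)"
  and smooth_mult: "smooth f \<Longrightarrow> smooth g \<Longrightarrow> smooth (\<lambda>x. f x * g x)"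
  and smooth_cnj: "smooth f \<Longrightarrow> smooth (\<lambda>x. cnj (f x))"
  and smooth_translate: "smooth f \<Longrightarrow> smooth (\<lambda>y. f (y - z))"
  by (simp_all add: smooth_def Ck_const Ck_add Ck_mult Ck_cnj Ck_translate)

lemma smooth_grad: "smooth f \<Longrightarrow> smooth (\<lambda>x. grad f x $ j)"
  unfolding smooth_def by (metis Ck.simps(2))

lemma smooth_differentiable: "smooth f \<Longrightarrow> f differentiable (at x)"
  unfolding smooth_def by (metis Ck.simps(2))

lemma smooth_continuous: "smooth f \<Longrightarrow> continuous_on UNIV f"
  unfolding smooth_def by (metis Ck.simps(1))

lemma smooth_minus: "smooth f \<Longrightarrow> smooth (\<lambda>x. - f x)"
  using smooth_mult[OF smooth_const[of "-1"]] by fastforce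

lemma smooth_diff: "smooth f \<Longrightarrow> smooth g \<Longrightarrow> smooth (\<lambda>x. f x - g x)"
  using smooth_add[OF _ smooth_minus] by fastforce

lemma smooth_sum: "(\<And>i. i \<in> I \<Longrightarrow> smooth (f i)) \<Longrightarrow> smooth (\<lambda>x. \<Sum>i\<in>I. f i x)"
  by (induction I rule: infinite_finite_induct) (auto intro: smooth_const smooth_add)

lemma smooth_coordinate: "smooth (\<lambda>x. of_real (x $ i))"
  unfolding smooth_def
proof
  fix k show "Ck k (\<lambda>x. of_real (x $ i))"
  proof (cases k)
    case 0
    then show ?thesis by (auto intro!: continuous_intros)
  next
    case (Suc m)
    have "((\<lambda>x. of_real (x $ i)::complex) has_derivative (\<lambda>h. of_real (h $ i))) (at x)" for x :: "real^2"
      by (intro bounded_linear_imp_has_derivative bounded_linear_of_real[THEN bounded_linear_compose] bounded_linear_vec_nth)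
    then show ?thesis unfolding Suc
      by (rule Ck_SucI) (rule Ck_const)
  qed
qed

lemma smooth_lipschitz:
  assumes \<phi>: "smooth \<phi>" and S: "convex S" and C: "\<And>x j. x \<in> S \<Longrightarrow> norm (grad \<phi> x $ j) \<le> C"
    and xy: "x \<in> S" "y \<in> S"
  shows "norm (\<phi> x - \<phi> y) \<le> 2 * C * norm (x - y)"
proof (rule differentiable_bound[where S=S and f'="\<lambda>x h. \<Sum>j\<in>UNIV. (h $ j) *\<^sub>R grad \<phi> x $ j"])
  fix z :: "real^2" assume z: "z \<in> S"
  show "(\<phi> has_derivative (\<lambda>h. \<Sum>j\<in>UNIV. (h $ j) *\<^sub>R grad \<phi> z $ j)) (at z within S)"
    using has_derivative_grad[OF smooth_differentiable[OF \<phi>, of z]] by (rule has_derivative_at_withinI)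
  show "onorm (\<lambda>h. \<Sum>j\<in>UNIV. (h $ j) *\<^sub>R grad \<phi> z $ j) \<le> 2 * C"
  proof (rule onorm_le)
    fix h :: "real^2"
    have "norm (\<Sum>j\<in>UNIV. (h $ j) *\<^sub>R grad \<phi> z $ j) \<le> \<bar>h $ 1\<bar> * norm (grad \<phi> z $ 1) + \<bar>h $ 2\<bar> * norm (grad \<phi> z $ 2)"
      unfolding sum_2 by (rule order_trans[OF norm_triangle_ineq]) simp
    also have "\<dots> \<le> norm h * C + norm h * C"
      using C[OF z] component_le_norm_cart[of h] by (intro add_mono mult_mono) auto
    finally show "norm (\<Sum>j\<in>UNIV. (h $ j) *\<^sub>R grad \<phi> z $ j) \<le> 2 * C * norm h" by (simp add: algebra_simps)
  qed
qed (use S xy in auto)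

text \<open>Bump functions enter through the composition of a smooth profile on the line with a
  smooth function on the plane; this predicate is the one-dimensional counterpart of
  \<^const>\<open>Ck\<close>.\<close>

primrec Ck_line :: "nat \<Rightarrow> (real \<Rightarrow> real) \<Rightarrow> bool" where
  "Ck_line 0 g \<longleftrightarrow> continuous_on UNIV g"
| "Ck_line (Suc k) g \<longleftrightarrow> (\<exists>g'. (\<forall>x. (g has_real_derivative g' x) (at x)) \<and> Ck_line k g')"

lemma Ck_line_add: "Ck_line k f \<Longrightarrow> Ck_line k g \<Longrightarrow> Ck_line k (\<lambda>x. f x + g x)"
proof (induction k arbitrary: f g)
  case (Suc k)
  then obtain f' g' where "\<forall>x. (f has_real_derivative f' x) (at x)" "Ck_line k f'"
    "\<forall>x. (g has_real_derivative g' x) (at x)" "Ck_line k g'" by auto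
  then show ?case using Suc.IH
    by (auto intro!: exI[of _ "\<lambda>x. f' x + g' x"] DERIV_add)
qed (auto intro: continuous_intros)

lemma Ck_line_cmult: "Ck_line k f \<Longrightarrow> Ck_line k (\<lambda>x. c * f x)"
proof (induction k arbitrary: f)
  case (Suc k)
  then obtain f' where "\<forall>x. (f has_real_derivative f' x) (at x)" "Ck_line k f'" by auto
  then show ?case using Suc.IH
    by (auto intro!: exI[of _ "\<lambda>x. c * f' x"] DERIV_cmult)
qed (auto intro: continuous_intros)

text \<open>The gradient of the inner function is real although it is an element of \<open>complex^2\<close>; this is
  what lets the chain rule for real functions be rewritten as a product of complex ones.\<close>

lemma Ck_compose_line:
  assumes "smooth (\<lambda>x. of_real (f x))" and "Ck_line k g"
  shows "Ck k (\<lambda>x. of_real (g (f x)))"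
  using assms(2)
proof (induction k arbitrary: g)
  case 0
  have "continuous_on UNIV (\<lambda>x. Re (of_real (f x)))"
    by (intro continuous_intros smooth_continuous assms)
  then show ?case using 0
    by (auto intro!: continuous_intros continuous_on_compose2[of UNIV g])
next
  case (Suc k)
  then obtain g' where g': "\<And>x. (g has_real_derivative g' x) (at x)" "Ck_line k g'" by auto
  define F where "F = (\<lambda>x. of_real (f x) :: complex)"
  have F: "(F has_derivative (\<lambda>h. \<Sum>j\<in>UNIV. (h $ j) *\<^sub>R grad F x $ j)) (at x)" for x
    using assms(1) by (auto intro!: has_derivative_grad smooth_differentiable simp: F_def)
  have f: "(f has_derivative (\<lambda>h. Re (\<Sum>j\<in>UNIV. (h $ j) *\<^sub>R grad F x $ j))) (at x)" for x
    using has_derivative_Re[OF F[of x]] by (simp add: F_def)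
  have Im: "(\<lambda>h. Im (\<Sum>j\<in>UNIV. (h $ j) *\<^sub>R grad F x $ j)) = (\<lambda>h. 0)" for x
    by (rule has_derivative_unique[OF has_derivative_Im[OF F[of x]]]) (simp add: F_def)
  have real: "of_real (Re (grad F x $ j)) = grad F x $ j" for x j
    using fun_cong[OF Im[of x], of "axis j 1"]
    by (simp add: complex_eq_iff axis_def if_distrib if_distribR cong: if_cong)
  have *: "((\<lambda>x. of_real (g (f x)) :: complex) has_derivative
      (\<lambda>h. of_real (g' (f x) * Re (\<Sum>j\<in>UNIV. (h $ j) *\<^sub>R grad F x $ j)))) (at x)" for x
    using f[of x] g'(1)[of "f x"]
    by (intro has_derivative_of_real has_derivative_compose[OF f]) (simp add: has_field_derivative_def)
  show ?case
  proof (rule Ck_SucI[OF *])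
    fix j
    have "Ck k (\<lambda>x. of_real (g' (f x)) * grad F x $ j)"
      using Suc.IH[OF g'(2)] smooth_grad[OF assms(1)] by (intro Ck_mult) (auto simp: F_def smooth_def)
    moreover have "of_real (g' (f x) * Re (\<Sum>i\<in>UNIV. (axis j 1 $ i) *\<^sub>R grad F x $ i))
        = of_real (g' (f x)) * grad F x $ j" for x
    proof -
      have "(\<Sum>i\<in>UNIV. (axis j 1 $ i) *\<^sub>R grad F x $ i) = grad F x $ j"
        by (simp add: axis_def if_distrib if_distribR cong: if_cong)
      then show ?thesis by (simp only: of_real_mult real)
    qed
    ultimately show "Ck k (\<lambda>x. of_real (g' (f x) * Re (\<Sum>i\<in>UNIV. (axis j 1 $ i) *\<^sub>R grad F x $ i)))"
      by (simp only:)
  qed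
qed

lemma smooth_compose_line:
  assumes "smooth (\<lambda>x. of_real (f x))" and "\<And>k. Ck_line k g"
  shows "smooth (\<lambda>x. of_real (g (f x)))"
  using Ck_compose_line[OF assms] by (simp add: smooth_def)

text \<open>The derivatives of \<open>exp (- 1 / t)\<close>, extended by zero, are linear combinations of these
  functions: \<open>g\<^sub>m = flat m\<close> satisfies \<open>g\<^sub>m' = g\<^sub>m\<^sub>+\<^sub>2 - m g\<^sub>m\<^sub>+\<^sub>1\<close>.\<close>

definition flat :: "nat \<Rightarrow> real \<Rightarrow> real" where
  "flat m t = (if t \<le> 0 then 0 else (1/t) ^ m * exp (- (1/t)))"

lemma power_exp_neg_bound: "x \<ge> 0 \<Longrightarrow> x ^ m * exp (- x) \<le> fact m" for x :: real
proof -
  assume "x \<ge> 0"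
  have "x ^ m / fact m \<le> exp x"
  proof -
    have "(\<Sum>n\<in>{m}. x ^ n /\<^sub>R fact n) \<le> (\<Sum>n. x ^ n /\<^sub>R fact n)"
      by (rule sum_le_suminf) (use \<open>x \<ge> 0\<close> summable_exp_generic[of x] in auto)
    then show ?thesis by (simp add: exp_def divide_inverse mult.commute)
  qed
  then have "x ^ m \<le> fact m * exp x" by (simp add: field_simps)
  then show ?thesis by (simp add: exp_minus field_simps)
qed

lemma flat_le: "t > 0 \<Longrightarrow> flat m t \<le> fact (m + 2) * t ^ 2"
proof -
  assume "t > 0"
  have "(1/t) ^ m * exp (- (1/t)) = ((1/t) ^ (m+2) * exp (- (1/t))) * t^2"
    using \<open>t > 0\<close> by (simp add: power_add power_divide field_simps power2_eq_square)
  also have "\<dots> \<le> fact (m+2) * t^2"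
    using power_exp_neg_bound[of "1/t" "m+2"] \<open>t > 0\<close> by (intro mult_right_mono) auto
  finally show ?thesis using \<open>t > 0\<close> by (simp add: flat_def)
qed

lemma flat_nonneg: "flat m t \<ge> 0"
  by (simp add: flat_def)

lemma flat_derivative:
  "(flat m has_real_derivative flat (m+2) t + (- real m) * flat (m+1) t) (at t)"
proof -
  consider "t > 0" | "t < 0" | "t = 0" by linarith
  then show ?thesis
  proof cases
    case 1
    have "((\<lambda>t. (1/t) ^ m * exp (- (1/t))) has_real_derivative
        (1/t)^(m+2) * exp (- (1/t)) + (- real m) * ((1/t)^(m+1) * exp (- (1/t)))) (at t)"
    proof (cases m)
      case 0
      then show ?thesis using 1 by (auto intro!: derivative_eq_intros simp: field_simps power2_eq_square)
    next
      case (Suc n)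
      show ?thesis unfolding Suc using 1
        by (auto intro!: derivative_eq_intros simp: power_divide divide_simps)
           (cases n; simp add: power2_eq_square algebra_simps)
    qed
    then have "(flat m has_real_derivative
        (1/t)^(m+2) * exp (- (1/t)) + (- real m) * ((1/t)^(m+1) * exp (- (1/t)))) (at t)"
      by (rule has_field_derivative_transform_within_open[of _ _ _ "{0<..}"])
         (use 1 in \<open>auto simp: flat_def\<close>)
    then show ?thesis using 1 by (simp add: flat_def)
  next
    case 2
    have "((\<lambda>t. 0) has_real_derivative 0) (at t)" by simp
    then have "(flat m has_real_derivative 0) (at t)"
      by (rule has_field_derivative_transform_within_open[of _ _ _ "{..<0}"])
         (use 2 in \<open>auto simp: flat_def\<close>)
    then show ?thesis using 2 by (simp add: flat_def)
  next
    case 3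
    have "((\<lambda>h. flat m h / h) \<longlongrightarrow> 0) (at 0)"
    proof (rule Lim_null_comparison)
      have "norm (flat m h / h) \<le> fact (m+2) * \<bar>h\<bar>" if "h \<noteq> 0" for h
      proof (cases "h > 0")
        case True
        then show ?thesis using flat_le[OF True, of m] flat_nonneg[of m h]
          by (simp add: field_simps power2_eq_square)
      qed (simp add: flat_def mult_nonneg_nonpos)
      then show "\<forall>\<^sub>F h in at 0. norm (flat m h / h) \<le> fact (m+2) * \<bar>h\<bar>"
        by (auto simp: eventually_at intro: exI[of _ 1])
      show "((\<lambda>h. fact (m+2) * \<bar>h\<bar>) \<longlongrightarrow> 0) (at (0::real))"
        by (auto intro!: tendsto_eq_intros)
    qed
    then show ?thesis using 3 by (simp add: DERIV_def flat_def)
  qed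
qed

lemma Ck_line_flat: "Ck_line k (flat m)"
proof (induction k arbitrary: m)
  case 0
  show ?case by (auto intro!: DERIV_continuous[OF flat_derivative] continuous_at_imp_continuous_on)
next
  case (Suc k)
  have "Ck_line k (\<lambda>t. flat (m+2) t + (- real m) * flat (m+1) t)"
    by (intro Ck_line_add Ck_line_cmult Suc)
  then show ?case unfolding Ck_line.simps
    by (intro exI[of _ "\<lambda>t. flat (m+2) t + (- real m) * flat (m+1) t"]) (simp only: flat_derivative simp_thms)
qed

lemma Ck_line_exp: "Ck_line k (\<lambda>t. b + c * exp (a * t))"
proof (induction k arbitrary: b c)
  case 0
  show ?case by (auto intro!: continuous_intros)
next
  case (Suc k)
  have "((\<lambda>t. b + c * exp (a * t)) has_real_derivative 0 + (c * a) * exp (a * t)) (at t)" for t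
    by (auto intro!: derivative_eq_intros)
  then show ?case unfolding Ck_line.simps using Suc[of 0 "c * a"]
    by (intro exI[of _ "\<lambda>t. 0 + (c * a) * exp (a * t)"]) blast
qed

text \<open>The function \<open>flat 0\<close> of \<open>|x|\<^sup>2 - \<rho>\<^sup>2\<close>, normalised on the circle of radius \<open>R\<close>.  It separates
  the inner disk from that circle.\<close>

lemma smooth_cutoff:
  assumes "0 \<le> \<rho>" "\<rho> < R"
  obtains \<eta> :: "real^2 \<Rightarrow> real" where "smooth (\<lambda>x. of_real (\<eta> x))"
    and "\<And>x. norm x \<le> \<rho> \<Longrightarrow> \<eta> x = 0" and "\<And>x. norm x = R \<Longrightarrow> \<eta> x = 1"
proof
  define f :: "real^2 \<Rightarrow> real" where "f x = (norm x)\<^sup>2 - \<rho>\<^sup>2" for x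
  define c where "c = flat 0 (R\<^sup>2 - \<rho>\<^sup>2)"
  have R: "R\<^sup>2 - \<rho>\<^sup>2 > 0" using assms by (simp add: power_strict_mono)
  then have c: "c > 0" by (simp add: c_def flat_def)
  have "of_real (f x) = (\<Sum>i\<in>UNIV. of_real (x $ i) * of_real (x $ i)) - complex_of_real (\<rho>\<^sup>2)" for x
    unfolding f_def power2_norm_eq_inner inner_vec_def by simp
  then have "smooth (\<lambda>x. of_real (f x))"
    by (simp only:) (intro smooth_diff smooth_sum smooth_mult smooth_coordinate smooth_const)
  from smooth_compose_line[OF this, of "\<lambda>t. (1/c) * flat 0 t"]
  show "smooth (\<lambda>x. of_real ((1/c) * flat 0 (f x)))"
    by (metis Ck_line_cmult Ck_line_flat)
  show "norm x \<le> \<rho> \<Longrightarrow> 1 / c * flat 0 (f x) = 0" for x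
    using power_mono[of "norm x" \<rho> 2] by (auto simp: flat_def f_def)
  show "norm x = R \<Longrightarrow> 1 / c * flat 0 (f x) = 1" for x
    using c by (simp add: f_def c_def)
qed

text \<open>The functions \<open>1 - exp (- n b)\<close>, with \<open>b\<close> a bump on an open box, increase to the
  indicator of the box.\<close>

lemma box_indicator_approximation:
  fixes a b :: "real^2"
  obtains \<phi> :: "nat \<Rightarrow> real^2 \<Rightarrow> real"
  where "\<And>n. smooth (\<lambda>x. of_real (\<phi> n x))" and "\<And>n x. 0 \<le> \<phi> n x \<and> \<phi> n x \<le> 1"
    and "\<And>n x. x \<notin> box a b \<Longrightarrow> \<phi> n x = 0"
    and "\<And>x. (\<lambda>n. \<phi> n x) \<longlonglongrightarrow> indicator (box a b) x"
proof
  define \<beta> :: "real^2 \<Rightarrow> real" where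
    "\<beta> x = flat 0 (x $ 1 - a $ 1) * flat 0 (b $ 1 - x $ 1) * (flat 0 (x $ 2 - a $ 2) * flat 0 (b $ 2 - x $ 2))" for x
  have sm: "smooth (\<lambda>x. of_real (flat 0 (x $ i - c)))" "smooth (\<lambda>x. of_real (flat 0 (c - x $ i)))" for i c
    by (rule smooth_compose_line[OF _ Ck_line_flat],
        use smooth_diff[OF smooth_coordinate[of i] smooth_const[of "of_real c"]]
            smooth_diff[OF smooth_const[of "of_real c"] smooth_coordinate[of i]] in simp)+
  have "smooth (\<lambda>x. of_real (\<beta> x))"
    unfolding \<beta>_def of_real_mult by (intro smooth_mult sm)
  then show "smooth (\<lambda>x. of_real (1 + (-1) * exp ((- real n) * \<beta> x)))" for n
    by (rule smooth_compose_line[OF _ Ck_line_exp])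
  have \<beta>0: "\<beta> x \<ge> 0" for x by (simp add: \<beta>_def flat_nonneg)
  then show "0 \<le> 1 + (-1) * exp ((- real n) * \<beta> x) \<and> 1 + (-1) * exp ((- real n) * \<beta> x) \<le> 1" for n x
    by simp
  have box: "x \<in> box a b \<longleftrightarrow> a $ 1 < x $ 1 \<and> x $ 1 < b $ 1 \<and> a $ 2 < x $ 2 \<and> x $ 2 < b $ 2" for x
    by (auto simp: mem_box_cart forall_2)
  have \<beta>_out: "x \<notin> box a b \<Longrightarrow> \<beta> x = 0" for x
    unfolding \<beta>_def box flat_def by auto
  then show "x \<notin> box a b \<Longrightarrow> 1 + (-1) * exp ((- real n) * \<beta> x) = 0" for n x by simp
  show "(\<lambda>n. 1 + (-1) * exp ((- real n) * \<beta> x)) \<longlonglongrightarrow> indicator (box a b) x" for x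
  proof (cases "x \<in> box a b")
    case True
    then have "\<beta> x > 0" unfolding \<beta>_def box flat_def by auto
    then have "(\<lambda>n. (exp (- \<beta> x)) ^ n) \<longlonglongrightarrow> 0" by (intro LIMSEQ_power_zero) auto
    then have "(\<lambda>n. exp ((- real n) * \<beta> x)) \<longlonglongrightarrow> 0"
      by (simp add: exp_of_nat_mult[symmetric])
    then have "(\<lambda>n. 1 + (-1) * exp ((- real n) * \<beta> x)) \<longlonglongrightarrow> 1 + (-1) * 0" by (intro tendsto_intros)
    then show ?thesis using True by simp
  qed (simp add: \<beta>_out)
qed

section \<open>Square integrable functions\<close>

lemma L2_iff: "f \<in> L2 M \<longleftrightarrow> f \<in> borel_measurable M \<and> integrable M (\<lambda>x. (norm (f x))\<^sup>2)"
  unfolding L2_def integrable_iff_bounded by auto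

lemma L2_measurable: "f \<in> L2 M \<Longrightarrow> f \<in> borel_measurable M"
  by (simp add: L2_def)

lemma L2I_bound:
  assumes "f \<in> borel_measurable M" "integrable M g" "\<And>x. x \<in> space M \<Longrightarrow> (norm (f x))\<^sup>2 \<le> g x"
  shows "f \<in> L2 M"
  unfolding L2_iff
proof
  show "integrable M (\<lambda>x. (norm (f x))\<^sup>2)"
  proof (rule Bochner_Integration.integrable_bound[OF assms(2)])
    show "AE x in M. norm ((norm (f x))\<^sup>2) \<le> norm (g x)"
    proof (rule AE_I2)
      fix x assume "x \<in> space M"
      from assms(3)[OF this] show "norm ((norm (f x))\<^sup>2) \<le> norm (g x)" by simp
    qed
  qed (use assms(1) in measurable)
qed fact

lemma norm_add_sq_le: "(norm (a + b))\<^sup>2 \<le> 2 * (norm a)\<^sup>2 + 2 * (norm b)\<^sup>2" for a b :: "'a::real_normed_vector"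
proof -
  have "(norm (a + b))\<^sup>2 \<le> (norm a + norm b)\<^sup>2" by (simp add: norm_triangle_ineq power_mono)
  also have "\<dots> \<le> 2 * (norm a)\<^sup>2 + 2 * (norm b)\<^sup>2"
    using zero_le_power2[of "norm a - norm b"] by (simp add: power2_eq_square algebra_simps)
  finally show ?thesis .
qed

lemma L2_add:
  assumes "f \<in> L2 M" "g \<in> L2 M"
  shows "(\<lambda>x. f x + g x) \<in> L2 M"
proof (rule L2I_bound)
  show "integrable M (\<lambda>x. 2 * (norm (f x))\<^sup>2 + 2 * (norm (g x))\<^sup>2)"
    using assms by (auto simp: L2_iff)
  show "(\<lambda>x. f x + g x) \<in> borel_measurable M" using assms by (auto simp: L2_iff)
qed (rule norm_add_sq_le)

lemma L2_scale_bounded: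
  fixes f :: "'a \<Rightarrow> complex"
  assumes "f \<in> L2 M" "m \<in> borel_measurable M" "\<And>x. x \<in> space M \<Longrightarrow> norm (m x) \<le> C"
  shows "(\<lambda>x. m x * f x) \<in> L2 M"
proof (rule L2I_bound)
  show "integrable M (\<lambda>x. C\<^sup>2 * (norm (f x))\<^sup>2)"
    using assms by (auto simp: L2_iff)
  show "(\<lambda>x. m x * f x) \<in> borel_measurable M" using assms by (auto simp: L2_iff)
  show "(norm (m x * f x))\<^sup>2 \<le> C\<^sup>2 * (norm (f x))\<^sup>2" if "x \<in> space M" for x
    using assms(3)[OF that] by (auto simp: norm_mult power_mult_distrib intro!: mult_right_mono power_mono)
qed

lemma L2_cmult: "f \<in> L2 M \<Longrightarrow> (\<lambda>x. c * f x) \<in> L2 M" for f :: "'a \<Rightarrow> complex"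
  by (rule L2_scale_bounded[of _ _ _ "norm c"]) auto

lemma L2_diff: "f \<in> L2 M \<Longrightarrow> g \<in> L2 M \<Longrightarrow> (\<lambda>x. f x - g x) \<in> L2 M"
  using L2_add[of f M "\<lambda>x. - g x"] by (simp add: L2_iff)

lemma L2_cnj: "f \<in> L2 M \<Longrightarrow> (\<lambda>x. cnj (f x)) \<in> L2 M"
  by (simp add: L2_iff borel_measurable_continuous_on[OF continuous_on_cnj[OF continuous_on_id]])

lemma measurable_vec_nth:
  "f \<in> borel_measurable M \<Longrightarrow> (\<lambda>x. f x $ j) \<in> borel_measurable M" for f :: "'a \<Rightarrow> complex^2"
  by (rule borel_measurable_continuous_on[where f="\<lambda>x. x $ j"]) (auto intro: continuous_intros)

lemma measurable_vecI:
  fixes f :: "'a \<Rightarrow> complex^2"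
  assumes "\<And>j. (\<lambda>x. f x $ j) \<in> borel_measurable M"
  shows "f \<in> borel_measurable M"
proof (rule borel_measurable_euclidean_space[THEN iffD2], intro ballI)
  fix i :: "complex^2" assume "i \<in> Basis"
  then obtain j e where i: "i = axis j e" by (auto simp: Basis_vec_def)
  show "(\<lambda>x. f x \<bullet> i) \<in> borel_measurable M"
    unfolding i inner_axis using assms[of j] by (intro borel_measurable_inner) auto
qed

lemma norm_complex_vec_sq: "(norm v)\<^sup>2 = (\<Sum>j\<in>UNIV. (norm (v $ j))\<^sup>2)" for v :: "complex^2"
  by (simp add: norm_vec_def L2_set_def real_sqrt_pow2 sum_nonneg)

lemma norm_vec_nth_sq_le: "(norm (v $ j))\<^sup>2 \<le> (norm v)\<^sup>2" for v :: "complex^2"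
  unfolding norm_complex_vec_sq by (rule member_le_sum) auto

lemma L2_nth: "v \<in> L2 M \<Longrightarrow> (\<lambda>x. v x $ j) \<in> L2 M" for v :: "'a \<Rightarrow> complex^2"
  by (rule L2I_bound[where g="\<lambda>x. (norm (v x))\<^sup>2"]) (auto simp: L2_iff measurable_vec_nth norm_vec_nth_sq_le)

lemma L2_vecI:
  fixes v :: "'a \<Rightarrow> complex^2"
  assumes "\<And>j. (\<lambda>x. v x $ j) \<in> L2 M"
  shows "v \<in> L2 M"
proof (rule L2I_bound)
  show "integrable M (\<lambda>x. \<Sum>j\<in>UNIV. (norm (v x $ j))\<^sup>2)" using assms by (auto simp: L2_iff)
  show "v \<in> borel_measurable M" using assms by (auto intro: measurable_vecI simp: L2_iff)
qed (simp add: norm_complex_vec_sq)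

lemma L2_mult_integrable:
  fixes f g :: "'a \<Rightarrow> complex"
  assumes "f \<in> L2 M" "g \<in> L2 M"
  shows "integrable M (\<lambda>x. f x * g x)"
proof (rule Bochner_Integration.integrable_bound)
  show "integrable M (\<lambda>x. (norm (f x))\<^sup>2 + (norm (g x))\<^sup>2)" using assms by (auto simp: L2_iff)
  show "(\<lambda>x. f x * g x) \<in> borel_measurable M" using assms by (auto simp: L2_iff)
  have "norm (f x) * norm (g x) \<le> (norm (f x))\<^sup>2 + (norm (g x))\<^sup>2" for x
    using sum_squares_bound[of "norm (f x)" "norm (g x)"]
      mult_nonneg_nonneg[OF norm_ge_zero[of "f x"] norm_ge_zero[of "g x"]]
    by linarith
  then show "AE x in M. norm (f x * g x) \<le> norm ((norm (f x))\<^sup>2 + (norm (g x))\<^sup>2)"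
    by (auto simp: norm_mult)
qed

lemma L2_bounded:
  fixes f :: "'a \<Rightarrow> complex"
  assumes "finite_measure M" "f \<in> borel_measurable M" "\<And>x. x \<in> space M \<Longrightarrow> norm (f x) \<le> C"
  shows "f \<in> L2 M"
proof -
  interpret finite_measure M by fact
  show ?thesis
    by (rule L2I_bound[of _ _ "\<lambda>_. C\<^sup>2"]) (use assms in \<open>auto intro!: power_mono\<close>)
qed

lemma L2_integrable:
  fixes f :: "'a \<Rightarrow> complex"
  assumes "finite_measure M" "f \<in> L2 M"
  shows "integrable M f"
  using L2_mult_integrable[OF assms(2) L2_bounded[OF assms(1), of "\<lambda>_. 1" 1]] by simp

text \<open>Cauchy--Schwarz, in the form in which limits are taken under the integral sign.\<close>

lemma L2_tendsto_integral:
  fixes f :: "'a \<Rightarrow> complex"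
  assumes "f \<in> L2 M" "g \<in> L2 M" "\<And>k. w k \<in> L2 M"
    and lim: "(\<lambda>k. \<integral>\<^sup>+x. ennreal ((norm (w k x - f x))\<^sup>2) \<partial>M) \<longlonglongrightarrow> 0"
  shows "(\<lambda>k. LINT x|M. w k x * g x) \<longlonglongrightarrow> (LINT x|M. f x * g x)"
proof -
  define G where "G = (\<integral>\<^sup>+x. ennreal ((norm (g x))\<^sup>2) \<partial>M)"
  have G: "G < \<infinity>" using assms(2) by (simp add: L2_def G_def)
  have meas[measurable]: "g \<in> borel_measurable M" "f \<in> borel_measurable M" "w k \<in> borel_measurable M" for k
    using assms by (auto simp: L2_def)
  define I where "I k = (\<integral>\<^sup>+x. ennreal ((norm (w k x - f x))\<^sup>2) \<partial>M)" for k
  have bound: "ennreal ((norm ((LINT x|M. w k x * g x) - (LINT x|M. f x * g x)))\<^sup>2) \<le> I k * G" for k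
  proof -
    have i1: "integrable M (\<lambda>x. w k x * g x)" "integrable M (\<lambda>x. f x * g x)"
      "integrable M (\<lambda>x. (w k x - f x) * g x)"
      using assms by (auto intro!: L2_mult_integrable L2_diff)
    have "ennreal (norm (LINT x|M. (w k x - f x) * g x)) \<le> (\<integral>\<^sup>+x. norm ((w k x - f x) * g x) \<partial>M)"
      by (rule integral_norm_bound_ennreal[OF i1(3)])
    also have "\<dots> = (\<integral>\<^sup>+x. ennreal (norm (w k x - f x)) * ennreal (norm (g x)) \<partial>M)"
      by (simp add: norm_mult ennreal_mult)
    finally have "ennreal (norm (LINT x|M. (w k x - f x) * g x)) ^ 2
       \<le> (\<integral>\<^sup>+x. ennreal (norm (w k x - f x)) * ennreal (norm (g x)) \<partial>M) ^ 2"
      by (rule power_mono) simp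
    also have "\<dots> \<le> (\<integral>\<^sup>+x. ennreal (norm (w k x - f x)) ^ 2 \<partial>M) * (\<integral>\<^sup>+x. ennreal (norm (g x)) ^ 2 \<partial>M)"
      by (rule Cauchy_Schwarz_nn_integral) auto
    also have "\<dots> = I k * G" by (simp add: I_def G_def ennreal_power)
    finally show ?thesis using i1
      by (simp add: left_diff_distrib Bochner_Integration.integral_diff ennreal_power)
  qed
  have "(\<lambda>k. I k * G) \<longlonglongrightarrow> 0 * G"
    using G by (intro tendsto_mult_ennreal lim[folded I_def] tendsto_const) auto
  then have IG: "(\<lambda>k. I k * G) \<longlonglongrightarrow> ennreal 0" by simp
  have "(\<lambda>k. ennreal ((norm ((LINT x|M. w k x * g x) - (LINT x|M. f x * g x)))\<^sup>2)) \<longlonglongrightarrow> ennreal 0"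
    by (rule tendsto_sandwich[OF _ _ tendsto_const IG]) (use bound in auto)
  then have "(\<lambda>k. (norm ((LINT x|M. w k x * g x) - (LINT x|M. f x * g x)))\<^sup>2) \<longlonglongrightarrow> 0"
    by (subst (asm) tendsto_ennreal_iff) auto
  then have "(\<lambda>k. norm ((LINT x|M. w k x * g x) - (LINT x|M. f x * g x))) \<longlonglongrightarrow> 0"
    by simp
  then show ?thesis by (simp add: LIM_zero_iff tendsto_norm_zero_iff)
qed

section \<open>The fundamental lemma of the calculus of variations\<close>

lemma sigma_finite_lebesgue: "sigma_finite_measure (lebesgue :: 'a::euclidean_space measure)"
proof
  obtain \<A> :: "'a set set" where "countable \<A>" "\<A> \<subseteq> sets lborel" "\<Union>\<A> = space lborel"
    "\<forall>a\<in>\<A>. emeasure lborel a \<noteq> \<infinity>"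
    using lborel.sigma_finite_countable by blast
  then show "\<exists>\<A>::'a set set. countable \<A> \<and> \<A> \<subseteq> sets lebesgue \<and> \<Union>\<A> = space lebesgue
      \<and> (\<forall>a\<in>\<A>. emeasure lebesgue a \<noteq> \<infinity>)"
    by (intro exI[of _ \<A>]) (auto simp: subset_eq)
qed

text \<open>Open boxes generate the Borel sets and are closed under intersection, so the integral vanishes
  over every Borel set, and then over every Lebesgue set since these differ from Borel sets by null
  sets.\<close>

lemma AE_zero_if_box_integrals_zero:
  fixes g :: "'a::euclidean_space \<Rightarrow> 'b::{banach,second_countable_topology}"
  assumes g: "integrable lebesgue g" and total: "integral\<^sup>L lebesgue g = 0"
    and box: "\<And>a b. (LINT x:box a b|lebesgue. g x) = 0"
  shows "AE x in lebesgue. g x = 0"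
proof (rule sigma_finite_measure.density_zero[OF sigma_finite_lebesgue g])
  have si: "set_integrable lebesgue A g" if "A \<in> sets lebesgue" for A
    unfolding set_integrable_def using that g by (rule integrable_mult_indicator)
  have borel: "(LINT x:A|lebesgue. g x) = 0" if A: "A \<in> sets borel" for A
  proof -
    have "Int_stable (range (\<lambda>(a, b). box a b :: 'a set))"
      by (auto simp: Int_stable_def box_Int_box)
    moreover have "(range (\<lambda>(a, b). box a b)) \<subseteq> Pow (UNIV :: 'a set)"
      by auto
    moreover have "A \<in> sigma_sets UNIV (range (\<lambda>(a, b). box a b))"
      using A unfolding borel_eq_box by simp
    ultimately show ?thesis
    proof (induction rule: sigma_sets_induct_disjoint)
      case (basic A) then show ?case using box by auto
    next
      case empty then show ?case by (simp add: set_lebesgue_integral_def)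
    next
      case (compl A)
      then have [measurable]: "A \<in> sets borel" by (simp add: borel_eq_box)
      have "(LINT x:A \<union> (UNIV - A)|lebesgue. g x) = (LINT x:A|lebesgue. g x) + (LINT x:UNIV - A|lebesgue. g x)"
        by (intro set_integral_Un si) auto
      moreover have "A \<union> (UNIV - A) = UNIV" by auto
      ultimately show ?case using compl total by (simp add: set_lebesgue_integral_def)
    next
      case (union F)
      then have F: "F i \<in> sets lebesgue" for i by (simp add: borel_eq_box subset_eq)
      have "(LINT x:(\<Union>i. F i)|lebesgue. g x) = (\<Sum>i. (LINT x:(F i)|lebesgue. g x))"
        using union F by (intro lebesgue_integral_countable_add si) (auto simp: disjoint_family_on_def)
      then show ?case using union by simp
    qed
  qed
  fix A :: "'a set" assume A: "A \<in> sets lebesgue"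
  then obtain S N N' where S: "A = S \<union> N" "N \<subseteq> N'" "N' \<in> null_sets lborel" "S \<in> sets lborel"
    by (rule sets_completionE)
  have N': "N' \<in> null_sets lebesgue" using S(3) by (rule null_sets_completionI)
  have "(LINT x:A|lebesgue. g x) = (LINT x:S|lebesgue. g x)"
    unfolding set_lebesgue_integral_def
  proof (rule integral_cong_AE)
    show "(\<lambda>x. indicator A x *\<^sub>R g x) \<in> borel_measurable lebesgue"
      "(\<lambda>x. indicator S x *\<^sub>R g x) \<in> borel_measurable lebesgue"
      using A S g by (auto intro!: borel_measurable_scaleR borel_measurable_indicator)
    show "AE x in lebesgue. indicator A x *\<^sub>R g x = indicator S x *\<^sub>R g x"
      using AE_not_in[OF N'] by eventually_elim (use S in \<open>auto simp: indicator_def\<close>)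
  qed
  then show "(LINT x:A|lebesgue. g x) = 0" using borel S by simp
qed

lemma closure_support_subset:
  assumes "\<And>x. x \<notin> S \<Longrightarrow> \<phi> x = 0" "closed S"
  shows "closure {x. \<phi> x \<noteq> 0} \<subseteq> S"
  using assms by (intro closure_minimal) auto

lemma test_functionsI:
  assumes "smooth \<phi>" "\<And>x. x \<notin> S \<Longrightarrow> \<phi> x = 0" "compact S" "S \<subseteq> \<Omega>"
  shows "\<phi> \<in> test_functions \<Omega>"
proof -
  have "closure {x. \<phi> x \<noteq> 0} \<subseteq> S"
    using assms by (intro closure_support_subset compact_imp_closed) auto
  moreover have "compact (closure {x. \<phi> x \<noteq> 0})"
    using \<open>compact S\<close> calculation by (metis closed_closure compact_Int_closed inf.absorb2)
  ultimately show ?thesis using assms by (auto simp: test_functions_def)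
qed

lemma test_functionsE:
  assumes "\<phi> \<in> test_functions \<Omega>"
  obtains S where "compact S" "S \<subseteq> \<Omega>" "\<And>x. x \<notin> S \<Longrightarrow> \<phi> x = 0" "smooth \<phi>"
  using assms that[of "closure {x. \<phi> x \<noteq> 0}"] closure_subset[of "{x. \<phi> x \<noteq> 0}"]
  by (fastforce simp: test_functions_def)

text \<open>Test functions increasing to the indicator of a box show that the integral of \<open>f\<close> over every
  box with closure in \<open>\<Omega>\<close> is zero, and countably many such boxes exhaust \<open>\<Omega>\<close>.\<close>

proposition fundamental_lemma_calculus_of_variations:
  fixes f :: "real^2 \<Rightarrow> complex"
  assumes \<Omega>: "open \<Omega>" and f: "integrable (lebesgue_on \<Omega>) f"
    and zero: "\<And>\<phi>. \<phi> \<in> test_functions \<Omega> \<Longrightarrow> (LINT x|lebesgue_on \<Omega>. f x * \<phi> x) = 0"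
  shows "AE x in lebesgue_on \<Omega>. f x = 0"
proof -
  have [measurable]: "\<Omega> \<in> sets lebesgue" using \<Omega> by (simp add: borel_open)
  have fi: "integrable lebesgue (\<lambda>x. indicator \<Omega> x *\<^sub>R f x)"
    using f by (subst (asm) integrable_restrict_space) auto
  have box_zero: "(LINT x:box a b|lebesgue. indicator \<Omega> x *\<^sub>R f x) = 0" if ab: "cbox a b \<subseteq> \<Omega>" for a b
  proof -
    obtain \<phi> :: "nat \<Rightarrow> real^2 \<Rightarrow> real" where \<phi>: "\<And>n. smooth (\<lambda>x. of_real (\<phi> n x))"
      "\<And>n x. 0 \<le> \<phi> n x \<and> \<phi> n x \<le> 1" "\<And>n x. x \<notin> box a b \<Longrightarrow> \<phi> n x = 0"
      "\<And>x. (\<lambda>n. \<phi> n x) \<longlonglongrightarrow> indicator (box a b) x"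
      using box_indicator_approximation[of a b] by metis
    have meas: "\<phi> n \<in> borel_measurable lebesgue" for n
    proof -
      have "continuous_on UNIV (\<lambda>x. Re (of_real (\<phi> n x)))"
        using smooth_continuous[OF \<phi>(1)] by (rule continuous_on_Re)
      then have "continuous_on UNIV (\<phi> n)" by simp
      then show ?thesis by (auto intro!: borel_measurable_continuous_onI measurable_completion)
    qed
    have "(LINT x|lebesgue. \<phi> n x *\<^sub>R (indicator \<Omega> x *\<^sub>R f x)) = 0" for n
    proof -
      have "(\<lambda>x. of_real (\<phi> n x)) \<in> test_functions \<Omega>"
      proof (rule test_functionsI[OF \<phi>(1) _ compact_cbox ab])
        fix x assume "x \<notin> cbox a b"
        then have "x \<notin> box a b" using box_subset_cbox by blast
        then show "complex_of_real (\<phi> n x) = 0" using \<phi>(3) by simp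
      qed
      from zero[OF this] show ?thesis
        by (subst (asm) integral_restrict_space) (auto simp: scaleR_conv_of_real mult_ac)
    qed
    moreover have "(\<lambda>n. LINT x|lebesgue. \<phi> n x *\<^sub>R (indicator \<Omega> x *\<^sub>R f x))
        \<longlonglongrightarrow> (LINT x|lebesgue. indicator (box a b) x *\<^sub>R (indicator \<Omega> x *\<^sub>R f x))"
    proof (rule integral_dominated_convergence[where w="\<lambda>x. norm (indicator \<Omega> x *\<^sub>R f x)"])
      show "integrable lebesgue (\<lambda>x. norm (indicator \<Omega> x *\<^sub>R f x))" using fi by (rule integrable_norm)
      show "AE x in lebesgue. (\<lambda>n. \<phi> n x *\<^sub>R (indicator \<Omega> x *\<^sub>R f x)) \<longlonglongrightarrow> indicator (box a b) x *\<^sub>R (indicator \<Omega> x *\<^sub>R f x)"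
        by (intro AE_I2 tendsto_intros \<phi>)
      show "AE x in lebesgue. norm (\<phi> n x *\<^sub>R (indicator \<Omega> x *\<^sub>R f x)) \<le> norm (indicator \<Omega> x *\<^sub>R f x)" for n
        using \<phi>(2)[of n] by (auto simp: mult.assoc intro!: mult_left_le_one_le)
      show "(\<lambda>x. \<phi> n x *\<^sub>R (indicator \<Omega> x *\<^sub>R f x)) \<in> borel_measurable lebesgue" for n
        using meas borel_measurable_integrable[OF fi] by (rule borel_measurable_scaleR)
      show "(\<lambda>x. indicator (box a b) x *\<^sub>R (indicator \<Omega> x *\<^sub>R f x)) \<in> borel_measurable lebesgue"
        using borel_measurable_integrable[OF fi] by (rule borel_measurable_scaleR[rotated])
          (auto intro!: borel_measurable_indicator)
    qed
    ultimately show ?thesis by (simp add: set_lebesgue_integral_def LIMSEQ_const_iff)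
  qed
  have box_AE: "AE x in lebesgue. x \<in> box c d \<longrightarrow> f x = 0" if cd: "cbox c d \<subseteq> \<Omega>" for c d
  proof -
    let ?g = "\<lambda>x. indicator (box c d) x *\<^sub>R (indicator \<Omega> x *\<^sub>R f x)"
    have "AE x in lebesgue. ?g x = 0"
    proof (rule AE_zero_if_box_integrals_zero)
      show "integrable lebesgue ?g" using fi by (rule integrable_mult_indicator[rotated]) simp
      show "integral\<^sup>L lebesgue ?g = 0" using box_zero[OF cd] by (simp add: set_lebesgue_integral_def)
      fix a b :: "real^2"
      obtain a' b' where ab': "box a b \<inter> box c d = box a' b'" "cbox a' b' \<subseteq> \<Omega>"
      proof (cases "box a b \<inter> box c d = {}")
        case True
        moreover have "box 1 (0::real^2) = {}" "cbox 1 (0::real^2) = {}"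
          by (auto simp: mem_box_cart forall_2 set_eq_iff)
        ultimately show ?thesis using that[of 1 0] by simp
      next
        case False
        obtain a' b' where *: "box a b \<inter> box c d = box a' b'"
          using box_Int_box[of a b c d] that by blast
        then have "closure (box a' b') \<subseteq> cbox c d"
          using box_subset_cbox[of c d] by (intro closure_minimal) auto
        have "closure (box a' b') = cbox a' b'" using False * by (intro closure_box) simp
        with \<open>closure (box a' b') \<subseteq> cbox c d\<close> have "cbox a' b' \<subseteq> \<Omega>" using cd by simp
        then show ?thesis by (rule that[OF *])
      qed
      have "(LINT x:box a b|lebesgue. ?g x) = (LINT x:box a' b'|lebesgue. indicator \<Omega> x *\<^sub>R f x)"
        unfolding ab'(1)[symmetric] set_lebesgue_integral_def
        by (intro Bochner_Integration.integral_cong) (auto simp: indicator_def)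
      then show "(LINT x:box a b|lebesgue. ?g x) = 0" using box_zero[OF ab'(2)] by simp
    qed
    then show ?thesis
    proof eventually_elim
      case (elim x)
      have "x \<in> \<Omega>" if "x \<in> box c d" using that cd box_subset_cbox[of c d] by blast
      then show ?case using elim by (auto simp: indicator_def split: if_splits)
    qed
  qed
  obtain \<D> where \<D>: "countable \<D>" "\<D> \<subseteq> Pow \<Omega>" "\<And>X. X \<in> \<D> \<Longrightarrow> \<exists>a b. X = cbox a b" "\<Union>\<D> = \<Omega>"
    using open_countable_Union_open_cbox[OF \<Omega>] by metis
  have fr: "AE x in lebesgue. x \<notin> cbox a b - box a b" for a b :: "real^2"
  proof (rule AE_not_in)
    have "negligible (frontier (cbox a b))" by (rule negligible_convex_frontier) simp
    then show "cbox a b - box a b \<in> null_sets lebesgue"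
      by (simp add: negligible_iff_null_sets frontier_cbox)
  qed
  have "AE x in lebesgue. \<forall>X\<in>\<D>. x \<in> X \<longrightarrow> f x = 0"
  proof (rule AE_ball_countable[THEN iffD2, OF \<D>(1)], rule ballI)
    fix X assume X: "X \<in> \<D>"
    then obtain a b where ab: "X = cbox a b" using \<D>(3) by blast
    then have "cbox a b \<subseteq> \<Omega>" using X \<D>(2) by auto
    from box_AE[OF this] fr[of a b] show "AE x in lebesgue. x \<in> X \<longrightarrow> f x = 0"
      unfolding ab by eventually_elim blast
  qed
  then have "AE x in lebesgue. x \<in> \<Omega> \<longrightarrow> f x = 0"
    by eventually_elim (use \<D>(4) in auto)
  then show ?thesis by (subst AE_restrict_space_iff) auto
qed

section \<open>Calculus in the Sobolev space of a bounded domain\<close>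

lemma grad_zero_outside:
  assumes "\<And>x. x \<notin> S \<Longrightarrow> \<phi> x = 0" "closed S" "x \<notin> S"
  shows "grad \<phi> x $ j = 0"
proof -
  have "((\<lambda>_. 0) has_derivative (\<lambda>_. 0)) (at x)" by simp
  then have "(\<phi> has_derivative (\<lambda>_. 0)) (at x)"
    by (rule has_derivative_transform_within_open[of _ _ _ _ "- S"]) (use assms in auto)
  then show ?thesis by (simp add: grad_eq)
qed

lemma test_functions_mult:
  assumes "\<phi> \<in> test_functions \<Omega>" "smooth m"
  shows "(\<lambda>x. m x * \<phi> x) \<in> test_functions \<Omega>"
  using assms(1) by (elim test_functionsE) (rule test_functionsI, auto intro: smooth_mult assms(2))

lemma test_functions_cnj:
  assumes "\<phi> \<in> test_functions \<Omega>"
  shows "(\<lambda>x. cnj (\<phi> x)) \<in> test_functions \<Omega>"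
  using assms by (elim test_functionsE) (rule test_functionsI, auto intro: smooth_cnj)

lemma test_functions_grad:
  assumes "\<phi> \<in> test_functions \<Omega>"
  shows "(\<lambda>x. grad \<phi> x $ j) \<in> test_functions \<Omega>"
  using assms by (elim test_functionsE)
    (rule test_functionsI, auto intro: smooth_grad grad_zero_outside compact_imp_closed)

lemma test_functions_smooth: "\<phi> \<in> test_functions \<Omega> \<Longrightarrow> smooth \<phi>"
  by (simp add: test_functions_def)

lemma test_functions_mono: "\<phi> \<in> test_functions S \<Longrightarrow> S \<subseteq> T \<Longrightarrow> \<phi> \<in> test_functions T"
  by (auto simp: test_functions_def)

lemma smooth_laplacian: "smooth \<phi> \<Longrightarrow> smooth (laplacian \<phi>)"
  unfolding laplacian_def by (intro smooth_sum smooth_grad)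

lemma norm_cvec_scale: "norm (\<chi> j. c * a $ j) = norm c * norm a" for a :: "complex^2"
proof -
  have "(norm (\<chi> j. c * a $ j))\<^sup>2 = (norm c * norm a)\<^sup>2"
    by (simp add: norm_complex_vec_sq norm_mult power_mult_distrib sum_distrib_left)
  then show ?thesis by (simp add: power2_eq_iff_nonneg)
qed

lemma norm_cvec_scale': "norm (\<chi> j. a $ j * c) = norm a * norm c" for a :: "complex^2"
  using norm_cvec_scale[of c a] by (simp add: mult.commute)

locale bounded_domain =
  fixes \<Omega> :: "(real^2) set"
  assumes open_dom: "open \<Omega>" and bounded_dom: "bounded \<Omega>"
begin

lemma sets_dom: "\<Omega> \<in> sets lebesgue"
  using open_dom by (simp add: borel_open)

lemma finite_measure_dom: "finite_measure (lebesgue_on \<Omega>)"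
  using bounded_dom sets_dom
  by (metis bounded_set_imp_lmeasurable finite_measure_lebesgue_on)

lemma continuous_measurable: "continuous_on UNIV f \<Longrightarrow> f \<in> borel_measurable (lebesgue_on \<Omega>)"
  by (rule continuous_imp_measurable_on_sets_lebesgue[OF _ sets_dom]) (auto intro: continuous_on_subset)

lemma smooth_measurable: "smooth f \<Longrightarrow> f \<in> borel_measurable (lebesgue_on \<Omega>)"
  by (intro continuous_measurable smooth_continuous)

lemma smooth_bounded:
  assumes "smooth f"
  obtains C where "C \<ge> 0" "\<And>x. x \<in> space (lebesgue_on \<Omega>) \<Longrightarrow> norm (f x) \<le> C"
proof -
  have "compact (closure \<Omega>)" using bounded_dom by (simp add: compact_closure)
  then have "compact (f ` closure \<Omega>)"
    by (rule compact_continuous_image[rotated])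
       (auto intro: continuous_on_subset[OF smooth_continuous[OF assms]])
  then have "bounded (f ` closure \<Omega>)" by (rule compact_imp_bounded)
  then obtain C where "\<forall>y\<in>f ` closure \<Omega>. norm y \<le> C" unfolding bounded_iff by blast
  then have "norm (f x) \<le> C" if "x \<in> closure \<Omega>" for x using that by blast
  then have "norm (f x) \<le> max C 0" if "x \<in> space (lebesgue_on \<Omega>)" for x
    using that closure_subset[of \<Omega>] by (auto simp: space_restrict_space intro: max.coboundedI1)
  from that[OF max.cobounded2 this] show ?thesis .
qed

lemma smooth_L2: "smooth f \<Longrightarrow> f \<in> L2 (lebesgue_on \<Omega>)"
  by (metis smooth_bounded L2_bounded finite_measure_dom smooth_measurable)

lemma smooth_grad_L2: "smooth f \<Longrightarrow> grad f \<in> L2 (lebesgue_on \<Omega>)"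
  by (intro L2_vecI smooth_L2 smooth_grad)

lemma L2_smooth_mult: "u \<in> L2 (lebesgue_on \<Omega>) \<Longrightarrow> smooth m \<Longrightarrow> (\<lambda>x. m x * u x) \<in> L2 (lebesgue_on \<Omega>)"
  using L2_scale_bounded[of u "lebesgue_on \<Omega>" m] smooth_bounded[of m] smooth_measurable[of m] by metis

lemma test_L2: "\<phi> \<in> test_functions \<Omega> \<Longrightarrow> \<phi> \<in> L2 (lebesgue_on \<Omega>)"
  by (simp add: smooth_L2 test_functions_smooth)

lemma L2_integral_determines:
  assumes "f \<in> L2 (lebesgue_on \<Omega>)" "g \<in> L2 (lebesgue_on \<Omega>)"
    and "\<And>\<phi>. \<phi> \<in> test_functions \<Omega> \<Longrightarrow> (LINT x|lebesgue_on \<Omega>. f x * \<phi> x) = (LINT x|lebesgue_on \<Omega>. g x * \<phi> x)"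
  shows "AE x in lebesgue_on \<Omega>. f x = g x"
proof -
  have "AE x in lebesgue_on \<Omega>. f x - g x = 0"
  proof (rule fundamental_lemma_calculus_of_variations[OF open_dom])
    show "integrable (lebesgue_on \<Omega>) (\<lambda>x. f x - g x)"
      using assms by (intro L2_integrable[OF finite_measure_dom] L2_diff)
    show "(LINT x|lebesgue_on \<Omega>. (f x - g x) * \<phi> x) = 0" if "\<phi> \<in> test_functions \<Omega>" for \<phi>
      using assms that test_L2[OF that]
      by (simp add: left_diff_distrib Bochner_Integration.integral_diff L2_mult_integrable)
  qed
  then show ?thesis by simp
qed

lemma has_L2_gradient_L2: "has_L2_gradient \<Omega> u v \<Longrightarrow> v \<in> L2 (lebesgue_on \<Omega>)"
  by (simp add: has_L2_gradient_def)

lemma has_L2_gradient_unique: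
  assumes "has_L2_gradient \<Omega> u v" "has_L2_gradient \<Omega> u' v'" "AE x in lebesgue_on \<Omega>. u x = u' x"
    and "u \<in> L2 (lebesgue_on \<Omega>)" "u' \<in> L2 (lebesgue_on \<Omega>)"
  shows "AE x in lebesgue_on \<Omega>. v x = v' x"
proof -
  have "AE x in lebesgue_on \<Omega>. v x $ j = v' x $ j" for j
  proof (rule L2_integral_determines)
    show "(\<lambda>x. v x $ j) \<in> L2 (lebesgue_on \<Omega>)" "(\<lambda>x. v' x $ j) \<in> L2 (lebesgue_on \<Omega>)"
      using assms by (auto intro: L2_nth simp: has_L2_gradient_def)
    fix \<phi> assume \<phi>: "\<phi> \<in> test_functions \<Omega>"
    have "(LINT x|lebesgue_on \<Omega>. u x * grad \<phi> x $ j) = (LINT x|lebesgue_on \<Omega>. u' x * grad \<phi> x $ j)"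
    proof (rule integral_cong_AE)
      show "(\<lambda>x. u x * grad \<phi> x $ j) \<in> borel_measurable (lebesgue_on \<Omega>)"
        "(\<lambda>x. u' x * grad \<phi> x $ j) \<in> borel_measurable (lebesgue_on \<Omega>)"
        using assms smooth_measurable[OF smooth_grad[OF test_functions_smooth[OF \<phi>]]]
        by (auto intro!: borel_measurable_times intro: L2_measurable)
    qed (use assms(3) in eventually_elim, simp)
    then show "(LINT x|lebesgue_on \<Omega>. v x $ j * \<phi> x) = (LINT x|lebesgue_on \<Omega>. v' x $ j * \<phi> x)"
      using assms(1,2) \<phi> by (simp add: has_L2_gradient_def)
  qed
  from this[of 1] this[of 2] show ?thesis
    by eventually_elim (simp add: vec_eq_iff forall_2)
qed

lemma has_L2_laplacian_unique:
  assumes "has_L2_laplacian \<Omega> u f" "has_L2_laplacian \<Omega> u f'"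
  shows "AE x in lebesgue_on \<Omega>. f x = f' x"
  using assms by (intro L2_integral_determines) (auto simp: has_L2_laplacian_def)

lemma has_L2_gradient_cnj:
  assumes "has_L2_gradient \<Omega> u v"
  shows "has_L2_gradient \<Omega> (\<lambda>x. cnj (u x)) (\<lambda>x. \<chi> j. cnj (v x $ j))"
  unfolding has_L2_gradient_def
proof (intro conjI ballI allI)
  show "(\<lambda>x. \<chi> j. cnj (v x $ j)) \<in> L2 (lebesgue_on \<Omega>)"
    using assms by (intro L2_vecI) (auto intro!: L2_cnj L2_nth simp: has_L2_gradient_def)
  fix \<phi> j assume \<phi>: "\<phi> \<in> test_functions \<Omega>"
  from assms test_functions_cnj[OF \<phi>]
  have "(LINT x|lebesgue_on \<Omega>. u x * grad (\<lambda>x. cnj (\<phi> x)) x $ j) = - (LINT x|lebesgue_on \<Omega>. v x $ j * cnj (\<phi> x))"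
    by (simp add: has_L2_gradient_def)
  then have "cnj (LINT x|lebesgue_on \<Omega>. u x * cnj (grad \<phi> x $ j)) = cnj (- (LINT x|lebesgue_on \<Omega>. v x $ j * cnj (\<phi> x)))"
    using test_functions_smooth[OF \<phi>] by (simp add: grad_cnj smooth_differentiable)
  then have "(LINT x|lebesgue_on \<Omega>. cnj (u x * cnj (grad \<phi> x $ j))) = - (LINT x|lebesgue_on \<Omega>. cnj (v x $ j * cnj (\<phi> x)))"
    by (simp only: Bochner_Integration.integral_cnj complex_cnj_minus)
  then show "(LINT x|lebesgue_on \<Omega>. cnj (u x) * grad \<phi> x $ j)
      = - (LINT x|lebesgue_on \<Omega>. (\<chi> j. cnj (v x $ j)) $ j * \<phi> x)"
    by simp
qed

text \<open>The product rule, by testing the gradient of \<open>u\<close> against \<open>m \<phi>\<close>.\<close>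

lemma has_L2_gradient_mult:
  assumes "u \<in> L2 (lebesgue_on \<Omega>)" "has_L2_gradient \<Omega> u v" "smooth m"
  shows "has_L2_gradient \<Omega> (\<lambda>x. m x * u x) (\<lambda>x. \<chi> j. m x * v x $ j + grad m x $ j * u x)"
  unfolding has_L2_gradient_def
proof (intro conjI ballI allI)
  have v: "(\<lambda>x. v x $ j) \<in> L2 (lebesgue_on \<Omega>)" for j
    using assms(2) by (auto intro: L2_nth simp: has_L2_gradient_def)
  show "(\<lambda>x. \<chi> j. m x * v x $ j + grad m x $ j * u x) \<in> L2 (lebesgue_on \<Omega>)"
    using v assms by (intro L2_vecI) (auto intro!: L2_add L2_smooth_mult smooth_grad)
  fix \<phi> j assume \<phi>: "\<phi> \<in> test_functions \<Omega>"
  note sm = test_functions_smooth[OF \<phi>]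
  have "(LINT x|lebesgue_on \<Omega>. u x * grad (\<lambda>x. m x * \<phi> x) x $ j) = - (LINT x|lebesgue_on \<Omega>. v x $ j * (m x * \<phi> x))"
    using assms(2) test_functions_mult[OF \<phi> assms(3)] by (simp add: has_L2_gradient_def)
  moreover have "(\<lambda>x. u x * grad (\<lambda>x. m x * \<phi> x) x $ j)
      = (\<lambda>x. (m x * u x) * grad \<phi> x $ j + (grad m x $ j * u x) * \<phi> x)"
    by (rule ext) (simp add: grad_mult smooth_differentiable sm assms(3) algebra_simps)
  moreover have i1: "integrable (lebesgue_on \<Omega>) (\<lambda>x. (m x * u x) * grad \<phi> x $ j)"
    by (intro L2_mult_integrable L2_smooth_mult smooth_grad smooth_L2 assms sm)
  moreover have i2: "integrable (lebesgue_on \<Omega>) (\<lambda>x. (grad m x $ j * u x) * \<phi> x)"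
    by (intro L2_mult_integrable L2_smooth_mult smooth_grad smooth_L2 assms sm)
  moreover have i3: "integrable (lebesgue_on \<Omega>) (\<lambda>x. v x $ j * (m x * \<phi> x))"
    by (intro L2_mult_integrable v smooth_L2 smooth_mult assms sm)
  ultimately have "(LINT x|lebesgue_on \<Omega>. m x * u x * grad \<phi> x $ j)
      = - ((LINT x|lebesgue_on \<Omega>. v x $ j * (m x * \<phi> x))
          + (LINT x|lebesgue_on \<Omega>. (grad m x $ j * u x) * \<phi> x))"
    by (simp add: Bochner_Integration.integral_add eq_neg_iff_add_eq_0 algebra_simps)
  also have "(LINT x|lebesgue_on \<Omega>. v x $ j * (m x * \<phi> x)) + (LINT x|lebesgue_on \<Omega>. (grad m x $ j * u x) * \<phi> x)
      = (LINT x|lebesgue_on \<Omega>. v x $ j * (m x * \<phi> x) + (grad m x $ j * u x) * \<phi> x)"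
    using i3 i2 by (rule Bochner_Integration.integral_add[symmetric])
  finally show "(LINT x|lebesgue_on \<Omega>. m x * u x * grad \<phi> x $ j)
      = - (LINT x|lebesgue_on \<Omega>. (\<chi> j. m x * v x $ j + grad m x $ j * u x) $ j * \<phi> x)"
    by (simp add: algebra_simps)
qed

lemma H1_cnj: "u \<in> H1 \<Omega> \<Longrightarrow> (\<lambda>x. cnj (u x)) \<in> H1 \<Omega>"
  using has_L2_gradient_cnj L2_cnj unfolding H1_def by blast

lemma H1_mult: "u \<in> H1 \<Omega> \<Longrightarrow> smooth m \<Longrightarrow> (\<lambda>x. m x * u x) \<in> H1 \<Omega>"
  using has_L2_gradient_mult L2_smooth_mult unfolding H1_def by blast

lemma H1_L2: "u \<in> H1 \<Omega> \<Longrightarrow> u \<in> L2 (lebesgue_on \<Omega>)"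
  by (simp add: H1_def)

text \<open>The convergence that defines traces, for a given choice of the weak gradient.\<close>

definition H1_limit :: "(nat \<Rightarrow> real^2 \<Rightarrow> complex) \<Rightarrow> (real^2 \<Rightarrow> complex) \<Rightarrow> (real^2 \<Rightarrow> complex^2) \<Rightarrow> bool" where
  "H1_limit w u v \<longleftrightarrow> (\<forall>k. smooth (w k)) \<and>
     (\<lambda>k. \<integral>\<^sup>+x. ennreal ((norm (w k x - u x))\<^sup>2) \<partial>lebesgue_on \<Omega>) \<longlonglongrightarrow> 0 \<and>
     (\<lambda>k. \<integral>\<^sup>+x. ennreal ((norm (grad (w k) x - v x))\<^sup>2) \<partial>lebesgue_on \<Omega>) \<longlonglongrightarrow> 0"

lemma has_trace_iff:
  "has_trace \<Omega> \<sigma> u g \<longleftrightarrow> u \<in> H1 \<Omega> \<and> g \<in> Hhalf \<sigma> \<and>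
     (\<exists>v w. has_L2_gradient \<Omega> u v \<and> H1_limit w u v \<and>
        (\<lambda>k. \<integral>\<^sup>+x. ennreal ((norm (w k x - g x))\<^sup>2) \<partial>\<sigma>) \<longlonglongrightarrow> 0)"
  unfolding has_trace_def H1_limit_def by blast

lemma H1_limit_cnj:
  assumes "H1_limit w u v"
  shows "H1_limit (\<lambda>k x. cnj (w k x)) (\<lambda>x. cnj (u x)) (\<lambda>x. \<chi> j. cnj (v x $ j))"
proof -
  have sm: "smooth (w k)" for k using assms by (simp add: H1_limit_def)
  have 1: "norm (cnj (w k x) - cnj (u x)) = norm (w k x - u x)" for k x
    by (metis complex_cnj_diff complex_mod_cnj)
  have 2: "norm (grad (\<lambda>x. cnj (w k x)) x - (\<chi> j. cnj (v x $ j))) = norm (grad (w k) x - v x)" for k x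
  proof -
    have "(norm (grad (\<lambda>x. cnj (w k x)) x - (\<chi> j. cnj (v x $ j))))\<^sup>2 = (norm (grad (w k) x - v x))\<^sup>2"
      unfolding norm_complex_vec_sq
      by (intro sum.cong refl)
         (simp add: grad_cnj smooth_differentiable sm flip: complex_cnj_diff)
    then show ?thesis by (simp add: power2_eq_iff_nonneg)
  qed
  show ?thesis using assms unfolding H1_limit_def 1 2 by (auto intro: smooth_cnj)
qed

text \<open>Multiplication by a smooth function is continuous in the Sobolev norm since the factor and its
  gradient are bounded on a bounded domain; this makes cutoffs compatible with traces.\<close>

lemma H1_limit_mult:
  assumes lim: "H1_limit w u v" and m: "smooth m" and u: "u \<in> L2 (lebesgue_on \<Omega>)" and v: "v \<in> L2 (lebesgue_on \<Omega>)"
  shows "H1_limit (\<lambda>k x. m x * w k x) (\<lambda>x. m x * u x) (\<lambda>x. \<chi> j. m x * v x $ j + grad m x $ j * u x)"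
proof -
  let ?M = "lebesgue_on \<Omega>"
  have sm: "smooth (w k)" for k using lim by (simp add: H1_limit_def)
  have [measurable]: "u \<in> borel_measurable ?M" "v \<in> borel_measurable ?M" "w k \<in> borel_measurable ?M"
    "grad (w k) \<in> borel_measurable ?M" for k
    using u v sm smooth_grad_L2[OF sm] by (auto simp: L2_def smooth_measurable)
  obtain C where C: "C \<ge> 0" "\<And>x. x \<in> space ?M \<Longrightarrow> norm (m x) \<le> C"
    using smooth_bounded[OF m] by blast
  obtain C1 where C1: "C1 \<ge> 0" "\<And>x. x \<in> space ?M \<Longrightarrow> norm (grad m x $ 1) \<le> C1"
    using smooth_bounded[OF smooth_grad[OF m]] by blast
  obtain C2 where C2: "C2 \<ge> 0" "\<And>x. x \<in> space ?M \<Longrightarrow> norm (grad m x $ 2) \<le> C2"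
    using smooth_bounded[OF smooth_grad[OF m]] by blast
  define I where "I k = (\<integral>\<^sup>+x. ennreal ((norm (w k x - u x))\<^sup>2) \<partial>?M)" for k
  define J where "J k = (\<integral>\<^sup>+x. ennreal ((norm (grad (w k) x - v x))\<^sup>2) \<partial>?M)" for k
  have IJ: "I \<longlonglongrightarrow> 0" "J \<longlonglongrightarrow> 0" using lim by (simp_all add: H1_limit_def I_def[abs_def] J_def[abs_def])
  have 1: "(\<integral>\<^sup>+x. ennreal ((norm (m x * w k x - m x * u x))\<^sup>2) \<partial>?M) \<le> ennreal (C\<^sup>2) * I k" for k
  proof -
    have "(norm (m x * w k x - m x * u x))\<^sup>2 \<le> C\<^sup>2 * (norm (w k x - u x))\<^sup>2" if "x \<in> space ?M" for x
      using C(2)[OF that] C(1)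
      by (auto simp: norm_mult power_mult_distrib simp flip: right_diff_distrib intro!: mult_right_mono power_mono)
    then have "(\<integral>\<^sup>+x. ennreal ((norm (m x * w k x - m x * u x))\<^sup>2) \<partial>?M)
        \<le> (\<integral>\<^sup>+x. ennreal (C\<^sup>2) * ennreal ((norm (w k x - u x))\<^sup>2) \<partial>?M)"
      by (intro nn_integral_mono) (simp flip: ennreal_mult)
    also have "\<dots> = ennreal (C\<^sup>2) * I k" unfolding I_def by (rule nn_integral_cmult) measurable
    finally show ?thesis .
  qed
  have 2: "(\<integral>\<^sup>+x. ennreal ((norm (grad (\<lambda>x. m x * w k x) x - (\<chi> j. m x * v x $ j + grad m x $ j * u x)))\<^sup>2) \<partial>?M)
      \<le> ennreal (2 * C\<^sup>2) * J k + ennreal (2 * (C1\<^sup>2 + C2\<^sup>2)) * I k" for k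
  proof -
    have "(norm (grad (\<lambda>x. m x * w k x) x - (\<chi> j. m x * v x $ j + grad m x $ j * u x)))\<^sup>2
        \<le> 2 * C\<^sup>2 * (norm (grad (w k) x - v x))\<^sup>2 + 2 * (C1\<^sup>2 + C2\<^sup>2) * (norm (w k x - u x))\<^sup>2"
      if x: "x \<in> space ?M" for x
    proof -
      have "grad (\<lambda>x. m x * w k x) x - (\<chi> j. m x * v x $ j + grad m x $ j * u x)
          = (\<chi> j. m x * (grad (w k) x - v x) $ j) + (\<chi> j. grad m x $ j * (w k x - u x))"
        by (simp add: vec_eq_iff grad_mult smooth_differentiable sm m algebra_simps)
      then have "(norm (grad (\<lambda>x. m x * w k x) x - (\<chi> j. m x * v x $ j + grad m x $ j * u x)))\<^sup>2
          \<le> 2 * (norm (m x) * norm (grad (w k) x - v x))\<^sup>2 + 2 * (norm (grad m x) * norm (w k x - u x))\<^sup>2"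
        using norm_add_sq_le[of "\<chi> j. m x * (grad (w k) x - v x) $ j" "\<chi> j. grad m x $ j * (w k x - u x)"]
        unfolding norm_cvec_scale norm_cvec_scale' by simp
      also have "\<dots> = 2 * ((norm (m x))\<^sup>2 * (norm (grad (w k) x - v x))\<^sup>2)
            + 2 * ((norm (grad m x))\<^sup>2 * (norm (w k x - u x))\<^sup>2)"
        by (simp add: power_mult_distrib)
      also have "\<dots> \<le> 2 * (C\<^sup>2 * (norm (grad (w k) x - v x))\<^sup>2) + 2 * ((C1\<^sup>2 + C2\<^sup>2) * (norm (w k x - u x))\<^sup>2)"
        unfolding norm_complex_vec_sq[of "grad m x"] sum_2
        using C(2)[OF x] C1(2)[OF x] C2(2)[OF x]
        by (intro add_mono mult_left_mono mult_right_mono power_mono) auto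
      finally show ?thesis by (simp only: mult.assoc)
    qed
    then have "(\<integral>\<^sup>+x. ennreal ((norm (grad (\<lambda>x. m x * w k x) x - (\<chi> j. m x * v x $ j + grad m x $ j * u x)))\<^sup>2) \<partial>?M)
        \<le> (\<integral>\<^sup>+x. ennreal (2 * C\<^sup>2) * ennreal ((norm (grad (w k) x - v x))\<^sup>2)
             + ennreal (2 * (C1\<^sup>2 + C2\<^sup>2)) * ennreal ((norm (w k x - u x))\<^sup>2) \<partial>?M)"
      by (intro nn_integral_mono) (simp flip: ennreal_mult ennreal_plus)
    also have "\<dots> = ennreal (2 * C\<^sup>2) * J k + ennreal (2 * (C1\<^sup>2 + C2\<^sup>2)) * I k"
      unfolding I_def J_def by (subst nn_integral_add) (auto simp: nn_integral_cmult)
    finally show ?thesis .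
  qed
  have L1: "(\<lambda>k. ennreal (C\<^sup>2) * I k) \<longlonglongrightarrow> 0"
    using tendsto_mult_ennreal[OF tendsto_const IJ(1), of "ennreal (C\<^sup>2)"] by simp
  have L2: "(\<lambda>k. ennreal (2 * C\<^sup>2) * J k + ennreal (2 * (C1\<^sup>2 + C2\<^sup>2)) * I k) \<longlonglongrightarrow> 0"
    using tendsto_add[OF tendsto_mult_ennreal[OF tendsto_const IJ(2), of "ennreal (2 * C\<^sup>2)"]
        tendsto_mult_ennreal[OF tendsto_const IJ(1), of "ennreal (2 * (C1\<^sup>2 + C2\<^sup>2))"]] by simp
  show ?thesis unfolding H1_limit_def
    using tendsto_sandwich[OF _ _ tendsto_const L1] tendsto_sandwich[OF _ _ tendsto_const L2] 1 2 sm m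
    by (auto intro!: smooth_mult)
qed

lemma Hhalf_cnj:
  assumes "g \<in> Hhalf \<sigma>"
  shows "(\<lambda>x. cnj (g x)) \<in> Hhalf \<sigma>"
proof -
  have "norm (cnj (g x) - cnj (g y)) = norm (g x - g y)" for x y
    by (metis complex_cnj_diff complex_mod_cnj)
  then have "Hhalf_sqnorm \<sigma> (\<lambda>x. cnj (g x)) = Hhalf_sqnorm \<sigma> g"
    by (simp add: Hhalf_sqnorm_def)
  then show ?thesis using assms
    by (auto simp: Hhalf_def intro: borel_measurable_continuous_on[OF continuous_on_cnj[OF continuous_on_id]])
qed

lemma Hhalf_zero: "(\<lambda>_. 0) \<in> Hhalf \<sigma>"
  by (simp add: Hhalf_def Hhalf_sqnorm_def)

lemma has_trace_cnj:
  assumes "has_trace \<Omega> \<sigma> u g"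
  shows "has_trace \<Omega> \<sigma> (\<lambda>x. cnj (u x)) (\<lambda>x. cnj (g x))"
proof -
  obtain v w where vw: "has_L2_gradient \<Omega> u v" "H1_limit w u v"
    "(\<lambda>k. \<integral>\<^sup>+x. ennreal ((norm (w k x - g x))\<^sup>2) \<partial>\<sigma>) \<longlonglongrightarrow> 0"
    using assms by (auto simp: has_trace_iff)
  have "norm (cnj (w k x) - cnj (g x)) = norm (w k x - g x)" for k x
    by (metis complex_cnj_diff complex_mod_cnj)
  then show ?thesis
    using assms H1_limit_cnj[OF vw(2)] has_L2_gradient_cnj[OF vw(1)] vw(3) unfolding has_trace_iff
    by (intro conjI exI[of _ "\<lambda>x. \<chi> j. cnj (v x $ j)"] exI[of _ "\<lambda>k x. cnj (w k x)"])
       (auto intro: H1_cnj Hhalf_cnj)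
qed

lemma has_trace_mult_one:
  assumes "has_trace \<Omega> \<sigma> u g" "smooth m" "\<And>x. x \<in> space \<sigma> \<Longrightarrow> m x = 1"
  shows "has_trace \<Omega> \<sigma> (\<lambda>x. m x * u x) g"
proof -
  obtain v w where vw: "has_L2_gradient \<Omega> u v" "H1_limit w u v"
    "(\<lambda>k. \<integral>\<^sup>+x. ennreal ((norm (w k x - g x))\<^sup>2) \<partial>\<sigma>) \<longlonglongrightarrow> 0" and u: "u \<in> H1 \<Omega>"
    using assms by (auto simp: has_trace_iff)
  have "(\<integral>\<^sup>+x. ennreal ((norm (m x * w k x - g x))\<^sup>2) \<partial>\<sigma>) = (\<integral>\<^sup>+x. ennreal ((norm (w k x - g x))\<^sup>2) \<partial>\<sigma>)" for k
    by (rule nn_integral_cong) (simp add: assms)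
  then show ?thesis
    using assms H1_limit_mult[OF vw(2) assms(2) H1_L2[OF u] has_L2_gradient_L2[OF vw(1)]]
      has_L2_gradient_mult[OF H1_L2[OF u] vw(1) assms(2)] vw(3) H1_mult[OF u assms(2)]
    unfolding has_trace_iff
    by (intro conjI exI[of _ "\<lambda>x. \<chi> j. m x * v x $ j + grad m x $ j * u x"] exI[of _ "\<lambda>k x. m x * w k x"]) auto
qed

text \<open>The smooth functions approximating \<open>u\<close>, multiplied by \<open>m\<close>, vanish on the second curve
  and approximate \<open>m u\<close>.\<close>

lemma has_trace_mult_zero:
  assumes "has_trace \<Omega> \<sigma> u g" "smooth m" "\<And>x. x \<in> space \<sigma>' \<Longrightarrow> m x = 0"
  shows "has_trace \<Omega> \<sigma>' (\<lambda>x. m x * u x) (\<lambda>_. 0)"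
proof -
  obtain v w where vw: "has_L2_gradient \<Omega> u v" "H1_limit w u v" and u: "u \<in> H1 \<Omega>"
    using assms by (auto simp: has_trace_iff)
  have "(\<integral>\<^sup>+x. ennreal ((norm (m x * w k x - 0))\<^sup>2) \<partial>\<sigma>') = (\<integral>\<^sup>+x. 0 \<partial>\<sigma>')" for k
    by (rule nn_integral_cong) (simp add: assms)
  then show ?thesis
    using assms H1_limit_mult[OF vw(2) assms(2) H1_L2[OF u] has_L2_gradient_L2[OF vw(1)]]
      has_L2_gradient_mult[OF H1_L2[OF u] vw(1) assms(2)] H1_mult[OF u assms(2)] Hhalf_zero
    unfolding has_trace_iff
    by (intro conjI exI[of _ "\<lambda>x. \<chi> j. m x * v x $ j + grad m x $ j * u x"] exI[of _ "\<lambda>k x. m x * w k x"]) auto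
qed

lemma has_trace_cong_AE:
  assumes "has_trace \<Omega> \<sigma> u g" "g' \<in> Hhalf \<sigma>" "AE x in \<sigma>. g x = g' x"
  shows "has_trace \<Omega> \<sigma> u g'"
proof -
  have "(\<integral>\<^sup>+x. ennreal ((norm (w x - g x))\<^sup>2) \<partial>\<sigma>) = (\<integral>\<^sup>+x. ennreal ((norm (w x - g' x))\<^sup>2) \<partial>\<sigma>)" for w
    by (rule nn_integral_cong_AE) (use assms(3) in eventually_elim, simp)
  then show ?thesis using assms(1,2) unfolding has_trace_def by simp
qed

section \<open>Green's formula\<close>

text \<open>The form is bilinear, like the duality pairings on the boundary; conjugates are inserted by hand
  where energies are wanted.\<close>

definition green_form ::
    "(real^2 \<Rightarrow> complex^2) \<Rightarrow> (real^2 \<Rightarrow> complex) \<Rightarrow> (real^2 \<Rightarrow> complex^2) \<Rightarrow> (real^2 \<Rightarrow> complex) \<Rightarrow> complex"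
  where
  "green_form v f w \<phi> = (LINT x|lebesgue_on \<Omega>. (\<Sum>j\<in>UNIV. v x $ j * w x $ j) + f x * \<phi> x)"

lemma green_integrable:
  fixes v w :: "real^2 \<Rightarrow> complex^2" and f \<phi> :: "real^2 \<Rightarrow> complex"
  assumes "v \<in> L2 (lebesgue_on \<Omega>)" "f \<in> L2 (lebesgue_on \<Omega>)" "w \<in> L2 (lebesgue_on \<Omega>)" "\<phi> \<in> L2 (lebesgue_on \<Omega>)"
  shows "integrable (lebesgue_on \<Omega>) (\<lambda>x. (\<Sum>j\<in>UNIV. v x $ j * w x $ j) + f x * \<phi> x)"
proof (rule Bochner_Integration.integrable_add)
  show "integrable (lebesgue_on \<Omega>) (\<lambda>x. \<Sum>j\<in>UNIV. v x $ j * w x $ j)"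
  proof (rule Bochner_Integration.integrable_sum)
    show "integrable (lebesgue_on \<Omega>) (\<lambda>x. v x $ j * w x $ j)" for j
      using L2_nth[OF assms(1), of j] L2_nth[OF assms(3), of j] by (rule L2_mult_integrable)
  qed
qed (rule L2_mult_integrable, fact+)

lemma green_form_cong_AE:
  assumes "v \<in> L2 (lebesgue_on \<Omega>)" "f \<in> L2 (lebesgue_on \<Omega>)" "w \<in> L2 (lebesgue_on \<Omega>)" "\<phi> \<in> L2 (lebesgue_on \<Omega>)"
    and "v' \<in> L2 (lebesgue_on \<Omega>)" "f' \<in> L2 (lebesgue_on \<Omega>)"
    and "AE x in lebesgue_on \<Omega>. v x = v' x" "AE x in lebesgue_on \<Omega>. f x = f' x"
  shows "green_form v f w \<phi> = green_form v' f' w \<phi>"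
  unfolding green_form_def
  using green_integrable[OF assms(1-4)] green_integrable[OF assms(5,6,3,4)] assms(7,8)
  by (intro integral_cong_AE) auto

text \<open>The weak normal derivative pairs in the same way for every choice of the gradient and of
  the Laplacian, since these are unique almost everywhere.\<close>

lemma weak_normal_derivative_pairing:
  assumes "has_weak_normal_derivative \<Omega> \<sigma> \<sigma>' u l"
    and "has_L2_gradient \<Omega> u v" "has_L2_laplacian \<Omega> u f"
    and "has_trace \<Omega> \<sigma> \<phi> g" "has_trace \<Omega> \<sigma>' \<phi> (\<lambda>_. 0)" "has_L2_gradient \<Omega> \<phi> w"
  shows "l g = green_form v f w \<phi>"
proof -
  obtain v' f' where *: "has_L2_gradient \<Omega> u v'" "has_L2_laplacian \<Omega> u f'"
    "l g = green_form v' f' w \<phi>"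
    using assms unfolding has_weak_normal_derivative_def green_form_def by blast
  have u: "u \<in> L2 (lebesgue_on \<Omega>)"
    using assms(1) by (simp add: has_weak_normal_derivative_def H1_def)
  have "green_form v' f' w \<phi> = green_form v f w \<phi>"
  proof (rule green_form_cong_AE)
    show "AE x in lebesgue_on \<Omega>. v' x = v x"
      by (rule has_L2_gradient_unique[OF *(1) assms(2) _ u u]) simp
    show "AE x in lebesgue_on \<Omega>. f' x = f x"
      by (rule has_L2_laplacian_unique[OF *(2) assms(3)])
  qed (use assms * in \<open>simp_all add: has_L2_gradient_def has_L2_laplacian_def has_trace_def H1_def\<close>)
  then show ?thesis using * by simp
qed

lemma smooth_one_minus: "smooth m \<Longrightarrow> smooth (\<lambda>x. 1 - m x)"
  by (intro smooth_diff smooth_const)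

text \<open>The two parts of the boundary are separated by a cutoff \<open>m\<close>; the contributions of
  \<open>m \<phi>\<close> and \<open>(1 - m) \<phi>\<close> add up to Green's formula for the whole boundary.\<close>

proposition green_identity:
  assumes l: "has_weak_normal_derivative \<Omega> \<sigma> \<sigma>' u l" and l': "has_weak_normal_derivative \<Omega> \<sigma>' \<sigma> u l'"
    and v: "has_L2_gradient \<Omega> u v" and f: "has_L2_laplacian \<Omega> u f"
    and g: "has_trace \<Omega> \<sigma> \<phi> g" and g': "has_trace \<Omega> \<sigma>' \<phi> g'" and w: "has_L2_gradient \<Omega> \<phi> w"
    and m: "smooth m" "\<And>x. x \<in> space \<sigma> \<Longrightarrow> m x = 1" "\<And>x. x \<in> space \<sigma>' \<Longrightarrow> m x = 0"
  shows "l g + l' g' = green_form v f w \<phi>"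
proof -
  let ?m' = "\<lambda>x. 1 - m x"
  have \<phi>: "\<phi> \<in> L2 (lebesgue_on \<Omega>)" using g by (simp add: has_trace_def H1_def)
  note m' = smooth_one_minus[OF m(1)]
  let ?w = "\<lambda>x. \<chi> j. m x * w x $ j + grad m x $ j * \<phi> x"
  let ?w' = "\<lambda>x. \<chi> j. ?m' x * w x $ j + grad ?m' x $ j * \<phi> x"
  have 1: "l g = green_form v f ?w (\<lambda>x. m x * \<phi> x)"
    using has_L2_gradient_mult[OF \<phi> w m(1)] has_trace_mult_one[OF g m(1,2)] has_trace_mult_zero[OF g m(1,3)]
    by (intro weak_normal_derivative_pairing[OF l v f]) auto
  have 2: "l' g' = green_form v f ?w' (\<lambda>x. ?m' x * \<phi> x)"
    using has_L2_gradient_mult[OF \<phi> w m'] has_trace_mult_one[OF g' m'] has_trace_mult_zero[OF g' m'] m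
    by (intro weak_normal_derivative_pairing[OF l' v f]) auto
  have L: "v \<in> L2 (lebesgue_on \<Omega>)" "f \<in> L2 (lebesgue_on \<Omega>)" "?w \<in> L2 (lebesgue_on \<Omega>)" "?w' \<in> L2 (lebesgue_on \<Omega>)"
    using v f has_L2_gradient_mult[OF \<phi> w m(1)] has_L2_gradient_mult[OF \<phi> w m']
    by (simp_all add: has_L2_gradient_def has_L2_laplacian_def)
  have grad': "grad ?m' x $ j = - grad m x $ j" for x j
  proof -
    have "((\<lambda>x. 1 - m x) has_derivative (\<lambda>h. 0 - (\<Sum>j\<in>UNIV. (h $ j) *\<^sub>R grad m x $ j))) (at x)"
      by (intro has_derivative_diff has_derivative_const has_derivative_grad smooth_differentiable m)
    from grad_eq[OF this] show ?thesis
      by (simp add: axis_def if_distrib if_distribR cong: if_cong)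
  qed
  have "green_form v f ?w (\<lambda>x. m x * \<phi> x) + green_form v f ?w' (\<lambda>x. ?m' x * \<phi> x)
     = (LINT x|lebesgue_on \<Omega>. ((\<Sum>j\<in>UNIV. v x $ j * ?w x $ j) + f x * (m x * \<phi> x))
          + ((\<Sum>j\<in>UNIV. v x $ j * ?w' x $ j) + f x * (?m' x * \<phi> x)))"
    unfolding green_form_def
    by (intro Bochner_Integration.integral_add[symmetric] green_integrable L L2_smooth_mult \<phi> m m')
  also have "\<dots> = green_form v f w \<phi>"
    unfolding green_form_def
    by (intro Bochner_Integration.integral_cong refl) (simp add: sum_2 grad' algebra_simps)
  finally show ?thesis using 1 2 by simp
qed

end

section \<open>Laplace integrals on the half line\<close>

text \<open>Differentiation under the integral sign will be reduced to integrating a second order Taylor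
  bound; this lemma turns the integrated bound back into a derivative.\<close>

lemma DERIV_of_quadratic_bound:
  fixes F :: "real \<Rightarrow> real"
  assumes "\<delta> > 0" and bound: "\<And>h. \<bar>h\<bar> \<le> \<delta> \<Longrightarrow> \<bar>F (z + h) - F z - h * D\<bar> \<le> C * h\<^sup>2"
  shows "(F has_real_derivative D) (at z)"
proof -
  have "((\<lambda>h. (F (z + h) - F z) / h - D) \<longlongrightarrow> 0) (at 0)"
  proof (rule Lim_null_comparison)
    have "norm ((F (z + h) - F z) / h - D) \<le> C * \<bar>h\<bar>" if h: "h \<noteq> 0" "\<bar>h\<bar> \<le> \<delta>" for h
    proof -
      have "norm ((F (z + h) - F z) / h - D) = \<bar>F (z + h) - F z - h * D\<bar> / \<bar>h\<bar>"
        unfolding abs_divide[symmetric] using h by (simp add: diff_divide_distrib)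
      also have "\<dots> \<le> C * h\<^sup>2 / \<bar>h\<bar>" using bound[OF h(2)] by (intro divide_right_mono) auto
      also have "h\<^sup>2 = \<bar>h\<bar> * \<bar>h\<bar>" by (simp add: power2_eq_square)
      also have "C * (\<bar>h\<bar> * \<bar>h\<bar>) / \<bar>h\<bar> = C * \<bar>h\<bar>"
        using nonzero_mult_div_cancel_right[of "\<bar>h\<bar>" "C * \<bar>h\<bar>"] h by (simp only: mult.assoc abs_eq_0 simp_thms)
      finally show ?thesis .
    qed
    then show "\<forall>\<^sub>F h in at 0. norm ((F (z + h) - F z) / h - D) \<le> C * \<bar>h\<bar>"
      using \<open>\<delta> > 0\<close> by (auto simp: eventually_at intro!: exI[of _ \<delta>])
    show "((\<lambda>h. C * \<bar>h\<bar>) \<longlongrightarrow> 0) (at 0)" by (auto intro!: tendsto_eq_intros)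
  qed
  then show ?thesis by (simp add: DERIV_def LIM_zero_iff)
qed

lemma exp_second_order_bound: "\<bar>exp x - 1 - x\<bar> \<le> x\<^sup>2 * exp \<bar>x\<bar>" for x :: real
proof -
  have 1: "exp y - 1 \<le> y * exp y" for y :: real
    using exp_ge_add_one_self[of "- y"] mult_right_mono[of "1 - y" "exp (-y)" "exp y"]
    by (simp add: exp_minus field_simps)
  have 2: "exp x - 1 - x \<ge> 0" using exp_ge_add_one_self[of x] by linarith
  have "x * (exp x - 1) \<le> x\<^sup>2 * exp \<bar>x\<bar>"
  proof (cases "x \<ge> 0")
    case True
    then show ?thesis using mult_left_mono[OF 1[of x] True] by (simp add: power2_eq_square mult_ac)
  next
    case False
    have "1 - exp x \<le> - x" using exp_ge_add_one_self[of x] by linarith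
    moreover have "exp \<bar>x\<bar> \<ge> 1" by simp
    ultimately have "(- x) * (1 - exp x) \<le> (- x) * (- x)" "x\<^sup>2 * 1 \<le> x\<^sup>2 * exp \<bar>x\<bar>"
      using False by (intro mult_left_mono; simp)+
    then show ?thesis by (simp add: power2_eq_square algebra_simps)
  qed
  moreover have "exp x - 1 - x \<le> x * (exp x - 1)" using 1[of x] by (simp add: algebra_simps)
  ultimately show ?thesis using 2 by linarith
qed

text \<open>The amplitudes admitted in Laplace integrals: closed under sums and products, and integrable
  against \<open>exp (- z a)\<close> for the phases \<open>a\<close> below.\<close>

definition exp_growth :: "(real \<Rightarrow> real) \<Rightarrow> bool" where
  "exp_growth b \<longleftrightarrow> continuous_on {0..} b \<and> (\<exists>M\<ge>0. \<exists>m\<ge>0. \<forall>t\<ge>0. \<bar>b t\<bar> \<le> M * exp (m * t))"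

lemma exp_growth_exp: "exp_growth (\<lambda>t. exp (c * t))"
  unfolding exp_growth_def
proof
  have "\<bar>exp (c * t)\<bar> \<le> 1 * exp (\<bar>c\<bar> * t)" if "t \<ge> 0" for t
    using that by (simp add: mult_right_mono)
  then show "\<exists>M\<ge>0. \<exists>m\<ge>0. \<forall>t\<ge>0. \<bar>exp (c * t)\<bar> \<le> M * exp (m * t)"
    by (intro exI[of _ 1] exI[of _ "\<bar>c\<bar>"] conjI) auto
qed (auto intro!: continuous_intros)

lemma exp_growth_cmult: "exp_growth b \<Longrightarrow> exp_growth (\<lambda>t. c * b t)"
  unfolding exp_growth_def
proof (elim conjE exE, intro conjI)
  fix M m assume "0 \<le> M" "0 \<le> m" "\<forall>t\<ge>0. \<bar>b t\<bar> \<le> M * exp (m * t)"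
  then show "\<exists>M\<ge>0. \<exists>m\<ge>0. \<forall>t\<ge>0. \<bar>c * b t\<bar> \<le> M * exp (m * t)"
    by (intro exI[of _ "\<bar>c\<bar> * M"] conjI exI[of _ m]) (auto simp: abs_mult mult.assoc intro!: mult_left_mono)
qed (auto intro!: continuous_intros)

lemma exp_growth_add:
  assumes "exp_growth b" "exp_growth c"
  shows "exp_growth (\<lambda>t. b t + c t)"
proof -
  obtain M m M' m' where *: "M \<ge> 0" "m \<ge> 0" "\<And>t. t \<ge> 0 \<Longrightarrow> \<bar>b t\<bar> \<le> M * exp (m * t)"
    "M' \<ge> 0" "m' \<ge> 0" "\<And>t. t \<ge> 0 \<Longrightarrow> \<bar>c t\<bar> \<le> M' * exp (m' * t)"
    using assms unfolding exp_growth_def by blast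
  have "\<bar>b t + c t\<bar> \<le> (M + M') * exp ((m + m') * t)" if "t \<ge> 0" for t
  proof -
    have "M * exp (m * t) \<le> M * exp ((m + m') * t)" "M' * exp (m' * t) \<le> M' * exp ((m + m') * t)"
      using * that by (auto intro!: mult_left_mono mult_right_mono)
    with *(3,6)[OF that] show ?thesis by (simp add: distrib_right)
  qed
  then have "\<exists>M\<ge>0. \<exists>m\<ge>0. \<forall>t\<ge>0. \<bar>b t + c t\<bar> \<le> M * exp (m * t)"
    using * by (intro exI[of _ "M + M'"] exI[of _ "m + m'"] conjI allI impI) simp_all
  moreover have "continuous_on {0..} (\<lambda>t. b t + c t)"
    using assms unfolding exp_growth_def by (intro continuous_on_add) simp_all
  ultimately show ?thesis by (simp add: exp_growth_def)
qed

lemma exp_growth_mult: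
  assumes "exp_growth b" "exp_growth c"
  shows "exp_growth (\<lambda>t. b t * c t)"
proof -
  obtain M m M' m' where *: "M \<ge> 0" "m \<ge> 0" "\<And>t. t \<ge> 0 \<Longrightarrow> \<bar>b t\<bar> \<le> M * exp (m * t)"
    "M' \<ge> 0" "m' \<ge> 0" "\<And>t. t \<ge> 0 \<Longrightarrow> \<bar>c t\<bar> \<le> M' * exp (m' * t)"
    using assms unfolding exp_growth_def by blast
  have "\<bar>b t * c t\<bar> \<le> (M * M') * exp ((m + m') * t)" if "t \<ge> 0" for t
  proof -
    have "\<bar>b t\<bar> * \<bar>c t\<bar> \<le> (M * exp (m * t)) * (M' * exp (m' * t))"
      using *(3,6)[OF that] * by (intro mult_mono) auto
    moreover have "exp ((m + m') * t) = exp (m * t) * exp (m' * t)"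
      by (simp add: distrib_right exp_add)
    ultimately show ?thesis by (simp add: abs_mult mult_ac)
  qed
  then have "\<exists>M\<ge>0. \<exists>m\<ge>0. \<forall>t\<ge>0. \<bar>b t * c t\<bar> \<le> M * exp (m * t)"
    using * by (intro exI[of _ "M * M'"] exI[of _ "m + m'"] conjI allI impI) simp_all
  moreover have "continuous_on {0..} (\<lambda>t. b t * c t)"
    using assms unfolding exp_growth_def by (intro continuous_on_mult) simp_all
  ultimately show ?thesis by (simp add: exp_growth_def)
qed

lemma exp_growth_diff: "exp_growth b \<Longrightarrow> exp_growth c \<Longrightarrow> exp_growth (\<lambda>t. b t - c t)"
  using exp_growth_add[of b "\<lambda>t. (-1) * c t"] exp_growth_cmult[of c "-1"] by simp

lemma exp_growth_const: "exp_growth (\<lambda>t. c)"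
  using exp_growth_cmult[OF exp_growth_exp[of 0], of c] by simp

lemma exp_growth_sinh: "exp_growth (\<lambda>t. sinh (c * t))"
  using exp_growth_cmult[OF exp_growth_diff[OF exp_growth_exp[of c] exp_growth_exp[of "-c"]], of "1/2"]
  by (simp add: sinh_field_def)

lemma exp_growth_cosh: "exp_growth (\<lambda>t. cosh (c * t))"
  using exp_growth_cmult[OF exp_growth_add[OF exp_growth_exp[of c] exp_growth_exp[of "-c"]], of "1/2"]
  by (simp add: cosh_field_def)

lemmas exp_growth_intros = exp_growth_const exp_growth_exp exp_growth_add exp_growth_diff
  exp_growth_mult exp_growth_sinh exp_growth_cosh exp_growth_sinh[of 1, simplified] exp_growth_cosh[of 1, simplified]

lemma integrable_exp_neg: "set_integrable lborel {0..} (\<lambda>t. exp (- t) :: real)"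
proof -
  have "(\<lambda>x. exp (-1 * x) :: real) integrable_on {0..}" by (rule integrable_on_exp_minus_to_infinity) simp
  then have "set_integrable lebesgue {0..} (\<lambda>t. exp (- t) :: real)"
    by (intro nonnegative_absolutely_integrable_1) auto
  then show ?thesis
    unfolding set_integrable_def by (subst (asm) integrable_completion) auto
qed

text \<open>A quadratic lower bound on \<open>a\<close> makes \<open>exp (- z a)\<close> decay faster than any exponential grows.  It
  treats \<open>a = sinh\<close>, as in the integral for \<open>Y\<^sub>n\<close>, and \<open>a = cosh\<close>, as in the one for \<open>K\<^sub>n\<close>, alike.\<close>

definition phase :: "(real \<Rightarrow> real) \<Rightarrow> bool" where
  "phase a \<longleftrightarrow> exp_growth a \<and> (\<forall>t\<ge>0. t\<^sup>2 / 4 \<le> a t)"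

lemma phase_sinh: "phase sinh"
  unfolding phase_def
proof (intro conjI allI impI)
  show "exp_growth sinh" using exp_growth_sinh[of 1] by simp
  show "t\<^sup>2 / 4 \<le> sinh t" if "t \<ge> 0" for t :: real
    using that exp_lower_Taylor_quadratic[OF that] by (simp add: sinh_field_def field_simps)
       (smt (verit) exp_le_one_iff)
qed

lemma phase_cosh: "phase cosh"
  unfolding phase_def
proof (intro conjI allI impI)
  show "exp_growth cosh" using exp_growth_cosh[of 1] by simp
  show "t\<^sup>2 / 4 \<le> cosh t" if "t \<ge> 0" for t :: real
    using that phase_sinh sinh_less_cosh_real[of t] unfolding phase_def by force
qed

lemma laplace_dominated:
  assumes "M \<ge> 0" "m \<ge> 0" "phase a" "z > 0" "t \<ge> 0"
  shows "M * exp (m * t) * exp (- z * a t) \<le> M * exp ((m + 1)\<^sup>2 / z) * exp (- t)"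
proof -
  have "z * (t\<^sup>2 / 4) \<le> z * a t" using assms by (intro mult_left_mono) (auto simp: phase_def)
  moreover have "(m + 1) * t \<le> z * (t\<^sup>2 / 4) + (m + 1)\<^sup>2 / z"
  proof -
    \<comment> \<open>completing the square in \<open>t\<close>\<close>
    have "0 \<le> (z * t / 2 - (m + 1))\<^sup>2" by simp
    then have "z * ((m + 1) * t) \<le> z * (z * (t\<^sup>2 / 4)) + (m + 1)\<^sup>2"
      by (simp add: power2_eq_square algebra_simps)
    also have "\<dots> = z * (z * (t\<^sup>2 / 4) + (m + 1)\<^sup>2 / z)"
      using \<open>z > 0\<close> by (simp add: distrib_left)
    finally have "z * ((m + 1) * t) \<le> z * (z * (t\<^sup>2 / 4) + (m + 1)\<^sup>2 / z)" .
    then show ?thesis using \<open>z > 0\<close> by (simp only: mult_le_cancel_left_pos)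
  qed
  ultimately have "m * t + - z * a t \<le> (m + 1)\<^sup>2 / z + (- t)" by (simp add: algebra_simps)
  then have "exp (m * t + - z * a t) \<le> exp ((m + 1)\<^sup>2 / z + (- t))" by simp
  then show ?thesis using \<open>M \<ge> 0\<close> unfolding exp_add by (simp add: mult.assoc mult_left_mono)
qed

lemma laplace_measurable:
  fixes f :: "real \<Rightarrow> real"
  assumes "continuous_on {0..} f"
  shows "(\<lambda>t. indicator {0..} t *\<^sub>R f t) \<in> borel_measurable lborel"
  using borel_measurable_continuous_on_indicator[OF _ assms] by simp

lemma laplace_integrable:
  assumes b: "exp_growth b" and a: "phase a" and z: "z > 0"
  shows "set_integrable lborel {0..} (\<lambda>t. b t * exp (- z * a t))"
proof -
  obtain M m where *: "M \<ge> 0" "m \<ge> 0" "\<And>t. t \<ge> 0 \<Longrightarrow> \<bar>b t\<bar> \<le> M * exp (m * t)"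
    using b unfolding exp_growth_def by blast
  have cont: "continuous_on {0..} (\<lambda>t. b t * exp (- z * a t))"
    using a b unfolding phase_def exp_growth_def by (auto intro!: continuous_intros)
  have i: "integrable lborel (\<lambda>t. (M * exp ((m + 1)\<^sup>2 / z)) * (indicator {0..} t *\<^sub>R exp (- t)))"
    using integrable_exp_neg unfolding set_integrable_def by (rule integrable_mult_right)
  show ?thesis unfolding set_integrable_def
  proof (rule Bochner_Integration.integrable_bound[OF i laplace_measurable[OF cont]], rule AE_I2)
    fix t :: real
    show "norm (indicator {0..} t *\<^sub>R (b t * exp (- z * a t)))
        \<le> norm ((M * exp ((m + 1)\<^sup>2 / z)) * (indicator {0..} t *\<^sub>R exp (- t)))"
    proof (cases "t \<ge> 0")
      case True
      have "\<bar>b t\<bar> * exp (- z * a t) \<le> M * exp (m * t) * exp (- z * a t)"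
        using *(3)[OF True] by (intro mult_right_mono) auto
      also have "\<dots> \<le> M * exp ((m + 1)\<^sup>2 / z) * exp (- t)"
        using laplace_dominated[OF *(1,2) a z True] .
      finally show ?thesis using True * by (simp add: abs_mult)
    qed simp
  qed
qed

lemma laplace_tendsto_zero:
  assumes b: "exp_growth b" and a: "phase a" and z: "z > 0"
  shows "((\<lambda>t. b t * exp (- z * a t)) \<longlongrightarrow> 0) at_top"
proof -
  obtain M m where *: "M \<ge> 0" "m \<ge> 0" "\<And>t. t \<ge> 0 \<Longrightarrow> \<bar>b t\<bar> \<le> M * exp (m * t)"
    using b unfolding exp_growth_def by blast
  show ?thesis
  proof (rule Lim_null_comparison)
    have "norm (b t * exp (- z * a t)) \<le> M * exp ((m + 1)\<^sup>2 / z) * exp (- t)" if "t \<ge> 0" for t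
    proof -
      have "\<bar>b t\<bar> * exp (- z * a t) \<le> M * exp (m * t) * exp (- z * a t)"
        using *(3)[OF that] by (intro mult_right_mono) auto
      also have "\<dots> \<le> M * exp ((m + 1)\<^sup>2 / z) * exp (- t)"
        using laplace_dominated[OF *(1,2) a z that] .
      finally show ?thesis by (simp add: abs_mult)
    qed
    then show "\<forall>\<^sub>F t in at_top. norm (b t * exp (- z * a t)) \<le> M * exp ((m + 1)\<^sup>2 / z) * exp (- t)"
      by (auto intro: eventually_at_top_linorderI[of 0])
    have "((\<lambda>t. exp (- t) :: real) \<longlongrightarrow> 0) at_top"
      by (rule filterlim_compose[OF exp_at_bot filterlim_uminus_at_bot_at_top])
    then show "((\<lambda>t. M * exp ((m + 1)\<^sup>2 / z) * exp (- t)) \<longlongrightarrow> 0) at_top"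
      by (rule tendsto_mult_right_zero)
  qed
qed

lemma half_line_FTC:
  fixes f :: "real \<Rightarrow> real"
  assumes int: "set_integrable lborel {0..} f" and cont: "continuous_on {0..} f"
    and F: "\<And>t. t \<ge> 0 \<Longrightarrow> (F has_real_derivative f t) (at t)" and lim: "(F \<longlongrightarrow> L) at_top"
  shows "(LINT t:{0..}|lborel. f t) = L - F 0"
proof -
  have "((\<lambda>b. LINT t:{0..b}|lborel. f t) \<longlongrightarrow> (LINT t:{0..}|lborel. f t)) at_top"
    using int by (intro tendsto_set_lebesgue_integral_at_top) auto
  moreover have "\<forall>\<^sub>F b in at_top. (LINT t:{0..b}|lborel. f t) = F b - F 0"
  proof (rule eventually_at_top_linorderI[of 0])
    fix b :: real assume "b \<ge> 0"
    then show "(LINT t:{0..b}|lborel. f t) = F b - F 0"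
      unfolding set_lebesgue_integral_def
      by (intro integral_FTC_atLeastAtMost)
         (auto intro: F has_real_derivative_iff_has_vector_derivative[THEN iffD1, OF has_field_derivative_at_within]
           continuous_on_subset[OF cont])
  qed
  ultimately have "((\<lambda>b. F b - F 0) \<longlongrightarrow> (LINT t:{0..}|lborel. f t)) at_top"
    by (rule Lim_transform_eventually)
  moreover have "((\<lambda>b. F b - F 0) \<longlongrightarrow> L - F 0) at_top" by (intro tendsto_intros lim)
  ultimately show ?thesis using tendsto_unique trivial_limit_at_top_linorder by blast
qed

text \<open>For \<open>|h| \<le> z/2\<close> the Taylor remainder of \<open>exp (- (z + h) a)\<close> is at most
  \<open>h\<^sup>2 a\<^sup>2 exp (- (z/2) a)\<close>, which is integrable against the amplitude.\<close>

lemma laplace_derivative: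
  assumes b: "exp_growth b" and a: "phase a" and z: "z > 0"
  shows "((\<lambda>z. LINT t:{0..}|lborel. b t * exp (- z * a t)) has_real_derivative
      (LINT t:{0..}|lborel. (- a t * b t) * exp (- z * a t))) (at z)"
proof (rule DERIV_of_quadratic_bound[of "z/2"])
  let ?F = "\<lambda>z. LINT t:{0..}|lborel. b t * exp (- z * a t)"
  let ?D = "LINT t:{0..}|lborel. (- a t * b t) * exp (- z * a t)"
  have ag: "exp_growth a" and a0: "\<And>t. t \<ge> 0 \<Longrightarrow> a t \<ge> 0"
  proof -
    show "exp_growth a" using a by (simp add: phase_def)
    fix t :: real assume "t \<ge> 0"
    then have "t\<^sup>2 / 4 \<le> a t" using a by (simp add: phase_def)
    moreover have "t\<^sup>2 / 4 \<ge> 0" by simp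
    ultimately show "a t \<ge> 0" by linarith
  qed
  have g: "exp_growth (\<lambda>t. - a t * b t)" "exp_growth (\<lambda>t. a t * a t * \<bar>b t\<bar>)"
  proof -
    show "exp_growth (\<lambda>t. - a t * b t)"
      using exp_growth_mult[OF exp_growth_cmult[OF ag, of "-1"] b] by simp
    have "exp_growth (\<lambda>t. \<bar>b t\<bar>)"
      using b by (auto simp: exp_growth_def intro!: continuous_intros)
    then show "exp_growth (\<lambda>t. a t * a t * \<bar>b t\<bar>)" by (intro exp_growth_mult ag)
  qed
  define C where "C = (LINT t:{0..}|lborel. (a t * a t * \<bar>b t\<bar>) * exp (- (z/2) * a t))"
  show "z/2 > 0" using z by simp
  fix h :: real assume h: "\<bar>h\<bar> \<le> z/2"
  then have zh: "z + h > 0" using z by linarith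
  have i: "set_integrable lborel {0..} (\<lambda>t. b t * exp (- (z + h) * a t))"
    "set_integrable lborel {0..} (\<lambda>t. b t * exp (- z * a t))"
    "set_integrable lborel {0..} (\<lambda>t. h * ((- a t * b t) * exp (- z * a t)))"
    "set_integrable lborel {0..} (\<lambda>t. h\<^sup>2 * ((a t * a t * \<bar>b t\<bar>) * exp (- (z/2) * a t)))"
    using z by (intro laplace_integrable set_integrable_mult_right b a g zh; simp)+
  have split: "?F (z + h) - ?F z - h * ?D
      = (LINT t:{0..}|lborel. b t * exp (- (z + h) * a t) - b t * exp (- z * a t) - h * ((- a t * b t) * exp (- z * a t)))"
    by (simp only: set_integral_diff(2)[OF set_integral_diff(1)[OF i(1,2)] i(3)]
        set_integral_diff(2)[OF i(1,2)] set_integral_mult_right)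
  have "\<bar>?F (z + h) - ?F z - h * ?D\<bar> \<le> (LINT t:{0..}|lborel. h\<^sup>2 * ((a t * a t * \<bar>b t\<bar>) * exp (- (z/2) * a t)))"
  proof -
    have *: "\<bar>b t * exp (- (z + h) * a t) - b t * exp (- z * a t) - h * ((- a t * b t) * exp (- z * a t))\<bar>
        \<le> h\<^sup>2 * ((a t * a t * \<bar>b t\<bar>) * exp (- (z/2) * a t))" if t: "t \<ge> 0" for t
    proof -
      have "b t * exp (- (z + h) * a t) - b t * exp (- z * a t) - h * ((- a t * b t) * exp (- z * a t))
          = (b t * exp (- z * a t)) * (exp (- h * a t) - 1 - (- h * a t))"
        by (simp add: algebra_simps flip: exp_add)
      also have "\<bar>\<dots>\<bar> \<le> (\<bar>b t\<bar> * exp (- z * a t)) * ((- h * a t)\<^sup>2 * exp \<bar>- h * a t\<bar>)"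
        unfolding abs_mult using exp_second_order_bound[of "- h * a t"] by (intro mult_mono) (auto simp: abs_mult)
      also have "\<dots> = h\<^sup>2 * ((a t * a t * \<bar>b t\<bar>) * exp (\<bar>h\<bar> * a t - z * a t))"
        using a0[OF t] by (simp add: exp_diff exp_minus power2_eq_square abs_mult field_simps)
      also have "\<dots> \<le> h\<^sup>2 * ((a t * a t * \<bar>b t\<bar>) * exp (- (z/2) * a t))"
        using mult_right_mono[OF h a0[OF t]] a0[OF t]
        by (intro mult_left_mono) (auto simp: field_simps)
      finally show ?thesis .
    qed
    have "norm (LINT t:{0..}|lborel. b t * exp (- (z + h) * a t) - b t * exp (- z * a t) - h * ((- a t * b t) * exp (- z * a t)))
       \<le> (LINT t:{0..}|lborel. h\<^sup>2 * ((a t * a t * \<bar>b t\<bar>) * exp (- (z/2) * a t)))"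
      unfolding set_lebesgue_integral_def
    proof (rule Bochner_Integration.integral_norm_bound_integral)
      show "integrable lborel (\<lambda>t. indicator {0..} t *\<^sub>R (b t * exp (- (z + h) * a t) - b t * exp (- z * a t)
          - h * ((- a t * b t) * exp (- z * a t))))"
        using set_integral_diff(1)[OF set_integral_diff(1)[OF i(1,2)] i(3)] by (simp add: set_integrable_def)
      show "integrable lborel (\<lambda>t. indicator {0..} t *\<^sub>R (h\<^sup>2 * ((a t * a t * \<bar>b t\<bar>) * exp (- (z/2) * a t))))"
        using i(4) by (simp only: set_integrable_def)
    qed (use * in \<open>auto simp: indicator_def\<close>)
    then show ?thesis unfolding split real_norm_def .
  qed
  then show "\<bar>?F (z + h) - ?F z - h * ?D\<bar> \<le> C * h\<^sup>2"
    unfolding C_def set_integral_mult_right by (simp only: mult.commute)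
qed

section \<open>Bessel functions of integer order\<close>

lemma trig_integral:
  fixes f :: "real \<Rightarrow> real"
  assumes "continuous_on {0..pi} f"
  shows "(LINT \<theta>:{0..pi}|lborel. f \<theta>) = integral {0..pi} f"
  by (intro set_borel_integral_eq_integral borel_integrable_atLeastAtMost' assms)

text \<open>The trigonometric and the exponential part of the integral for \<open>Y\<^sub>n\<close>.  Both satisfy the
  derivative formula of Bessel functions, but the three-term recurrence only up to the term
  \<open>2 (1 - (-1)\<^sup>n) / \<pi>\<close>, a boundary term of the integration by parts that is the same for both and
  therefore cancels in \<open>Y\<^sub>n\<close>.\<close>

definition bessel_S :: "int \<Rightarrow> real \<Rightarrow> real" where
  "bessel_S n z = (1/pi) * integral {0..pi} (\<lambda>\<theta>. sin (z * sin \<theta> - of_int n * \<theta>))"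

definition bessel_E :: "int \<Rightarrow> real \<Rightarrow> real" where
  "bessel_E n z = (1/pi) * (LINT t:{0..}|lborel.
        (exp (of_int n * t) + (-1) powi n * exp (- of_int n * t)) * exp (- z * sinh t))"

lemma bessel_Y_eq: "bessel_Y n z = bessel_S n z - bessel_E n z"
  unfolding bessel_Y_def bessel_S_def bessel_E_def
  by (subst trig_integral) (auto intro!: continuous_intros)

lemma bessel_J_eq: "bessel_J n z = (1/pi) * integral {0..pi} (\<lambda>\<theta>. cos (of_int n * \<theta> - z * sin \<theta>))"
  unfolding bessel_J_def by (subst trig_integral) (auto intro!: continuous_intros)

lemma sin_int_pi: "sin (of_int n * pi) = 0"
  by (cases n rule: int_cases2) auto

lemma cos_int_pi: "cos (of_int n * pi) = (-1) powi n"
  by (cases n rule: int_cases2) (auto simp: power_int_minus simp flip: power_inverse)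

lemma trig_integrable:
  fixes f :: "real \<Rightarrow> real"
  assumes "continuous_on UNIV f"
  shows "f integrable_on {0..pi}"
  using assms by (intro integrable_continuous_real) (auto intro: continuous_on_subset)

lemma scale_recurrence:
  "z * (X + Y) = 2 * (n * Z + c) \<Longrightarrow> z * (p * X + p * Y) = 2 * n * (p * Z) + 2 * p * c"
  for X Y Z c n p z :: real
  by algebra

lemma bessel_J_derivative:
  "(bessel_J n has_real_derivative (bessel_J (n - 1) z - bessel_J (n + 1) z) / 2) (at z)"
proof -
  let ?f = "\<lambda>z \<theta>. cos (of_int n * \<theta> - z * sin \<theta>)"
  let ?g = "\<lambda>z \<theta>. sin (of_int n * \<theta> - z * sin \<theta>) * sin \<theta>"
  have "((\<lambda>z. integral (cbox 0 pi) (?f z)) has_field_derivative integral (cbox 0 pi) (?g z)) (at z within UNIV)"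
  proof (rule leibniz_rule_field_derivative)
    show "((\<lambda>z. ?f z \<theta>) has_field_derivative ?g z \<theta>) (at z within UNIV)" for z \<theta>
      by (auto intro!: derivative_eq_intros)
    show "continuous_on (UNIV \<times> cbox 0 pi) (\<lambda>(z, \<theta>). ?g z \<theta>)"
      by (auto intro!: continuous_intros simp: case_prod_unfold)
  qed (auto intro!: trig_integrable continuous_intros)
  then have "((\<lambda>z. (1/pi) * integral {0..pi} (?f z)) has_real_derivative (1/pi) * integral {0..pi} (?g z)) (at z)"
    by (intro DERIV_cmult) simp
  moreover have "(1/pi) * integral {0..pi} (?g z) = (bessel_J (n - 1) z - bessel_J (n + 1) z) / 2"
  proof -
    have "?g z = (\<lambda>\<theta>. (cos (of_int (n - 1) * \<theta> - z * sin \<theta>) - cos (of_int (n + 1) * \<theta> - z * sin \<theta>)) * (1/2))"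
    proof
      fix \<theta>
      have "of_int (n - 1) * \<theta> - z * sin \<theta> = (of_int n * \<theta> - z * sin \<theta>) - \<theta>"
        "of_int (n + 1) * \<theta> - z * sin \<theta> = (of_int n * \<theta> - z * sin \<theta>) + \<theta>"
        by (simp_all add: algebra_simps)
      then show "?g z \<theta> = (cos (of_int (n - 1) * \<theta> - z * sin \<theta>) - cos (of_int (n + 1) * \<theta> - z * sin \<theta>)) * (1/2)"
        by (simp only: cos_diff cos_add) simp
    qed
    then have "integral {0..pi} (?g z) = (integral {0..pi} (\<lambda>\<theta>. cos (of_int (n - 1) * \<theta> - z * sin \<theta>))
         - integral {0..pi} (\<lambda>\<theta>. cos (of_int (n + 1) * \<theta> - z * sin \<theta>))) * (1/2)"
      by (simp only: integral_mult_left)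
         (subst Henstock_Kurzweil_Integration.integral_diff, auto intro!: trig_integrable continuous_intros)
    then show ?thesis by (simp add: bessel_J_eq diff_divide_distrib)
  qed
  moreover have "bessel_J n = (\<lambda>z. (1/pi) * integral {0..pi} (?f z))"
    by (rule ext) (rule bessel_J_eq)
  ultimately show ?thesis by (simp only:)
qed

text \<open>The derivative of \<open>sin (n \<theta> - z sin \<theta>)\<close> integrates to zero over \<open>[0, \<pi>]\<close>.\<close>

lemma bessel_J_recurrence: "z * (bessel_J (n - 1) z + bessel_J (n + 1) z) = 2 * of_int n * bessel_J n z"
proof -
  let ?A = "\<lambda>\<theta>. of_int n * \<theta> - z * sin \<theta>"
  have "((\<lambda>\<theta>. (of_int n - z * cos \<theta>) * cos (?A \<theta>)) has_integral (sin (?A pi) - sin (?A 0))) {0..pi}"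
    by (rule fundamental_theorem_of_calculus)
       (auto intro!: derivative_eq_intros simp flip: has_real_derivative_iff_has_vector_derivative)
  then have 0: "integral {0..pi} (\<lambda>\<theta>. (of_int n - z * cos \<theta>) * cos (?A \<theta>)) = 0"
    by (simp add: integral_unique sin_int_pi)
  have "(\<lambda>\<theta>. z * (cos (of_int (n - 1) * \<theta> - z * sin \<theta>) + cos (of_int (n + 1) * \<theta> - z * sin \<theta>)))
      = (\<lambda>\<theta>. 2 * (of_int n * cos (?A \<theta>) - (of_int n - z * cos \<theta>) * cos (?A \<theta>)))"
  proof
    fix \<theta>
    have "of_int (n - 1) * \<theta> - z * sin \<theta> = ?A \<theta> - \<theta>" "of_int (n + 1) * \<theta> - z * sin \<theta> = ?A \<theta> + \<theta>"
      by (simp_all add: algebra_simps)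
    then show "z * (cos (of_int (n - 1) * \<theta> - z * sin \<theta>) + cos (of_int (n + 1) * \<theta> - z * sin \<theta>))
       = 2 * (of_int n * cos (?A \<theta>) - (of_int n - z * cos \<theta>) * cos (?A \<theta>))"
      by (simp only: cos_diff cos_add) (simp add: algebra_simps)
  qed
  then have "integral {0..pi} (\<lambda>\<theta>. z * (cos (of_int (n - 1) * \<theta> - z * sin \<theta>) + cos (of_int (n + 1) * \<theta> - z * sin \<theta>)))
      = integral {0..pi} (\<lambda>\<theta>. 2 * (of_int n * cos (?A \<theta>) - (of_int n - z * cos \<theta>) * cos (?A \<theta>)))"
    by simp
  also have "\<dots> = 2 * (of_int n * integral {0..pi} (\<lambda>\<theta>. cos (?A \<theta>)))"
    unfolding integral_mult_right
    by (subst Henstock_Kurzweil_Integration.integral_diff) (auto intro!: trig_integrable continuous_intros simp: 0)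
  finally have "z * (integral {0..pi} (\<lambda>\<theta>. cos (of_int (n - 1) * \<theta> - z * sin \<theta>)) + integral {0..pi} (\<lambda>\<theta>. cos (of_int (n + 1) * \<theta> - z * sin \<theta>)))
     = 2 * (of_int n * integral {0..pi} (\<lambda>\<theta>. cos (?A \<theta>)))"
    unfolding integral_mult_right
    by (subst (asm) Henstock_Kurzweil_Integration.integral_add) (auto intro!: trig_integrable continuous_intros)
  then show ?thesis by (simp add: bessel_J_eq field_simps)
qed

lemma bessel_S_derivative:
  "(bessel_S n has_real_derivative (bessel_S (n - 1) z - bessel_S (n + 1) z) / 2) (at z)"
proof -
  let ?f = "\<lambda>z \<theta>. sin (z * sin \<theta> - of_int n * \<theta>)"
  let ?g = "\<lambda>z \<theta>. cos (z * sin \<theta> - of_int n * \<theta>) * sin \<theta>"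
  have "((\<lambda>z. integral (cbox 0 pi) (?f z)) has_field_derivative integral (cbox 0 pi) (?g z)) (at z within UNIV)"
  proof (rule leibniz_rule_field_derivative)
    show "((\<lambda>z. ?f z \<theta>) has_field_derivative ?g z \<theta>) (at z within UNIV)" for z \<theta>
      by (auto intro!: derivative_eq_intros)
    show "continuous_on (UNIV \<times> cbox 0 pi) (\<lambda>(z, \<theta>). ?g z \<theta>)"
      by (auto intro!: continuous_intros simp: case_prod_unfold)
  qed (auto intro!: trig_integrable continuous_intros)
  then have "((\<lambda>z. (1/pi) * integral {0..pi} (?f z)) has_real_derivative (1/pi) * integral {0..pi} (?g z)) (at z)"
    by (intro DERIV_cmult) simp
  moreover have "(1/pi) * integral {0..pi} (?g z) = (bessel_S (n - 1) z - bessel_S (n + 1) z) / 2"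
  proof -
    have "?g z = (\<lambda>\<theta>. (sin (z * sin \<theta> - of_int (n - 1) * \<theta>) - sin (z * sin \<theta> - of_int (n + 1) * \<theta>)) * (1/2))"
    proof
      fix \<theta>
      have "z * sin \<theta> - of_int (n - 1) * \<theta> = (z * sin \<theta> - of_int n * \<theta>) + \<theta>"
        "z * sin \<theta> - of_int (n + 1) * \<theta> = (z * sin \<theta> - of_int n * \<theta>) - \<theta>"
        by (simp_all add: algebra_simps)
      then show "?g z \<theta> = (sin (z * sin \<theta> - of_int (n - 1) * \<theta>) - sin (z * sin \<theta> - of_int (n + 1) * \<theta>)) * (1/2)"
        by (simp only: sin_diff sin_add) simp
    qed
    then have "integral {0..pi} (?g z) = (integral {0..pi} (\<lambda>\<theta>. sin (z * sin \<theta> - of_int (n - 1) * \<theta>))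
         - integral {0..pi} (\<lambda>\<theta>. sin (z * sin \<theta> - of_int (n + 1) * \<theta>))) * (1/2)"
      by (simp only: integral_mult_left)
         (subst Henstock_Kurzweil_Integration.integral_diff, auto intro!: trig_integrable continuous_intros)
    then show ?thesis by (simp add: bessel_S_def diff_divide_distrib)
  qed
  moreover have "bessel_S n = (\<lambda>z. (1/pi) * integral {0..pi} (?f z))"
    by (rule ext) (rule bessel_S_def)
  ultimately show ?thesis by (simp only:)
qed

lemma bessel_S_recurrence:
  "z * (bessel_S (n - 1) z + bessel_S (n + 1) z) = 2 * of_int n * bessel_S n z + 2 / pi * (1 - (-1) powi n)"
proof -
  let ?A = "\<lambda>\<theta>. z * sin \<theta> - of_int n * \<theta>"
  have "((\<lambda>\<theta>. (z * cos \<theta> - of_int n) * sin (?A \<theta>)) has_integral (- cos (?A pi) - (- cos (?A 0)))) {0..pi}"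
    by (rule fundamental_theorem_of_calculus)
       (auto intro!: derivative_eq_intros simp flip: has_real_derivative_iff_has_vector_derivative)
  moreover have "cos (?A pi) = (-1) powi n"
    by (simp add: cos_int_pi)
  ultimately have 0: "integral {0..pi} (\<lambda>\<theta>. (z * cos \<theta> - of_int n) * sin (?A \<theta>)) = 1 - (-1) powi n"
    by (simp add: integral_unique)
  have "(\<lambda>\<theta>. z * (sin (z * sin \<theta> - of_int (n - 1) * \<theta>) + sin (z * sin \<theta> - of_int (n + 1) * \<theta>)))
      = (\<lambda>\<theta>. 2 * (of_int n * sin (?A \<theta>) + (z * cos \<theta> - of_int n) * sin (?A \<theta>)))"
  proof
    fix \<theta>
    have "z * sin \<theta> - of_int (n - 1) * \<theta> = ?A \<theta> + \<theta>" "z * sin \<theta> - of_int (n + 1) * \<theta> = ?A \<theta> - \<theta>"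
      by (simp_all add: algebra_simps)
    then show "z * (sin (z * sin \<theta> - of_int (n - 1) * \<theta>) + sin (z * sin \<theta> - of_int (n + 1) * \<theta>))
       = 2 * (of_int n * sin (?A \<theta>) + (z * cos \<theta> - of_int n) * sin (?A \<theta>))"
      by (simp only: sin_diff sin_add) (simp add: algebra_simps)
  qed
  then have "integral {0..pi} (\<lambda>\<theta>. z * (sin (z * sin \<theta> - of_int (n - 1) * \<theta>) + sin (z * sin \<theta> - of_int (n + 1) * \<theta>)))
      = integral {0..pi} (\<lambda>\<theta>. 2 * (of_int n * sin (?A \<theta>) + (z * cos \<theta> - of_int n) * sin (?A \<theta>)))"
    by simp
  also have "\<dots> = 2 * (of_int n * integral {0..pi} (\<lambda>\<theta>. sin (?A \<theta>)) + (1 - (-1) powi n))"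
    unfolding integral_mult_right
    by (subst Henstock_Kurzweil_Integration.integral_add) (auto intro!: trig_integrable continuous_intros simp: 0)
  finally have "z * (integral {0..pi} (\<lambda>\<theta>. sin (z * sin \<theta> - of_int (n - 1) * \<theta>)) + integral {0..pi} (\<lambda>\<theta>. sin (z * sin \<theta> - of_int (n + 1) * \<theta>)))
     = 2 * (of_int n * integral {0..pi} (\<lambda>\<theta>. sin (?A \<theta>)) + (1 - (-1) powi n))"
    unfolding integral_mult_right
    by (subst (asm) Henstock_Kurzweil_Integration.integral_add) (auto intro!: trig_integrable continuous_intros)
  from scale_recurrence[OF this, of "1/pi"] show ?thesis by (simp add: bessel_S_def)
qed

lemma exp_growth_bessel_E: "exp_growth (\<lambda>t. exp (of_int n * t) + s * exp (- of_int n * t))"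
  by (intro exp_growth_add exp_growth_exp exp_growth_cmult)

lemma power_int_minus_one_pred: "(-1) powi (n - 1) = - ((-1) powi n :: real)"
  by (subst power_int_diff) auto

lemma power_int_minus_one_succ: "(-1) powi (n + 1) = - ((-1) powi n :: real)"
  by (subst power_int_add) auto

lemma bessel_E_derivative:
  assumes z: "z > 0"
  shows "(bessel_E n has_real_derivative (bessel_E (n - 1) z - bessel_E (n + 1) z) / 2) (at z)"
proof -
  let ?b = "\<lambda>n t. exp (of_int n * t) + (-1) powi n * exp (- of_int n * t) :: real"
  let ?I = "\<lambda>n. LINT t:{0..}|lborel. ?b n t * exp (- z * sinh t)"
  have i: "set_integrable lborel {0..} (\<lambda>t. ?b n t * exp (- z * sinh t))" for n
    by (intro laplace_integrable exp_growth_bessel_E phase_sinh z)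
  have "(bessel_E n has_real_derivative (1/pi) *
      (LINT t:{0..}|lborel. (- sinh t * ?b n t) * exp (- z * sinh t))) (at z)"
    unfolding bessel_E_def[abs_def]
    by (intro DERIV_cmult laplace_derivative exp_growth_bessel_E phase_sinh z)
  moreover have "(LINT t:{0..}|lborel. (- sinh t * ?b n t) * exp (- z * sinh t)) = (?I (n - 1) - ?I (n + 1)) / 2"
  proof -
    have "(- sinh t * ?b n t) * exp (- z * sinh t)
        = (?b (n - 1) t * exp (- z * sinh t) - ?b (n + 1) t * exp (- z * sinh t)) * (1/2)" for t
    proof -
      have "exp (of_int (n - 1) * t) = exp (of_int n * t) * exp (- t)"
        "exp (- of_int (n - 1) * t) = exp (- of_int n * t) * exp t"
        "exp (of_int (n + 1) * t) = exp (of_int n * t) * exp t"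
        "exp (- of_int (n + 1) * t) = exp (- of_int n * t) * exp (- t)"
        by (simp_all add: algebra_simps flip: exp_add)
      then show ?thesis
        unfolding power_int_minus_one_pred power_int_minus_one_succ sinh_field_def
        by (simp only:) (simp add: field_simps)
    qed
    then have "(LINT t:{0..}|lborel. (- sinh t * ?b n t) * exp (- z * sinh t))
       = (LINT t:{0..}|lborel. (?b (n - 1) t * exp (- z * sinh t) - ?b (n + 1) t * exp (- z * sinh t)) * (1/2))"
      by (simp only:)
    also have "\<dots> = (LINT t:{0..}|lborel. ?b (n - 1) t * exp (- z * sinh t) - ?b (n + 1) t * exp (- z * sinh t)) * (1/2)"
      by (rule set_integral_mult_left)
    also have "\<dots> = (?I (n - 1) - ?I (n + 1)) * (1/2)"
      by (simp only: set_integral_diff(2)[OF i i])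
    finally show ?thesis by simp
  qed
  moreover have "(1/pi) * ((?I (n - 1) - ?I (n + 1)) / 2) = (bessel_E (n - 1) z - bessel_E (n + 1) z) / 2"
    unfolding bessel_E_def by (simp only: right_diff_distrib times_divide_eq_right diff_divide_distrib)
  ultimately show ?thesis by (simp only:)
qed

lemma bessel_E_recurrence:
  assumes z: "z > 0"
  shows "z * (bessel_E (n - 1) z + bessel_E (n + 1) z) = 2 * of_int n * bessel_E n z + 2 / pi * (1 - (-1) powi n)"
proof -
  let ?b = "\<lambda>n t. exp (of_int n * t) + (-1) powi n * exp (- of_int n * t) :: real"
  let ?e = "\<lambda>t. exp (- z * sinh t)"
  let ?I = "\<lambda>n. LINT t:{0..}|lborel. ?b n t * ?e t"
  let ?c = "\<lambda>t. exp (of_int n * t) + (- ((-1) powi n)) * exp (- of_int n * t) :: real"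
  have cg: "exp_growth ?c" by (rule exp_growth_bessel_E)
  have i: "set_integrable lborel {0..} (\<lambda>t. ?b n t * ?e t)" for n
    by (intro laplace_integrable exp_growth_bessel_E phase_sinh z)
  have ic: "set_integrable lborel {0..} (\<lambda>t. (z * cosh t * ?c t) * ?e t)"
    by (intro laplace_integrable phase_sinh z exp_growth_mult[OF exp_growth_cmult] cg) (rule exp_growth_cosh[of 1, simplified])
  have "(LINT t:{0..}|lborel. (z * cosh t * ?c t) * ?e t - of_int n * (?b n t * ?e t)) = 0 - (- ?c 0 * ?e 0)"
  proof (rule half_line_FTC)
    show "set_integrable lborel {0..} (\<lambda>t. (z * cosh t * ?c t) * ?e t - of_int n * (?b n t * ?e t))"
      using ic i by (intro set_integral_diff(1) set_integrable_mult_right)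
    show "continuous_on {0..} (\<lambda>t. (z * cosh t * ?c t) * ?e t - of_int n * (?b n t * ?e t))"
      by (intro continuous_intros)
    show "((\<lambda>t. - ?c t * ?e t) has_real_derivative (z * cosh t * ?c t) * ?e t - of_int n * (?b n t * ?e t)) (at t)" for t
      by (auto intro!: derivative_eq_intros simp: algebra_simps)
    show "((\<lambda>t. - ?c t * ?e t) \<longlongrightarrow> 0) at_top"
      using laplace_tendsto_zero[OF exp_growth_cmult[OF cg, of "-1"] phase_sinh z] by simp
  qed
  then have "(LINT t:{0..}|lborel. (z * cosh t * ?c t) * ?e t) - of_int n * ?I n = 1 - (-1) powi n"
    by (simp only: set_integral_diff(2)[OF ic set_integrable_mult_right[OF i]] set_integral_mult_right) simp
  moreover have "z * (?I (n - 1) + ?I (n + 1)) = 2 * (LINT t:{0..}|lborel. (z * cosh t * ?c t) * ?e t)"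
  proof -
    have *: "z * (?b (n - 1) t * ?e t + ?b (n + 1) t * ?e t) = 2 * ((z * cosh t * ?c t) * ?e t)" for t
    proof -
      have "exp (of_int (n - 1) * t) = exp (of_int n * t) * exp (- t)"
        "exp (- of_int (n - 1) * t) = exp (- of_int n * t) * exp t"
        "exp (of_int (n + 1) * t) = exp (of_int n * t) * exp t"
        "exp (- of_int (n + 1) * t) = exp (- of_int n * t) * exp (- t)"
        by (simp_all add: algebra_simps flip: exp_add)
      then show ?thesis
        unfolding power_int_minus_one_pred power_int_minus_one_succ cosh_field_def
        by (simp only:) (simp add: field_simps)
    qed
    have "z * (?I (n - 1) + ?I (n + 1)) = (LINT t:{0..}|lborel. z * (?b (n - 1) t * ?e t + ?b (n + 1) t * ?e t))"
      by (simp only: set_integral_mult_right set_integral_add(2)[OF i i])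
    then show ?thesis unfolding * set_integral_mult_right .
  qed
  ultimately have "z * (?I (n - 1) + ?I (n + 1)) = 2 * (of_int n * ?I n + (1 - (-1) powi n))" by simp
  from scale_recurrence[OF this, of "1/pi"] show ?thesis by (simp add: bessel_E_def)
qed

lemma bessel_Y_derivative:
  assumes "z > 0"
  shows "(bessel_Y n has_real_derivative (bessel_Y (n - 1) z - bessel_Y (n + 1) z) / 2) (at z)"
proof -
  have "bessel_Y n = (\<lambda>z. bessel_S n z - bessel_E n z)" by (rule ext) (rule bessel_Y_eq)
  moreover have "(bessel_Y (n - 1) z - bessel_Y (n + 1) z) / 2
      = (bessel_S (n - 1) z - bessel_S (n + 1) z) / 2 - (bessel_E (n - 1) z - bessel_E (n + 1) z) / 2"
    by (simp add: bessel_Y_eq diff_divide_distrib add_divide_distrib)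
  ultimately show ?thesis
    using DERIV_diff[OF bessel_S_derivative bessel_E_derivative[OF assms], of n n] by (simp only:)
qed

lemma bessel_Y_recurrence:
  "z > 0 \<Longrightarrow> z * (bessel_Y (n - 1) z + bessel_Y (n + 1) z) = 2 * of_int n * bessel_Y n z"
  using bessel_S_recurrence[of z n] bessel_E_recurrence[of z n] by (simp add: bessel_Y_eq algebra_simps)

section \<open>The Wronskian and the Dirichlet-to-Neumann symbols\<close>

text \<open>This is \<open>J\<^sub>n Y\<^sub>n' - J\<^sub>n' Y\<^sub>n\<close> after elimination of the derivatives.\<close>

definition wronskian :: "int \<Rightarrow> real \<Rightarrow> real" where
  "wronskian n z = bessel_J (n + 1) z * bessel_Y n z - bessel_J n z * bessel_Y (n + 1) z"

lemma wronskian_pred: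
  assumes "z > 0"
  shows "wronskian n z = wronskian (n - 1) z"
proof -
  have "z * wronskian n z = z * wronskian (n - 1) z"
    using bessel_J_recurrence[of z n] bessel_Y_recurrence[OF assms, of n]
    unfolding wronskian_def diff_add_cancel by algebra
  then show ?thesis using assms by simp
qed

lemma wronskian_order:
  assumes "z > 0"
  shows "wronskian n z = wronskian 0 z"
proof (induction n rule: int_induct[of _ 0])
  case (step1 i)
  then show ?case using wronskian_pred[OF assms, of "i + 1"] by simp
next
  case (step2 i)
  then show ?case using wronskian_pred[OF assms, of i] by simp
qed simp

text \<open>The derivative of \<open>z W\<close> at order zero, where \<open>A\<close>, \<open>B\<close>, \<open>C\<close> stand for \<open>J\<^sub>0\<close>, \<open>J\<^sub>1\<close>, \<open>J\<^sub>2\<close> and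
  \<open>a\<close>, \<open>b\<close>, \<open>c\<close> for \<open>Y\<^sub>0\<close>, \<open>Y\<^sub>1\<close>, \<open>Y\<^sub>2\<close>; the orders \<open>-1\<close> are minus those of order one.\<close>

lemma wronskian_identity:
  fixes z :: real
  assumes "z * (A + C) = 2 * B" "z * (a + c) = 2 * b"
  shows "B * a - A * b + ((A - C) / 2 * a + (- b - b) / 2 * B - ((- B - B) / 2 * b + (a - c) / 2 * A)) * z = 0"
proof -
  have "2 * (B * a - A * b) + ((A - C) * a + (- b - b) * B - ((- B - B) * b + (a - c) * A)) * z = 0"
    using assms by algebra
  then show ?thesis by (simp add: field_simps)
qed

lemma wronskian_derivative:
  assumes "z > 0"
  shows "((\<lambda>z. z * wronskian 0 z) has_real_derivative 0) (at z)"
proof -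
  from DERIV_mult[OF DERIV_ident DERIV_diff[OF
      DERIV_mult[OF bessel_J_derivative[of "0 + 1" z] bessel_Y_derivative[OF assms, of 0]]
      DERIV_mult[OF bessel_J_derivative[of 0 z] bessel_Y_derivative[OF assms, of "0 + 1"]]]]
  show ?thesis unfolding wronskian_def
  proof (rule DERIV_cong)
    have "bessel_J (-1) z = - bessel_J 1 z" "bessel_Y (-1) z = - bessel_Y 1 z"
      using bessel_J_recurrence[of z 0] bessel_Y_recurrence[OF assms, of 0] assms by (auto simp: add_eq_0_iff2)
    moreover have "z * (bessel_J 0 z + bessel_J 2 z) = 2 * bessel_J 1 z"
      "z * (bessel_Y 0 z + bessel_Y 2 z) = 2 * bessel_Y 1 z"
      using bessel_J_recurrence[of z 1] bessel_Y_recurrence[OF assms, of 1] by auto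
    ultimately show "1 * (bessel_J (0 + 1) z * bessel_Y 0 z - bessel_J 0 z * bessel_Y (0 + 1) z) +
      ((bessel_J (0 + 1 - 1) z - bessel_J (0 + 1 + 1) z) / 2 * bessel_Y 0 z +
       (bessel_Y (0 - 1) z - bessel_Y (0 + 1) z) / 2 * bessel_J (0 + 1) z -
       ((bessel_J (0 - 1) z - bessel_J (0 + 1) z) / 2 * bessel_Y (0 + 1) z +
        (bessel_Y (0 + 1 - 1) z - bessel_Y (0 + 1 + 1) z) / 2 * bessel_J 0 z)) * z = 0"
      using wronskian_identity[of z "bessel_J 0 z" "bessel_J 2 z" "bessel_J 1 z" "bessel_Y 0 z" "bessel_Y 2 z" "bessel_Y 1 z"]
      by simp
  qed
qed

lemma half_line_integral_nonneg:
  fixes f :: "real \<Rightarrow> real"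
  shows "(\<And>t. t \<ge> 0 \<Longrightarrow> 0 \<le> f t) \<Longrightarrow> 0 \<le> (LINT t:{0..}|lborel. f t)"
  unfolding set_lebesgue_integral_def
  by (rule Bochner_Integration.integral_nonneg) (auto simp: indicator_def)

text \<open>The singular behaviour of \<open>Y\<^sub>0\<close> and \<open>Y\<^sub>1\<close> at zero.  Everything is compared with
  \<open>\<integral> z cosh t exp (- z sinh t) dt = 1\<close>, using \<open>1 \<le> cosh t\<close> for order zero and
  \<open>sinh t = cosh t - exp (- t)\<close> for order one.\<close>

lemma bessel_E_zero_bounds:
  assumes "z > 0"
  shows "0 \<le> z * bessel_E 0 z" "z * bessel_E 0 z \<le> 2 / pi"
    and "\<bar>z * bessel_E 1 z - 2 / pi\<bar> \<le> 2 * z / pi"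
proof -
  let ?e = "\<lambda>t. exp (- z * sinh t)"
  have i: "set_integrable lborel {0..} (\<lambda>t. 1 * ?e t)" "set_integrable lborel {0..} (\<lambda>t. (z * cosh t) * ?e t)"
    "set_integrable lborel {0..} (\<lambda>t. exp (-1 * t) * ?e t)"
    by (intro laplace_integrable phase_sinh assms exp_growth_intros)+
  have total: "(LINT t:{0..}|lborel. (z * cosh t) * ?e t) = 1"
  proof -
    have "(LINT t:{0..}|lborel. (z * cosh t) * ?e t) = 0 - (- ?e 0)"
    proof (rule half_line_FTC[OF i(2)])
      show "((\<lambda>t. - ?e t) has_real_derivative (z * cosh t) * ?e t) (at t)" for t
        by (auto intro!: derivative_eq_intros)
      show "((\<lambda>t. - ?e t) \<longlongrightarrow> 0) at_top"
        using tendsto_minus[OF laplace_tendsto_zero[OF exp_growth_const[of 1] phase_sinh assms]] by simp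
    qed (intro continuous_intros)
    then show ?thesis by simp
  qed
  have le: "(LINT t:{0..}|lborel. z * (1 * ?e t)) \<le> (LINT t:{0..}|lborel. (z * cosh t) * ?e t)"
    using cosh_real_ge_1 assms by (intro set_integral_mono set_integrable_mult_right i) auto
  have E0: "bessel_E 0 z = (1/pi) * (2 * (LINT t:{0..}|lborel. 1 * ?e t))"
    unfolding bessel_E_def set_integral_mult_right[symmetric] by simp
  have "0 \<le> (LINT t:{0..}|lborel. 1 * ?e t)" by (intro half_line_integral_nonneg) auto
  then show "0 \<le> z * bessel_E 0 z" using assms unfolding E0 by auto
  show "z * bessel_E 0 z \<le> 2 / pi"
    using le total unfolding E0 set_integral_mult_right by (simp add: field_simps)
  have "(exp (of_int 1 * t) + (-1) powi 1 * exp (- of_int 1 * t)) * ?e t = 2 * (cosh t * ?e t) - 2 * (exp (-1 * t) * ?e t)" for t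
    by (simp add: cosh_field_def field_simps)
  moreover have i2: "set_integrable lborel {0..} (\<lambda>t. 2 * (cosh t * ?e t))" "set_integrable lborel {0..} (\<lambda>t. 2 * (exp (-1 * t) * ?e t))"
    by (intro set_integrable_mult_right laplace_integrable phase_sinh assms exp_growth_intros)+
  ultimately have "pi * bessel_E 1 z = 2 * (LINT t:{0..}|lborel. cosh t * ?e t) - 2 * (LINT t:{0..}|lborel. exp (-1 * t) * ?e t)"
    unfolding bessel_E_def by (simp only: set_integral_diff(2)[OF i2] set_integral_mult_right) simp
  moreover have "z * (LINT t:{0..}|lborel. cosh t * ?e t) = 1"
    using total by (simp only: set_integral_mult_right mult.assoc)
  ultimately have *: "pi * (z * bessel_E 1 z) - 2 = - 2 * z * (LINT t:{0..}|lborel. exp (-1 * t) * ?e t)"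
    by algebra
  have "(LINT t:{0..}|lborel. exp (-1 * t) * ?e t) \<ge> 0" by (intro half_line_integral_nonneg) auto
  moreover have "(LINT t:{0..}|lborel. exp (-1 * t) * ?e t) \<le> (LINT t:{0..}|lborel. exp (- t))"
    using assms by (intro set_integral_mono i integrable_exp_neg) (auto simp: mult_left_le)
  moreover have "(LINT t:{0..}|lborel. exp (- t) :: real) = 0 - (- exp (- 0))"
  proof (rule half_line_FTC[OF integrable_exp_neg])
    have "((\<lambda>t. exp (- t) :: real) \<longlongrightarrow> 0) at_top"
      by (rule filterlim_compose[OF exp_at_bot filterlim_uminus_at_bot_at_top])
    then show "((\<lambda>t. - exp (- t) :: real) \<longlongrightarrow> 0) at_top" using tendsto_minus by fastforce
  qed (auto intro!: continuous_intros derivative_eq_intros)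
  ultimately have "\<bar>pi * (z * bessel_E 1 z) - 2\<bar> \<le> 2 * z"
    unfolding * using assms by (simp add: abs_mult)
  then have "\<bar>pi * (z * bessel_E 1 z) - 2\<bar> / pi \<le> 2 * z / pi" by (rule divide_right_mono) simp
  moreover have "\<bar>pi * (z * bessel_E 1 z) - 2\<bar> / pi = \<bar>z * bessel_E 1 z - 2 / pi\<bar>"
  proof -
    have "z * bessel_E 1 z - 2 / pi = (pi * (z * bessel_E 1 z) - 2) / pi" by (simp add: diff_divide_distrib)
    then show ?thesis by (simp only: abs_divide) simp
  qed
  ultimately show "\<bar>z * bessel_E 1 z - 2 / pi\<bar> \<le> 2 * z / pi" by simp
qed

text \<open>By the recurrences \<open>z W\<close> depends neither on the order nor on \<open>z\<close>, and as
  \<open>z\<close> tends to zero \<open>J\<^sub>0\<close> tends to one, \<open>J\<^sub>1\<close> to zero and \<open>z Y\<^sub>1\<close> to \<open>- 2 / \<pi>\<close>.\<close>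

proposition wronskian_value:
  assumes "z > 0"
  shows "z * wronskian n z = 2 / pi"
proof -
  obtain c where c: "\<And>x. x > 0 \<Longrightarrow> x * wronskian 0 x = c"
    using has_field_derivative_zero_constant[of "{0<..}" "\<lambda>z. z * wronskian 0 z"]
      wronskian_derivative has_field_derivative_at_within by (metis convex_real_interval(3) greaterThan_iff)
  have J: "(bessel_J n \<longlongrightarrow> bessel_J n 0) (at_right 0)" for n
    using DERIV_isCont[OF bessel_J_derivative] by (simp add: isCont_def filterlim_at_split)
  have S: "(bessel_S n \<longlongrightarrow> bessel_S n 0) (at_right 0)" for n
    using DERIV_isCont[OF bessel_S_derivative] by (simp add: isCont_def filterlim_at_split)
  have J0: "bessel_J 0 0 = 1" by (simp add: bessel_J_eq)
  have J1: "bessel_J 1 0 = 0" using bessel_J_recurrence[of 0 1] by simp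
  have id: "((\<lambda>z. z) \<longlongrightarrow> 0) (at_right (0::real))" by simp
  have pos: "\<forall>\<^sub>F z in at_right 0. z > (0::real)" by (simp add: eventually_at_right_less)
  have "((\<lambda>z. bessel_J 1 z * (z * bessel_S 0 z - z * bessel_E 0 z)) \<longlongrightarrow> 0) (at_right 0)"
  proof (rule Lim_null_comparison)
    show "\<forall>\<^sub>F z in at_right 0. norm (bessel_J 1 z * (z * bessel_S 0 z - z * bessel_E 0 z))
        \<le> \<bar>bessel_J 1 z\<bar> * (\<bar>z * bessel_S 0 z\<bar> + 2 / pi)"
      using pos
    proof eventually_elim
      case (elim z)
      have "\<bar>z * bessel_S 0 z - z * bessel_E 0 z\<bar> \<le> \<bar>z * bessel_S 0 z\<bar> + 2 / pi"
        using bessel_E_zero_bounds(1,2)[OF elim] by linarith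
      then show ?case by (simp add: abs_mult mult_left_mono)
    qed
    have "((\<lambda>z. \<bar>bessel_J 1 z\<bar> * (\<bar>z * bessel_S 0 z\<bar> + 2 / pi)) \<longlongrightarrow> \<bar>bessel_J 1 0\<bar> * (\<bar>0 * bessel_S 0 0\<bar> + 2 / pi)) (at_right 0)"
      by (intro tendsto_intros J S id)
    then show "((\<lambda>z. \<bar>bessel_J 1 z\<bar> * (\<bar>z * bessel_S 0 z\<bar> + 2 / pi)) \<longlongrightarrow> 0) (at_right 0)"
      by (simp add: J1)
  qed
  moreover have "((\<lambda>z. z * bessel_E 1 z - 2 / pi) \<longlongrightarrow> 0) (at_right 0)"
  proof (rule Lim_null_comparison)
    show "\<forall>\<^sub>F z in at_right 0. norm (z * bessel_E 1 z - 2 / pi) \<le> 2 * z / pi"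
      using pos by eventually_elim (use bessel_E_zero_bounds(3) in auto)
    show "((\<lambda>z. 2 * z / pi) \<longlongrightarrow> 0) (at_right 0)"
      using tendsto_mult_right_zero[OF id, of "2/pi"] by simp
  qed
  then have "((\<lambda>z. bessel_J 0 z * (z * bessel_S 1 z - (z * bessel_E 1 z - 2 / pi + 2 / pi)))
     \<longlongrightarrow> bessel_J 0 0 * (0 * bessel_S 1 0 - (0 + 2 / pi))) (at_right 0)"
    by (intro tendsto_intros J S id)
  ultimately have "((\<lambda>z. bessel_J 1 z * (z * bessel_S 0 z - z * bessel_E 0 z)
        - bessel_J 0 z * (z * bessel_S 1 z - (z * bessel_E 1 z - 2 / pi + 2 / pi)))
      \<longlongrightarrow> 0 - bessel_J 0 0 * (0 * bessel_S 1 0 - (0 + 2 / pi))) (at_right 0)"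
    by (rule tendsto_diff)
  moreover have "\<forall>\<^sub>F z in at_right 0. bessel_J 1 z * (z * bessel_S 0 z - z * bessel_E 0 z)
        - bessel_J 0 z * (z * bessel_S 1 z - (z * bessel_E 1 z - 2 / pi + 2 / pi)) = c"
    using pos
  proof eventually_elim
    case (elim z)
    then show ?case using c[OF elim] by (simp add: wronskian_def bessel_Y_eq algebra_simps)
  qed
  ultimately have "((\<lambda>z. c) \<longlongrightarrow> 0 - bessel_J 0 0 * (0 * bessel_S 1 0 - (0 + 2 / pi))) (at_right (0::real))"
    by (rule Lim_transform_eventually)
  then have "((\<lambda>z. c) \<longlongrightarrow> 2 / pi) (at_right (0::real))" by (simp add: J0)
  then have "c = 2 / pi" by (simp add: tendsto_const_iff)
  then show ?thesis using c[OF assms] wronskian_order[OF assms, of n] by simp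
qed

lemma hankel1_derivative:
  assumes "z > 0"
  shows "vector_derivative (hankel1 n) (at z) = (hankel1 (n - 1) z - hankel1 (n + 1) z) / 2"
proof -
  have J: "((\<lambda>z. of_real (bessel_J n z) :: complex) has_vector_derivative
      of_real ((bessel_J (n - 1) z - bessel_J (n + 1) z) / 2)) (at z)"
    by (intro has_vector_derivative_of_real has_real_derivative_iff_has_vector_derivative[THEN iffD1] bessel_J_derivative)
  have Y: "((\<lambda>z. of_real (bessel_Y n z) :: complex) has_vector_derivative
      of_real ((bessel_Y (n - 1) z - bessel_Y (n + 1) z) / 2)) (at z)"
    by (intro has_vector_derivative_of_real has_real_derivative_iff_has_vector_derivative[THEN iffD1] bessel_Y_derivative assms)
  have "hankel1 n = (\<lambda>z. of_real (bessel_J n z) + \<i> * of_real (bessel_Y n z))"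
    by (rule ext) (rule hankel1_def)
  then have "(hankel1 n has_vector_derivative of_real ((bessel_J (n - 1) z - bessel_J (n + 1) z) / 2)
      + \<i> * of_real ((bessel_Y (n - 1) z - bessel_Y (n + 1) z) / 2)) (at z)"
    by (simp only:) (intro has_vector_derivative_add J has_vector_derivative_mult_right Y)
  then show ?thesis
    by (simp add: vector_derivative_at hankel1_def field_simps)
qed

lemma h_symbol_eq:
  assumes "z > 0"
  shows "h_symbol n z = of_real z * (hankel1 (n - 1) z - hankel1 (n + 1) z) / (2 * hankel1 n z)"
  unfolding h_symbol_def hankel1_derivative[OF assms] by simp

lemma hankel1_recurrence:
  assumes "z > 0"
  shows "of_real z * (hankel1 (n - 1) z + hankel1 (n + 1) z) = 2 * of_int n * hankel1 n z"
proof -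
  have "of_real z * (hankel1 (n - 1) z + hankel1 (n + 1) z)
     = of_real (z * (bessel_J (n - 1) z + bessel_J (n + 1) z)) + \<i> * of_real (z * (bessel_Y (n - 1) z + bessel_Y (n + 1) z))"
    by (simp add: hankel1_def algebra_simps)
  then show ?thesis
    unfolding bessel_J_recurrence bessel_Y_recurrence[OF assms] by (simp add: hankel1_def algebra_simps)
qed

lemma wronskian_Im: "Im (hankel1 n z * cnj (hankel1 (n + 1) z)) = wronskian n z"
  by (simp add: hankel1_def wronskian_def mult.commute)

lemma wronskian_le: "\<bar>wronskian n z\<bar> \<le> norm (hankel1 n z) * norm (hankel1 (n + 1) z)"
  unfolding wronskian_Im[symmetric] using abs_Im_le_cmod[of "hankel1 n z * cnj (hankel1 (n + 1) z)"]
  by (simp add: norm_mult)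

lemma wronskian_pos: "z > 0 \<Longrightarrow> wronskian n z > 0"
  using wronskian_value[of z n] by (metis divide_pos_pos pi_gt_zero zero_less_mult_pos zero_less_numeral)

lemma hankel1_nonzero: "z > 0 \<Longrightarrow> hankel1 n z \<noteq> 0"
  using wronskian_le[of n z] wronskian_pos[of z n] by auto

text \<open>Multiplying numerator and denominator of the symbol by the conjugate of \<open>H\<^sub>n\<close> leaves the sum
  of two consecutive Wronskians as the imaginary part.\<close>

proposition h_symbol_Im_pos:
  assumes "z > 0"
  shows "Im (h_symbol n z) > 0"
proof -
  let ?H = "hankel1 n z" and ?D = "hankel1 (n - 1) z - hankel1 (n + 1) z"
  have "Im (?D * cnj ?H) = wronskian (n - 1) z + wronskian n z"
    using wronskian_Im[of "n - 1" z] wronskian_Im[of n z] by (simp add: algebra_simps)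
  then have pos: "Im (?D * cnj ?H) > 0" using wronskian_pos[OF assms] by (simp add: add_pos_pos)
  have "h_symbol n z = of_real (z / (2 * (norm ?H)\<^sup>2)) * (?D * cnj ?H)"
    using hankel1_nonzero[OF assms, of n] complex_norm_square[of ?H] unfolding h_symbol_eq[OF assms]
    by (simp add: divide_simps mult.commute)
  then have "Im (h_symbol n z) = z / (2 * (norm ?H)\<^sup>2) * Im (?D * cnj ?H)"
    by (simp only: times_complex.sel Re_complex_of_real Im_complex_of_real mult_zero_left add_0_right)
  then show ?thesis using pos assms hankel1_nonzero[OF assms, of n] by simp
qed

text \<open>Once the modulus of a solution of the recurrence fails to decrease at an index beyond \<open>z\<close>, it
  never decreases again.  If it always decreases, it is at most of order \<open>1 / n\<close>, which contradicts
  the lower bound on products of consecutive terms; for the Hankel functions the Wronskian is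
  such a bound.\<close>

lemma recurrence_eventually_increasing:
  fixes c :: "nat \<Rightarrow> complex"
  assumes z: "z > 0" and rec: "\<And>k. of_real z * (c k + c (k + 2)) = 2 * of_nat (k + 1) * c (k + 1)"
    and \<delta>: "\<delta> > 0" "\<And>k. \<delta> \<le> norm (c k) * norm (c (k + 1))"
  obtains N where "\<And>n. n \<ge> N \<Longrightarrow> norm (c n) \<le> norm (c (n + 1))"
proof -
  have norm_rec: "z * norm (c k + c (k + 2)) = 2 * real (k + 1) * norm (c (k + 1))" for k
    using arg_cong[OF rec[of k], of norm] z by (simp only: norm_mult norm_of_real norm_of_nat norm_numeral abs_of_pos)
  show ?thesis
  proof (cases "\<exists>n. real n \<ge> z \<and> norm (c n) \<le> norm (c (n + 1))")
    case True
    then obtain N where N: "real N \<ge> z" "norm (c N) \<le> norm (c (N + 1))" by blast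
    have "norm (c n) \<le> norm (c (n + 1))" if "n \<ge> N" for n
      using that
    proof (induction n rule: dec_induct)
      case (step n)
      have "(2 * z) * norm (c (n + 1)) \<le> (2 * real (n + 1)) * norm (c (n + 1))"
        using N(1) step(1) by (intro mult_right_mono) auto
      then have "z * (2 * norm (c (n + 1))) \<le> 2 * real (n + 1) * norm (c (n + 1))"
        by (simp only: mult_ac)
      also have "\<dots> = z * norm (c n + c (n + 2))" using norm_rec by simp
      finally have "2 * norm (c (n + 1)) \<le> norm (c n + c (n + 2))"
        using z by simp
      then show ?case using step.IH norm_triangle_ineq[of "c n" "c (n + 2)"] by simp
    qed (rule N)
    then show ?thesis by (rule that)
  next
    case False
    define N where "N = nat \<lceil>z\<rceil>"
    have dec: "norm (c (n + 1)) < norm (c n)" if "n \<ge> N" for n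
    proof -
      have "real n \<ge> z" using that z unfolding N_def by linarith
      then show ?thesis using False by (meson not_le)
    qed
    define A where "A = norm (c N)"
    have A: "norm (c n) \<le> A" if "n \<ge> N" for n
      using that
    proof (induction n rule: dec_induct)
      case (step n)
      then show ?case using dec[of n] by simp
    qed (simp add: A_def)
    have "\<delta> * real (n + 1) \<le> A * (z * A)" if "n \<ge> N" for n
    proof -
      have "2 * real (n + 1) * norm (c (n + 1)) \<le> z * (2 * A)"
        unfolding norm_rec[symmetric] using norm_triangle_ineq[of "c n" "c (n + 2)"] A[of n] A[of "n + 2"] that z
        by (intro mult_left_mono) auto
      moreover have "z * (2 * A) = 2 * (z * A)" by simp
      ultimately have *: "real (n + 1) * norm (c (n + 1)) \<le> z * A" by linarith
      have "\<delta> * real (n + 1) \<le> (norm (c n) * norm (c (n + 1))) * real (n + 1)"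
        using \<delta> by (intro mult_right_mono) auto
      also have "\<dots> = norm (c n) * (real (n + 1) * norm (c (n + 1)))" by simp
      also have "\<dots> \<le> A * (z * A)" using A[OF that] * order_trans[OF norm_ge_zero A[OF that]]
        by (rule mult_mono) simp
      finally show ?thesis .
    qed
    moreover obtain m where "real m > A * (z * A) / \<delta>" using reals_Archimedean2 by blast
    then have "real (max m N + 1) > A * (z * A) / \<delta>" by linarith
    then have "\<delta> * real (max m N + 1) > A * (z * A)" using \<delta> by (simp add: field_simps)
    ultimately show ?thesis using not_le by (metis max.cobounded2)
  qed
qed

lemma int_bound_of_cofinite:
  fixes f :: "int \<Rightarrow> real"
  assumes "\<And>n. \<bar>n\<bar> \<ge> int N \<Longrightarrow> f n \<le> A * (1 + \<bar>of_int n\<bar>)" "A \<ge> 0"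
  obtains C where "C \<ge> 0" "\<And>n. f n \<le> C * (1 + \<bar>of_int n\<bar>)"
proof -
  define B where "B = Max (insert 0 (f ` {- int N..int N}))"
  have B: "0 \<le> B" "\<And>n. n \<in> {- int N..int N} \<Longrightarrow> f n \<le> B"
    unfolding B_def by (rule Max_ge; simp)+
  have "f n \<le> (A + B) * (1 + \<bar>of_int n\<bar>)" for n
  proof (cases "\<bar>n\<bar> \<ge> int N")
    case True
    then have "f n \<le> A * (1 + \<bar>of_int n\<bar>)" by (rule assms)
    also have "\<dots> \<le> (A + B) * (1 + \<bar>of_int n\<bar>)" using B by (intro mult_right_mono) auto
    finally show ?thesis .
  next
    case False
    then have "n \<in> {- int N..int N}" by auto
    then have "f n \<le> B * 1" using B(2)[of n] by simp
    also have "\<dots> \<le> (A + B) * (1 + \<bar>of_int n\<bar>)" using B assms(2) by (intro mult_mono) auto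
    finally show ?thesis .
  qed
  then show ?thesis using that[of "A + B"] assms(2) B(1) by auto
qed

text \<open>If one of the neighbours \<open>H\<^sub>n\<^sub>-\<^sub>1\<close>, \<open>H\<^sub>n\<^sub>+\<^sub>1\<close> is no larger in modulus than \<open>H\<^sub>n\<close>, the recurrence gives
  \<open>z |H\<^sub>n\<^sub>-\<^sub>1 - H\<^sub>n\<^sub>+\<^sub>1| \<le> 2 (|n| + z) |H\<^sub>n|\<close>.  For large \<open>|n|\<close> the neighbour closer to order
  zero has this property.\<close>

proposition h_symbol_bound:
  assumes z: "z > 0"
  obtains C where "C \<ge> 0" "\<And>n. norm (h_symbol n z) \<le> C * (1 + \<bar>of_int n\<bar>)"
proof -
  let ?H = "\<lambda>n. hankel1 n z"
  note W = wronskian_order[OF z] wronskian_pos[OF z]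
  have W_le: "wronskian 0 z \<le> norm (?H n) * norm (?H (n + 1))" for n
    using wronskian_le[of n z] W(1)[of n] W(2)[of 0] by simp
  obtain N1 where N1: "\<And>n. n \<ge> N1 \<Longrightarrow> norm (?H (int n)) \<le> norm (?H (int (n + 1)))"
  proof (rule recurrence_eventually_increasing[of z "\<lambda>n. ?H (int n)" "wronskian 0 z"])
    show "of_real z * (?H (int k) + ?H (int (k + 2))) = 2 * of_nat (k + 1) * ?H (int (k + 1))" for k
      using hankel1_recurrence[OF z, of "int k + 1"] by (simp add: algebra_simps)
    show "wronskian 0 z \<le> norm (?H (int k)) * norm (?H (int (k + 1)))" for k
      using W_le[of "int k"] by (simp add: algebra_simps)
  qed (use z W in auto)
  \<comment> \<open>the alternating sign turns the recurrence for descending orders into the ascending one\<close>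
  obtain N2 where N2: "\<And>n. n \<ge> N2 \<Longrightarrow> norm ((-1) ^ n * ?H (- int n)) \<le> norm ((-1) ^ (n + 1) * ?H (- int (n + 1)))"
  proof (rule recurrence_eventually_increasing[of z "\<lambda>n. (-1) ^ n * ?H (- int n)" "wronskian 0 z"])
    show "of_real z * ((-1) ^ k * ?H (- int k) + (-1) ^ (k + 2) * ?H (- int (k + 2)))
        = 2 * of_nat (k + 1) * ((-1) ^ (k + 1) * ?H (- int (k + 1)))" for k
    proof -
      have *: "of_real z * (?H (- int (k + 2)) + ?H (- int k)) = 2 * of_int (- int (k + 1)) * ?H (- int (k + 1))"
        using hankel1_recurrence[OF z, of "- int (k + 1)"] by (simp add: algebra_simps)
      have "of_real z * ((-1) ^ k * ?H (- int k) + (-1) ^ (k + 2) * ?H (- int (k + 2)))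
          = (-1) ^ k * (of_real z * (?H (- int (k + 2)) + ?H (- int k)))"
        by (simp add: algebra_simps)
      then show ?thesis unfolding * by (simp add: algebra_simps)
    qed
    show "wronskian 0 z \<le> norm ((-1) ^ k * ?H (- int k)) * norm ((-1) ^ (k + 1) * ?H (- int (k + 1)))" for k
      using W_le[of "- int (k + 1)"] by (simp add: norm_mult norm_power mult.commute)
  qed (use z W in auto)
  have bound: "norm (h_symbol n z) \<le> (z + 1) * (1 + \<bar>of_int n\<bar>)"
    if le: "norm (?H (n - 1)) \<le> norm (?H n) \<or> norm (?H (n + 1)) \<le> norm (?H n)" for n
  proof -
    have H: "norm (?H n) > 0" using hankel1_nonzero[OF z] by simp
    have r: "z * norm (?H (n - 1) + ?H (n + 1)) = 2 * \<bar>of_int n\<bar> * norm (?H n)"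
      using arg_cong[OF hankel1_recurrence[OF z, of n], of norm] z by (simp add: norm_mult)
    have "norm (?H (n - 1) - ?H (n + 1)) \<le> norm (?H (n - 1) + ?H (n + 1)) + 2 * norm (?H n)"
    proof (cases "norm (?H (n - 1)) \<le> norm (?H n)")
      case True
      have "?H (n - 1) - ?H (n + 1) = 2 * ?H (n - 1) - (?H (n - 1) + ?H (n + 1))" by simp
      then have "norm (?H (n - 1) - ?H (n + 1)) \<le> norm (2 * ?H (n - 1)) + norm (?H (n - 1) + ?H (n + 1))"
        by (metis norm_triangle_ineq4)
      then show ?thesis using True by (simp add: norm_mult)
    next
      case False
      have "?H (n - 1) - ?H (n + 1) = (?H (n - 1) + ?H (n + 1)) - 2 * ?H (n + 1)" by simp
      then have "norm (?H (n - 1) - ?H (n + 1)) \<le> norm (?H (n - 1) + ?H (n + 1)) + norm (2 * ?H (n + 1))"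
        by (metis norm_triangle_ineq4)
      then show ?thesis using False le by (simp add: norm_mult)
    qed
    then have "z * norm (?H (n - 1) - ?H (n + 1)) \<le> 2 * \<bar>of_int n\<bar> * norm (?H n) + 2 * z * norm (?H n)"
      using z mult_left_mono[of _ _ z] unfolding r[symmetric] by (fastforce simp: algebra_simps)
    then have "z * norm (?H (n - 1) - ?H (n + 1)) / (2 * norm (?H n)) \<le> \<bar>of_int n\<bar> + z"
      using H by (simp add: field_simps)
    then have "norm (h_symbol n z) \<le> \<bar>of_int n\<bar> + z"
      using z by (simp add: h_symbol_eq norm_divide norm_mult)
    also have "\<dots> \<le> (z + 1) * (1 + \<bar>of_int n\<bar>)" using z by (simp add: algebra_simps)
    finally show ?thesis .
  qed
  show ?thesis
  proof (rule int_bound_of_cofinite[of "N1 + N2 + 1" "\<lambda>n. norm (h_symbol n z)" "z + 1"])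
    fix n :: int assume n: "int (N1 + N2 + 1) \<le> \<bar>n\<bar>"
    show "norm (h_symbol n z) \<le> (z + 1) * (1 + \<bar>of_int n\<bar>)"
    proof (cases "n \<ge> 0")
      case True
      then have "norm (?H (n - 1)) \<le> norm (?H n)"
        using N1[of "nat (n - 1)"] n by simp
      then show ?thesis using bound by blast
    next
      case False
      then have "norm (?H (n + 1)) \<le> norm (?H n)"
        using N2[of "nat (- n - 1)"] n by (simp add: norm_mult norm_power add.commute)
      then show ?thesis using bound by blast
    qed
  qed (use z that in auto)
qed

lemma bessel_K_eq: "bessel_K n z = (LINT t:{0..}|lborel. cosh (of_int n * t) * exp (- z * cosh t))"
  unfolding bessel_K_def by (simp add: mult.commute)

lemma bessel_K_derivative:
  assumes "z > 0"
  shows "deriv (bessel_K n) z = - (LINT t:{0..}|lborel. (cosh t * cosh (of_int n * t)) * exp (- z * cosh t))"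
proof -
  have "(bessel_K n has_real_derivative (LINT t:{0..}|lborel. (- cosh t * cosh (of_int n * t)) * exp (- z * cosh t))) (at z)"
    unfolding bessel_K_eq[abs_def] by (intro laplace_derivative exp_growth_cosh phase_cosh assms)
  then have "deriv (bessel_K n) z = (LINT t:{0..}|lborel. (- cosh t * cosh (of_int n * t)) * exp (- z * cosh t))"
    by (rule DERIV_imp_deriv)
  also have "\<dots> = (LINT t:{0..}|lborel. (-1) * ((cosh t * cosh (of_int n * t)) * exp (- z * cosh t)))" by simp
  finally show ?thesis unfolding set_integral_mult_right by simp
qed

lemma bessel_K_nonneg: "bessel_K n z \<ge> 0"
  unfolding bessel_K_eq by (intro half_line_integral_nonneg) auto

lemma deriv_bessel_K_nonpos: "z > 0 \<Longrightarrow> deriv (bessel_K n) z \<le> 0"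
  unfolding bessel_K_derivative by (simp, intro half_line_integral_nonneg) auto

lemma k_symbol_Re_nonpos: "z > 0 \<Longrightarrow> Re (k_symbol n z) \<le> 0"
  using bessel_K_nonneg[of n z] deriv_bessel_K_nonpos[of z n]
  by (simp add: k_symbol_def divide_nonpos_nonneg mult_nonneg_nonpos)

lemma k_symbol_Im: "Im (k_symbol n z) = 0"
  by (simp add: k_symbol_def)

text \<open>The weight \<open>cosh t cosh (n t)\<close> in the integral for \<open>- K\<^sub>n'\<close> equals \<open>sinh t sinh (n t) + cosh ((n - 1) t)\<close>.
  The first term integrates by parts to \<open>n K\<^sub>n / z\<close>, and the second one is at most
  \<open>cosh (n t)\<close>; here \<open>n \<ge> 1\<close>, since everything is even in \<open>n\<close>.\<close>

lemma deriv_bessel_K_bound: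
  assumes z: "z > 0" and n: "n \<noteq> 0"
  shows "z * \<bar>deriv (bessel_K n) z\<bar> \<le> (\<bar>of_int n\<bar> + z) * bessel_K n z"
proof -
  let ?e = "\<lambda>t. exp (- z * cosh t)" and ?m = "\<bar>of_int n\<bar> :: real"
  have cosh_abs: "cosh (of_int n * t) = cosh (?m * t)" for t :: real
    by (cases "n \<ge> 0") auto
  have gs: "exp_growth (\<lambda>t. z * sinh t * sinh (?m * t))" "exp_growth (\<lambda>t. cosh (?m * t))"
    "exp_growth (\<lambda>t. cosh t * cosh (?m * t))"
    using exp_growth_mult[OF exp_growth_mult[OF exp_growth_const exp_growth_sinh[of 1, simplified]] exp_growth_sinh[of ?m], of z]
      exp_growth_cosh[of ?m] exp_growth_mult[OF exp_growth_cosh[of 1, simplified] exp_growth_cosh[of ?m]] by auto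
  note i = laplace_integrable[OF _ phase_cosh z]
  have FTC: "(LINT t:{0..}|lborel. (z * sinh t * sinh (?m * t)) * ?e t - ?m * (cosh (?m * t) * ?e t)) = 0 - (- (sinh (?m * 0) * ?e 0))"
  proof (rule half_line_FTC)
    show "set_integrable lborel {0..} (\<lambda>t. (z * sinh t * sinh (?m * t)) * ?e t - ?m * (cosh (?m * t) * ?e t))"
      by (intro set_integral_diff(1) set_integrable_mult_right i gs)
    show "((\<lambda>t. - (sinh (?m * t) * ?e t)) has_real_derivative (z * sinh t * sinh (?m * t)) * ?e t - ?m * (cosh (?m * t) * ?e t)) (at t)" for t
      by (auto intro!: derivative_eq_intros simp: algebra_simps)
    show "((\<lambda>t. - (sinh (?m * t) * ?e t)) \<longlongrightarrow> 0) at_top"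
      using tendsto_minus[OF laplace_tendsto_zero[OF exp_growth_sinh[of ?m] phase_cosh z]] by simp
  qed (intro continuous_intros)
  have K_eq: "bessel_K n z = (LINT t:{0..}|lborel. cosh (?m * t) * ?e t)"
    by (simp only: bessel_K_eq cosh_abs)
  have parts: "(LINT t:{0..}|lborel. (z * sinh t * sinh (?m * t)) * ?e t) = ?m * bessel_K n z"
    using FTC
    by (simp only: set_integral_diff(2)[OF i[OF gs(1)] set_integrable_mult_right[OF i[OF gs(2)]]]
        set_integral_mult_right K_eq[symmetric]) simp
  have pointwise: "z * ((cosh t * cosh (?m * t)) * ?e t) \<le> (z * sinh t * sinh (?m * t)) * ?e t + z * (cosh (?m * t) * ?e t)"
    if "t \<ge> 0" for t
  proof -
    have m: "?m \<ge> 1" using n by simp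
    have "cosh (?m * t - t) \<le> cosh (?m * t)"
      using that m mult_right_mono[OF m that] by (intro cosh_real_nonneg_le_iff[THEN iffD2]) (auto simp: algebra_simps)
    then have "cosh t * cosh (?m * t) \<le> sinh t * sinh (?m * t) + cosh (?m * t)"
      by (simp add: cosh_diff mult.commute)
    then have "(z * ?e t) * (cosh t * cosh (?m * t)) \<le> (z * ?e t) * (sinh t * sinh (?m * t) + cosh (?m * t))"
      using z by (intro mult_left_mono) auto
    then show ?thesis by (simp add: algebra_simps)
  qed
  have "z * (LINT t:{0..}|lborel. (cosh t * cosh (?m * t)) * ?e t)
      \<le> (LINT t:{0..}|lborel. (z * sinh t * sinh (?m * t)) * ?e t + z * (cosh (?m * t) * ?e t))"
    unfolding set_integral_mult_right[symmetric]
    by (intro set_integral_mono set_integral_add(1) set_integrable_mult_right i gs) (use pointwise in auto)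
  also have "\<dots> = ?m * bessel_K n z + z * bessel_K n z"
    by (simp only: set_integral_add(2)[OF i[OF gs(1)] set_integrable_mult_right[OF i[OF gs(2)]]]
        set_integral_mult_right parts K_eq[symmetric])
  finally show ?thesis
    using deriv_bessel_K_nonpos[OF z, of n] unfolding bessel_K_derivative[OF z] cosh_abs
    by (simp add: algebra_simps)
qed

proposition k_symbol_bound:
  assumes z: "z > 0"
  obtains C where "C \<ge> 0" "\<And>n. norm (k_symbol n z) \<le> C * (1 + \<bar>of_int n\<bar>)"
proof (rule int_bound_of_cofinite[of 1 "\<lambda>n. norm (k_symbol n z)" "z + 1"])
  fix n :: int assume "int 1 \<le> \<bar>n\<bar>"
  then have n: "n \<noteq> 0" by auto
  show "norm (k_symbol n z) \<le> (z + 1) * (1 + \<bar>of_int n\<bar>)"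
  proof (cases "bessel_K n z = 0")
    case True
    then show ?thesis using z by (simp add: k_symbol_def)
  next
    case False
    then have K: "bessel_K n z > 0" using bessel_K_nonneg[of n z] by simp
    have "norm (k_symbol n z) = z * \<bar>deriv (bessel_K n) z\<bar> / bessel_K n z"
      using z K by (simp add: k_symbol_def norm_divide norm_mult)
    also have "\<dots> \<le> \<bar>of_int n\<bar> + z"
      using deriv_bessel_K_bound[OF z n] K by (simp add: divide_le_eq)
    also have "\<dots> \<le> (z + 1) * (1 + \<bar>of_int n\<bar>)" using z by (simp add: algebra_simps)
    finally show ?thesis .
  qed
qed (use z that in auto)

section \<open>Fourier coefficients on the circle\<close>

text \<open>The closed parameter interval, as in the definition of the Fourier coefficients.\<close>

definition circ :: "real measure" where
  "circ = restrict_space lborel {0..2*pi}"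

lemma circ_integral: "(LINT \<theta>:{0..2*pi}|lborel. f \<theta>) = (LINT \<theta>|circ. f \<theta>)"
  for f :: "real \<Rightarrow> 'a::{banach,second_countable_topology}"
  unfolding circ_def set_lebesgue_integral_def by (subst integral_restrict_space) auto

lemma emeasure_circ: "emeasure circ (space circ) = ennreal (2 * pi)"
  unfolding circ_def by (subst emeasure_restrict_space) (auto simp: space_restrict_space)

lemma finite_measure_circ: "finite_measure circ"
  by (rule finite_measureI) (simp add: emeasure_circ)

lemma circ_measurable: "f \<in> borel_measurable borel \<Longrightarrow> f \<in> borel_measurable circ"
  unfolding circ_def by (intro measurable_restrict_space1) simp

lemma circ_continuous_bounded:
  fixes f :: "real \<Rightarrow> complex"
  assumes "continuous_on UNIV f"
  obtains C where "\<And>x. x \<in> space circ \<Longrightarrow> norm (f x) \<le> C"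
proof -
  have "compact (f ` {0..2*pi})"
    using assms by (intro compact_continuous_image) (auto intro: continuous_on_subset)
  then have "bounded (f ` {0..2*pi})" by (rule compact_imp_bounded)
  then obtain C where "\<forall>y\<in>f ` {0..2*pi}. norm y \<le> C" unfolding bounded_iff by blast
  then show ?thesis using that[of C] by (auto simp: circ_def space_restrict_space)
qed

lemma circ_continuous_L2:
  fixes f :: "real \<Rightarrow> complex"
  assumes "continuous_on UNIV f"
  shows "f \<in> L2 circ"
  using circ_continuous_bounded[OF assms] L2_bounded[OF finite_measure_circ circ_measurable]
    borel_measurable_continuous_onI[OF assms] by metis

lemma circ_integrable_mult_continuous:
  fixes f :: "real \<Rightarrow> complex"
  assumes "integrable circ f" "continuous_on UNIV h"
  shows "integrable circ (\<lambda>x. f x * h x)"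
proof -
  obtain C where C: "\<And>x. x \<in> space circ \<Longrightarrow> norm (h x) \<le> C"
    using circ_continuous_bounded[OF assms(2)] by blast
  show ?thesis
  proof (rule Bochner_Integration.integrable_bound)
    show "integrable circ (\<lambda>x. C * norm (f x))" using assms by simp
    show "(\<lambda>x. f x * h x) \<in> borel_measurable circ"
      using borel_measurable_integrable[OF assms(1)] circ_measurable[OF borel_measurable_continuous_onI[OF assms(2)]]
      by (rule borel_measurable_times)
    show "AE x in circ. norm (f x * h x) \<le> norm (C * norm (f x))"
    proof (rule AE_I2)
      fix x assume "x \<in> space circ"
      from C[OF this] have "norm (f x) * norm (h x) \<le> norm (f x) * C" by (intro mult_left_mono) auto
      then show "norm (f x * h x) \<le> norm (C * norm (f x))"
        using abs_ge_self[of "C * norm (f x)"] by (simp add: norm_mult mult.commute)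
    qed
  qed
qed

lemma integral_cis: "(LINT \<theta>|circ. cis (of_int n * \<theta>)) = (if n = 0 then 2 * pi else 0)"
proof (cases "n = 0")
  case True
  then show ?thesis
    using emeasure_circ by (simp add: measure_def scaleR_conv_of_real)
next
  case False
  have "((\<lambda>\<theta>. cis (of_int n * \<theta>)) has_integral (cis (of_int n * (2*pi)) / (\<i> * of_int n) - cis (of_int n * 0) / (\<i> * of_int n))) {0..2*pi}"
  proof (rule fundamental_theorem_of_calculus)
    fix x :: real
    have "((\<lambda>z. exp (\<i> * of_int n * z) / (\<i> * of_int n)) has_field_derivative exp (\<i> * of_int n * of_real x)) (at (of_real x))"
      using False by (auto intro!: derivative_eq_intros)
    from has_vector_derivative_real_field[OF this, of "{0..2*pi}"]
    have "((\<lambda>\<theta>. exp (\<i> * of_int n * of_real \<theta>) / (\<i> * of_int n)) has_vector_derivative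
        exp (\<i> * of_int n * of_real x)) (at x within {0..2*pi})" .
    then show "((\<lambda>\<theta>. cis (of_int n * \<theta>) / (\<i> * of_int n)) has_vector_derivative cis (of_int n * x)) (at x within {0..2*pi})"
      by (simp add: cis_conv_exp mult.assoc)
  qed simp
  moreover have "cis (of_int n * (2*pi)) = 1"
    using cis_multiple_2pi[of "of_int n"] by (simp add: mult.commute)
  ultimately have "integral {0..2*pi} (\<lambda>\<theta>. cis (of_int n * \<theta>)) = 0"
    by (simp add: integral_unique)
  moreover have "set_integrable lborel {0..2*pi} (\<lambda>\<theta>. cis (of_int n * \<theta>))"
    by (intro borel_integrable_atLeastAtMost' continuous_intros)
  ultimately have "(LINT \<theta>:{0..2*pi}|lborel. cis (of_int n * \<theta>)) = 0"
    using set_borel_integral_eq_integral(2) by metis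
  then show ?thesis using False by (simp add: circ_integral)
qed

definition circ_coeff :: "(real \<Rightarrow> complex) \<Rightarrow> int \<Rightarrow> complex" where
  "circ_coeff G n = 1 / (2*pi) * (LINT \<theta>|circ. G \<theta> * cis (- of_int n * \<theta>))"

lemma fourier_coeff_eq: "fourier_coeff R \<phi> n = circ_coeff (\<lambda>\<theta>. \<phi> (polar R \<theta>)) n"
  by (simp add: fourier_coeff_def circ_coeff_def circ_integral)

lemma integral_trig_polynomial:
  fixes c :: "int \<Rightarrow> complex"
  assumes "finite F"
  shows "(LINT \<theta>|circ. (norm (\<Sum>n\<in>F. c n * cis (of_int n * \<theta>)))\<^sup>2) = 2 * pi * (\<Sum>n\<in>F. (norm (c n))\<^sup>2)"
proof -
  have i: "integrable circ (\<lambda>\<theta>. c m * cnj (c n) * cis (of_int (m - n) * \<theta>))" for m n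
    by (intro L2_integrable[OF finite_measure_circ] circ_continuous_L2 continuous_intros)
  have "of_real ((norm (\<Sum>n\<in>F. c n * cis (of_int n * \<theta>)))\<^sup>2)
      = (\<Sum>m\<in>F. \<Sum>n\<in>F. c m * cnj (c n) * cis (of_int (m - n) * \<theta>))" for \<theta>
  proof -
    have "cis (of_int m * \<theta>) * cnj (cis (of_int n * \<theta>)) = cis (of_int (m - n) * \<theta>)" for m n
      by (simp add: cis_cnj cis_mult algebra_simps)
    then have "c m * cis (of_int m * \<theta>) * cnj (c n * cis (of_int n * \<theta>)) = c m * cnj (c n) * cis (of_int (m - n) * \<theta>)" for m n
      by (simp add: mult_ac)
    then show ?thesis unfolding complex_norm_square cnj_sum sum_product by (intro sum.cong refl)
  qed
  then have "complex_of_real (LINT \<theta>|circ. (norm (\<Sum>n\<in>F. c n * cis (of_int n * \<theta>)))\<^sup>2)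
     = (LINT \<theta>|circ. (\<Sum>m\<in>F. \<Sum>n\<in>F. c m * cnj (c n) * cis (of_int (m - n) * \<theta>)))"
    unfolding integral_complex_of_real[symmetric] by simp
  also have "\<dots> = (\<Sum>m\<in>F. \<Sum>n\<in>F. c m * cnj (c n) * (LINT \<theta>|circ. cis (of_int (m - n) * \<theta>)))"
    using i by (simp add: Bochner_Integration.integral_sum)
  also have "\<dots> = (\<Sum>m\<in>F. c m * cnj (c m) * (2 * pi))"
    unfolding integral_cis using assms by (intro sum.cong refl) (simp add: if_distrib cong: if_cong)
  also have "\<dots> = of_real (2 * pi * (\<Sum>n\<in>F. (norm (c n))\<^sup>2))"
    by (simp add: sum_distrib_left complex_norm_square[symmetric] mult.commute)
  finally show ?thesis by (simp only: of_real_eq_iff)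
qed

lemma bessel_inequality:
  assumes G: "G \<in> L2 circ" and F: "finite F"
  shows "2 * pi * (\<Sum>n\<in>F. (norm (circ_coeff G n))\<^sup>2) \<le> (LINT \<theta>|circ. (norm (G \<theta>))\<^sup>2)"
proof -
  define P where "P \<theta> = (\<Sum>n\<in>F. circ_coeff G n * cis (of_int n * \<theta>))" for \<theta>
  define S where "S = (\<Sum>n\<in>F. (norm (circ_coeff G n))\<^sup>2)"
  have P: "P \<in> L2 circ" unfolding P_def[abs_def] by (intro circ_continuous_L2 continuous_intros)
  have GP: "integrable circ (\<lambda>\<theta>. G \<theta> * cnj (P \<theta>))" by (intro L2_mult_integrable L2_cnj G P)
  have "(LINT \<theta>|circ. G \<theta> * cnj (P \<theta>)) = (\<Sum>n\<in>F. cnj (circ_coeff G n) * (LINT \<theta>|circ. G \<theta> * cis (- of_int n * \<theta>)))"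
  proof -
    have "G \<theta> * cnj (P \<theta>) = (\<Sum>n\<in>F. cnj (circ_coeff G n) * (G \<theta> * cis (- of_int n * \<theta>)))" for \<theta>
      by (simp add: P_def cnj_sum sum_distrib_left cis_cnj mult_ac)
    moreover have "integrable circ (\<lambda>\<theta>. G \<theta> * cis (- of_int n * \<theta>))" for n
      by (intro L2_mult_integrable G circ_continuous_L2 continuous_intros)
    ultimately show ?thesis by (simp add: Bochner_Integration.integral_sum)
  qed
  also have "\<dots> = (\<Sum>n\<in>F. of_real (2 * pi * (norm (circ_coeff G n))\<^sup>2))"
  proof (intro sum.cong refl)
    fix n
    have "(LINT \<theta>|circ. G \<theta> * cis (- of_int n * \<theta>)) = 2 * pi * circ_coeff G n" by (simp add: circ_coeff_def)
    then show "cnj (circ_coeff G n) * (LINT \<theta>|circ. G \<theta> * cis (- of_int n * \<theta>)) = of_real (2 * pi * (norm (circ_coeff G n))\<^sup>2)"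
      using complex_norm_square[of "circ_coeff G n"] by (simp add: mult_ac)
  qed
  also have "\<dots> = of_real (2 * pi * S)" by (simp add: S_def sum_distrib_left)
  finally have "Re (LINT \<theta>|circ. G \<theta> * cnj (P \<theta>)) = 2 * pi * S" by simp
  then have Re: "(LINT \<theta>|circ. Re (G \<theta> * cnj (P \<theta>))) = 2 * pi * S"
    using integral_Re[OF GP] by (simp only:)
  have sq: "(norm (G \<theta> - P \<theta>))\<^sup>2 = (norm (G \<theta>))\<^sup>2 - 2 * Re (G \<theta> * cnj (P \<theta>)) + (norm (P \<theta>))\<^sup>2" for \<theta>
    unfolding cmod_power2 by (simp add: power2_eq_square algebra_simps)
  have i: "integrable circ (\<lambda>\<theta>. (norm (G \<theta>))\<^sup>2)" "integrable circ (\<lambda>\<theta>. (norm (P \<theta>))\<^sup>2)"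
    "integrable circ (\<lambda>\<theta>. Re (G \<theta> * cnj (P \<theta>)))"
    using G P integrable_Re[OF GP] by (simp_all only: L2_iff)
  have "0 \<le> (LINT \<theta>|circ. (norm (G \<theta> - P \<theta>))\<^sup>2)" by simp
  also have "\<dots> = (LINT \<theta>|circ. (norm (G \<theta>))\<^sup>2) - 2 * (2 * pi * S) + (LINT \<theta>|circ. (norm (P \<theta>))\<^sup>2)"
    unfolding sq Re[symmetric]
    by (simp only: Bochner_Integration.integral_add[OF Bochner_Integration.integrable_diff[OF i(1) integrable_mult_right[OF i(3)]] i(2)]
        Bochner_Integration.integral_diff[OF i(1) integrable_mult_right[OF i(3)]] Bochner_Integration.integral_mult_right_zero)
  also have "(LINT \<theta>|circ. (norm (P \<theta>))\<^sup>2) = 2 * pi * S"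
    unfolding P_def S_def by (rule integral_trig_polynomial[OF F])
  finally show ?thesis by (simp add: S_def)
qed

text \<open>Multiplication by \<open>cos \<theta>\<close> or \<open>sin \<theta>\<close> only shifts the Fourier coefficients of \<open>G\<close>; if all of
  them vanish, they still do after multiplication by any polynomial in the two coordinates.\<close>

lemma zero_coefficients_annihilate_polynomials:
  assumes G: "integrable circ G" and zero: "\<And>n. circ_coeff G n = 0" and p: "real_polynomial_function p"
  shows "(LINT \<theta>|circ. G \<theta> * of_real (p (polar R \<theta>))) = 0"
proof -
  define P :: "(real \<Rightarrow> complex) \<Rightarrow> bool" where
    "P h \<longleftrightarrow> continuous_on UNIV h \<and> (\<forall>n. (LINT \<theta>|circ. G \<theta> * (h \<theta> * cis (of_int n * \<theta>))) = 0)" for h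
  have i: "integrable circ (\<lambda>\<theta>. G \<theta> * (h \<theta> * cis (of_int n * \<theta>)))" if "continuous_on UNIV h" for h n
    using that by (intro circ_integrable_mult_continuous G continuous_intros)
  have add: "P (\<lambda>\<theta>. h \<theta> + k \<theta>)" if "P h" "P k" for h k
    using that i[of h] i[of k] by (auto simp: P_def distrib_left distrib_right intro!: continuous_intros)
  have scale: "P (\<lambda>\<theta>. h \<theta> * c)" if "P h" for h c
  proof -
    have "(LINT \<theta>|circ. G \<theta> * (h \<theta> * c * cis (of_int n * \<theta>))) = (LINT \<theta>|circ. G \<theta> * (h \<theta> * cis (of_int n * \<theta>)) * c)" for n
      by (intro Bochner_Integration.integral_cong) (simp_all add: mult_ac)
    then show ?thesis using that unfolding P_def
      by (simp add: continuous_intros)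
  qed
  have cis: "P (\<lambda>\<theta>. h \<theta> * cis (of_int m * \<theta>))" if "P h" for h m
  proof -
    have "h \<theta> * cis (of_int m * \<theta>) * cis (of_int n * \<theta>) = h \<theta> * cis (of_int (m + n) * \<theta>)" for \<theta> n
      by (simp add: mult.assoc cis_mult algebra_simps)
    then show ?thesis using that unfolding P_def by (simp only:) (intro conjI continuous_intros; blast)
  qed
  have multiplier: "P (\<lambda>\<theta>. h \<theta> * of_real (p (polar R \<theta>)))" if "P h" for h
    using p that
  proof (induction p arbitrary: h rule: real_polynomial_function.induct)
    case (linear f)
    define a b where "a = f (polar R 0)" and "b = f (polar R (pi/2))"
    have "f (polar R \<theta>) = cos \<theta> * a + sin \<theta> * b" for \<theta>
    proof -
      have "polar R \<theta> = cos \<theta> *\<^sub>R polar R 0 + sin \<theta> *\<^sub>R polar R (pi/2)"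
        by (simp add: polar_def vec_eq_iff forall_2)
      then show ?thesis using linear by (simp add: linear_simps a_def b_def)
    qed
    moreover have "of_real (cos \<theta>) = (cis (of_int 1 * \<theta>) + cis (of_int (-1) * \<theta>)) * (1/2)"
      "of_real (sin \<theta>) = (cis (of_int 1 * \<theta>) + cis (of_int (-1) * \<theta>) * (-1)) * (- \<i> / 2)" for \<theta>
      by (simp_all add: complex_eq_iff)
    moreover have "u * ((x + y) * (1/2) * a + (x + y * (-1)) * (- \<i> / 2) * b)
        = (u * x + u * y) * (a / 2) + (u * x + u * y * (-1)) * (- \<i> / 2 * b)" for u x y a b :: complex
      by (simp add: field_simps)
    ultimately have "(\<lambda>\<theta>. h \<theta> * of_real (f (polar R \<theta>)))
        = (\<lambda>\<theta>. (h \<theta> * cis (of_int 1 * \<theta>) + h \<theta> * cis (of_int (-1) * \<theta>)) * (of_real a / 2)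
          + (h \<theta> * cis (of_int 1 * \<theta>) + h \<theta> * cis (of_int (-1) * \<theta>) * (-1)) * (- \<i> / 2 * of_real b))"
      by (simp only: of_real_add of_real_mult)
    moreover have "P (\<lambda>\<theta>. (h \<theta> * cis (of_int 1 * \<theta>) + h \<theta> * cis (of_int (-1) * \<theta>)) * (of_real a / 2)
          + (h \<theta> * cis (of_int 1 * \<theta>) + h \<theta> * cis (of_int (-1) * \<theta>) * (-1)) * (- \<i> / 2 * of_real b))"
      by (intro add scale cis linear.prems)
    ultimately show ?case by (simp only:)
  next
    case (const c)
    then show ?case by (rule scale)
  next
    case (add f g)
    then show ?case using assms add.IH[OF add.prems] by (simp add: distrib_left \<open>\<And>k h. P h \<Longrightarrow> P k \<Longrightarrow> P (\<lambda>\<theta>. h \<theta> + k \<theta>)\<close>)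
  next
    case (mult f g)
    have "P (\<lambda>\<theta>. h \<theta> * of_real (f (polar R \<theta>)) * of_real (g (polar R \<theta>)))"
      by (intro mult.IH mult.prems)
    then show ?case by (simp add: mult.assoc)
  qed
  have "P (\<lambda>_. 1)"
    unfolding P_def
  proof (intro conjI allI)
    fix n
    show "(LINT \<theta>|circ. G \<theta> * (1 * cis (of_int n * \<theta>))) = 0"
      using zero[of "- n"] by (simp add: circ_coeff_def)
  qed simp
  from multiplier[OF this] show ?thesis unfolding P_def by (auto dest: spec[of _ 0])
qed

lemma norm_polar: "R \<ge> 0 \<Longrightarrow> norm (polar R \<theta>) = R"
proof -
  assume "R \<ge> 0"
  have "(norm (polar R \<theta>))\<^sup>2 = (R * cos \<theta>)\<^sup>2 + (R * sin \<theta>)\<^sup>2"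
    unfolding power2_norm_eq_inner inner_vec_def polar_def by (simp add: sum_2 power2_eq_square)
  then have "(norm (polar R \<theta>))\<^sup>2 = R\<^sup>2" by (simp add: power_mult_distrib flip: distrib_left)
  then show ?thesis using \<open>R \<ge> 0\<close> by (simp add: power2_eq_iff_nonneg)
qed

lemma polar_axis: "polar R \<theta> = (R * cos \<theta>) *\<^sub>R axis 1 1 + (R * sin \<theta>) *\<^sub>R axis 2 1"
  by (simp add: polar_def vec_eq_iff forall_2 axis_def)

lemma continuous_polar [continuous_intros]: "continuous_on S f \<Longrightarrow> continuous_on S (\<lambda>x. polar R (f x))"
  for f :: "'a::t2_space \<Rightarrow> real"
  unfolding polar_axis by (auto intro!: continuous_intros)

lemma continuous_polynomial_polar:
  assumes "real_polynomial_function f"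
  shows "continuous_on UNIV (\<lambda>\<theta>. f (polar R \<theta>))"
proof -
  have "continuous_on UNIV f"
    using assms unfolding real_polynomial_function_eq by (rule continuous_on_polymonial_function)
  moreover have "continuous_on UNIV (polar R)"
    using continuous_polar[OF continuous_on_id] by simp
  ultimately show ?thesis by (rule continuous_on_compose2) simp
qed

text \<open>Polynomials are dense in the continuous functions on the circle by the Stone--Weierstrass
  theorem.\<close>

proposition zero_coefficients_annihilate_continuous:
  fixes \<psi> :: "real^2 \<Rightarrow> complex"
  assumes R: "R \<ge> 0" and G: "integrable circ G" and zero: "\<And>n. circ_coeff G n = 0"
    and \<psi>: "continuous_on (sphere 0 R) \<psi>"
  shows "(LINT \<theta>|circ. G \<theta> * \<psi> (polar R \<theta>)) = 0"
proof -
  have polar_in: "polar R \<theta> \<in> sphere 0 R" for \<theta> using R by (simp add: norm_polar)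
  have c: "continuous_on UNIV (\<lambda>\<theta>. \<psi> (polar R \<theta>))"
    by (rule continuous_on_compose2[OF \<psi>]) (use polar_in in \<open>auto intro!: continuous_intros\<close>)
  have bound: "norm (LINT \<theta>|circ. G \<theta> * \<psi> (polar R \<theta>)) \<le> (LINT \<theta>|circ. norm (G \<theta>)) * e" if e: "e > 0" for e
  proof -
    have e2: "e/2 > 0" using e by simp
    obtain f where f: "real_polynomial_function f" "\<And>x. x \<in> sphere 0 R \<Longrightarrow> \<bar>Re (\<psi> x) - f x\<bar> < e/2"
      using Stone_Weierstrass_real_polynomial_function[OF compact_sphere _ e2, of 0 R "\<lambda>x. Re (\<psi> x)"] \<psi>
      by (auto intro!: continuous_intros)
    obtain g where g: "real_polynomial_function g" "\<And>x. x \<in> sphere 0 R \<Longrightarrow> \<bar>Im (\<psi> x) - g x\<bar> < e/2"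
      using Stone_Weierstrass_real_polynomial_function[OF compact_sphere _ e2, of 0 R "\<lambda>x. Im (\<psi> x)"] \<psi>
      by (auto intro!: continuous_intros)
    define h where "h x = complex_of_real (f x) + \<i> * of_real (g x)" for x
    have fg: "continuous_on UNIV (\<lambda>\<theta>. complex_of_real (f (polar R \<theta>)))" "continuous_on UNIV (\<lambda>\<theta>. complex_of_real (g (polar R \<theta>)))"
      by (intro continuous_on_of_real continuous_polynomial_polar f(1) g(1))+
    have ifg: "integrable circ (\<lambda>\<theta>. G \<theta> * of_real (f (polar R \<theta>)))" "integrable circ (\<lambda>\<theta>. G \<theta> * of_real (g (polar R \<theta>)) * \<i>)"
      using circ_integrable_mult_continuous[OF G fg(1)] circ_integrable_mult_continuous[OF G fg(2)] by auto
    have "(LINT \<theta>|circ. G \<theta> * h (polar R \<theta>))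
       = (LINT \<theta>|circ. G \<theta> * of_real (f (polar R \<theta>)) + G \<theta> * of_real (g (polar R \<theta>)) * \<i>)"
      by (simp add: h_def algebra_simps)
    also have "\<dots> = 0"
      using zero_coefficients_annihilate_polynomials[OF G zero f(1)] zero_coefficients_annihilate_polynomials[OF G zero g(1)]
      by (subst Bochner_Integration.integral_add[OF ifg]) simp
    finally have h0: "(LINT \<theta>|circ. G \<theta> * h (polar R \<theta>)) = 0" .
    have hc: "continuous_on UNIV (\<lambda>\<theta>. h (polar R \<theta>))" unfolding h_def by (intro continuous_intros fg)
    have "(LINT \<theta>|circ. G \<theta> * \<psi> (polar R \<theta>)) = (LINT \<theta>|circ. G \<theta> * (\<psi> (polar R \<theta>) - h (polar R \<theta>)))"
      using h0 circ_integrable_mult_continuous[OF G c] circ_integrable_mult_continuous[OF G hc]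
      by (simp add: right_diff_distrib)
    also have "norm \<dots> \<le> (LINT \<theta>|circ. norm (G \<theta>) * e)"
    proof (rule Bochner_Integration.integral_norm_bound_integral)
      show "integrable circ (\<lambda>\<theta>. G \<theta> * (\<psi> (polar R \<theta>) - h (polar R \<theta>)))"
        by (intro circ_integrable_mult_continuous G continuous_intros c hc)
      show "integrable circ (\<lambda>\<theta>. norm (G \<theta>) * e)" using G by simp
      fix \<theta>
      have "norm (\<psi> (polar R \<theta>) - h (polar R \<theta>)) \<le> \<bar>Re (\<psi> (polar R \<theta>) - h (polar R \<theta>))\<bar> + \<bar>Im (\<psi> (polar R \<theta>) - h (polar R \<theta>))\<bar>"
        by (rule cmod_le)
      also have "\<dots> \<le> e" using f(2)[OF polar_in[of \<theta>]] g(2)[OF polar_in[of \<theta>]] by (simp add: h_def)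
      finally show "norm (G \<theta> * (\<psi> (polar R \<theta>) - h (polar R \<theta>))) \<le> norm (G \<theta>) * e"
        by (simp add: norm_mult mult_left_mono)
    qed
    finally show ?thesis by simp
  qed
  have "norm (LINT \<theta>|circ. G \<theta> * \<psi> (polar R \<theta>)) \<le> 0"
  proof (rule field_le_epsilon)
    fix e :: real assume e: "e > 0"
    define I where "I = (LINT \<theta>|circ. norm (G \<theta>))"
    have I: "I \<ge> 0" by (simp add: I_def)
    have "norm (LINT \<theta>|circ. G \<theta> * \<psi> (polar R \<theta>)) \<le> I * (e / (I + 1))"
      using bound[of "e / (I + 1)"] e I by (simp add: I_def add_nonneg_pos)
    also have "\<dots> \<le> 0 + e" using e I by (simp add: field_simps)
    finally show "norm (LINT \<theta>|circ. G \<theta> * \<psi> (polar R \<theta>)) \<le> 0 + e" .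
  qed
  then show ?thesis by simp
qed

section \<open>The Slobodeckij norm on the circle\<close>

lemma circ_space_sets: "space circ = {0..2*pi}" "sets circ = sets (restrict_space borel {0..2*pi})"
  unfolding circ_def by (auto simp: space_restrict_space intro!: sets_restrict_space_cong)

text \<open>Arc length is defined through the half-open interval, the Fourier coefficients through the closed
  one; the common endpoint is a null set.\<close>

lemma nn_integral_circ:
  fixes f :: "real \<Rightarrow> ennreal"
  shows "(\<integral>\<^sup>+x. f x \<partial>circ) = (\<integral>\<^sup>+x. f x * indicator {0..<2*pi} x \<partial>lborel)"
proof -
  have "(\<integral>\<^sup>+x. f x \<partial>circ) = (\<integral>\<^sup>+x. f x * indicator {0..2*pi} x \<partial>lborel)"
    unfolding circ_def by (subst nn_integral_restrict_space) auto
  also have "\<dots> = (\<integral>\<^sup>+x. f x * indicator {0..<2*pi} x \<partial>lborel)"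
    by (rule nn_integral_cong_AE) (use AE_lborel_singleton[of "2*pi"] in \<open>eventually_elim, auto simp: indicator_def\<close>)
  finally show ?thesis .
qed

lemma integral_circ:
  fixes f :: "real \<Rightarrow> complex"
  assumes "f \<in> borel_measurable borel"
  shows "(LINT x|circ. f x) = (LINT x:{0..<2*pi}|lborel. f x)"
  unfolding circ_integral[symmetric] set_lebesgue_integral_def
proof (rule integral_cong_AE)
  show "AE x in lborel. indicator {0..2*pi} x *\<^sub>R f x = indicator {0..<2*pi} x *\<^sub>R f x"
    using AE_lborel_singleton[of "2*pi"] by eventually_elim (auto simp: indicator_def)
qed (use assms in measurable)

lemma nn_integral_circ_shift:
  fixes f :: "real \<Rightarrow> ennreal"
  assumes [measurable]: "f \<in> borel_measurable borel" and per: "\<And>x. f (x + 2*pi) = f x"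
    and s: "0 \<le> s" "s \<le> 2*pi"
  shows "(\<integral>\<^sup>+x. f (x + s) \<partial>circ) = (\<integral>\<^sup>+x. f x \<partial>circ)"
proof -
  have "(\<integral>\<^sup>+x. f (x + s) \<partial>circ) = (\<integral>\<^sup>+x. f (s + 1 * x) * indicator {s..<2*pi + s} (s + 1 * x) \<partial>lborel)"
    unfolding nn_integral_circ by (intro nn_integral_cong) (auto simp: indicator_def add.commute)
  also have "\<dots> = (\<integral>\<^sup>+x. f x * indicator {s..<2*pi + s} x \<partial>lborel)"
    using nn_integral_real_affine[of "\<lambda>x. f x * indicator {s..<2*pi + s} x" 1 s] by simp
  also have "\<dots> = (\<integral>\<^sup>+x. f x * indicator {s..<2*pi} x + f x * indicator {2*pi..<2*pi + s} x \<partial>lborel)"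
    using s by (intro nn_integral_cong) (auto simp: indicator_def)
  also have "\<dots> = (\<integral>\<^sup>+x. f x * indicator {s..<2*pi} x \<partial>lborel) + (\<integral>\<^sup>+x. f x * indicator {2*pi..<2*pi + s} x \<partial>lborel)"
    by (rule nn_integral_add) measurable
  also have "(\<integral>\<^sup>+x. f x * indicator {2*pi..<2*pi + s} x \<partial>lborel)
      = (\<integral>\<^sup>+x. f (2*pi + 1 * x) * indicator {2*pi..<2*pi + s} (2*pi + 1 * x) \<partial>lborel)"
    using nn_integral_real_affine[of "\<lambda>x. f x * indicator {2*pi..<2*pi + s} x" 1 "2*pi"] by simp
  also have "\<dots> = (\<integral>\<^sup>+x. f x * indicator {0..<s} x \<partial>lborel)"
    using per by (intro nn_integral_cong) (auto simp: indicator_def add.commute)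
  also have "(\<integral>\<^sup>+x. f x * indicator {s..<2*pi} x \<partial>lborel) + (\<integral>\<^sup>+x. f x * indicator {0..<s} x \<partial>lborel)
      = (\<integral>\<^sup>+x. f x * indicator {s..<2*pi} x + f x * indicator {0..<s} x \<partial>lborel)"
    by (rule nn_integral_add[symmetric]) measurable
  also have "\<dots> = (\<integral>\<^sup>+x. f x \<partial>circ)"
    unfolding nn_integral_circ using s by (intro nn_integral_cong) (auto simp: indicator_def)
  finally show ?thesis .
qed

lemma integral_circ_shift:
  fixes f :: "real \<Rightarrow> complex"
  assumes [measurable]: "f \<in> borel_measurable borel" and per: "\<And>x. f (x + 2*pi) = f x"
    and int: "integrable circ f" and s: "0 \<le> s" "s \<le> 2*pi"
  shows "(LINT x|circ. f (x + s)) = (LINT x|circ. f x)"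
proof -
  have "integrable lborel (\<lambda>x. indicator {0..2*pi} x *\<^sub>R f x)"
    using int unfolding circ_def by (subst (asm) integrable_restrict_space) auto
  then have set_int: "set_integrable lborel {0..2*pi} f" by (simp add: set_integrable_def)
  have i1: "set_integrable lborel {s..<2*pi} f" "set_integrable lborel {0..<s} f"
    using s by (auto intro: set_integrable_subset[OF set_int])
  have shift: "indicator {0..<s} x *\<^sub>R f x = indicator {2*pi..<2*pi + s} (2*pi + 1 * x) *\<^sub>R f (2*pi + 1 * x)" for x
    using per[of x] by (auto simp: indicator_def add.commute)
  have i2: "set_integrable lborel {2*pi..<2*pi + s} f"
    using i1(2) lborel_integrable_real_affine_iff[of 1 "\<lambda>x. indicator {2*pi..<2*pi + s} x *\<^sub>R f x" "2*pi"]
    unfolding set_integrable_def shift by simp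
  have "(LINT x|circ. f (x + s)) = (LINT x|lborel. indicator {s..<2*pi + s} (s + 1 * x) *\<^sub>R f (s + 1 * x))"
    by (subst integral_circ, measurable, unfold set_lebesgue_integral_def,
        intro Bochner_Integration.integral_cong) (auto simp: indicator_def add.commute)
  also have "\<dots> = (LINT x:{s..<2*pi + s}|lborel. f x)"
    using lborel_integral_real_affine[of 1 "\<lambda>x. indicator {s..<2*pi + s} x *\<^sub>R f x" s]
    by (simp add: set_lebesgue_integral_def)
  also have "{s..<2*pi + s} = {s..<2*pi} \<union> {2*pi..<2*pi + s}" using s by auto
  also have "(LINT x:{s..<2*pi} \<union> {2*pi..<2*pi + s}|lborel. f x) = (LINT x:{s..<2*pi}|lborel. f x) + (LINT x:{2*pi..<2*pi + s}|lborel. f x)"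
    by (intro set_integral_Un i1 i2) auto
  also have "(LINT x:{2*pi..<2*pi + s}|lborel. f x) = (LINT x:{0..<s}|lborel. f x)"
    using lborel_integral_real_affine[of 1 "\<lambda>x. indicator {2*pi..<2*pi + s} x *\<^sub>R f x" "2*pi"]
    unfolding set_lebesgue_integral_def shift by simp
  also have "(LINT x:{s..<2*pi}|lborel. f x) + (LINT x:{0..<s}|lborel. f x) = (LINT x:{s..<2*pi} \<union> {0..<s}|lborel. f x)"
    by (intro set_integral_Un[symmetric] i1) auto
  also have "{s..<2*pi} \<union> {0..<s} = {0..<2*pi}" using s by auto
  also have "(LINT x:{0..<2*pi}|lborel. f x) = (LINT x|circ. f x)" by (simp add: integral_circ)
  finally show ?thesis .
qed

lemma cis_int_periodic: "cis (of_int n * (x + 2*pi)) = cis (of_int n * x)"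
proof -
  have "cis (of_int n * (x + 2*pi)) = cis (of_int n * x) * cis (2 * pi * of_int n)"
    by (simp add: cis_mult algebra_simps)
  then show ?thesis using cis_multiple_2pi[of "of_int n"] by simp
qed

lemma circ_coeff_shift:
  assumes [measurable]: "G \<in> borel_measurable borel" and G: "G \<in> L2 circ" and per: "\<And>x. G (x + 2*pi) = G x"
    and s: "0 \<le> s" "s \<le> 2*pi"
  shows "circ_coeff (\<lambda>x. G (x + s)) n = cis (of_int n * s) * circ_coeff G n"
proof -
  have [measurable]: "(\<lambda>x. cis (- of_int n * x)) \<in> borel_measurable borel"
    by (intro borel_measurable_continuous_onI continuous_intros)
  have "(LINT x|circ. G (x + s) * cis (- of_int n * (x + s))) = (LINT x|circ. G x * cis (- of_int n * x))"
  proof (rule integral_circ_shift[where f="\<lambda>x. G x * cis (- of_int n * x)"])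
    show "integrable circ (\<lambda>x. G x * cis (- of_int n * x))"
      by (intro L2_mult_integrable G circ_continuous_L2 continuous_intros)
    show "G (x + 2*pi) * cis (- of_int n * (x + 2*pi)) = G x * cis (- of_int n * x)" for x
      using cis_int_periodic[of "- n" x] per by simp
    show "(\<lambda>x. G x * cis (- of_int n * x)) \<in> borel_measurable borel" by measurable
  qed (use s in auto)
  moreover have "G (x + s) * cis (- of_int n * x) = cis (of_int n * s) * (G (x + s) * cis (- of_int n * (x + s)))" for x
    by (simp add: cis_mult algebra_simps flip: cis_mult[of "of_int n * s"])
  then have "(LINT x|circ. G (x + s) * cis (- of_int n * x))
      = cis (of_int n * s) * (LINT x|circ. G (x + s) * cis (- of_int n * (x + s)))"
    by (simp only: Bochner_Integration.integral_mult_right_zero)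
  ultimately show ?thesis by (simp add: circ_coeff_def)
qed

lemma L2_circ_shift:
  fixes G :: "real \<Rightarrow> complex"
  assumes [measurable]: "G \<in> borel_measurable borel" and G: "G \<in> L2 circ" and per: "\<And>x. G (x + 2*pi) = G x"
    and s: "0 \<le> s" "s \<le> 2*pi"
  shows "(\<lambda>x. G (x + s)) \<in> L2 circ"
proof -
  have "(\<integral>\<^sup>+x. ennreal ((norm (G (x + s)))\<^sup>2) \<partial>circ) = (\<integral>\<^sup>+x. ennreal ((norm (G x))\<^sup>2) \<partial>circ)"
    using per s by (intro nn_integral_circ_shift[where f="\<lambda>x. ennreal ((norm (G x))\<^sup>2)"]) auto
  then show ?thesis using G by (auto simp: L2_def intro!: circ_measurable)
qed

lemma shifted_difference_bound:
  assumes [measurable]: "G \<in> borel_measurable borel" and G: "G \<in> L2 circ" and per: "\<And>x. G (x + 2*pi) = G x"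
    and s: "0 \<le> s" "s \<le> 2*pi" and F: "finite F"
  shows "ennreal (2 * pi * (\<Sum>n\<in>F. (norm (circ_coeff G n))\<^sup>2 * (norm (cis (of_int n * s) - 1))\<^sup>2))
     \<le> (\<integral>\<^sup>+x. ennreal ((norm (G (x + s) - G x))\<^sup>2) \<partial>circ)"
proof -
  have Gs: "(\<lambda>x. G (x + s)) \<in> L2 circ" by (rule L2_circ_shift) (use assms in auto)
  have D: "(\<lambda>x. G (x + s) - G x) \<in> L2 circ" by (rule L2_diff[OF Gs G])
  have "circ_coeff (\<lambda>x. G (x + s) - G x) n = circ_coeff (\<lambda>x. G (x + s)) n - circ_coeff G n" for n
  proof -
    have "integrable circ (\<lambda>x. G (x + s) * cis (- of_int n * x))" "integrable circ (\<lambda>x. G x * cis (- of_int n * x))"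
      by (intro L2_mult_integrable G Gs circ_continuous_L2 continuous_intros)+
    then show ?thesis by (simp add: circ_coeff_def left_diff_distrib right_diff_distrib diff_divide_distrib)
  qed
  then have c: "circ_coeff (\<lambda>x. G (x + s) - G x) n = circ_coeff G n * (cis (of_int n * s) - 1)" for n
    using circ_coeff_shift[OF assms(1) G per s] by (simp add: algebra_simps)
  have "2 * pi * (\<Sum>n\<in>F. (norm (circ_coeff G n))\<^sup>2 * (norm (cis (of_int n * s) - 1))\<^sup>2)
      \<le> (LINT x|circ. (norm (G (x + s) - G x))\<^sup>2)"
    using bessel_inequality[OF D F] by (simp add: c norm_mult power_mult_distrib)
  then show ?thesis
    using D by (subst nn_integral_eq_integral) (auto simp: L2_iff intro: ennreal_leI)
qed

text \<open>The factors \<open>1\<close> make the geometric sum an instance of \<open>integral_trig_polynomial\<close>.\<close>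

lemma geometric_cis:
  "norm (cis (of_int n * s) - 1) = norm (cis s - 1) * norm (\<Sum>k\<in>{0..<\<bar>n\<bar>}. 1 * cis (of_int k * s))"
proof -
  have nat: "cis (of_nat m * s) - 1 = (cis s - 1) * (\<Sum>k\<in>{0..<int m}. 1 * cis (of_int k * s))" for m
  proof (induction m)
    case (Suc m)
    have "{0..<int (Suc m)} = insert (int m) {0..<int m}" by auto
    moreover have "cis (of_nat (Suc m) * s) = cis s * cis (of_nat m * s)" by (simp add: cis_mult algebra_simps)
    moreover have "a * b - 1 = (a - 1) * (X + b)" if "b - 1 = (a - 1) * X" for a b X :: complex
      using that by algebra
    ultimately show ?case using Suc by (simp add: add.commute)
  qed simp
  have "norm (cis (of_int n * s) - 1) = norm (cis (of_nat (nat \<bar>n\<bar>) * s) - 1)"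
  proof (cases "n \<ge> 0")
    case False
    then have "cis (of_int n * s) - 1 = cnj (cis (of_nat (nat \<bar>n\<bar>) * s) - 1)"
      by (simp add: cis_cnj)
    then show ?thesis by (simp only: complex_mod_cnj)
  qed simp
  then show ?thesis unfolding nat by (simp add: norm_mult)
qed

lemma cis_neq_1: "0 < s \<Longrightarrow> s < 2*pi \<Longrightarrow> cis s \<noteq> 1"
proof
  assume s: "0 < s" "s < 2*pi" and "cis s = 1"
  then have "cos s = 1" by (simp add: complex_eq_iff)
  then have "cos (2 * (s/2)) = 1" by simp
  then have "sin (s/2) = 0" unfolding cos_double_sin by simp
  moreover have "sin (s/2) > 0" using s by (intro sin_gt_zero) auto
  ultimately show False by simp
qed

text \<open>For each shift \<open>s\<close> the coefficients of \<open>G (\<theta> + s) - G \<theta>\<close> are \<open>(exp (i n s) - 1)\<close> times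
  those of \<open>G\<close>; dividing by \<open>|exp (i s) - 1|\<^sup>2\<close> and integrating in \<open>s\<close> turns
  the factor into \<open>2 \<pi> |n|\<close>.\<close>

lemma slobodeckij_bound:
  assumes [measurable]: "G \<in> borel_measurable borel" and G: "G \<in> L2 circ" and per: "\<And>x. G (x + 2*pi) = G x"
    and F: "finite F"
  shows "ennreal (4 * pi\<^sup>2 * (\<Sum>n\<in>F. \<bar>of_int n\<bar> * (norm (circ_coeff G n))\<^sup>2))
     \<le> (\<integral>\<^sup>+x. \<integral>\<^sup>+y. ennreal ((norm (G x - G y))\<^sup>2 / (norm (cis x - cis y))\<^sup>2) \<partial>circ \<partial>circ)"
proof -
  interpret circ: finite_measure circ by (rule finite_measure_circ)
  interpret pair_sigma_finite circ circ ..
  define P where "P n s = (norm (\<Sum>k\<in>{0..<\<bar>n\<bar>}. 1 * cis (of_int k * s)))\<^sup>2" for n :: int and s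
  have [measurable]: "(\<lambda>x. G x) \<in> borel_measurable circ" using assms(1) by (rule circ_measurable)
  have cis_m[measurable]: "cis \<in> borel_measurable borel"
    by (intro borel_measurable_continuous_onI continuous_intros)
  have circ_id[measurable]: "(\<lambda>x. x) \<in> borel_measurable circ" by (rule circ_measurable) simp
  have i: "integrable circ (P n)" for n
  proof -
    have "(\<lambda>s. \<Sum>k\<in>{0..<\<bar>n\<bar>}. 1 * cis (of_int k * s)) \<in> L2 circ"
      by (intro circ_continuous_L2 continuous_intros)
    then show ?thesis by (simp add: L2_iff P_def[abs_def])
  qed
  have P_nonneg: "P n s \<ge> 0" for n s by (simp add: P_def)
  have Pn: "(LINT s|circ. P n s) = 2 * pi * \<bar>of_int n\<bar>" for n
    unfolding P_def by (subst integral_trig_polynomial) auto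
  have "4 * pi\<^sup>2 * (\<Sum>n\<in>F. \<bar>of_int n\<bar> * (norm (circ_coeff G n))\<^sup>2)
      = (LINT s|circ. (\<Sum>n\<in>F. 2 * pi * (norm (circ_coeff G n))\<^sup>2 * P n s))"
    using i by (simp add: Bochner_Integration.integral_sum Pn sum_distrib_left power2_eq_square mult_ac)
  then have "ennreal (4 * pi\<^sup>2 * (\<Sum>n\<in>F. \<bar>of_int n\<bar> * (norm (circ_coeff G n))\<^sup>2))
      = (\<integral>\<^sup>+s. ennreal (\<Sum>n\<in>F. 2 * pi * (norm (circ_coeff G n))\<^sup>2 * P n s) \<partial>circ)"
    using i by (subst nn_integral_eq_integral)
      (auto intro!: sum_nonneg Bochner_Integration.integrable_sum simp: P_nonneg)
  also have "\<dots> \<le> (\<integral>\<^sup>+s. \<integral>\<^sup>+x. ennreal ((norm (G (x + s) - G x))\<^sup>2 / (norm (cis s - 1))\<^sup>2) \<partial>circ \<partial>circ)"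
  proof (rule nn_integral_mono_AE)
    have "AE s in circ. s \<noteq> 0 \<and> s \<noteq> 2*pi"
      unfolding circ_def using AE_lborel_singleton[of 0] AE_lborel_singleton[of "2*pi"]
      by (subst AE_restrict_space_iff) (auto elim!: AE_mp)
    moreover have "AE s in circ. s \<in> space circ" by (rule AE_space)
    ultimately show "AE s in circ. ennreal (\<Sum>n\<in>F. 2 * pi * (norm (circ_coeff G n))\<^sup>2 * P n s)
        \<le> (\<integral>\<^sup>+x. ennreal ((norm (G (x + s) - G x))\<^sup>2 / (norm (cis s - 1))\<^sup>2) \<partial>circ)"
    proof eventually_elim
      case (elim s)
      then have s: "0 < s" "s < 2*pi" by (auto simp: circ_space_sets)
      define a where "a = 1 / (norm (cis s - 1))\<^sup>2"
      have a: "a > 0" using cis_neq_1[OF s] by (simp add: a_def)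
      have [measurable]: "(\<lambda>x. G (x + s)) \<in> borel_measurable circ" by (rule circ_measurable) measurable
      have "(\<Sum>n\<in>F. 2 * pi * (norm (circ_coeff G n))\<^sup>2 * P n s)
          = a * (2 * pi * (\<Sum>n\<in>F. (norm (circ_coeff G n))\<^sup>2 * (norm (cis (of_int n * s) - 1))\<^sup>2))"
        unfolding sum_distrib_left
        using cis_neq_1[OF s] by (intro sum.cong refl) (simp add: geometric_cis P_def a_def power_mult_distrib)
      then have "ennreal (\<Sum>n\<in>F. 2 * pi * (norm (circ_coeff G n))\<^sup>2 * P n s)
          = ennreal a * ennreal (2 * pi * (\<Sum>n\<in>F. (norm (circ_coeff G n))\<^sup>2 * (norm (cis (of_int n * s) - 1))\<^sup>2))"
        using a by (simp add: ennreal_mult sum_nonneg)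
      also have "\<dots> \<le> ennreal a * (\<integral>\<^sup>+x. ennreal ((norm (G (x + s) - G x))\<^sup>2) \<partial>circ)"
        using shifted_difference_bound[OF assms(1) G per _ _ F, of s] s by (intro mult_left_mono) auto
      also have "\<dots> = (\<integral>\<^sup>+x. ennreal a * ennreal ((norm (G (x + s) - G x))\<^sup>2) \<partial>circ)"
        by (rule nn_integral_cmult[symmetric]) measurable
      also have "\<dots> = (\<integral>\<^sup>+x. ennreal ((norm (G (x + s) - G x))\<^sup>2 / (norm (cis s - 1))\<^sup>2) \<partial>circ)"
        using a by (intro nn_integral_cong) (simp add: a_def flip: ennreal_mult)
      finally show ?case .
    qed
  qed
  also have "\<dots> = (\<integral>\<^sup>+x. \<integral>\<^sup>+s. ennreal ((norm (G (x + s) - G x))\<^sup>2 / (norm (cis s - 1))\<^sup>2) \<partial>circ \<partial>circ)"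
    by (rule Fubini') measurable
  also have "\<dots> = (\<integral>\<^sup>+x. \<integral>\<^sup>+y. ennreal ((norm (G x - G y))\<^sup>2 / (norm (cis x - cis y))\<^sup>2) \<partial>circ \<partial>circ)"
  proof (rule nn_integral_cong)
    fix x assume x: "x \<in> space circ"
    have "norm (cis x - cis (s + x)) = norm (cis s - 1)" for s
    proof -
      have "cis x - cis (s + x) = - (cis x * (cis s - 1))" by (simp add: algebra_simps cis_mult)
      then show ?thesis by (simp add: norm_mult norm_minus_cancel del: minus_mult_right)
    qed
    then have "(\<integral>\<^sup>+s. ennreal ((norm (G (x + s) - G x))\<^sup>2 / (norm (cis s - 1))\<^sup>2) \<partial>circ)
        = (\<integral>\<^sup>+s. ennreal ((norm (G x - G (s + x)))\<^sup>2 / (norm (cis x - cis (s + x)))\<^sup>2) \<partial>circ)"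
      by (simp add: add.commute norm_minus_commute)
    also have "\<dots> = (\<integral>\<^sup>+y. ennreal ((norm (G x - G y))\<^sup>2 / (norm (cis x - cis y))\<^sup>2) \<partial>circ)"
      using x per cis_int_periodic[of 1]
      by (intro nn_integral_circ_shift[where f="\<lambda>y. ennreal ((norm (G x - G y))\<^sup>2 / (norm (cis x - cis y))\<^sup>2)"])
         (auto simp: circ_space_sets)
    finally show "(\<integral>\<^sup>+s. ennreal ((norm (G (x + s) - G x))\<^sup>2 / (norm (cis s - 1))\<^sup>2) \<partial>circ)
        = (\<integral>\<^sup>+y. ennreal ((norm (G x - G y))\<^sup>2 / (norm (cis x - cis y))\<^sup>2) \<partial>circ)" .
  qed
  finally show ?thesis .
qed

section \<open>Traces on the circle and the Dirichlet-to-Neumann forms\<close>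

lemma sets_circle_measure: "sets (circle_measure R) = sets (restrict_space borel (sphere 0 R))"
  by (simp add: circle_measure_def)

lemma space_circle_measure: "space (circle_measure R) = sphere 0 R"
  using sets_eq_imp_space_eq[OF sets_circle_measure[of R]] by (simp add: space_restrict_space)

lemma continuous_polar': "continuous_on UNIV (polar R)"
  using continuous_polar[OF continuous_on_id] by simp

lemma measurable_polar: "R \<ge> 0 \<Longrightarrow> polar R \<in> borel \<rightarrow>\<^sub>M circle_measure R"
  using borel_measurable_continuous_onI[OF continuous_polar'[of R]]
  by (subst measurable_cong_sets[OF refl sets_circle_measure], intro measurable_restrict_space2)
     (auto simp: norm_polar)

lemma circle_measurable_polar:
  "R \<ge> 0 \<Longrightarrow> f \<in> circle_measure R \<rightarrow>\<^sub>M N \<Longrightarrow> (\<lambda>\<theta>. f (polar R \<theta>)) \<in> borel \<rightarrow>\<^sub>M N"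
  by (rule measurable_compose[OF measurable_polar])

lemma polar_periodic: "polar R (x + 2*pi) = polar R x"
  by (simp add: polar_def)

lemma nn_integral_circle:
  fixes f :: "real^2 \<Rightarrow> ennreal"
  assumes R: "R \<ge> 0" and f: "f \<in> borel_measurable (circle_measure R)"
  shows "(\<integral>\<^sup>+x. f x \<partial>circle_measure R) = ennreal R * (\<integral>\<^sup>+\<theta>. f (polar R \<theta>) \<partial>circ)"
proof -
  let ?M = "restrict_space lborel {0..<2*pi}" and ?N = "restrict_space borel (sphere 0 R) :: (real^2) measure"
  have f': "f \<in> borel_measurable ?N" using f by (simp add: measurable_cong_sets[OF sets_circle_measure refl])
  have p: "polar R \<in> ?M \<rightarrow>\<^sub>M ?N"
    using borel_measurable_continuous_onI[OF continuous_polar'[of R]] R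
    by (intro measurable_restrict_space2 measurable_restrict_space1) (auto simp: norm_polar)
  have "(\<integral>\<^sup>+x. f x \<partial>circle_measure R) = ennreal R * (\<integral>\<^sup>+x. f x \<partial>distr ?M ?N (polar R))"
    unfolding circle_measure_def using f' by (subst nn_integral_scale_measure) auto
  also have "(\<integral>\<^sup>+x. f x \<partial>distr ?M ?N (polar R)) = (\<integral>\<^sup>+\<theta>. f (polar R \<theta>) \<partial>?M)"
    by (rule nn_integral_distr[OF p]) (simp add: f')
  also have "\<dots> = (\<integral>\<^sup>+\<theta>. f (polar R \<theta>) \<partial>circ)"
    unfolding nn_integral_circ by (subst nn_integral_restrict_space) auto
  finally show ?thesis .
qed

lemma norm_polar_diff:
  assumes "R \<ge> 0"
  shows "norm (polar R x - polar R y) = R * norm (cis x - cis y)"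
proof -
  have "(norm (polar R x - polar R y))\<^sup>2 = (R * norm (cis x - cis y))\<^sup>2"
  proof -
    have "(norm (polar R x - polar R y))\<^sup>2 = (R * cos x - R * cos y)\<^sup>2 + (R * sin x - R * sin y)\<^sup>2"
      unfolding power2_norm_eq_inner inner_vec_def by (simp add: polar_def sum_2 power2_eq_square)
    also have "\<dots> = R\<^sup>2 * ((cos x - cos y)\<^sup>2 + (sin x - sin y)\<^sup>2)"
      by (simp only: right_diff_distrib[symmetric] power_mult_distrib distrib_left[symmetric])
    finally show ?thesis by (simp add: power_mult_distrib cmod_power2)
  qed
  then show ?thesis using assms by (simp add: power2_eq_iff_nonneg)
qed

lemma Hhalf_circle_L2:
  assumes R: "R > 0" and g: "g \<in> Hhalf (circle_measure R)"
  shows "(\<lambda>\<theta>. g (polar R \<theta>)) \<in> L2 circ" "(\<lambda>\<theta>. g (polar R \<theta>)) \<in> borel_measurable borel"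
proof -
  have gm: "g \<in> borel_measurable (circle_measure R)" using g by (simp add: Hhalf_def)
  then show m: "(\<lambda>\<theta>. g (polar R \<theta>)) \<in> borel_measurable borel"
    using R by (intro circle_measurable_polar) auto
  have "(\<integral>\<^sup>+x. ennreal ((norm (g x))\<^sup>2) \<partial>circle_measure R) < \<infinity>"
    using g by (auto simp: Hhalf_def Hhalf_sqnorm_def intro: le_less_trans[rotated])
  then have "ennreal R * (\<integral>\<^sup>+\<theta>. ennreal ((norm (g (polar R \<theta>)))\<^sup>2) \<partial>circ) < \<infinity>"
    using gm R by (subst (asm) nn_integral_circle) auto
  then show "(\<lambda>\<theta>. g (polar R \<theta>)) \<in> L2 circ"
    using R m by (auto simp: L2_def ennreal_mult_less_top circ_measurable)
qed

text \<open>In the parameter \<open>\<theta>\<close> the two factors \<open>R\<close> of arc length cancel against the scaling of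
  \<open>|x - y|\<^sup>2\<close>, so the Slobodeckij integral over the circle is the double integral that bounds
  \<open>\<Sum>\<^sub>n |n| |g\<^sup>(\<^sup>n\<^sup>)|\<^sup>2\<close>; Bessel's inequality bounds the remaining part.\<close>

proposition Hhalf_coefficients_summable:
  assumes R: "R > 0" and g: "g \<in> Hhalf (circle_measure R)"
  shows "(\<lambda>n. (1 + \<bar>of_int n\<bar>) * (norm (fourier_coeff R g n))\<^sup>2) summable_on UNIV"
proof -
  define G where "G \<theta> = g (polar R \<theta>)" for \<theta>
  define K where "K x y = ennreal ((norm (g x - g y))\<^sup>2 / (norm (x - y))\<^sup>2)" for x y
  have gm: "g \<in> borel_measurable (circle_measure R)" using g by (simp add: Hhalf_def)
  have Gm[measurable]: "G \<in> borel_measurable borel" and G: "G \<in> L2 circ"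
    using Hhalf_circle_L2[OF R g] by (simp_all add: G_def[abs_def])
  have per: "G (x + 2*pi) = G x" for x by (simp add: G_def polar_periodic)
  interpret circ: finite_measure circ by (rule finite_measure_circ)
  have pm[measurable]: "polar R \<in> borel_measurable borel"
    by (intro borel_measurable_continuous_onI continuous_polar')
  have cm[measurable]: "cis \<in> borel_measurable borel"
    by (intro borel_measurable_continuous_onI continuous_intros)
  have idm[measurable]: "(\<lambda>x. x) \<in> borel_measurable circ" by (rule circ_measurable) simp
  have xm: "(\<lambda>x. x) \<in> borel_measurable (circle_measure R)"
    by (simp add: measurable_cong_sets[OF sets_circle_measure refl] measurable_restrict_space1)
  have "(\<integral>\<^sup>+x. \<integral>\<^sup>+y. K x y \<partial>circle_measure R \<partial>circle_measure R) < \<infinity>"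
    using g by (auto simp: Hhalf_def Hhalf_sqnorm_def K_def intro: le_less_trans[rotated])
  moreover have "(\<integral>\<^sup>+x. \<integral>\<^sup>+y. K x y \<partial>circle_measure R \<partial>circle_measure R)
      = (\<integral>\<^sup>+x. ennreal R * (\<integral>\<^sup>+y. K x (polar R y) \<partial>circ) \<partial>circle_measure R)"
    using R gm xm unfolding K_def
    by (intro nn_integral_cong nn_integral_circle measurable_compose[OF _ measurable_ennreal] borel_measurable_divide
         borel_measurable_power borel_measurable_norm borel_measurable_diff) auto
  moreover have "\<dots> = ennreal R * (\<integral>\<^sup>+x. ennreal R * (\<integral>\<^sup>+y. K (polar R x) (polar R y) \<partial>circ) \<partial>circ)"
  proof (rule nn_integral_circle)
    have [measurable]: "(\<lambda>y. g (polar R y)) \<in> borel_measurable circ"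
      using G by (simp add: G_def[abs_def] L2_def)
    have [measurable]: "(\<lambda>y. polar R y) \<in> borel_measurable circ" by (rule circ_measurable) (rule pm)
    note [measurable] = gm xm
    show "(\<lambda>x. ennreal R * (\<integral>\<^sup>+y. K x (polar R y) \<partial>circ)) \<in> borel_measurable (circle_measure R)"
      unfolding K_def by measurable
  qed (use R in auto)
  moreover have "\<dots> = (\<integral>\<^sup>+x. \<integral>\<^sup>+y. ennreal ((norm (G x - G y))\<^sup>2 / (norm (cis x - cis y))\<^sup>2) \<partial>circ \<partial>circ)"
  proof -
    have [measurable]: "G \<in> borel_measurable circ" using Gm by (rule circ_measurable)
    define L where "L x y = ennreal ((norm (G x - G y))\<^sup>2 / (norm (cis x - cis y))\<^sup>2)" for x y
    have K: "K (polar R x) (polar R y) = ennreal (1 / R\<^sup>2) * L x y" for x y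
      using R by (simp add: K_def L_def norm_polar_diff G_def power_mult_distrib flip: ennreal_mult)
    have Lm[measurable]: "case_prod L \<in> borel_measurable (circ \<Otimes>\<^sub>M circ)"
      unfolding L_def[abs_def] by measurable
    have c: "ennreal R * (ennreal R * ennreal (1 / R\<^sup>2)) = 1"
      using R by (simp add: power2_eq_square flip: ennreal_mult)
    have "ennreal R * (\<integral>\<^sup>+x. ennreal R * (\<integral>\<^sup>+y. K (polar R x) (polar R y) \<partial>circ) \<partial>circ)
        = ennreal R * (\<integral>\<^sup>+x. ennreal R * (ennreal (1 / R\<^sup>2) * (\<integral>\<^sup>+y. L x y \<partial>circ)) \<partial>circ)"
      unfolding K by (intro arg_cong2[where f="(*)"] refl nn_integral_cong nn_integral_cmult) measurable
    also have "\<dots> = ennreal R * (ennreal R * (ennreal (1 / R\<^sup>2) * (\<integral>\<^sup>+x. \<integral>\<^sup>+y. L x y \<partial>circ \<partial>circ)))"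
      by (subst nn_integral_cmult, measurable)+
    also have "\<dots> = (\<integral>\<^sup>+x. \<integral>\<^sup>+y. L x y \<partial>circ \<partial>circ)"
      using c by (metis mult.assoc mult_1)
    finally show ?thesis by (simp add: L_def)
  qed
  ultimately have fin: "(\<integral>\<^sup>+x. \<integral>\<^sup>+y. ennreal ((norm (G x - G y))\<^sup>2 / (norm (cis x - cis y))\<^sup>2) \<partial>circ \<partial>circ) < \<infinity>"
    by simp
  define B where "B = enn2real (\<integral>\<^sup>+x. \<integral>\<^sup>+y. ennreal ((norm (G x - G y))\<^sup>2 / (norm (cis x - cis y))\<^sup>2) \<partial>circ \<partial>circ)"
  have B: "4 * pi\<^sup>2 * (\<Sum>n\<in>F. \<bar>of_int n\<bar> * (norm (circ_coeff G n))\<^sup>2) \<le> B" if "finite F" for F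
    using slobodeckij_bound[OF Gm G per that] fin unfolding B_def
    by (subst ennreal_le_iff[symmetric]) (auto simp: ennreal_enn2real_if)
  define A where "A = (LINT \<theta>|circ. (norm (G \<theta>))\<^sup>2)"
  have A: "2 * pi * (\<Sum>n\<in>F. (norm (circ_coeff G n))\<^sup>2) \<le> A" if "finite F" for F
    unfolding A_def by (rule bessel_inequality[OF G that])
  have "(\<Sum>n\<in>F. (1 + \<bar>of_int n\<bar>) * (norm (circ_coeff G n))\<^sup>2) \<le> A / (2 * pi) + B / (4 * pi\<^sup>2)" if "finite F" for F
  proof -
    have "(\<Sum>n\<in>F. (norm (circ_coeff G n))\<^sup>2) \<le> A / (2 * pi)"
      "(\<Sum>n\<in>F. \<bar>of_int n\<bar> * (norm (circ_coeff G n))\<^sup>2) \<le> B / (4 * pi\<^sup>2)"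
      using A[OF that] B[OF that] by (simp_all add: field_simps)
    then show ?thesis by (simp add: distrib_right sum.distrib)
  qed
  then have "(\<lambda>n. (1 + \<bar>of_int n\<bar>) * (norm (circ_coeff G n))\<^sup>2) summable_on UNIV"
    by (intro nonneg_bdd_above_summable_on) (auto intro!: bdd_aboveI)
  then show ?thesis by (simp add: fourier_coeff_eq G_def[abs_def])
qed

lemma dtn_cnj_eq:
  assumes R: "R > 0"
  shows "dtn s R g (\<lambda>x. cnj (h x)) = (\<Sum>\<^sub>\<infinity>n. 2 * pi * (s n * fourier_coeff R g n * cnj (fourier_coeff R h n)))"
proof -
  have "(LINT \<theta>:{0..2*pi}|lborel. cis (of_int n * \<theta>) * cnj (h (polar R \<theta>))) = 2 * pi * cnj (fourier_coeff R h n)" for n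
  proof -
    have "(LINT \<theta>|circ. cis (of_int n * \<theta>) * cnj (h (polar R \<theta>)))
        = (LINT \<theta>|circ. cnj (h (polar R \<theta>) * cis (- of_int n * \<theta>)))"
      by (simp add: cis_cnj mult.commute)
    also have "\<dots> = cnj (LINT \<theta>|circ. h (polar R \<theta>) * cis (- of_int n * \<theta>))"
      by (rule Bochner_Integration.integral_cnj)
    also have "\<dots> = 2 * pi * cnj (fourier_coeff R h n)"
      by (simp add: fourier_coeff_eq circ_coeff_def)
    finally show ?thesis by (simp add: circ_integral)
  qed
  then have "dtn s R g (\<lambda>x. cnj (h x))
      = 1 / of_real R * (\<Sum>\<^sub>\<infinity>n. of_real R * (2 * pi * (s n * fourier_coeff R g n * cnj (fourier_coeff R h n))))"
    unfolding dtn_def by (simp only:) (simp only: mult_ac)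
  also have "\<dots> = 1 / of_real R * (of_real R * (\<Sum>\<^sub>\<infinity>n. 2 * pi * (s n * fourier_coeff R g n * cnj (fourier_coeff R h n))))"
    by (subst infsum_cmult_right') simp
  finally show ?thesis using R by simp
qed

text \<open>The linear growth of the symbol is absorbed by the weight \<open>1 + |n|\<close> in
  \<open>Hhalf_coefficients_summable\<close>.\<close>

lemma dtn_summable:
  assumes R: "R > 0" and g: "g \<in> Hhalf (circle_measure R)" and h: "h \<in> Hhalf (circle_measure R)"
    and s: "\<And>n. norm (s n) \<le> C * (1 + \<bar>of_int n\<bar>)" "C \<ge> 0"
  shows "(\<lambda>n. 2 * pi * (s n * fourier_coeff R g n * cnj (fourier_coeff R h n))) summable_on UNIV"
proof (rule abs_summable_summable)
  let ?a = "\<lambda>n. norm (fourier_coeff R g n)" and ?b = "\<lambda>n. norm (fourier_coeff R h n)"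
  have "(\<lambda>n. 2 * pi * C * ((1 + \<bar>of_int n\<bar>) * (?a n)\<^sup>2 + (1 + \<bar>of_int n\<bar>) * (?b n)\<^sup>2)) summable_on UNIV"
    by (intro summable_on_cmult_right summable_on_add Hhalf_coefficients_summable R g h)
  then show "(\<lambda>n. norm (2 * pi * (s n * fourier_coeff R g n * cnj (fourier_coeff R h n)))) summable_on UNIV"
  proof (rule summable_on_comparison_test)
    fix n :: int
    have "?a n * ?b n \<le> (?a n)\<^sup>2 + (?b n)\<^sup>2"
      using sum_squares_bound[of "?a n" "?b n"]
        mult_nonneg_nonneg[OF norm_ge_zero[of "fourier_coeff R g n"] norm_ge_zero[of "fourier_coeff R h n"]] by linarith
    then have "norm (s n) * (?a n * ?b n) \<le> (C * (1 + \<bar>of_int n\<bar>)) * ((?a n)\<^sup>2 + (?b n)\<^sup>2)"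
      using s by (intro mult_mono) auto
    then have "2 * pi * (norm (s n) * (?a n * ?b n)) \<le> 2 * pi * ((C * (1 + \<bar>of_int n\<bar>)) * ((?a n)\<^sup>2 + (?b n)\<^sup>2))"
      by (intro mult_left_mono) auto
    then show "norm (2 * pi * (s n * fourier_coeff R g n * cnj (fourier_coeff R h n)))
        \<le> 2 * pi * C * ((1 + \<bar>of_int n\<bar>) * (?a n)\<^sup>2 + (1 + \<bar>of_int n\<bar>) * (?b n)\<^sup>2)"
      by (simp add: norm_mult algebra_simps)
  qed auto
qed

text \<open>The sesquilinear form of the operator at a difference, expanded into the four mixed terms;
  convergence of each of them justifies the expansion.\<close>

lemma dtn_polarized:
  fixes s :: "int \<Rightarrow> complex" and g :: "nat \<Rightarrow> real^2 \<Rightarrow> complex"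
  assumes R: "R > 0" and g: "\<And>i. i \<in> {1, 2::nat} \<Longrightarrow> g i \<in> Hhalf (circle_measure R)"
    and s: "\<And>n. norm (s n) \<le> C * (1 + \<bar>of_int n\<bar>)" "C \<ge> 0"
  defines "f \<equiv> \<lambda>n. 2 * pi * (s n * of_real ((norm (fourier_coeff R (g 1) n - fourier_coeff R (g 2) n))\<^sup>2))"
  shows "f summable_on UNIV"
    and "dtn s R (g 1) (\<lambda>x. cnj (g 1 x)) - dtn s R (g 1) (\<lambda>x. cnj (g 2 x))
       - dtn s R (g 2) (\<lambda>x. cnj (g 1 x)) + dtn s R (g 2) (\<lambda>x. cnj (g 2 x)) = (\<Sum>\<^sub>\<infinity>n. f n)"
proof -
  define t where "t i j n = 2 * pi * (s n * fourier_coeff R (g i) n * cnj (fourier_coeff R (g j) n))" for i j n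
  have S: "t i j summable_on UNIV" if "i \<in> {1,2}" "j \<in> {1,2}" for i j
    unfolding t_def[abs_def] by (rule dtn_summable[OF R g g s]) (use that in auto)
  have f: "f = (\<lambda>n. ((t 1 1 n + (- t 1 2 n)) + (- t 2 1 n)) + t 2 2 n)"
    unfolding f_def t_def complex_norm_square by (rule ext) (simp add: algebra_simps)
  have neg: "(\<lambda>n. - t 1 2 n) summable_on UNIV" "(\<lambda>n. - t 2 1 n) summable_on UNIV"
    using summable_on_cmult_right[OF S[of 1 2], of "-1"] summable_on_cmult_right[OF S[of 2 1], of "-1"] by simp_all
  show "f summable_on UNIV"
    unfolding f by (intro summable_on_add neg S) auto
  have "(\<Sum>\<^sub>\<infinity>n. f n) = (\<Sum>\<^sub>\<infinity>n. t 1 1 n) + - (\<Sum>\<^sub>\<infinity>n. t 1 2 n) + - (\<Sum>\<^sub>\<infinity>n. t 2 1 n) + (\<Sum>\<^sub>\<infinity>n. t 2 2 n)"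
    unfolding f infsum_uminus[symmetric]
    by (simp only: infsum_add[OF summable_on_add[OF summable_on_add[OF S[of 1 1] neg(1)] neg(2)] S[of 2 2]]
      infsum_add[OF summable_on_add[OF S[of 1 1] neg(1)] neg(2)] infsum_add[OF S[of 1 1] neg(1)] insert_iff simp_thms)
  then show "dtn s R (g 1) (\<lambda>x. cnj (g 1 x)) - dtn s R (g 1) (\<lambda>x. cnj (g 2 x))
       - dtn s R (g 2) (\<lambda>x. cnj (g 1 x)) + dtn s R (g 2) (\<lambda>x. cnj (g 2 x)) = (\<Sum>\<^sub>\<infinity>n. f n)"
    unfolding dtn_cnj_eq[OF R] t_def by simp
qed

lemma emeasure_circle_measure: "R \<ge> 0 \<Longrightarrow> emeasure (circle_measure R) (space (circle_measure R)) = ennreal (2 * pi * R)"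
proof -
  assume R: "R \<ge> 0"
  have "emeasure (circle_measure R) (space (circle_measure R)) = (\<integral>\<^sup>+x. 1 \<partial>circle_measure R)" by simp
  also have "\<dots> = ennreal R * (\<integral>\<^sup>+\<theta>. 1 \<partial>circ)" using R by (intro nn_integral_circle) auto
  also have "\<dots> = ennreal (2 * pi * R)" using R by (simp add: emeasure_circ mult.commute flip: ennreal_mult)
  finally show ?thesis .
qed

text \<open>A Lipschitz function has a bounded difference quotient, and the circle has finite length.\<close>

lemma smooth_Hhalf_circle:
  assumes R: "R \<ge> 0" and \<phi>: "smooth \<phi>"
  shows "\<phi> \<in> Hhalf (circle_measure R)"
proof -
  let ?\<sigma> = "circle_measure R"
  have m: "\<phi> \<in> borel_measurable ?\<sigma>"
    using smooth_continuous[OF \<phi>]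
    by (simp add: measurable_cong_sets[OF sets_circle_measure refl] measurable_restrict_space1 borel_measurable_continuous_onI)
  have bdd: "\<exists>C\<ge>0. \<forall>x\<in>cball 0 R. norm (f x) \<le> C" if "smooth f" for f
  proof -
    have "compact (f ` cball 0 R)"
      using smooth_continuous[OF that] by (intro compact_continuous_image) (auto intro: continuous_on_subset)
    then have "bounded (f ` cball 0 R)" by (rule compact_imp_bounded)
    then obtain C where "\<forall>y\<in>f ` cball 0 R. norm y \<le> C" unfolding bounded_iff by blast
    then show ?thesis by (intro exI[of _ "max C 0"]) (auto intro: max.coboundedI1)
  qed
  obtain C where C: "C \<ge> 0" "\<And>x. x \<in> cball 0 R \<Longrightarrow> norm (\<phi> x) \<le> C" using bdd[OF \<phi>] by blast
  obtain C1 where C1: "C1 \<ge> 0" "\<And>x. x \<in> cball 0 R \<Longrightarrow> norm (grad \<phi> x $ 1) \<le> C1"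
    using bdd[OF smooth_grad[OF \<phi>]] by blast
  obtain C2 where C2: "C2 \<ge> 0" "\<And>x. x \<in> cball 0 R \<Longrightarrow> norm (grad \<phi> x $ 2) \<le> C2"
    using bdd[OF smooth_grad[OF \<phi>]] by blast
  have lip: "norm (\<phi> x - \<phi> y) \<le> 2 * max C1 C2 * norm (x - y)" if "x \<in> cball 0 R" "y \<in> cball 0 R" for x y
  proof (rule smooth_lipschitz[OF \<phi> convex_cball _ that])
    show "norm (grad \<phi> z $ j) \<le> max C1 C2" if "z \<in> cball 0 R" for z j
      using C1(2)[OF that] C2(2)[OF that] exhaust_2[of j] by auto
  qed
  have fin: "(\<integral>\<^sup>+x. ennreal c \<partial>?\<sigma>) < \<infinity>" for c
    by (simp add: emeasure_circle_measure[OF R] ennreal_mult_less_top)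
  have "(\<integral>\<^sup>+x. ennreal ((norm (\<phi> x))\<^sup>2) \<partial>?\<sigma>) \<le> (\<integral>\<^sup>+x. ennreal (C\<^sup>2) \<partial>?\<sigma>)"
    using C by (intro nn_integral_mono ennreal_leI power_mono) (auto simp: space_circle_measure)
  then have 1: "(\<integral>\<^sup>+x. ennreal ((norm (\<phi> x))\<^sup>2) \<partial>?\<sigma>) < \<infinity>" using fin by (rule le_less_trans)
  define E where "E = (\<integral>\<^sup>+y. ennreal ((2 * max C1 C2)\<^sup>2) \<partial>?\<sigma>)"
  have "(\<integral>\<^sup>+x. \<integral>\<^sup>+y. ennreal ((norm (\<phi> x - \<phi> y))\<^sup>2 / (norm (x - y))\<^sup>2) \<partial>?\<sigma> \<partial>?\<sigma>) \<le> (\<integral>\<^sup>+x. E \<partial>?\<sigma>)"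
    unfolding E_def
  proof (intro nn_integral_mono ennreal_leI)
    fix x y assume xy: "x \<in> space ?\<sigma>" "y \<in> space ?\<sigma>"
    have "(norm (\<phi> x - \<phi> y))\<^sup>2 \<le> ((2 * max C1 C2) * norm (x - y))\<^sup>2"
      using xy by (intro power_mono lip) (auto simp: space_circle_measure)
    then show "(norm (\<phi> x - \<phi> y))\<^sup>2 / (norm (x - y))\<^sup>2 \<le> (2 * max C1 C2)\<^sup>2"
      by (cases "x = y") (auto simp: power_mult_distrib divide_simps)
  qed
  also have "(\<integral>\<^sup>+x. E \<partial>?\<sigma>) < \<infinity>"
    unfolding E_def by (simp add: emeasure_circle_measure[OF R] ennreal_mult_less_top)
  finally show ?thesis using 1 m by (simp add: Hhalf_def Hhalf_sqnorm_def)
qed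

section \<open>The divergence theorem on a disk\<close>

text \<open>The substitution \<open>t = R cos \<theta>\<close>: the point of the diameter at \<open>t\<close> lies below the point with angle
  \<open>arccos (t/R)\<close> of the upper semicircle and above the one with the opposite angle.\<close>

lemma integral_over_diameter:
  fixes \<Phi> :: "real \<Rightarrow> complex"
  assumes cont: "continuous_on UNIV \<Phi>" and per: "\<And>x. \<Phi> (x + 2*pi) = \<Phi> x" and R: "R > 0"
  shows "integral {-R..R} (\<lambda>t. \<Phi> (arccos (t/R)) - \<Phi> (- arccos (t/R)))
    = of_real R * integral {0..2*pi} (\<lambda>\<theta>. \<Phi> \<theta> * of_real (sin \<theta>))"
proof -
  let ?f = "\<lambda>t. \<Phi> (arccos (t/R)) - \<Phi> (- arccos (t/R))" and ?h = "\<lambda>\<theta>. \<Phi> \<theta> * of_real (sin \<theta>)"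
  have cont_c: "continuous_on S (\<lambda>x. \<Phi> (u x))" if "continuous_on S u" for S u
    using continuous_on_compose2[OF cont that] by auto
  have hc: "continuous_on S ?h" for S
    by (intro continuous_intros cont_c continuous_on_id)
  have hi: "?h integrable_on {a..b}" for a b by (intro integrable_continuous_real hc)
  have fc: "continuous_on {-R..R} ?f"
    using R by (intro continuous_intros cont_c) (auto simp: field_simps)
  have "((\<lambda>\<theta>. (- R * sin \<theta>) *\<^sub>R ?f (R * cos \<theta>)) has_integral
      (integral {R * cos 0..R * cos pi} ?f - integral {R * cos pi..R * cos 0} ?f)) {0..pi}"
  proof (rule has_integral_substitution_general[OF _ _ _ fc, of "{}"])
    show "(\<lambda>\<theta>. R * cos \<theta>) ` {0..pi} \<subseteq> {- R..R}"
    proof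
      fix y assume "y \<in> (\<lambda>\<theta>. R * cos \<theta>) ` {0..pi}"
      then obtain \<theta> where "y = R * cos \<theta>" by auto
      moreover have "R * cos \<theta> \<le> R * 1" "R * (-1) \<le> R * cos \<theta>" using R by (intro mult_left_mono; simp)+
      ultimately show "y \<in> {-R..R}" by simp
    qed
  qed (auto intro!: derivative_eq_intros continuous_intros)
  then have "integral {0..pi} (\<lambda>\<theta>. (- R * sin \<theta>) *\<^sub>R ?f (R * cos \<theta>))
      = integral {R * cos 0..R * cos pi} ?f - integral {R * cos pi..R * cos 0} ?f"
    by (rule integral_unique)
  also have "\<dots> = - integral {-R..R} ?f" using R by simp
  finally have "integral {0..pi} (\<lambda>\<theta>. (- R * sin \<theta>) *\<^sub>R ?f (R * cos \<theta>)) = - integral {-R..R} ?f" .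
  moreover have "integral {0..pi} (\<lambda>\<theta>. (- R * sin \<theta>) *\<^sub>R ?f (R * cos \<theta>))
      = integral {0..pi} (\<lambda>\<theta>. (- of_real R) * (?h \<theta> + ?h (2*pi - \<theta>)))"
  proof (rule Henstock_Kurzweil_Integration.integral_cong)
    fix \<theta> :: real assume \<theta>: "\<theta> \<in> {0..pi}"
    have "\<Phi> (2*pi - \<theta>) = \<Phi> (- \<theta>)" using per[of "- \<theta>"] by (simp add: add.commute)
    moreover have "sin (2*pi - \<theta>) = - sin \<theta>" by (simp add: sin_diff)
    ultimately show "(- R * sin \<theta>) *\<^sub>R ?f (R * cos \<theta>) = (- of_real R) * (?h \<theta> + ?h (2*pi - \<theta>))"
      using \<theta> R by (simp add: arccos_cos scaleR_conv_of_real algebra_simps)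
  qed
  moreover have "\<dots> = (- of_real R) * (integral {0..pi} ?h + integral {0..pi} (\<lambda>\<theta>. ?h (2*pi - \<theta>)))"
    by (subst integral_mult_right, subst Henstock_Kurzweil_Integration.integral_add)
       (auto intro!: hi integrable_continuous_real continuous_intros cont_c)
  moreover have "integral {0..pi} (\<lambda>\<theta>. ?h (2*pi - \<theta>)) = integral {pi..2*pi} ?h"
  proof -
    have "((\<lambda>\<theta>. (-1) *\<^sub>R ?h (2*pi - \<theta>)) has_integral
        (integral {2*pi - 0..2*pi - pi} ?h - integral {2*pi - pi..2*pi - 0} ?h)) {0..pi}"
      by (rule has_integral_substitution_general[OF _ _ _ hc, of "{}" 0 pi "\<lambda>x. 2*pi - x" pi "2*pi"])
         (auto intro!: derivative_eq_intros continuous_intros)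
    then have "integral {0..pi} (\<lambda>\<theta>. - ?h (2*pi - \<theta>)) = - integral {pi..2*pi} ?h"
      by (simp add: integral_unique)
    then show ?thesis by (simp only: integral_neg) simp
  qed
  moreover have "integral {0..pi} ?h + integral {pi..2*pi} ?h = integral {0..2*pi} ?h"
    by (intro Henstock_Kurzweil_Integration.integral_combine hi) auto
  ultimately have "- integral {-R..R} ?f = - of_real R * integral {0..2*pi} ?h" by (simp only:)
  then show ?thesis by simp
qed

text \<open>By Fubini's theorem and the fundamental theorem of calculus on each vertical chord.\<close>

lemma disk_vertical_divergence:
  fixes f f' :: "real \<Rightarrow> real \<Rightarrow> complex"
  assumes f: "continuous_on UNIV (\<lambda>p. f (fst p) (snd p))" and f': "continuous_on UNIV (\<lambda>p. f' (fst p) (snd p))"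
    and deriv: "\<And>a b. (f a has_vector_derivative f' a b) (at b)" and R: "R > 0"
  shows "(LINT p|(lborel \<Otimes>\<^sub>M lborel). indicator (cball 0 R) p *\<^sub>R f' (fst p) (snd p))
     = of_real R * (LINT \<theta>|circ. f (R * cos \<theta>) (R * sin \<theta>) * of_real (sin \<theta>))"
proof -
  let ?g = "\<lambda>p. indicator (cball 0 R) p *\<^sub>R f' (fst p) (snd p)"
  define c where "c a = R * sin (arccos (a/R))" for a
  have gi: "integrable (lborel \<Otimes>\<^sub>M lborel) ?g"
    unfolding lborel_prod by (intro borel_integrable_compact) (auto intro: continuous_on_subset[OF f'])
  have mem: "(a, b) \<in> cball (0::real\<times>real) R \<longleftrightarrow> a\<^sup>2 + b\<^sup>2 \<le> R\<^sup>2" for a b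
  proof -
    have "(a, b) \<in> cball (0::real\<times>real) R \<longleftrightarrow> sqrt (a\<^sup>2 + b\<^sup>2) \<le> R" by (simp add: norm_Pair)
    also have "\<dots> \<longleftrightarrow> a\<^sup>2 + b\<^sup>2 \<le> R\<^sup>2" using R real_sqrt_le_iff[of "a\<^sup>2 + b\<^sup>2" "R\<^sup>2"] by simp
    finally show ?thesis .
  qed
  have arc: "a / R \<in> {-1..1}" "cos (arccos (a/R)) = a / R" "c a \<ge> 0" "(c a)\<^sup>2 = R\<^sup>2 - a\<^sup>2" if "a \<in> {-R..R}" for a
  proof -
    show 1: "a / R \<in> {-1..1}" using that R by (auto simp: field_simps)
    then show 2: "cos (arccos (a/R)) = a / R" by (intro cos_arccos) auto
    show "c a \<ge> 0" unfolding c_def using 1 R arccos_lbound arccos_ubound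
      by (intro mult_nonneg_nonneg sin_ge_zero) auto
    have "(sin (arccos (a/R)))\<^sup>2 = 1 - (a/R)\<^sup>2" unfolding sin_squared_eq 2 ..
    then show "(c a)\<^sup>2 = R\<^sup>2 - a\<^sup>2" using R by (simp add: c_def power_mult_distrib power_divide field_simps)
  qed
  have inner: "(LINT b|lborel. ?g (a, b)) = indicator {-R..R} a *\<^sub>R (f a (c a) - f a (- c a))" for a
  proof (cases "a \<in> {-R..R}")
    case True
    have "a\<^sup>2 + b\<^sup>2 \<le> R\<^sup>2 \<longleftrightarrow> b \<in> {- c a..c a}" for b
    proof -
      have "a\<^sup>2 + b\<^sup>2 \<le> R\<^sup>2 \<longleftrightarrow> b\<^sup>2 \<le> (c a)\<^sup>2" using arc(4)[OF True] by linarith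
      also have "\<dots> \<longleftrightarrow> \<bar>b\<bar> \<le> c a" using arc(3)[OF True] by (simp add: power2_le_iff_abs_le)
      finally show ?thesis by auto
    qed
    then have "indicator (cball 0 R) (a, b) = (indicator {- c a..c a} b :: real)" for b
      unfolding indicator_def mem by (simp only:)
    then have "(LINT b|lborel. ?g (a, b)) = (LINT b|lborel. indicator {- c a..c a} b *\<^sub>R f' a b)"
      by (simp only: fst_conv snd_conv)
    also have "\<dots> = f a (c a) - f a (- c a)"
    proof (rule integral_FTC_atLeastAtMost)
      show "continuous_on {- c a..c a} (f' a)"
        using continuous_on_compose2[OF f', of "{- c a..c a}" "\<lambda>b. (a, b)"] by (simp add: continuous_intros)
    qed (use arc(3)[OF True] deriv in \<open>auto intro: has_vector_derivative_at_within\<close>)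
    finally show ?thesis using True by simp
  next
    case False
    then have "R < \<bar>a\<bar>" by auto
    then have "a\<^sup>2 > R\<^sup>2" using R power_strict_mono[of R "\<bar>a\<bar>" 2] by simp
    then have "\<not> a\<^sup>2 + b\<^sup>2 \<le> R\<^sup>2" for b using zero_le_power2[of b] by linarith
    then have "indicator (cball 0 R) (a, b) = (0 :: real)" for b :: real
      using mem[of a b] by (simp add: indicator_def del: mem_cball)
    then have "(\<lambda>b. ?g (a, b)) = (\<lambda>b. 0)" by (simp only: scaleR_zero_left fst_conv snd_conv)
    then show ?thesis using False by (simp only:) simp
  qed
  define \<Phi> where "\<Phi> \<theta> = f (R * cos \<theta>) (R * sin \<theta>)" for \<theta>
  have \<Phi>c: "continuous_on UNIV \<Phi>"
    unfolding \<Phi>_def using continuous_on_compose2[OF f, of UNIV "\<lambda>\<theta>. (R * cos \<theta>, R * sin \<theta>)"]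
    by (simp add: continuous_intros)
  have \<Phi>c': "continuous_on S (\<lambda>x. \<Phi> (u x))" if "continuous_on S u" for S u
    using continuous_on_compose2[OF \<Phi>c that] by auto
  have \<Phi>f: "f a (c a) - f a (- c a) = \<Phi> (arccos (a/R)) - \<Phi> (- arccos (a/R))" if "a \<in> {-R..R}" for a
    using arc(2)[OF that] R by (simp add: \<Phi>_def c_def)
  have "(LINT p|(lborel \<Otimes>\<^sub>M lborel). ?g p) = (LINT a|lborel. LINT b|lborel. ?g (a, b))"
    using lborel_pair.integral_fst'[OF gi] by simp
  also have "\<dots> = (LINT a:{-R..R}|lborel. \<Phi> (arccos (a/R)) - \<Phi> (- arccos (a/R)))"
    unfolding inner set_lebesgue_integral_def by (intro Bochner_Integration.integral_cong refl) (auto simp: indicator_def \<Phi>f)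
  also have "\<dots> = integral {-R..R} (\<lambda>a. \<Phi> (arccos (a/R)) - \<Phi> (- arccos (a/R)))"
    using R by (intro set_borel_integral_eq_integral borel_integrable_atLeastAtMost' continuous_intros \<Phi>c')
      (auto simp: field_simps)
  also have "\<dots> = of_real R * integral {0..2*pi} (\<lambda>\<theta>. \<Phi> \<theta> * of_real (sin \<theta>))"
    by (rule integral_over_diameter[OF \<Phi>c _ R]) (simp add: \<Phi>_def)
  also have "integral {0..2*pi} (\<lambda>\<theta>. \<Phi> \<theta> * of_real (sin \<theta>)) = (LINT \<theta>:{0..2*pi}|lborel. \<Phi> \<theta> * of_real (sin \<theta>))"
    by (intro set_borel_integral_eq_integral(2)[symmetric] borel_integrable_atLeastAtMost' continuous_intros \<Phi>c' continuous_on_id)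
  finally show ?thesis by (simp add: circ_integral \<Phi>_def)
qed

lemma vector_axis: "vector [a, b] = a *\<^sub>R axis 1 1 + b *\<^sub>R (axis 2 1 :: real^2)" for a b :: real
  by (simp add: vec_eq_iff forall_2 axis_def)

lemma continuous_vector [continuous_intros]:
  fixes f g :: "'a::t2_space \<Rightarrow> real"
  shows "continuous_on S f \<Longrightarrow> continuous_on S g \<Longrightarrow> continuous_on S (\<lambda>x. vector [f x, g x] :: real^2)"
  unfolding vector_axis by (intro continuous_intros)

lemma lborel_plane: "(lborel :: (real^2) measure) = distr (lborel \<Otimes>\<^sub>M lborel) borel (\<lambda>p. vector [fst p, snd p])"
proof (rule lborel_eqI)
  have c: "continuous_on UNIV (\<lambda>p :: real \<times> real. vector [fst p, snd p] :: real^2)"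
    by (intro continuous_intros)
  have m: "(\<lambda>p. vector [fst p, snd p] :: real^2) \<in> lborel \<Otimes>\<^sub>M lborel \<rightarrow>\<^sub>M borel"
    using borel_measurable_continuous_onI[OF c] by (simp add: lborel_prod)
  fix l u :: "real^2" assume le: "\<And>b. b \<in> Basis \<Longrightarrow> l \<bullet> b \<le> u \<bullet> b"
  have le': "l $ i \<le> u $ i" for i
    using le[of "axis i 1"] by (simp add: inner_axis axis_in_Basis_iff)
  have "emeasure (distr (lborel \<Otimes>\<^sub>M lborel) borel (\<lambda>p. vector [fst p, snd p])) (box l u)
      = emeasure (lborel \<Otimes>\<^sub>M lborel) ({l$1<..<u$1} \<times> {l$2<..<u$2})"
    by (subst emeasure_distr[OF m]) (auto intro!: arg_cong[where f="emeasure _"] simp: space_pair_measure mem_box_cart forall_2)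
  also have "\<dots> = ennreal (u$1 - l$1) * ennreal (u$2 - l$2)"
    using le' by (subst lborel.emeasure_pair_measure_Times) auto
  also have "\<dots> = ennreal ((u$1 - l$1) * (u$2 - l$2))" using le' by (simp add: ennreal_mult)
  also have "(u$1 - l$1) * (u$2 - l$2) = (\<Prod>b\<in>Basis. (u - l) \<bullet> b)"
  proof -
    have B: "(Basis :: (real^2) set) = {axis 1 1, axis 2 1}" unfolding Basis_vec_def UNIV_2 by auto
    have "axis 1 1 \<noteq> (axis 2 1 :: real^2)" by (simp add: axis_eq_axis)
    then show ?thesis unfolding B by (simp add: inner_axis)
  qed
  finally show "emeasure (distr (lborel \<Otimes>\<^sub>M lborel) borel (\<lambda>p. vector [fst p, snd p])) (box l u) = (\<Prod>b\<in>Basis. (u - l) \<bullet> b)" .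
qed simp

lemma integral_plane:
  fixes f :: "real^2 \<Rightarrow> complex"
  assumes "f \<in> borel_measurable borel"
  shows "(LINT x|lborel. f x) = (LINT p|(lborel \<Otimes>\<^sub>M lborel). f (vector [fst p, snd p]))"
    and "(LINT x|lborel. f x) = (LINT p|(lborel \<Otimes>\<^sub>M lborel). f (vector [snd p, fst p]))"
proof -
  have m: "(\<lambda>p. vector [fst p, snd p] :: real^2) \<in> lborel \<Otimes>\<^sub>M lborel \<rightarrow>\<^sub>M borel"
  proof -
    have "(\<lambda>p. vector [fst p, snd p] :: real^2) \<in> borel_measurable (borel :: (real \<times> real) measure)"
      by (intro borel_measurable_continuous_onI continuous_intros)
    then show ?thesis by (simp add: lborel_prod)
  qed
  show 1: "(LINT x|lborel. f x) = (LINT p|(lborel \<Otimes>\<^sub>M lborel). f (vector [fst p, snd p]))"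
    by (subst lborel_plane) (rule integral_distr[OF m assms])
  show "(LINT x|lborel. f x) = (LINT p|(lborel \<Otimes>\<^sub>M lborel). f (vector [snd p, fst p]))"
    unfolding 1 using lborel_pair.integral_product_swap[of "\<lambda>p. f (vector [fst p, snd p])"] m assms
    by (auto simp: case_prod_unfold measurable_compose[OF m])
qed

lemma grad_along_axis:
  assumes "F differentiable (at (x + b *\<^sub>R axis j 1))"
  shows "((\<lambda>b. F (x + b *\<^sub>R axis j 1)) has_vector_derivative grad F (x + b *\<^sub>R axis j 1) $ j) (at b)"
proof -
  have "((\<lambda>b. F (x + b *\<^sub>R axis j 1)) has_derivative
      (\<lambda>h. \<Sum>i\<in>UNIV. ((h *\<^sub>R axis j 1) $ i) *\<^sub>R grad F (x + b *\<^sub>R axis j 1) $ i)) (at b)"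
    by (rule has_derivative_compose[of "\<lambda>b. x + b *\<^sub>R axis j 1" "\<lambda>h. h *\<^sub>R axis j 1" b UNIV F, OF _ has_derivative_grad[OF assms]])
       (auto intro!: derivative_eq_intros)
  then show ?thesis
    unfolding has_vector_derivative_def
    by (rule has_derivative_eq_rhs) (simp add: axis_def if_distrib if_distribR cong: if_cong)
qed

text \<open>Integrating along vertical chords gives the component \<open>sin \<theta>\<close> of the normal; the other
  component follows by reflecting the plane at the diagonal.\<close>

proposition disk_divergence:
  fixes F :: "real^2 \<Rightarrow> complex"
  assumes F: "smooth F" and R: "R > 0"
  shows "(LINT x|lborel. indicator (cball 0 R) x *\<^sub>R grad F x $ 2) = of_real R * (LINT \<theta>|circ. F (polar R \<theta>) * of_real (sin \<theta>))"
    and "(LINT x|lborel. indicator (cball 0 R) x *\<^sub>R grad F x $ 1) = of_real R * (LINT \<theta>|circ. F (polar R \<theta>) * of_real (cos \<theta>))"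
proof -
  have Fc: "continuous_on S (\<lambda>x. F (u x))" if "continuous_on S u" for S :: "'b::t2_space set" and u
    using continuous_on_compose2[OF smooth_continuous[OF F] that] by auto
  have Gc: "continuous_on S (\<lambda>x. grad F (u x) $ j)" if "continuous_on S u" for S :: "'b::t2_space set" and u j
    using continuous_on_compose2[OF smooth_continuous[OF smooth_grad[OF F, of j]] that] by auto
  have m: "(\<lambda>x. indicator (cball 0 R) x *\<^sub>R grad F x $ j) \<in> borel_measurable borel" for j
    using smooth_continuous[OF smooth_grad[OF F, of j]]
    by (intro borel_measurable_scaleR borel_measurable_indicator borel_measurable_continuous_onI) auto
  have mem: "vector [a, b] \<in> cball (0::real^2) R \<longleftrightarrow> (a, b) \<in> cball 0 R"
    "vector [b, a] \<in> cball (0::real^2) R \<longleftrightarrow> (a, b) \<in> cball 0 R" for a b :: real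
    by (simp_all add: norm_Pair norm_vec_def L2_set_def sum_2 add.commute)
  have ind: "indicator (cball 0 R) (vector [a, b] :: real^2) = (indicator (cball 0 R) (a, b) :: real)" for a b :: real
    unfolding indicator_def mem(1) by (rule refl)
  have ind': "indicator (cball 0 R) (vector [b, a] :: real^2) = (indicator (cball 0 R) (a, b) :: real)" for a b :: real
    unfolding indicator_def mem(2) by (rule refl)
  have "(LINT x|lborel. indicator (cball 0 R) x *\<^sub>R grad F x $ 2)
      = (LINT p|(lborel \<Otimes>\<^sub>M lborel). indicator (cball 0 R) p *\<^sub>R grad F (vector [fst p, snd p]) $ 2)"
    unfolding integral_plane(1)[OF m] by (simp only: ind prod.collapse)
  also have "\<dots> = of_real R * (LINT \<theta>|circ. F (vector [R * cos \<theta>, R * sin \<theta>]) * of_real (sin \<theta>))"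
  proof (rule disk_vertical_divergence[OF _ _ _ R])
    show "((\<lambda>b. F (vector [a, b])) has_vector_derivative grad F (vector [a, b]) $ 2) (at b)" for a b
      unfolding vector_axis by (rule grad_along_axis[OF smooth_differentiable[OF F]])
  qed (intro Fc Gc continuous_intros)+
  finally show "(LINT x|lborel. indicator (cball 0 R) x *\<^sub>R grad F x $ 2) = of_real R * (LINT \<theta>|circ. F (polar R \<theta>) * of_real (sin \<theta>))"
    by (simp add: polar_def)
  define \<Psi> where "\<Psi> \<theta> = F (polar R \<theta>) * of_real (cos \<theta>)" for \<theta>
  have \<Psi>c: "continuous_on UNIV \<Psi>" unfolding \<Psi>_def by (intro continuous_intros Fc)
  have \<Psi>c': "continuous_on S (\<lambda>x. \<Psi> (u x))" if "continuous_on S u" for S and u :: "real \<Rightarrow> real"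
    using continuous_on_compose2[OF \<Psi>c that] by auto
  have per: "\<Psi> (x + 2*pi) = \<Psi> x" for x by (simp add: \<Psi>_def polar_periodic)
  have "(LINT x|lborel. indicator (cball 0 R) x *\<^sub>R grad F x $ 1)
      = (LINT p|(lborel \<Otimes>\<^sub>M lborel). indicator (cball 0 R) p *\<^sub>R grad F (vector [snd p, fst p]) $ 1)"
    unfolding integral_plane(2)[OF m] by (simp only: ind' prod.collapse)
  also have "\<dots> = of_real R * (LINT \<theta>|circ. F (vector [R * sin \<theta>, R * cos \<theta>]) * of_real (sin \<theta>))"
  proof (rule disk_vertical_divergence[OF _ _ _ R])
    show "((\<lambda>b. F (vector [b, a])) has_vector_derivative grad F (vector [b, a]) $ 1) (at b)" for a b
      unfolding vector_axis add.commute[of "_ *\<^sub>R axis 1 1"] by (rule grad_along_axis[OF smooth_differentiable[OF F]])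
  qed (intro Fc Gc continuous_intros)+
  also have "(LINT \<theta>|circ. F (vector [R * sin \<theta>, R * cos \<theta>]) * of_real (sin \<theta>)) = (LINT \<theta>|circ. \<Psi> (pi/2 - \<theta>))"
    by (simp add: \<Psi>_def polar_def cos_diff sin_diff)
  also have "\<dots> = integral {0..2*pi} (\<lambda>\<theta>. \<Psi> (pi/2 - \<theta>))"
    unfolding circ_integral[symmetric]
    by (intro set_borel_integral_eq_integral borel_integrable_atLeastAtMost' \<Psi>c' continuous_intros)
  also have "\<dots> = integral {-(3*pi/2)..pi/2} \<Psi>"
  proof -
    have "((\<lambda>\<theta>. (-1) *\<^sub>R \<Psi> (pi/2 - \<theta>)) has_integral
        (integral {pi/2 - 0..pi/2 - 2*pi} \<Psi> - integral {pi/2 - 2*pi..pi/2 - 0} \<Psi>)) {0..2*pi}"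
      by (rule has_integral_substitution_general[of "{}" 0 "2*pi" "\<lambda>x. pi/2 - x" "-(3*pi/2)" "pi/2"])
         (auto intro!: derivative_eq_intros continuous_intros \<Psi>c' continuous_on_id)
    from integral_unique[OF this]
    have "integral {0..2*pi} (\<lambda>\<theta>. - \<Psi> (pi/2 - \<theta>))
        = integral {pi/2 - 0..pi/2 - 2*pi} \<Psi> - integral {pi/2 - 2*pi..pi/2 - 0} \<Psi>"
      by (simp only: scaleR_minus1_left)
    moreover have "integral {pi/2 - 0..pi/2 - 2*pi} \<Psi> = 0" by simp
    moreover have "pi/2 - 2*pi = -(3*pi/2)" "pi/2 - 0 = pi/2" by simp_all
    ultimately have "- integral {0..2*pi} (\<lambda>\<theta>. \<Psi> (pi/2 - \<theta>)) = - integral {-(3*pi/2)..pi/2} \<Psi>"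
      by (simp only: integral_neg) simp
    then show ?thesis by simp
  qed
  also have "\<dots> = (LINT \<theta>|circ. \<Psi> (\<theta> + pi/2))"
  proof -
    have shift: "(\<lambda>\<theta>. \<Psi> (\<theta> + pi/2)) = \<Psi> \<circ> (\<lambda>x. x + (- (3*pi/2)))"
    proof
      fix \<theta>
      have "\<Psi> (\<theta> + (- (3*pi/2)) + 2*pi) = \<Psi> (\<theta> + (- (3*pi/2)))" by (rule per)
      moreover have "\<theta> + (- (3*pi/2)) + 2*pi = \<theta> + pi/2" by simp
      ultimately show "\<Psi> (\<theta> + pi/2) = (\<Psi> \<circ> (\<lambda>x. x + (- (3*pi/2)))) \<theta>" by (simp only: o_def)
    qed
    have "(LINT \<theta>|circ. \<Psi> (\<theta> + pi/2)) = integral {0..2*pi} (\<lambda>\<theta>. \<Psi> (\<theta> + pi/2))"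
      unfolding circ_integral[symmetric]
      by (intro set_borel_integral_eq_integral borel_integrable_atLeastAtMost' \<Psi>c' continuous_intros)
    also have "\<dots> = integral {0 + (- (3*pi/2))..2*pi + (- (3*pi/2))} \<Psi>"
      unfolding shift by (rule integral_shift) (rule continuous_on_subset[OF \<Psi>c], simp)
    also have "\<dots> = integral {-(3*pi/2)..pi/2} \<Psi>" by simp
    finally show ?thesis by (rule sym)
  qed
  also have "\<dots> = (LINT \<theta>|circ. \<Psi> \<theta>)"
    by (rule integral_circ_shift[OF borel_measurable_continuous_onI[OF \<Psi>c] per L2_integrable[OF finite_measure_circ circ_continuous_L2[OF \<Psi>c]]]) auto
  finally show "(LINT x|lborel. indicator (cball 0 R) x *\<^sub>R grad F x $ 1) = of_real R * (LINT \<theta>|circ. F (polar R \<theta>) * of_real (cos \<theta>))"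
    by (simp add: \<Psi>_def)
qed

section \<open>Unique continuation for smooth solutions\<close>

text \<open>Gronwall's argument for the energy \<open>|a|\<^sup>2 + |b|\<^sup>2\<close>.\<close>

lemma second_order_ode_zero:
  fixes a b d :: "real \<Rightarrow> complex"
  assumes a: "\<And>r. r \<in> {s..t} \<Longrightarrow> (a has_vector_derivative b r) (at r)"
    and b: "\<And>r. r \<in> {s..t} \<Longrightarrow> (b has_vector_derivative d r) (at r)"
    and bound: "\<And>r. r \<in> {s..t} \<Longrightarrow> norm (d r) \<le> K * (norm (a r) + norm (b r))"
    and init: "a s = 0" "b s = 0" and st: "s \<le> t" and K: "K \<ge> 0"
  shows "a t = 0"
proof -
  define M where "M = 1 + 3 * K"
  define E where "E r = a r \<bullet> a r + b r \<bullet> b r" for r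
  have sq: "2 * x * y \<le> x * x + y * y" for x y :: real
    using sum_squares_bound[of x y] by (simp add: power2_eq_square)
  have "exp (- M * t) * E t \<le> exp (- M * s) * E s"
  proof (rule DERIV_nonpos_imp_nonincreasing[OF st])
    fix r assume r: "s \<le> r" "r \<le> t"
    then have r': "r \<in> {s..t}" by simp
    have D: "((\<lambda>r. exp (- M * r) * E r) has_real_derivative
        exp (- M * r) * (2 * (a r \<bullet> b r) + 2 * (b r \<bullet> d r)) + (- M * exp (- M * r)) * E r) (at r)"
    proof -
      have "(E has_real_derivative (a r \<bullet> b r + b r \<bullet> a r) + (b r \<bullet> d r + d r \<bullet> b r)) (at r)"
        unfolding E_def has_real_derivative_iff_has_vector_derivative
        by (intro has_vector_derivative_add bounded_bilinear.has_vector_derivative[OF bounded_bilinear_inner] a b r')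
      then show ?thesis
        by (auto intro!: derivative_eq_intros simp: inner_commute)
    qed
    have "a r \<bullet> b r \<le> norm (a r) * norm (b r)" by (rule norm_cauchy_schwarz)
    moreover have "b r \<bullet> d r \<le> norm (b r) * (K * (norm (a r) + norm (b r)))"
      using norm_cauchy_schwarz[of "b r" "d r"] mult_left_mono[OF bound[OF r'] norm_ge_zero[of "b r"]] by linarith
    moreover have "E r = norm (a r) * norm (a r) + norm (b r) * norm (b r)"
      by (simp add: E_def power2_norm_eq_inner[symmetric] power2_eq_square)
    moreover have "2 * norm (a r) * norm (b r) \<le> norm (a r) * norm (a r) + norm (b r) * norm (b r)" by (rule sq)
    moreover have "K * (2 * norm (a r) * norm (b r)) \<le> K * (norm (a r) * norm (a r) + norm (b r) * norm (b r))"
      by (rule mult_left_mono[OF sq K])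
    moreover have "K * (norm (a r) * norm (a r)) \<ge> 0" using K by simp
    ultimately have "2 * (a r \<bullet> b r) + 2 * (b r \<bullet> d r) - M * E r \<le> 0"
      unfolding M_def by (simp add: algebra_simps)
    then have "exp (- M * r) * (2 * (a r \<bullet> b r) + 2 * (b r \<bullet> d r) - M * E r) \<le> 0"
      by (simp add: mult_nonneg_nonpos)
    with D show "\<exists>y. ((\<lambda>r. exp (- M * r) * E r) has_real_derivative y) (at r) \<and> y \<le> 0"
      by (auto intro!: exI simp: algebra_simps)
  qed
  then have "E t \<le> 0" using init by (simp add: E_def mult_le_0_iff)
  then have "a t \<bullet> a t \<le> 0" using inner_ge_zero[of "b t"] by (simp add: E_def del: inner_ge_zero)
  then show ?thesis by (metis inner_ge_zero antisym inner_eq_zero_iff)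
qed

lemma polar_radial_derivative:
  assumes "U differentiable (at (x0 + polar r \<theta>))"
  shows "((\<lambda>r. U (x0 + polar r \<theta>)) has_vector_derivative
     of_real (cos \<theta>) * grad U (x0 + polar r \<theta>) $ 1 + of_real (sin \<theta>) * grad U (x0 + polar r \<theta>) $ 2) (at r)"
proof -
  have "((\<lambda>r. x0 + polar r \<theta>) has_derivative (\<lambda>h. (h * cos \<theta>) *\<^sub>R axis 1 1 + (h * sin \<theta>) *\<^sub>R axis 2 1)) (at r)"
    unfolding polar_axis by (auto intro!: derivative_eq_intros)
  from has_derivative_compose[OF this has_derivative_grad[OF assms]]
  show ?thesis unfolding has_vector_derivative_def
    by (rule has_derivative_eq_rhs) (simp add: sum_2 axis_def scaleR_conv_of_real[where 'a=complex] algebra_simps)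
qed

lemma polar_angular_derivative:
  assumes "U differentiable (at (x0 + polar r \<theta>))"
  shows "((\<lambda>\<theta>. U (x0 + polar r \<theta>)) has_vector_derivative
     of_real r * (- of_real (sin \<theta>) * grad U (x0 + polar r \<theta>) $ 1 + of_real (cos \<theta>) * grad U (x0 + polar r \<theta>) $ 2)) (at \<theta>)"
proof -
  have "((\<lambda>\<theta>. x0 + polar r \<theta>) has_derivative (\<lambda>h. (- r * sin \<theta> * h) *\<^sub>R axis 1 1 + (r * cos \<theta> * h) *\<^sub>R axis 2 1)) (at \<theta>)"
    unfolding polar_axis by (auto intro!: derivative_eq_intros simp: mult_ac)
  from has_derivative_compose[OF this has_derivative_grad[OF assms]]
  show ?thesis unfolding has_vector_derivative_def
    by (rule has_derivative_eq_rhs) (simp add: sum_2 axis_def scaleR_conv_of_real[where 'a=complex] algebra_simps)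
qed

lemma cis_vector_derivative:
  "((\<lambda>\<theta>. cis (c * \<theta>)) has_vector_derivative \<i> * of_real c * cis (c * \<theta>)) (at \<theta>)"
proof -
  have "((\<lambda>z. exp (\<i> * of_real c * z)) has_field_derivative \<i> * of_real c * exp (\<i> * of_real c * of_real \<theta>)) (at (of_real \<theta>))"
    by (auto intro!: derivative_eq_intros)
  from has_vector_derivative_real_field[OF this, of UNIV] show ?thesis
    by (simp add: cis_conv_exp mult.assoc)
qed

lemma continuous_polar_joint [continuous_intros]:
  fixes f g :: "'a::t2_space \<Rightarrow> real"
  shows "continuous_on S f \<Longrightarrow> continuous_on S g \<Longrightarrow> continuous_on S (\<lambda>x. polar (f x) (g x))"
  unfolding polar_axis by (intro continuous_intros)

text \<open>The mode \<open>a s\<close> satisfies Bessel's equation \<open>s\<^sup>2 a'' + s a' + (c s\<^sup>2 - n\<^sup>2) a = 0\<close>.  It is regular away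
  from the centre, and at \<open>s = \<epsilon> / 2\<close> the mode vanishes together with its derivative.\<close>

lemma helmholtz_mode_zero:
  fixes U :: "real^2 \<Rightarrow> complex"
  assumes U: "smooth U" and pde: "\<And>x. x \<in> ball x0 \<rho> \<Longrightarrow> laplacian U x + c * U x = 0"
    and zero: "\<And>x. x \<in> ball x0 \<epsilon> \<Longrightarrow> U x = 0" and \<epsilon>: "0 < \<epsilon>" and r: "0 < r" "r < \<rho>"
  shows "integral {0..2*pi} (\<lambda>\<theta>. U (x0 + polar r \<theta>) * cis (of_int n * \<theta>)) = 0"
proof -
  define V where "V s \<theta> = U (x0 + polar s \<theta>)" for s \<theta>
  define P where "P i s \<theta> = grad U (x0 + polar s \<theta>) $ i" for i s \<theta>
  define Q where "Q i j s \<theta> = grad (\<lambda>x. grad U x $ i) (x0 + polar s \<theta>) $ j" for i j s \<theta>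
  define Vr where "Vr s \<theta> = of_real (cos \<theta>) * P 1 s \<theta> + of_real (sin \<theta>) * P 2 s \<theta>" for s \<theta>
  define Vrr where "Vrr s \<theta> = of_real (cos \<theta>) * (of_real (cos \<theta>) * Q 1 1 s \<theta> + of_real (sin \<theta>) * Q 1 2 s \<theta>)
      + of_real (sin \<theta>) * (of_real (cos \<theta>) * Q 2 1 s \<theta> + of_real (sin \<theta>) * Q 2 2 s \<theta>)" for s \<theta>
  define Vt where "Vt s \<theta> = of_real s * (- of_real (sin \<theta>) * P 1 s \<theta> + of_real (cos \<theta>) * P 2 s \<theta>)" for s \<theta>
  define Vtt where "Vtt s \<theta> = of_real s * (- of_real (cos \<theta>) * P 1 s \<theta> - of_real (sin \<theta>) * P 2 s \<theta>)
      + of_real s * of_real s * (of_real (sin \<theta>) * of_real (sin \<theta>) * Q 1 1 s \<theta>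
         - of_real (sin \<theta>) * of_real (cos \<theta>) * (Q 1 2 s \<theta> + Q 2 1 s \<theta>)
         + of_real (cos \<theta>) * of_real (cos \<theta>) * Q 2 2 s \<theta>)" for s \<theta>
  define e where "e \<theta> = cis (of_int n * \<theta>)" for \<theta>
  have smP: "smooth (\<lambda>x. grad U x $ i)" for i by (rule smooth_grad[OF U])
  have smQ: "smooth (\<lambda>x. grad (\<lambda>x. grad U x $ i) x $ j)" for i j by (rule smooth_grad[OF smP])
  have ec[continuous_intros]: "continuous_on S (\<lambda>x. e (g x))" if "continuous_on S g" for S :: "'b::t2_space set" and g
    unfolding e_def using that by (intro continuous_intros)
  have Vc[continuous_intros]: "continuous_on S (\<lambda>x. V (f x) (g x))"
    if "continuous_on S f" "continuous_on S g" for S :: "'b::t2_space set" and f g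
    unfolding V_def by (rule continuous_on_compose2[OF smooth_continuous[OF U]]) (auto intro!: continuous_intros that)
  have Pc[continuous_intros]: "continuous_on S (\<lambda>x. P i (f x) (g x))"
    if "continuous_on S f" "continuous_on S g" for S :: "'b::t2_space set" and f g i
    unfolding P_def by (rule continuous_on_compose2[OF smooth_continuous[OF smP]]) (auto intro!: continuous_intros that)
  have Qc[continuous_intros]: "continuous_on S (\<lambda>x. Q i j (f x) (g x))"
    if "continuous_on S f" "continuous_on S g" for S :: "'b::t2_space set" and f g i j
    unfolding Q_def by (rule continuous_on_compose2[OF smooth_continuous[OF smQ]]) (auto intro!: continuous_intros that)
  have dV: "((\<lambda>s. V s \<theta>) has_vector_derivative Vr s \<theta>) (at s)" for s \<theta>
    unfolding V_def Vr_def P_def by (rule polar_radial_derivative[OF smooth_differentiable[OF U]])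
  have dP: "((\<lambda>s. P i s \<theta>) has_vector_derivative of_real (cos \<theta>) * Q i 1 s \<theta> + of_real (sin \<theta>) * Q i 2 s \<theta>) (at s)" for i s \<theta>
    unfolding Q_def P_def by (rule polar_radial_derivative[OF smooth_differentiable[OF smP]])
  have dVr: "((\<lambda>s. Vr s \<theta>) has_vector_derivative Vrr s \<theta>) (at s)" for s \<theta>
    unfolding Vr_def Vrr_def
    by (intro has_vector_derivative_add has_vector_derivative_mult_right dP)
  have tV: "((\<lambda>\<theta>. V s \<theta>) has_vector_derivative Vt s \<theta>) (at \<theta>)" for s \<theta>
    unfolding V_def Vt_def P_def by (rule polar_angular_derivative[OF smooth_differentiable[OF U]])
  have tP: "((\<lambda>\<theta>. P i s \<theta>) has_vector_derivative of_real s * (- of_real (sin \<theta>) * Q i 1 s \<theta> + of_real (cos \<theta>) * Q i 2 s \<theta>)) (at \<theta>)" for i s \<theta>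
    unfolding Q_def P_def by (rule polar_angular_derivative[OF smooth_differentiable[OF smP]])
  have tVt: "((\<lambda>\<theta>. Vt s \<theta>) has_vector_derivative Vtt s \<theta>) (at \<theta>)" for s \<theta>
  proof -
    have sc: "((\<lambda>\<theta>. - complex_of_real (sin \<theta>)) has_vector_derivative - of_real (cos \<theta>)) (at \<theta>)"
      "((\<lambda>\<theta>. complex_of_real (cos \<theta>)) has_vector_derivative of_real (- sin \<theta>)) (at \<theta>)"
      by (intro has_vector_derivative_minus has_vector_derivative_of_real,
          auto intro!: derivative_eq_intros simp: has_real_derivative_iff_has_vector_derivative[symmetric])+
    have "((\<lambda>\<theta>. Vt s \<theta>) has_vector_derivative of_real s *
        ((- of_real (sin \<theta>) * (of_real s * (- of_real (sin \<theta>) * Q 1 1 s \<theta> + of_real (cos \<theta>) * Q 1 2 s \<theta>)) + - of_real (cos \<theta>) * P 1 s \<theta>)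
        + (of_real (cos \<theta>) * (of_real s * (- of_real (sin \<theta>) * Q 2 1 s \<theta> + of_real (cos \<theta>) * Q 2 2 s \<theta>)) + of_real (- sin \<theta>) * P 2 s \<theta>))) (at \<theta>)"
      unfolding Vt_def
      by (intro has_vector_derivative_mult_right has_vector_derivative_add has_vector_derivative_mult tP sc)
    then show ?thesis
      by (rule has_vector_derivative_eq_rhs) (simp add: Vtt_def algebra_simps)
  qed
  \<comment> \<open>the Laplacian in polar coordinates; the mixed derivatives \<open>Q 1 2\<close> and \<open>Q 2 1\<close> cancel without being equal\<close>
  have polar_pde: "of_real s * of_real s * Vrr s \<theta> + of_real s * Vr s \<theta> + Vtt s \<theta> + c * (of_real s * of_real s * V s \<theta>) = 0"
    if s: "0 < s" "s < \<rho>" for s \<theta>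
  proof -
    have "x0 + polar s \<theta> \<in> ball x0 \<rho>" using s by (simp add: dist_norm norm_polar)
    from pde[OF this] have lap: "Q 1 1 s \<theta> + Q 2 2 s \<theta> + c * V s \<theta> = 0"
      by (simp add: laplacian_def sum_2 Q_def V_def)
    have trig: "complex_of_real (cos \<theta>) * of_real (cos \<theta>) + of_real (sin \<theta>) * of_real (sin \<theta>) = 1"
      using sin_cos_squared_add3[of \<theta>] by (metis of_real_1 of_real_add of_real_mult)
    show ?thesis unfolding Vrr_def Vr_def Vtt_def using lap trig by algebra
  qed
  \<comment> \<open>two integrations by parts over a period\<close>
  have angular: "integral {0..2*pi} (\<lambda>\<theta>. (Vtt s \<theta> + of_int n * of_int n * V s \<theta>) * e \<theta>) = 0" for s
  proof -
    define W where "W \<theta> = Vt s \<theta> * e \<theta> - \<i> * of_int n * (V s \<theta> * e \<theta>)" for \<theta>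
    have de: "(e has_vector_derivative \<i> * of_int n * e \<theta>) (at \<theta>)" for \<theta>
      using cis_vector_derivative[of "of_int n" \<theta>] by (simp add: e_def[abs_def])
    have "(W has_vector_derivative ((Vt s \<theta> * (\<i> * of_int n * e \<theta>) + Vtt s \<theta> * e \<theta>)
         - \<i> * of_int n * (V s \<theta> * (\<i> * of_int n * e \<theta>) + Vt s \<theta> * e \<theta>))) (at \<theta>)" for \<theta>
      unfolding W_def by (intro has_vector_derivative_diff has_vector_derivative_mult_right has_vector_derivative_mult tV tVt de)
    moreover have "(Vt s \<theta> * (\<i> * of_int n * e \<theta>) + Vtt s \<theta> * e \<theta>)
         - \<i> * of_int n * (V s \<theta> * (\<i> * of_int n * e \<theta>) + Vt s \<theta> * e \<theta>) = (Vtt s \<theta> + of_int n * of_int n * V s \<theta>) * e \<theta>" for \<theta>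
      by (simp add: algebra_simps)
    ultimately have "(W has_vector_derivative (Vtt s \<theta> + of_int n * of_int n * V s \<theta>) * e \<theta>) (at \<theta>)" for \<theta> by simp
    then have "((\<lambda>\<theta>. (Vtt s \<theta> + of_int n * of_int n * V s \<theta>) * e \<theta>) has_integral W (2*pi) - W 0) {0..2*pi}"
      by (intro fundamental_theorem_of_calculus) (auto intro: has_vector_derivative_at_within)
    moreover have "W (2*pi) = W 0"
      using polar_periodic[of s 0] cis_int_periodic[of n 0] by (simp add: W_def Vt_def V_def P_def e_def)
    ultimately show ?thesis by (simp add: integral_unique)
  qed
  define a where "a s = integral (cbox 0 (2*pi)) (\<lambda>\<theta>. V s \<theta> * e \<theta>)" for s
  define b where "b s = integral (cbox 0 (2*pi)) (\<lambda>\<theta>. Vr s \<theta> * e \<theta>)" for s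
  define d where "d s = integral (cbox 0 (2*pi)) (\<lambda>\<theta>. Vrr s \<theta> * e \<theta>)" for s
  have da: "(a has_vector_derivative b s) (at s within UNIV)" for s
    unfolding a_def b_def
  proof (rule leibniz_rule_vector_derivative)
    show "((\<lambda>s. V s \<theta> * e \<theta>) has_vector_derivative Vr s \<theta> * e \<theta>) (at s within UNIV)" for s \<theta>
      using dV by (auto intro: has_vector_derivative_mult_left)
    show "continuous_on (UNIV \<times> cbox 0 (2*pi)) (\<lambda>(s, \<theta>). Vr s \<theta> * e \<theta>)"
      unfolding case_prod_unfold Vr_def by (intro continuous_intros)
    show "(\<lambda>\<theta>. V s \<theta> * e \<theta>) integrable_on cbox 0 (2*pi)" for s
      by (intro integrable_continuous continuous_intros)
  qed auto
  have db: "(b has_vector_derivative d s) (at s within UNIV)" for s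
    unfolding d_def b_def
  proof (rule leibniz_rule_vector_derivative)
    show "((\<lambda>s. Vr s \<theta> * e \<theta>) has_vector_derivative Vrr s \<theta> * e \<theta>) (at s within UNIV)" for s \<theta>
      using dVr by (auto intro: has_vector_derivative_mult_left)
    show "continuous_on (UNIV \<times> cbox 0 (2*pi)) (\<lambda>(s, \<theta>). Vrr s \<theta> * e \<theta>)"
      unfolding case_prod_unfold Vrr_def by (intro continuous_intros)
    show "(\<lambda>\<theta>. Vr s \<theta> * e \<theta>) integrable_on cbox 0 (2*pi)" for s
      unfolding Vr_def by (intro integrable_continuous continuous_intros)
  qed auto
  have ode: "of_real s * of_real s * d s + of_real s * b s + (c * of_real s * of_real s - of_int n * of_int n) * a s = 0"
    if s: "0 < s" "s < \<rho>" for s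
  proof -
    have i: "(\<lambda>\<theta>. V s \<theta> * e \<theta>) integrable_on {0..2*pi}" "(\<lambda>\<theta>. Vr s \<theta> * e \<theta>) integrable_on {0..2*pi}"
      "(\<lambda>\<theta>. Vrr s \<theta> * e \<theta>) integrable_on {0..2*pi}"
      unfolding Vr_def Vrr_def by (intro integrable_continuous_real continuous_intros)+
    have "of_real s * of_real s * d s + of_real s * b s + (c * of_real s * of_real s - of_int n * of_int n) * a s
       = integral {0..2*pi} (\<lambda>\<theta>. of_real s * of_real s * (Vrr s \<theta> * e \<theta>) + of_real s * (Vr s \<theta> * e \<theta>)
            + (c * of_real s * of_real s - of_int n * of_int n) * (V s \<theta> * e \<theta>))"
      unfolding a_def b_def d_def cbox_interval
      by (subst Henstock_Kurzweil_Integration.integral_add | subst integral_mult_right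
          | rule refl | intro integrable_add integrable_on_mult_right i)+
    also have "\<dots> = integral {0..2*pi} (\<lambda>\<theta>. - ((Vtt s \<theta> + of_int n * of_int n * V s \<theta>) * e \<theta>))"
    proof (rule Henstock_Kurzweil_Integration.integral_cong)
      fix \<theta>
      show "of_real s * of_real s * (Vrr s \<theta> * e \<theta>) + of_real s * (Vr s \<theta> * e \<theta>)
            + (c * of_real s * of_real s - of_int n * of_int n) * (V s \<theta> * e \<theta>)
          = - ((Vtt s \<theta> + of_int n * of_int n * V s \<theta>) * e \<theta>)"
        using polar_pde[OF s, of \<theta>] by algebra
    qed
    also have "\<dots> = 0" using angular[of s] by (simp only: integral_neg) simp
    finally show ?thesis .
  qed
  show ?thesis
  proof (cases "r < \<epsilon>")
    case True
    have "U (x0 + polar r \<theta>) = 0" for \<theta> using True r by (intro zero) (simp add: dist_norm norm_polar)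
    then show ?thesis by simp
  next
    case False
    define s where "s = \<epsilon> / 2"
    have s: "0 < s" "s < \<epsilon>" "s \<le> r" using \<epsilon> False by (auto simp: s_def)
    have "\<forall>t\<in>ball s s. a t = 0"
    proof
      fix t assume "t \<in> ball s s"
      then have "0 < t" "t < \<epsilon>" using s by (auto simp: dist_real_def s_def abs_if split: if_splits)
      then have "V t \<theta> = 0" for \<theta> unfolding V_def by (intro zero) (simp add: dist_norm norm_polar)
      then show "a t = 0" by (simp add: a_def)
    qed
    then have a0: "a t = 0" if "t \<in> ball s s" for t using that by blast
    have b0: "b s = 0"
    proof -
      have "((\<lambda>t. 0) has_vector_derivative b s) (at s)"
        by (rule has_vector_derivative_transform_within_open[of a _ _ "ball s s"]) (use da s a0 in auto)
      then show ?thesis using vector_derivative_unique_at[OF _ has_vector_derivative_const] by metis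
    qed
    define K where "K = 1 / s + norm c + of_int (n * n) / (s * s)"
    have "a r = 0"
    proof (rule second_order_ode_zero[of s r a b d K])
      fix t assume t: "t \<in> {s..r}"
      then have t0: "0 < t" "t < \<rho>" "s \<le> t" using s r by auto
      show "(a has_vector_derivative b t) (at t)" "(b has_vector_derivative d t) (at t)" using da db by auto
      have "d t = - (b t / of_real t) - (c - of_int (n * n) / (of_real t * of_real t)) * a t"
        using ode[OF t0(1,2)] t0(1) by (simp add: field_simps)
      then have "norm (d t) \<le> norm (b t / of_real t) + norm ((c - of_int (n * n) / (of_real t * of_real t)) * a t)"
        by (metis norm_minus_cancel norm_triangle_ineq4)
      also have "\<dots> \<le> (1 / s) * norm (b t) + (norm c + of_int (n * n) / (s * s)) * norm (a t)"
      proof (rule add_mono)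
        show "norm (b t / of_real t) \<le> (1 / s) * norm (b t)"
          using t0 s by (simp add: norm_divide divide_simps mult_left_mono)
        have "norm (c - of_int (n * n) / (of_real t * of_real t)) \<le> norm c + norm (of_int (n * n) / (of_real t * of_real t) :: complex)"
          by (rule norm_triangle_ineq4)
        also have "norm (of_int (n * n) / (of_real t * of_real t) :: complex) = of_int (n * n) / (t * t)"
          using t0 by (simp add: norm_divide norm_mult abs_mult_self_eq flip: of_int_mult)
        also have "of_int (n * n) / (t * t) \<le> (of_int (n * n) / (s * s) :: real)"
          using t0 s by (intro divide_left_mono mult_mono mult_pos_pos) auto
        finally show "norm ((c - of_int (n * n) / (of_real t * of_real t)) * a t) \<le> (norm c + of_int (n * n) / (s * s)) * norm (a t)"
          by (simp add: norm_mult mult_right_mono)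
      qed
      also have "\<dots> \<le> K * norm (b t) + K * norm (a t)"
        using s by (intro add_mono mult_right_mono) (auto simp: K_def)
      finally show "norm (d t) \<le> K * (norm (a t) + norm (b t))" by (simp add: algebra_simps)
    qed (use s a0 b0 in \<open>auto simp: K_def\<close>)
    then show ?thesis by (simp add: a_def V_def e_def)
  qed
qed

lemma polar_surj:
  obtains \<theta> where "\<theta> \<in> {0..2*pi}" "x = polar (norm x) \<theta>"
proof (cases "x = 0")
  case True
  then have "x = polar (norm x) 0" by (simp add: polar_def vec_eq_iff forall_2)
  then show ?thesis using that[of 0] by simp
next
  case False
  have n2: "(norm x)\<^sup>2 = (x $ 1)\<^sup>2 + (x $ 2)\<^sup>2"
    by (simp add: norm_vec_def L2_set_def sum_2)
  have "(x $ 1 / norm x)\<^sup>2 + (x $ 2 / norm x)\<^sup>2 = 1"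
  proof -
    have "(x $ 1 / norm x)\<^sup>2 + (x $ 2 / norm x)\<^sup>2 = ((x $ 1)\<^sup>2 + (x $ 2)\<^sup>2) / (norm x)\<^sup>2"
      by (simp add: power_divide add_divide_distrib)
    then show ?thesis using False by (simp only: n2[symmetric]) simp
  qed
  then obtain \<theta> where \<theta>: "0 \<le> \<theta>" "\<theta> < 2*pi" "x $ 1 / norm x = cos \<theta>" "x $ 2 / norm x = sin \<theta>"
    by (rule sincos_total_2pi)
  then have "x = polar (norm x) \<theta>"
    using False by (simp add: polar_def vec_eq_iff forall_2 flip: \<theta>(3,4))
  then show ?thesis using that[of \<theta>] \<theta> by auto
qed

text \<open>On each circle around \<open>x0\<close> all Fourier coefficients of \<open>U\<close> vanish, so \<open>U\<close> is orthogonal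
  to itself there.\<close>

proposition helmholtz_classical_continuation:
  fixes U :: "real^2 \<Rightarrow> complex"
  assumes U: "smooth U" and pde: "\<And>x. x \<in> ball x0 \<rho> \<Longrightarrow> laplacian U x + c * U x = 0"
    and zero: "\<And>x. x \<in> ball x0 \<epsilon> \<Longrightarrow> U x = 0" and \<epsilon>: "0 < \<epsilon>" and x: "x \<in> ball x0 \<rho>"
  shows "U x = 0"
proof (cases "x = x0")
  case True
  then show ?thesis using zero[of x0] \<epsilon> by simp
next
  case False
  define r where "r = norm (x - x0)"
  have r: "0 < r" "r < \<rho>" using False x by (auto simp: r_def dist_norm norm_minus_commute)
  define V where "V y = U (x0 + y)" for y
  have Vc: "continuous_on S (\<lambda>x. V (f x))" if "continuous_on S f" for S :: "'b::t2_space set" and f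
    unfolding V_def by (rule continuous_on_compose2[OF smooth_continuous[OF U]]) (auto intro!: continuous_intros that)
  have Vp: "continuous_on UNIV (\<lambda>\<theta>. V (polar r \<theta>))" by (intro Vc continuous_polar')
  have "circ_coeff (\<lambda>\<theta>. V (polar r \<theta>)) n = 0" for n
  proof -
    have "(LINT \<theta>|circ. V (polar r \<theta>) * cis (- of_int n * \<theta>)) = integral {0..2*pi} (\<lambda>\<theta>. V (polar r \<theta>) * cis (of_int (- n) * \<theta>))"
      unfolding circ_integral[symmetric]
      by (subst set_borel_integral_eq_integral(2))
         (auto intro!: borel_integrable_atLeastAtMost' continuous_intros Vc)
    also have "\<dots> = 0"
      unfolding V_def by (rule helmholtz_mode_zero[OF U pde zero \<epsilon> r])
    finally show ?thesis by (simp add: circ_coeff_def)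
  qed
  then have "(LINT \<theta>|circ. V (polar r \<theta>) * cnj (V (polar r \<theta>))) = 0"
    using r by (intro zero_coefficients_annihilate_continuous[where \<psi>="\<lambda>y. cnj (V y)"] Vc continuous_intros
        L2_integrable[OF finite_measure_circ circ_continuous_L2[OF Vp]]) auto
  then have "complex_of_real (LINT \<theta>|circ. (norm (V (polar r \<theta>)))\<^sup>2) = 0"
    unfolding integral_complex_of_real[symmetric] complex_norm_square .
  moreover have "(LINT \<theta>|circ. (norm (V (polar r \<theta>)))\<^sup>2) = integral {0..2*pi} (\<lambda>\<theta>. (norm (V (polar r \<theta>)))\<^sup>2)"
    unfolding circ_integral[symmetric]
    by (intro set_borel_integral_eq_integral borel_integrable_atLeastAtMost' continuous_intros Vc)
  ultimately have int0: "integral (cbox 0 (2*pi)) (\<lambda>\<theta>. (norm (V (polar r \<theta>)))\<^sup>2) = 0" by simp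
  have cont: "continuous_on (cbox 0 (2*pi)) (\<lambda>\<theta>. (norm (V (polar r \<theta>)))\<^sup>2)" by (intro continuous_intros Vc)
  have "box 0 (2*pi) \<noteq> {}" by (simp add: not_le)
  then have all: "\<forall>\<theta>\<in>cbox 0 (2*pi). (norm (V (polar r \<theta>)))\<^sup>2 = 0"
    using integral_cbox_eq_0_iff[OF cont] int0 by simp
  obtain \<theta> where "\<theta> \<in> {0..2*pi}" "x - x0 = polar r \<theta>"
    using polar_surj[of "x - x0"] by (auto simp: r_def)
  then have "V (x - x0) = 0" using all by auto
  then show ?thesis by (simp add: V_def)
qed

section \<open>Unique continuation for distributional solutions\<close>

lemma test_function_bounded:
  assumes "\<phi> \<in> test_functions S"
  obtains C where "C \<ge> 0" "\<And>x. norm (\<phi> x) \<le> C"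
proof -
  obtain T where T: "compact T" "T \<subseteq> S" "\<And>x. x \<notin> T \<Longrightarrow> \<phi> x = 0" "smooth \<phi>"
    using test_functionsE[OF assms] by blast
  have "compact (\<phi> ` T)"
    using T by (intro compact_continuous_image) (auto intro: continuous_on_subset[OF smooth_continuous])
  then have "bounded (\<phi> ` T)" by (rule compact_imp_bounded)
  then obtain C where "\<forall>y\<in>\<phi> ` T. norm y \<le> C" unfolding bounded_iff by blast
  then have "norm (\<phi> x) \<le> max C 0" for x using T(3)[of x] by (cases "x \<in> T") (auto intro: max.coboundedI1)
  from that[OF max.cobounded2 this] show ?thesis .
qed

text \<open>The uniform Taylor bound behind differentiation of \<open>translate_pairing\<close> below.\<close>

lemma test_function_second_order:
  assumes \<phi>: "\<phi> \<in> test_functions S"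
  obtains C where "C \<ge> 0"
    "\<And>x h. norm (\<phi> (x + h) - \<phi> x - (\<Sum>j\<in>UNIV. (h $ j) *\<^sub>R grad \<phi> x $ j)) \<le> C * (norm h)\<^sup>2"
proof -
  note sm = test_functions_smooth[OF \<phi>]
  have "\<exists>C\<ge>0. \<forall>x. norm (grad (\<lambda>x. grad \<phi> x $ i) x $ j) \<le> C" for i j
    using test_function_bounded[OF test_functions_grad[OF test_functions_grad[OF \<phi>]], of i j] by metis
  then obtain B where B: "\<And>i j. B i j \<ge> 0" "\<And>i j x. norm (grad (\<lambda>x. grad \<phi> x $ i) x $ j) \<le> B i j"
    by metis
  define C where "C = (\<Sum>i\<in>UNIV. \<Sum>j\<in>UNIV. B i j)"
  have C: "B i j \<le> C" for i j
    unfolding C_def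
    by (rule order_trans[OF member_le_sum[of j UNIV "B i"] member_le_sum[of i UNIV "\<lambda>i. \<Sum>j\<in>UNIV. B i j"]])
       (auto intro: B sum_nonneg)
  have lip: "norm (grad \<phi> x $ i - grad \<phi> y $ i) \<le> 2 * C * norm (x - y)" for x y i
    by (rule smooth_lipschitz[OF smooth_grad[OF sm] convex_UNIV]) (auto intro: order_trans[OF B(2) C])
  have "norm (\<phi> (x + h) - \<phi> x - (\<Sum>j\<in>UNIV. (h $ j) *\<^sub>R grad \<phi> x $ j)) \<le> (4 * C) * (norm h)\<^sup>2" for x h
  proof -
    define G where "G k = \<phi> (x + k) - (\<Sum>j\<in>UNIV. (k $ j) *\<^sub>R grad \<phi> x $ j)" for k
    have "norm (G h - G 0) \<le> (4 * C * norm h) * norm (h - 0)"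
    proof (rule differentiable_bound[where S="cball 0 (norm h)"
          and f'="\<lambda>k l. (\<Sum>j\<in>UNIV. (l $ j) *\<^sub>R grad \<phi> (x + k) $ j) - (\<Sum>j\<in>UNIV. (l $ j) *\<^sub>R grad \<phi> x $ j)"])
      fix k :: "real^2" assume k: "k \<in> cball 0 (norm h)"
      have d1: "((\<lambda>k. \<phi> (x + k)) has_derivative (\<lambda>l. \<Sum>j\<in>UNIV. (l $ j) *\<^sub>R grad \<phi> (x + k) $ j)) (at k)"
        by (rule has_derivative_compose[of "\<lambda>k. x + k" "\<lambda>l. l" k UNIV \<phi>, OF _ has_derivative_grad[OF smooth_differentiable[OF sm]]])
           (auto intro!: derivative_eq_intros)
      have d2: "((\<lambda>k. \<Sum>j\<in>UNIV. (k $ j) *\<^sub>R grad \<phi> x $ j) has_derivative (\<lambda>l. \<Sum>j\<in>UNIV. (l $ j) *\<^sub>R grad \<phi> x $ j)) (at k)"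
        by (rule bounded_linear_imp_has_derivative)
           (intro bounded_linear_sum bounded_linear_scaleR_const bounded_linear_vec_nth)
      show "(G has_derivative (\<lambda>l. (\<Sum>j\<in>UNIV. (l $ j) *\<^sub>R grad \<phi> (x + k) $ j) - (\<Sum>j\<in>UNIV. (l $ j) *\<^sub>R grad \<phi> x $ j)))
          (at k within cball 0 (norm h))"
        unfolding G_def by (rule has_derivative_at_withinI[OF has_derivative_diff[OF d1 d2]])
      show "onorm (\<lambda>l. (\<Sum>j\<in>UNIV. (l $ j) *\<^sub>R grad \<phi> (x + k) $ j) - (\<Sum>j\<in>UNIV. (l $ j) *\<^sub>R grad \<phi> x $ j)) \<le> 4 * C * norm h"
      proof (rule onorm_le)
        fix l :: "real^2"
        have C0: "C \<ge> 0" using order_trans[OF B(1) C] .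
        have *: "norm (grad \<phi> (x + k) $ j - grad \<phi> x $ j) \<le> 2 * C * norm h" for j
          using lip[of "x + k" j x] k mult_left_mono[of "norm k" "norm h" "2 * C"] C0 by simp
        have "norm ((\<Sum>j\<in>UNIV. (l $ j) *\<^sub>R grad \<phi> (x + k) $ j) - (\<Sum>j\<in>UNIV. (l $ j) *\<^sub>R grad \<phi> x $ j))
            = norm ((l $ 1) *\<^sub>R (grad \<phi> (x + k) $ 1 - grad \<phi> x $ 1) + (l $ 2) *\<^sub>R (grad \<phi> (x + k) $ 2 - grad \<phi> x $ 2))"
          by (simp add: sum_2 algebra_simps)
        also have "\<dots> \<le> \<bar>l $ 1\<bar> * norm (grad \<phi> (x + k) $ 1 - grad \<phi> x $ 1) + \<bar>l $ 2\<bar> * norm (grad \<phi> (x + k) $ 2 - grad \<phi> x $ 2)"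
          by (rule order_trans[OF norm_triangle_ineq]) simp
        also have "\<dots> \<le> norm l * (2 * C * norm h) + norm l * (2 * C * norm h)"
          using * component_le_norm_cart[of l] by (intro add_mono mult_mono) auto
        finally show "norm ((\<Sum>j\<in>UNIV. (l $ j) *\<^sub>R grad \<phi> (x + k) $ j) - (\<Sum>j\<in>UNIV. (l $ j) *\<^sub>R grad \<phi> x $ j))
            \<le> 4 * C * norm h * norm l" by (simp add: algebra_simps)
      qed
    qed auto
    then show ?thesis by (simp add: G_def power2_eq_square algebra_simps)
  qed
  then show ?thesis using that[of "4 * C"] order_trans[OF B(1) C] by auto
qed

text \<open>Pairing an integrable function with the translates of a fixed test function gives a smooth function
  of the translation, which inherits every constant coefficient equation that the function solves
  in the sense of distributions.\<close>

definition translate_pairing :: "(real^2 \<Rightarrow> complex) \<Rightarrow> (real^2 \<Rightarrow> complex) \<Rightarrow> real^2 \<Rightarrow> complex" where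
  "translate_pairing u \<phi> z = (LINT y|lebesgue. u y * \<phi> (y - z))"

lemma smooth_lebesgue_measurable: "smooth f \<Longrightarrow> f \<in> borel_measurable lebesgue"
  by (intro measurable_completion) (simp add: borel_measurable_continuous_onI smooth_continuous)

lemma integrable_mult_test:
  assumes u: "integrable lebesgue u" and \<phi>: "smooth \<phi>" and C: "\<And>x. norm (\<phi> x) \<le> C"
  shows "integrable lebesgue (\<lambda>y. u y * \<phi> y)"
proof (rule Bochner_Integration.integrable_bound)
  show "integrable lebesgue (\<lambda>y. C * norm (u y))" using u by simp
  show "(\<lambda>y. u y * \<phi> y) \<in> borel_measurable lebesgue"
    by (intro borel_measurable_times borel_measurable_integrable[OF u] smooth_lebesgue_measurable \<phi>)
  have "norm (u y * \<phi> y) \<le> norm (C * norm (u y))" for y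
    using mult_left_mono[OF C[of y] norm_ge_zero[of "u y"]] abs_ge_self[of "C * norm (u y)"]
    by (simp add: norm_mult mult.commute)
  then show "AE y in lebesgue. norm (u y * \<phi> y) \<le> norm (C * norm (u y))" by simp
qed

lemma translate_integrable:
  assumes u: "integrable lebesgue u" and \<phi>: "\<phi> \<in> test_functions S"
  shows "integrable lebesgue (\<lambda>y. u y * \<phi> (y - z))"
proof -
  obtain C where "\<And>x. norm (\<phi> x) \<le> C" using test_function_bounded[OF \<phi>] by blast
  then show ?thesis
    by (intro integrable_mult_test[OF u smooth_translate[OF test_functions_smooth[OF \<phi>]], of _ C])
qed

lemma translate_pairing_derivative:
  assumes u: "integrable lebesgue u" and \<phi>: "\<phi> \<in> test_functions S"
  shows "(translate_pairing u \<phi> has_derivative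
    (\<lambda>h. \<Sum>j\<in>UNIV. (h $ j) *\<^sub>R - translate_pairing u (\<lambda>x. grad \<phi> x $ j) z)) (at z)"
proof -
  obtain C where C: "C \<ge> 0"
    "\<And>x h. norm (\<phi> (x + h) - \<phi> x - (\<Sum>j\<in>UNIV. (h $ j) *\<^sub>R grad \<phi> x $ j)) \<le> C * (norm h)\<^sup>2"
    using test_function_second_order[OF \<phi>] by blast
  define I where "I = (LINT y|lebesgue. norm (u y))"
  define D where "D h = (\<Sum>j\<in>UNIV. (h $ j) *\<^sub>R - translate_pairing u (\<lambda>x. grad \<phi> x $ j) z)" for h
  have bound: "norm (translate_pairing u \<phi> (z + h) - translate_pairing u \<phi> z - D h) \<le> C * (norm h)\<^sup>2 * I" for h
  proof -
    define \<psi> where "\<psi> y = \<phi> (y - z + - h) - \<phi> (y - z) - (\<Sum>j\<in>UNIV. ((- h) $ j) *\<^sub>R grad \<phi> (y - z) $ j)" for y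
    have i: "integrable lebesgue (\<lambda>y. u y * \<phi> (y - (z + h)))" "integrable lebesgue (\<lambda>y. u y * \<phi> (y - z))"
      "integrable lebesgue (\<lambda>y. (h $ j) *\<^sub>R (u y * grad \<phi> (y - z) $ j))" for j
      using translate_integrable[OF u \<phi>] translate_integrable[OF u test_functions_grad[OF \<phi>]] by auto
    have "translate_pairing u \<phi> (z + h) - translate_pairing u \<phi> z - D h
        = (LINT y|lebesgue. u y * \<phi> (y - (z + h)) - u y * \<phi> (y - z) + (\<Sum>j\<in>UNIV. (h $ j) *\<^sub>R (u y * grad \<phi> (y - z) $ j)))"
      unfolding translate_pairing_def D_def using i by (simp add: sum_negf)
    also have "\<dots> = (LINT y|lebesgue. u y * \<psi> y)"
      by (intro Bochner_Integration.integral_cong refl)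
         (simp add: \<psi>_def sum_2 scaleR_conv_of_real[where 'a=complex] algebra_simps)
    finally have eq: "translate_pairing u \<phi> (z + h) - translate_pairing u \<phi> z - D h = (LINT y|lebesgue. u y * \<psi> y)" .
    have sm: "smooth \<psi>"
    proof -
      have "\<psi> = (\<lambda>y. \<phi> (y - (z + h)) - \<phi> (y - z) - (\<Sum>j\<in>UNIV. of_real (- h $ j) * grad \<phi> (y - z) $ j))"
        by (simp add: \<psi>_def fun_eq_iff scaleR_conv_of_real[where 'a=complex] algebra_simps)
      then show ?thesis
        by (simp only:) (intro smooth_diff smooth_sum smooth_mult smooth_const
          smooth_translate[OF test_functions_smooth[OF \<phi>]] smooth_translate[OF smooth_grad[OF test_functions_smooth[OF \<phi>]]])
    qed
    have \<psi>: "norm (\<psi> y) \<le> C * (norm h)\<^sup>2" for y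
      unfolding \<psi>_def using C(2)[of "y - z" "- h"] by simp
    have "norm (LINT y|lebesgue. u y * \<psi> y) \<le> (LINT y|lebesgue. norm (u y) * (C * (norm h)\<^sup>2))"
    proof (rule Bochner_Integration.integral_norm_bound_integral)
      show "integrable lebesgue (\<lambda>y. u y * \<psi> y)" by (rule integrable_mult_test[OF u sm \<psi>])
      show "norm (u y * \<psi> y) \<le> norm (u y) * (C * (norm h)\<^sup>2)" for y
        using \<psi> by (simp add: norm_mult mult_left_mono)
    qed (use u in auto)
    then show ?thesis unfolding eq by (simp add: I_def mult.commute)
  qed
  have "(translate_pairing u \<phi> has_derivative D) (at z)"
    unfolding has_derivative_at
  proof
    show "bounded_linear D"
      unfolding D_def by (intro bounded_linear_sum bounded_linear_scaleR_const bounded_linear_vec_nth)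
    show "(\<lambda>h. norm (translate_pairing u \<phi> (z + h) - translate_pairing u \<phi> z - D h) / norm h) \<midarrow>0\<rightarrow> 0"
    proof (rule Lim_null_comparison)
      have "norm (norm (translate_pairing u \<phi> (z + h) - translate_pairing u \<phi> z - D h) / norm h) \<le> C * I * norm h"
        if "h \<noteq> 0" for h
        using bound[of h] that by (simp add: power2_eq_square divide_le_eq mult_ac)
      then show "\<forall>\<^sub>F h in at 0. norm (norm (translate_pairing u \<phi> (z + h) - translate_pairing u \<phi> z - D h) / norm h) \<le> C * I * norm h"
        by (auto simp: eventually_at intro!: exI[of _ 1])
      show "((\<lambda>h. C * I * norm h) \<longlongrightarrow> 0) (at 0)" by (auto intro!: tendsto_eq_intros)
    qed
  qed
  then show ?thesis by (simp add: D_def[abs_def])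
qed

lemma grad_translate_pairing:
  assumes "integrable lebesgue u" and "\<phi> \<in> test_functions S"
  shows "grad (translate_pairing u \<phi>) z $ j = - translate_pairing u (\<lambda>x. grad \<phi> x $ j) z"
  using grad_eq[OF translate_pairing_derivative[OF assms, of z], of j]
  by (simp add: axis_def if_distrib if_distribR cong: if_cong)

lemma smooth_translate_pairing:
  assumes u: "integrable lebesgue u" and \<phi>: "\<phi> \<in> test_functions S"
  shows "smooth (translate_pairing u \<phi>)"
proof -
  have "Ck k (translate_pairing u \<phi>)" if "\<phi> \<in> test_functions S" for k \<phi>
    using that
  proof (induction k arbitrary: \<phi>)
    case 0
    show ?case unfolding Ck.simps
      by (intro continuous_at_imp_continuous_on ballI has_derivative_continuous[OF translate_pairing_derivative[OF u 0]])
  next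
    case (Suc k)
    have "Ck k (\<lambda>z. - 1 * translate_pairing u (\<lambda>x. grad \<phi> x $ j) z)" for j
      by (intro Ck_mult Ck_const Suc.IH test_functions_grad Suc.prems)
    then show ?case
      using translate_pairing_derivative[OF u Suc.prems]
      by (auto simp: differentiable_def grad_translate_pairing[OF u Suc.prems])
  qed
  then show ?thesis using \<phi> by (simp add: smooth_def)
qed

lemma laplacian_translate_pairing:
  assumes u: "integrable lebesgue u" and \<phi>: "\<phi> \<in> test_functions S"
  shows "laplacian (translate_pairing u \<phi>) z + c * translate_pairing u \<phi> z
    = (LINT y|lebesgue. u y * (laplacian \<phi> (y - z) + c * \<phi> (y - z)))"
proof -
  have "grad (\<lambda>y. grad (translate_pairing u \<phi>) y $ j) z $ j = translate_pairing u (\<lambda>x. grad (\<lambda>x. grad \<phi> x $ j) x $ j) z" for j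
  proof -
    have "(\<lambda>y. grad (translate_pairing u \<phi>) y $ j) = (\<lambda>y. (- 1) * translate_pairing u (\<lambda>x. grad \<phi> x $ j) y)"
      by (simp add: grad_translate_pairing[OF u \<phi>])
    moreover have "grad (\<lambda>y. (- 1) * translate_pairing u (\<lambda>x. grad \<phi> x $ j) y) z $ j
        = (- 1) * grad (translate_pairing u (\<lambda>x. grad \<phi> x $ j)) z $ j + grad (\<lambda>_. - 1) z $ j * translate_pairing u (\<lambda>x. grad \<phi> x $ j) z"
      by (intro grad_mult smooth_differentiable smooth_const smooth_translate_pairing[OF u test_functions_grad[OF \<phi>]])
    moreover have "grad (\<lambda>_. - 1) z $ j = 0" by (simp add: grad_eq[OF has_derivative_const])
    ultimately show ?thesis by (simp add: grad_translate_pairing[OF u test_functions_grad[OF \<phi>]])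
  qed
  then have "laplacian (translate_pairing u \<phi>) z + c * translate_pairing u \<phi> z
     = translate_pairing u (\<lambda>x. grad (\<lambda>x. grad \<phi> x $ 1) x $ 1) z + translate_pairing u (\<lambda>x. grad (\<lambda>x. grad \<phi> x $ 2) x $ 2) z
       + c * translate_pairing u \<phi> z"
    by (simp add: laplacian_def sum_2)
  also have "\<dots> = (LINT y|lebesgue. u y * grad (\<lambda>x. grad \<phi> x $ 1) (y - z) $ 1 + u y * grad (\<lambda>x. grad \<phi> x $ 2) (y - z) $ 2
       + c * (u y * \<phi> (y - z)))"
    using translate_integrable[OF u test_functions_grad[OF test_functions_grad[OF \<phi>]]] translate_integrable[OF u \<phi>]
    by (simp add: translate_pairing_def)
  also have "\<dots> = (LINT y|lebesgue. u y * (laplacian \<phi> (y - z) + c * \<phi> (y - z)))"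
    by (simp add: laplacian_def sum_2 algebra_simps)
  finally show ?thesis .
qed

definition weak_helmholtz :: "(real^2) set \<Rightarrow> complex \<Rightarrow> (real^2 \<Rightarrow> complex) \<Rightarrow> bool" where
  "weak_helmholtz G c u \<longleftrightarrow> integrable lebesgue u \<and>
     (\<forall>\<phi>\<in>test_functions G. (LINT y|lebesgue. u y * (laplacian \<phi> y + c * \<phi> y)) = 0)"

lemma laplacian_translate: "laplacian (\<lambda>y. \<phi> (y - z)) x = laplacian \<phi> (x - z)"
  unfolding laplacian_def by (simp add: grad_translate grad_translate[of "\<lambda>y. grad \<phi> y $ j" for j])

lemma test_functions_translate:
  assumes \<phi>: "\<phi> \<in> test_functions (ball a \<delta>)"
  shows "(\<lambda>y. \<phi> (y - z)) \<in> test_functions (ball (a + z) \<delta>)"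
  using \<phi>
proof (rule test_functionsE)
  fix T assume T: "compact T" "T \<subseteq> ball a \<delta>" "\<And>x. x \<notin> T \<Longrightarrow> \<phi> x = 0" "smooth \<phi>"
  show ?thesis
  proof (rule test_functionsI)
    show "smooth (\<lambda>y. \<phi> (y - z))" by (rule smooth_translate) fact
    show "compact ((\<lambda>y. z + y) ` T)" by (rule compact_translation) fact
    show "(\<lambda>y. z + y) ` T \<subseteq> ball (a + z) \<delta>" using T(2) by (force simp: dist_norm)
    show "\<phi> (x - z) = 0" if "x \<notin> (\<lambda>y. z + y) ` T" for x
      using that by (intro T(3)) (auto simp: image_iff)
  qed
qed

lemma AE_zero_on_ball_test:
  assumes u: "AE y in lebesgue. y \<in> S \<longrightarrow> u y = 0" and \<phi>: "\<phi> \<in> test_functions S"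
  shows "(LINT y|lebesgue. u y * \<phi> y) = 0"
proof -
  obtain T where T: "compact T" "T \<subseteq> S" "\<And>x. x \<notin> T \<Longrightarrow> \<phi> x = 0" "smooth \<phi>"
    using test_functionsE[OF \<phi>] by blast
  have "AE y in lebesgue. u y * \<phi> y = 0" using u by eventually_elim (use T in auto)
  then show ?thesis by (rule integral_eq_zero_AE)
qed

lemma AE_zero_locally:
  assumes "\<And>x. x \<in> S \<Longrightarrow> \<exists>\<delta>>0. AE y in lebesgue. y \<in> ball x \<delta> \<longrightarrow> u y = 0"
  shows "AE y in lebesgue. y \<in> S \<longrightarrow> u y = 0"
proof -
  let ?N = "{y \<in> S. u y \<noteq> 0}"
  have "negligible ?N"
  proof (rule locally_negligible_alt[THEN iffD2], rule ballI)
    fix x assume x: "x \<in> ?N"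
    then obtain \<delta> where \<delta>: "\<delta> > 0" "AE y in lebesgue. y \<in> ball x \<delta> \<longrightarrow> u y = 0" using assms by blast
    obtain N where N: "{y \<in> space lebesgue. \<not> (y \<in> ball x \<delta> \<longrightarrow> u y = 0)} \<subseteq> N"
      "emeasure lebesgue N = 0" "N \<in> sets lebesgue"
      using \<delta>(2) by (rule AE_E)
    then have "negligible N" by (simp add: negligible_iff_null_sets null_setsI)
    then have "negligible (?N \<inter> ball x \<delta>)"
      by (rule negligible_subset[of N]) (use N(1) in auto)
    moreover have "openin (top_of_set ?N) (?N \<inter> ball x \<delta>)" by (intro openin_open_Int) auto
    ultimately show "\<exists>U. openin (top_of_set ?N) U \<and> x \<in> U \<and> negligible U"
      using x \<delta> by (intro exI[of _ "?N \<inter> ball x \<delta>"]) auto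
  qed
  then have "AE y in lebesgue. y \<notin> ?N" by (intro AE_not_in) (simp add: negligible_iff_null_sets)
  then show ?thesis by eventually_elim auto
qed

text \<open>Let \<open>\<phi>\<close> be a test function on a \<open>\<delta>\<close>-ball around \<open>x1\<close>.  The pairings of \<open>u\<close> with its translates by \<open>z\<close>
  form a smooth solution for \<open>z\<close> in a ball around \<open>x0 - x1\<close>, which vanishes for \<open>z\<close> near the centre and hence at
  \<open>z = 0\<close>.\<close>

lemma weak_continuation_ball:
  assumes u: "weak_helmholtz G c u" and G: "ball x0 \<rho> \<subseteq> G" and \<epsilon>: "0 < \<epsilon>" "\<epsilon> \<le> \<rho>"
    and zero: "AE y in lebesgue. y \<in> ball x0 \<epsilon> \<longrightarrow> u y = 0"
  shows "AE y in lebesgue. y \<in> ball x0 \<rho> \<longrightarrow> u y = 0"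
proof (rule AE_zero_locally)
  have ui: "integrable lebesgue u" using u by (simp add: weak_helmholtz_def)
  fix x1 assume x1: "x1 \<in> ball x0 \<rho>"
  define \<delta> where "\<delta> = min \<epsilon> (\<rho> - dist x0 x1) / 2"
  have \<delta>: "\<delta> > 0" "\<delta> < \<epsilon>" "dist x0 x1 + \<delta> < \<rho>" using x1 \<epsilon> by (auto simp: \<delta>_def min_def field_simps)
  have "(LINT y|lebesgue. u y * \<phi> y) = 0" if \<phi>: "\<phi> \<in> test_functions (ball x1 \<delta>)" for \<phi>
  proof -
    have "translate_pairing u \<phi> 0 = 0"
    proof (rule helmholtz_classical_continuation[of _ "x0 - x1" "\<rho> - \<delta>" c "\<epsilon> - \<delta>"])
      show "smooth (translate_pairing u \<phi>)" by (rule smooth_translate_pairing[OF ui \<phi>])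
      show "laplacian (translate_pairing u \<phi>) z + c * translate_pairing u \<phi> z = 0" if z: "z \<in> ball (x0 - x1) (\<rho> - \<delta>)" for z
      proof -
        have "ball (x1 + z) \<delta> \<subseteq> ball x0 \<rho>"
          unfolding ball_subset_ball_iff using z by (simp add: dist_norm algebra_simps norm_minus_commute)
        then have "(\<lambda>y. \<phi> (y - z)) \<in> test_functions G"
          using test_functions_translate[OF \<phi>, of z] G by (auto intro: test_functions_mono)
        then have "(LINT y|lebesgue. u y * (laplacian (\<lambda>y. \<phi> (y - z)) y + c * \<phi> (y - z))) = 0"
          using u by (simp add: weak_helmholtz_def)
        then show ?thesis unfolding laplacian_translate_pairing[OF ui \<phi>] laplacian_translate[of \<phi> z] .
      qed
      show "translate_pairing u \<phi> z = 0" if z: "z \<in> ball (x0 - x1) (\<epsilon> - \<delta>)" for z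
      proof -
        have "ball (x1 + z) \<delta> \<subseteq> ball x0 \<epsilon>"
          unfolding ball_subset_ball_iff using z by (simp add: dist_norm algebra_simps norm_minus_commute)
        then have "(\<lambda>y. \<phi> (y - z)) \<in> test_functions (ball x0 \<epsilon>)"
          using test_functions_translate[OF \<phi>, of z] by (auto intro: test_functions_mono)
        then show ?thesis unfolding translate_pairing_def by (rule AE_zero_on_ball_test[OF zero])
      qed
      show "0 \<in> ball (x0 - x1) (\<rho> - \<delta>)" using \<delta> by (simp add: dist_norm)
    qed (use \<delta> in auto)
    then show ?thesis by (simp add: translate_pairing_def)
  qed
  then have "AE y in lebesgue_on (ball x1 \<delta>). u y = 0"
  proof (intro fundamental_lemma_calculus_of_variations)
    show "integrable (lebesgue_on (ball x1 \<delta>)) u"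
      using integrable_mult_indicator[OF _ ui, of "ball x1 \<delta>"] by (subst integrable_restrict_space) auto
    fix \<phi> assume zero: "\<And>\<phi>. \<phi> \<in> test_functions (ball x1 \<delta>) \<Longrightarrow> (LINT y|lebesgue. u y * \<phi> y) = 0"
      and \<phi>: "\<phi> \<in> test_functions (ball x1 \<delta>)"
    obtain T where T: "compact T" "T \<subseteq> ball x1 \<delta>" "\<And>x. x \<notin> T \<Longrightarrow> \<phi> x = 0" "smooth \<phi>"
      using test_functionsE[OF \<phi>] by blast
    have "(LINT x|lebesgue_on (ball x1 \<delta>). u x * \<phi> x) = (LINT x|lebesgue. indicator (ball x1 \<delta>) x *\<^sub>R (u x * \<phi> x))"
      by (subst integral_restrict_space) auto
    also have "(\<lambda>x. indicator (ball x1 \<delta>) x *\<^sub>R (u x * \<phi> x)) = (\<lambda>x. u x * \<phi> x)"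
      using T by (force simp: indicator_def)
    finally show "(LINT x|lebesgue_on (ball x1 \<delta>). u x * \<phi> x) = 0" using zero[OF \<phi>] by simp
  qed auto
  then have "AE y in lebesgue. y \<in> ball x1 \<delta> \<longrightarrow> u y = 0" by (subst (asm) AE_restrict_space_iff) auto
  then show "\<exists>\<delta>>0. AE y in lebesgue. y \<in> ball x1 \<delta> \<longrightarrow> u y = 0" using \<delta> by blast
qed

text \<open>The set of points near which \<open>u\<close> vanishes is open, and it is closed in \<open>G\<close> because
  vanishing spreads from a small ball to every concentric ball inside \<open>G\<close>.\<close>

theorem weak_unique_continuation:
  assumes u: "weak_helmholtz G c u" and G: "open G" "connected G"
    and x0: "x0 \<in> G" "\<epsilon>0 > 0" "AE y in lebesgue. y \<in> ball x0 \<epsilon>0 \<longrightarrow> u y = 0"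
  shows "AE y in lebesgue. y \<in> G \<longrightarrow> u y = 0"
proof -
  define Z where "Z = {x \<in> G. \<exists>\<epsilon>>0. AE y in lebesgue. y \<in> ball x \<epsilon> \<longrightarrow> u y = 0}"
  have sub: "AE y in lebesgue. y \<in> S \<longrightarrow> u y = 0" if "AE y in lebesgue. y \<in> T \<longrightarrow> u y = 0" "S \<subseteq> T" for S T
    using that(1) by eventually_elim (use that(2) in auto)
  have "openin (top_of_set G) Z"
    unfolding openin_contains_ball
  proof (intro conjI ballI)
    fix x assume "x \<in> Z"
    then obtain \<epsilon> where \<epsilon>: "\<epsilon> > 0" "AE y in lebesgue. y \<in> ball x \<epsilon> \<longrightarrow> u y = 0" by (auto simp: Z_def)
    have "ball x \<epsilon> \<inter> G \<subseteq> Z"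
    proof
      fix z assume z: "z \<in> ball x \<epsilon> \<inter> G"
      then have "ball z (\<epsilon> - dist x z) \<subseteq> ball x \<epsilon>" "\<epsilon> - dist x z > 0"
        by (auto simp: ball_subset_ball_iff dist_commute)
      then show "z \<in> Z" using z sub[OF \<epsilon>(2)] unfolding Z_def by blast
    qed
    then show "\<exists>e>0. ball x e \<inter> G \<subseteq> Z" using \<epsilon> by blast
  qed (auto simp: Z_def)
  moreover have "closedin (top_of_set G) Z"
  proof -
    have "x \<in> Z" if x: "x \<in> G" "x \<in> closure Z" for x
    proof -
      obtain e where e: "e > 0" "ball x e \<subseteq> G"
        using G(1) x(1) unfolding open_contains_ball by blast
      define r where "r = e / 2"
      have r: "r > 0" "ball x (2 * r) \<subseteq> G" using e by (auto simp: r_def)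
      obtain z where z: "z \<in> Z" "dist z x < r" using x(2) r(1) unfolding closure_approachable by blast
      then obtain \<epsilon> where \<epsilon>: "\<epsilon> > 0" "AE y in lebesgue. y \<in> ball z \<epsilon> \<longrightarrow> u y = 0" by (auto simp: Z_def)
      have zr: "ball z r \<subseteq> G"
        using r z by (intro order_trans[OF _ r(2)]) (auto simp: ball_subset_ball_iff)
      have "AE y in lebesgue. y \<in> ball z (min \<epsilon> r) \<longrightarrow> u y = 0" by (rule sub[OF \<epsilon>(2)]) auto
      then have "AE y in lebesgue. y \<in> ball z r \<longrightarrow> u y = 0"
        using \<epsilon> r by (intro weak_continuation_ball[OF u zr, of "min \<epsilon> r"]) auto
      moreover have "ball x (r - dist z x) \<subseteq> ball z r" by (auto simp: ball_subset_ball_iff dist_commute)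
      ultimately have "AE y in lebesgue. y \<in> ball x (r - dist z x) \<longrightarrow> u y = 0" by (rule sub)
      then show ?thesis using z x(1) unfolding Z_def by (auto intro!: exI[of _ "r - dist z x"])
    qed
    then have "Z = G \<inter> closure Z" using closure_subset[of Z] by (auto simp: Z_def)
    then show ?thesis by (metis closed_closure closedin_closed_Int)
  qed
  moreover have "x0 \<in> Z" using x0 by (auto simp: Z_def)
  ultimately have "Z = G" using G(2) unfolding connected_clopen by auto
  then show ?thesis by (intro AE_zero_locally) (auto simp: Z_def)
qed

section \<open>The annular domain between the cavity and the circle\<close>

context bounded_domain
begin

text \<open>The counterpart in the domain of the expansion \<open>dtn_polarized\<close> on the circle.\<close>

lemma green_form_polarized:
  fixes v :: "nat \<Rightarrow> real^2 \<Rightarrow> complex^2" and u :: "nat \<Rightarrow> real^2 \<Rightarrow> complex" and c :: real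
  assumes v: "\<And>i. v i \<in> L2 (lebesgue_on \<Omega>)" and u: "\<And>i. u i \<in> L2 (lebesgue_on \<Omega>)"
  defines "A \<equiv> \<lambda>i j. green_form (v i) (\<lambda>x. of_real c * u i x) (\<lambda>x. \<chi> k. cnj (v j x $ k)) (\<lambda>x. cnj (u j x))"
  shows "A 1 1 - A 1 2 - A 2 1 + A 2 2
    = of_real (LINT x|lebesgue_on \<Omega>. (norm (v 1 x - v 2 x))\<^sup>2 + c * (norm (u 1 x - u 2 x))\<^sup>2)"
proof -
  define a where "a i j x = (\<Sum>k\<in>UNIV. v i x $ k * (\<chi> k. cnj (v j x $ k)) $ k) + of_real c * u i x * cnj (u j x)" for i j :: nat and x
  have i: "integrable (lebesgue_on \<Omega>) (a i j)" for i j
    unfolding a_def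
    by (intro green_integrable v u L2_cmult L2_cnj L2_vecI) (simp add: L2_cnj L2_nth v)
  have "a 1 1 x - a 1 2 x - a 2 1 x + a 2 2 x = of_real ((norm (v 1 x - v 2 x))\<^sup>2 + c * (norm (u 1 x - u 2 x))\<^sup>2)" for x
    unfolding a_def norm_complex_vec_sq of_real_add of_real_mult of_real_sum complex_norm_square
    by (simp add: sum_2 algebra_simps)
  then have "of_real (LINT x|lebesgue_on \<Omega>. (norm (v 1 x - v 2 x))\<^sup>2 + c * (norm (u 1 x - u 2 x))\<^sup>2)
      = (LINT x|lebesgue_on \<Omega>. a 1 1 x - a 1 2 x - a 2 1 x + a 2 2 x)"
    unfolding integral_complex_of_real[symmetric] by simp
  also have "\<dots> = (LINT x|lebesgue_on \<Omega>. a 1 1 x) - (LINT x|lebesgue_on \<Omega>. a 1 2 x)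
      - (LINT x|lebesgue_on \<Omega>. a 2 1 x) + (LINT x|lebesgue_on \<Omega>. a 2 2 x)"
    using i by simp
  finally show ?thesis by (simp add: A_def green_form_def a_def)
qed

end

locale cavity =
  fixes D :: "(real^2) set" and R :: real
  assumes R_pos: "R > 0" and D_inside: "closure D \<subseteq> ball 0 R"
begin

abbreviation annulus :: "(real^2) set" where "annulus \<equiv> ball 0 R - closure D"

sublocale bounded_domain annulus
  by standard (auto intro: bounded_subset[OF bounded_ball])

lemma cutoff:
  obtains m where "smooth m" "\<And>x. x \<in> space (circle_measure R) \<Longrightarrow> m x = 1"
    "\<And>x. x \<in> space (arclength (frontier D)) \<Longrightarrow> m x = 0"
proof -
  have bdd: "bounded (closure D)" using D_inside bounded_ball bounded_subset by blast
  obtain \<rho> where \<rho>: "0 \<le> \<rho>" "\<rho> < R" "\<And>x. x \<in> closure D \<Longrightarrow> norm x \<le> \<rho>"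
  proof (cases "closure D = {}")
    case True
    then show ?thesis using that[of 0] R_pos by simp
  next
    case False
    have "compact (closure D)" using bdd by (simp add: compact_eq_bounded_closed)
    then obtain y where y: "y \<in> closure D" "\<forall>x\<in>closure D. norm x \<le> norm y"
      using continuous_attains_sup[OF _ False, of norm] by (auto intro: continuous_intros)
    then show ?thesis using that[of "norm y"] D_inside by (auto simp: subset_iff)
  qed
  obtain \<eta> :: "real^2 \<Rightarrow> real" where "smooth (\<lambda>x. of_real (\<eta> x))" "\<And>x. norm x \<le> \<rho> \<Longrightarrow> \<eta> x = 0" "\<And>x. norm x = R \<Longrightarrow> \<eta> x = 1"
    using smooth_cutoff[OF \<rho>(1,2)] by metis
  moreover have "space (arclength (frontier D)) \<subseteq> closure D"
    unfolding arclength_def space_restrict_space by (auto simp: frontier_def)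
  ultimately show ?thesis
    using \<rho>(3) that[of "\<lambda>x. of_real (\<eta> x)"] by (auto simp: space_circle_measure)
qed

text \<open>Functions that vanish on the cavity are integrated over the full disk, where the divergence theorem
  is available.\<close>

lemma annulus_integral:
  fixes h :: "real^2 \<Rightarrow> complex"
  assumes h: "continuous_on UNIV h" and zero: "\<And>x. x \<in> closure D \<Longrightarrow> h x = 0"
  shows "(LINT x|lebesgue_on annulus. h x) = (LINT x|lborel. indicator (cball 0 R) x *\<^sub>R h x)"
proof -
  have hm: "h \<in> borel_measurable borel" using h by (rule borel_measurable_continuous_onI)
  have "(LINT x|lebesgue_on annulus. h x) = (LINT x|lebesgue. indicator annulus x *\<^sub>R h x)"
    using sets_dom by (subst integral_restrict_space) auto
  also have "\<dots> = (LINT x|lebesgue. indicator (cball 0 R) x *\<^sub>R h x)"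
  proof (rule integral_cong_AE)
    have "sphere 0 R \<in> null_sets (lebesgue :: (real^2) measure)"
      using negligible_sphere[of 0 R] by (simp add: negligible_iff_null_sets)
    from AE_not_in[OF this]
    show "AE x in lebesgue. indicator annulus x *\<^sub>R h x = indicator (cball 0 R) x *\<^sub>R h x"
      by eventually_elim (use zero in \<open>auto simp: indicator_def\<close>)
    have "h \<in> borel_measurable lebesgue" using hm by (simp add: measurable_completion)
    then show "(\<lambda>x. indicator annulus x *\<^sub>R h x) \<in> borel_measurable lebesgue"
      "(\<lambda>x. indicator (cball 0 R) x *\<^sub>R h x) \<in> borel_measurable lebesgue"
      using sets_dom by (auto intro!: borel_measurable_scaleR borel_measurable_indicator)
  qed
  also have "\<dots> = (LINT x|lborel. indicator (cball 0 R) x *\<^sub>R h x)"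
    using hm by (intro integral_completion) (auto intro!: borel_measurable_scaleR borel_measurable_indicator)
  finally show ?thesis .
qed

lemma integrable_disk:
  assumes "smooth F"
  shows "integrable lborel (\<lambda>x. indicator (cball 0 R) x *\<^sub>R F x)"
  by (intro borel_integrable_compact) (auto intro: continuous_on_subset[OF smooth_continuous[OF assms]])

text \<open>The divergence theorem for \<open>w \<nabla>\<phi>\<close>.  The test function vanishes near the cavity but not
  on the circle, so only the circle contributes.\<close>

lemma smooth_green:
  assumes w: "smooth w" and \<phi>: "\<phi> \<in> test_functions (- closure D)"
  shows "(LINT x|lebesgue_on annulus. (\<Sum>j\<in>UNIV. grad w x $ j * grad \<phi> x $ j) + w x * laplacian \<phi> x)
    = of_real R * (LINT \<theta>|circ. w (polar R \<theta>) * (of_real (cos \<theta>) * grad \<phi> (polar R \<theta>) $ 1 + of_real (sin \<theta>) * grad \<phi> (polar R \<theta>) $ 2))"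
proof -
  obtain T where T: "compact T" "T \<subseteq> - closure D" "\<And>x. x \<notin> T \<Longrightarrow> \<phi> x = 0" "smooth \<phi>"
    using test_functionsE[OF \<phi>] by blast
  define F where "F j x = w x * grad \<phi> x $ j" for j x
  have F: "smooth (F j)" for j unfolding F_def by (intro smooth_mult w smooth_grad T)
  have zero: "F j x = 0" if "x \<notin> T" for j x
    using grad_zero_outside[OF T(3) compact_imp_closed[OF T(1)] that] by (simp add: F_def)
  have gF: "grad (F j) x $ j = w x * grad (\<lambda>x. grad \<phi> x $ j) x $ j + grad w x $ j * grad \<phi> x $ j" for j x
    unfolding F_def by (intro grad_mult smooth_differentiable w smooth_grad T)
  have "(LINT x|lebesgue_on annulus. (\<Sum>j\<in>UNIV. grad w x $ j * grad \<phi> x $ j) + w x * laplacian \<phi> x)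
      = (LINT x|lebesgue_on annulus. grad (F 1) x $ 1 + grad (F 2) x $ 2)"
    by (simp add: gF laplacian_def sum_2 algebra_simps)
  also have "\<dots> = (LINT x|lborel. indicator (cball 0 R) x *\<^sub>R (grad (F 1) x $ 1 + grad (F 2) x $ 2))"
  proof (rule annulus_integral)
    show "continuous_on UNIV (\<lambda>x. grad (F 1) x $ 1 + grad (F 2) x $ 2)"
      by (intro continuous_intros smooth_continuous smooth_grad F)
    show "grad (F 1) x $ 1 + grad (F 2) x $ 2 = 0" if "x \<in> closure D" for x
    proof -
      have "x \<notin> T" using that T(2) by blast
      then show ?thesis using grad_zero_outside[OF zero compact_imp_closed[OF T(1)]] by simp
    qed
  qed
  also have "\<dots> = (LINT x|lborel. indicator (cball 0 R) x *\<^sub>R grad (F 1) x $ 1) + (LINT x|lborel. indicator (cball 0 R) x *\<^sub>R grad (F 2) x $ 2)"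
    unfolding scaleR_add_right
    by (intro Bochner_Integration.integral_add integrable_disk smooth_grad F)
  also have "\<dots> = of_real R * (LINT \<theta>|circ. F 1 (polar R \<theta>) * of_real (cos \<theta>)) + of_real R * (LINT \<theta>|circ. F 2 (polar R \<theta>) * of_real (sin \<theta>))"
    by (simp only: disk_divergence[OF F R_pos])
  also have "\<dots> = of_real R * (LINT \<theta>|circ. F 1 (polar R \<theta>) * of_real (cos \<theta>) + F 2 (polar R \<theta>) * of_real (sin \<theta>))"
  proof -
    have c: "continuous_on UNIV (\<lambda>\<theta>. F j (polar R \<theta>))" for j
      by (rule continuous_on_compose2[OF smooth_continuous[OF F] continuous_polar']) simp
    have "integrable circ (\<lambda>\<theta>. F 1 (polar R \<theta>) * of_real (cos \<theta>))" "integrable circ (\<lambda>\<theta>. F 2 (polar R \<theta>) * of_real (sin \<theta>))"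
      by (intro L2_integrable[OF finite_measure_circ] circ_continuous_L2 continuous_intros c)+
    then show ?thesis by (simp add: distrib_left)
  qed
  finally show ?thesis by (simp add: F_def algebra_simps)
qed

text \<open>The approximating smooth functions of a trace carry Green's formula over to the limit.\<close>

lemma trace_green:
  assumes tr: "has_trace annulus (circle_measure R) u g" and v: "has_L2_gradient annulus u v"
    and \<phi>: "\<phi> \<in> test_functions (- closure D)"
  shows "green_form v u (grad \<phi>) (laplacian \<phi>)
    = of_real R * (LINT \<theta>|circ. g (polar R \<theta>) * (of_real (cos \<theta>) * grad \<phi> (polar R \<theta>) $ 1 + of_real (sin \<theta>) * grad \<phi> (polar R \<theta>) $ 2))"
proof -
  let ?M = "lebesgue_on annulus"
  note sm = test_functions_smooth[OF \<phi>]
  obtain v' w where vw: "has_L2_gradient annulus u v'" "H1_limit w u v'"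
    "(\<lambda>k. \<integral>\<^sup>+x. ennreal ((norm (w k x - g x))\<^sup>2) \<partial>circle_measure R) \<longlonglongrightarrow> 0"
    and u: "u \<in> H1 annulus" and g: "g \<in> Hhalf (circle_measure R)"
    using tr by (auto simp: has_trace_iff)
  have uL: "u \<in> L2 ?M" using u by (rule H1_L2)
  have vL: "v \<in> L2 ?M" "v' \<in> L2 ?M" using v vw by (auto intro: has_L2_gradient_L2)
  have w: "smooth (w k)" for k using vw(2) by (simp add: H1_limit_def)
  define N where "N \<theta> = of_real (cos \<theta>) * grad \<phi> (polar R \<theta>) $ 1 + of_real (sin \<theta>) * grad \<phi> (polar R \<theta>) $ 2" for \<theta>
  have polar_c: "continuous_on UNIV (\<lambda>\<theta>. f (polar R \<theta>))" if "smooth f" for f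
    by (rule continuous_on_compose2[OF smooth_continuous[OF that] continuous_polar']) simp
  have N: "N \<in> L2 circ"
    unfolding N_def[abs_def] by (intro circ_continuous_L2 continuous_intros polar_c smooth_grad sm)
  have 1: "(\<lambda>k. LINT x|?M. w k x * laplacian \<phi> x) \<longlonglongrightarrow> (LINT x|?M. u x * laplacian \<phi> x)"
    using vw(2) by (intro L2_tendsto_integral uL smooth_L2 w smooth_laplacian sm) (simp add: H1_limit_def)
  have 2: "(\<lambda>k. LINT x|?M. grad (w k) x $ j * grad \<phi> x $ j) \<longlonglongrightarrow> (LINT x|?M. v' x $ j * grad \<phi> x $ j)" for j
  proof (rule L2_tendsto_integral)
    show "(\<lambda>k. \<integral>\<^sup>+x. ennreal ((norm (grad (w k) x $ j - v' x $ j))\<^sup>2) \<partial>?M) \<longlonglongrightarrow> 0"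
    proof (rule tendsto_sandwich[OF _ _ tendsto_const])
      show "(\<lambda>k. \<integral>\<^sup>+x. ennreal ((norm (grad (w k) x - v' x))\<^sup>2) \<partial>?M) \<longlonglongrightarrow> 0"
        using vw(2) by (simp add: H1_limit_def)
      show "\<forall>\<^sub>F k in sequentially. (\<integral>\<^sup>+x. ennreal ((norm (grad (w k) x $ j - v' x $ j))\<^sup>2) \<partial>?M)
          \<le> (\<integral>\<^sup>+x. ennreal ((norm (grad (w k) x - v' x))\<^sup>2) \<partial>?M)"
        using norm_vec_nth_sq_le[of "grad (w _) _ - v' _" j]
        by (intro always_eventually allI nn_integral_mono ennreal_leI) simp
    qed simp
  qed (intro L2_nth vL smooth_L2 smooth_grad w sm)+
  have 3: "(\<lambda>k. LINT \<theta>|circ. w k (polar R \<theta>) * N \<theta>) \<longlonglongrightarrow> (LINT \<theta>|circ. g (polar R \<theta>) * N \<theta>)"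
  proof (rule L2_tendsto_integral[OF _ N])
    show "(\<lambda>\<theta>. g (polar R \<theta>)) \<in> L2 circ" by (rule Hhalf_circle_L2[OF R_pos g])
    show "(\<lambda>\<theta>. w k (polar R \<theta>)) \<in> L2 circ" for k by (intro circ_continuous_L2 polar_c w)
    have "(\<lambda>k. ennreal (1/R) * (\<integral>\<^sup>+x. ennreal ((norm (w k x - g x))\<^sup>2) \<partial>circle_measure R)) \<longlonglongrightarrow> ennreal (1/R) * 0"
      using vw(3) by (intro tendsto_mult_ennreal tendsto_const) auto
    moreover have "ennreal (1/R) * (\<integral>\<^sup>+x. ennreal ((norm (w k x - g x))\<^sup>2) \<partial>circle_measure R)
        = (\<integral>\<^sup>+\<theta>. ennreal ((norm (w k (polar R \<theta>) - g (polar R \<theta>)))\<^sup>2) \<partial>circ)" for k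
    proof -
      have "w k \<in> borel_measurable (circle_measure R)" "g \<in> borel_measurable (circle_measure R)"
        using smooth_Hhalf_circle[of R "w k"] g w R_pos by (auto simp: Hhalf_def)
      then have "(\<integral>\<^sup>+x. ennreal ((norm (w k x - g x))\<^sup>2) \<partial>circle_measure R)
          = ennreal R * (\<integral>\<^sup>+\<theta>. ennreal ((norm (w k (polar R \<theta>) - g (polar R \<theta>)))\<^sup>2) \<partial>circ)"
        using R_pos by (intro nn_integral_circle) auto
      then show ?thesis using R_pos by (simp add: mult.assoc[symmetric] flip: ennreal_mult)
    qed
    ultimately show "(\<lambda>k. \<integral>\<^sup>+\<theta>. ennreal ((norm (w k (polar R \<theta>) - g (polar R \<theta>)))\<^sup>2) \<partial>circ) \<longlonglongrightarrow> 0"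
      by simp
  qed
  have split: "(LINT x|?M. (\<Sum>j\<in>UNIV. b x $ j * grad \<phi> x $ j) + a x * laplacian \<phi> x)
      = (LINT x|?M. b x $ 1 * grad \<phi> x $ 1) + (LINT x|?M. b x $ 2 * grad \<phi> x $ 2) + (LINT x|?M. a x * laplacian \<phi> x)"
    if "b \<in> L2 ?M" "a \<in> L2 ?M" for a and b :: "real^2 \<Rightarrow> complex^2"
  proof -
    have "integrable ?M (\<lambda>x. b x $ j * grad \<phi> x $ j)" "integrable ?M (\<lambda>x. a x * laplacian \<phi> x)" for j
      using L2_mult_integrable[OF L2_nth[OF that(1), of j] smooth_L2[OF smooth_grad[OF sm, of j]]]
        L2_mult_integrable[OF that(2) smooth_L2[OF smooth_laplacian[OF sm]]] by auto
    then show ?thesis by (simp add: sum_2)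
  qed
  have "(\<lambda>k. (LINT x|?M. grad (w k) x $ 1 * grad \<phi> x $ 1) + (LINT x|?M. grad (w k) x $ 2 * grad \<phi> x $ 2) + (LINT x|?M. w k x * laplacian \<phi> x))
     \<longlonglongrightarrow> (LINT x|?M. v' x $ 1 * grad \<phi> x $ 1) + (LINT x|?M. v' x $ 2 * grad \<phi> x $ 2) + (LINT x|?M. u x * laplacian \<phi> x)"
    by (intro tendsto_add 1 2)
  then have "(\<lambda>k. LINT x|?M. (\<Sum>j\<in>UNIV. grad (w k) x $ j * grad \<phi> x $ j) + w k x * laplacian \<phi> x)
     \<longlonglongrightarrow> green_form v' u (grad \<phi>) (laplacian \<phi>)"
    unfolding green_form_def split[OF vL(2) uL] split[OF smooth_grad_L2[OF w] smooth_L2[OF w]] .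
  then have "(\<lambda>k. of_real R * (LINT \<theta>|circ. w k (polar R \<theta>) * N \<theta>)) \<longlonglongrightarrow> green_form v' u (grad \<phi>) (laplacian \<phi>)"
    unfolding smooth_green[OF w \<phi>] N_def .
  moreover have "(\<lambda>k. of_real R * (LINT \<theta>|circ. w k (polar R \<theta>) * N \<theta>)) \<longlonglongrightarrow> of_real R * (LINT \<theta>|circ. g (polar R \<theta>) * N \<theta>)"
    by (intro tendsto_mult tendsto_const 3)
  ultimately have "green_form v' u (grad \<phi>) (laplacian \<phi>) = of_real R * (LINT \<theta>|circ. g (polar R \<theta>) * N \<theta>)"
    by (rule LIMSEQ_unique)
  moreover have "green_form v u (grad \<phi>) (laplacian \<phi>) = green_form v' u (grad \<phi>) (laplacian \<phi>)"
    using has_L2_gradient_unique[OF v vw(1) _ uL uL]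
    by (intro green_form_cong_AE vL uL smooth_grad_L2 smooth_L2 smooth_laplacian sm) auto
  ultimately show ?thesis by (simp add: N_def)
qed

lemma smooth_weak_gradient:
  assumes \<phi>: "smooth \<phi>"
  shows "has_L2_gradient annulus \<phi> (grad \<phi>)"
  unfolding has_L2_gradient_def
proof (intro conjI ballI allI)
  show "grad \<phi> \<in> L2 (lebesgue_on annulus)" by (rule smooth_grad_L2[OF \<phi>])
  fix \<psi> and j :: 2 assume \<psi>: "\<psi> \<in> test_functions annulus"
  obtain T where T: "compact T" "T \<subseteq> annulus" "\<And>x. x \<notin> T \<Longrightarrow> \<psi> x = 0" "smooth \<psi>"
    using test_functionsE[OF \<psi>] by blast
  define F where "F x = \<phi> x * \<psi> x" for x
  have F: "smooth F" unfolding F_def by (intro smooth_mult \<phi> T)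
  have F0: "F x = 0" if "x \<notin> T" for x using T(3)[OF that] by (simp add: F_def)
  have "polar R \<theta> \<notin> T" for \<theta> using T(2) norm_polar[of R \<theta>] R_pos by auto
  then have "(LINT x|lborel. indicator (cball 0 R) x *\<^sub>R grad F x $ j) = 0"
    using disk_divergence[OF F R_pos] F0 exhaust_2[of j] by auto
  moreover have "(LINT x|lebesgue_on annulus. grad F x $ j) = (LINT x|lborel. indicator (cball 0 R) x *\<^sub>R grad F x $ j)"
  proof (rule annulus_integral)
    show "grad F x $ j = 0" if "x \<in> closure D" for x
      by (rule grad_zero_outside[OF F0 compact_imp_closed[OF T(1)]]) (use that T(2) in auto)
  qed (intro smooth_continuous smooth_grad F)
  moreover have "(LINT x|lebesgue_on annulus. grad F x $ j)
      = (LINT x|lebesgue_on annulus. \<phi> x * grad \<psi> x $ j) + (LINT x|lebesgue_on annulus. grad \<phi> x $ j * \<psi> x)"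
  proof -
    have "grad F x $ j = \<phi> x * grad \<psi> x $ j + grad \<phi> x $ j * \<psi> x" for x
      unfolding F_def by (intro grad_mult smooth_differentiable \<phi> T)
    moreover have "integrable (lebesgue_on annulus) (\<lambda>x. \<phi> x * grad \<psi> x $ j)"
      "integrable (lebesgue_on annulus) (\<lambda>x. grad \<phi> x $ j * \<psi> x)"
      by (intro L2_mult_integrable smooth_L2 smooth_grad \<phi> T)+
    ultimately show ?thesis by simp
  qed
  ultimately show "(LINT x|lebesgue_on annulus. \<phi> x * grad \<psi> x $ j) = - (LINT x|lebesgue_on annulus. grad \<phi> x $ j * \<psi> x)"
    by (simp add: eq_neg_iff_add_eq_0)
qed

text \<open>The constant sequence approximates a smooth function.\<close>

lemma smooth_has_trace:
  assumes \<phi>: "smooth \<phi>" and g: "g \<in> Hhalf \<sigma>" "\<And>x. x \<in> space \<sigma> \<Longrightarrow> \<phi> x = g x"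
  shows "has_trace annulus \<sigma> \<phi> g"
proof -
  have "(\<integral>\<^sup>+x. ennreal ((norm (\<phi> x - g x))\<^sup>2) \<partial>\<sigma>) = (\<integral>\<^sup>+x. 0 \<partial>\<sigma>)"
    by (rule nn_integral_cong) (simp add: g)
  moreover have "\<phi> \<in> H1 annulus"
    using smooth_L2[OF \<phi>] smooth_weak_gradient[OF \<phi>] by (auto simp: H1_def)
  ultimately show ?thesis
    using g(1) smooth_weak_gradient[OF \<phi>] \<phi> unfolding has_trace_iff
    by (intro conjI exI[of _ "grad \<phi>"] exI[of _ "\<lambda>k. \<phi>"]) (auto simp: H1_limit_def)
qed

end

section \<open>Uniqueness\<close>

context cavity
begin

abbreviation "\<sigma>D \<equiv> arclength (frontier D)"
abbreviation "\<sigma>R \<equiv> circle_measure R"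

text \<open>The existential statements in \<open>coupled_solution\<close> with their witnesses as parameters.  A common
  trace \<open>g\<close> of \<open>p\<close> and \<open>q\<close> on the cavity replaces two traces that agree almost everywhere.\<close>

definition solution_data where
  "solution_data \<kappa> \<alpha> p q v w g p0 q0 lD mD lR mR \<longleftrightarrow>
     has_L2_gradient annulus p v \<and> has_L2_gradient annulus q w \<and>
     has_L2_laplacian annulus p (\<lambda>x. of_real (- (\<kappa>\<^sup>2)) * p x) \<and> has_L2_laplacian annulus q (\<lambda>x. of_real (\<kappa>\<^sup>2) * q x) \<and>
     has_trace annulus \<sigma>D p g \<and> has_trace annulus \<sigma>D q g \<and>
     has_weak_normal_derivative annulus \<sigma>D \<sigma>R p lD \<and> has_weak_normal_derivative annulus \<sigma>D \<sigma>R q mD \<and>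
     (\<forall>\<psi>\<in>Hhalf \<sigma>D. lD \<psi> = mD \<psi>) \<and>
     has_trace annulus \<sigma>R p p0 \<and> has_weak_normal_derivative annulus \<sigma>R \<sigma>D p lR \<and>
     (\<forall>\<psi>\<in>Hhalf \<sigma>R. lR \<psi> = T1 \<kappa> R p0 \<psi> - g1 \<kappa> \<alpha> R \<psi>) \<and>
     has_trace annulus \<sigma>R q q0 \<and> has_weak_normal_derivative annulus \<sigma>R \<sigma>D q mR \<and>
     (\<forall>\<psi>\<in>Hhalf \<sigma>R. mR \<psi> = T2 \<kappa> R q0 \<psi>)"

lemma solution_data_exists:
  assumes "coupled_solution D R \<kappa> \<alpha> p q"
  shows "\<exists>v w g p0 q0 lD mD lR mR. solution_data \<kappa> \<alpha> p q v w g p0 q0 lD mD lR mR"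
proof -
  note c = assms[unfolded coupled_solution_def Let_def]
  obtain p' q' where tr: "has_trace annulus \<sigma>D p p'" "has_trace annulus \<sigma>D q q'" "AE x in \<sigma>D. p' x - q' x = 0"
    using c by blast
  have trq: "has_trace annulus \<sigma>D q p'"
  proof (rule has_trace_cong_AE[OF tr(2)])
    show "p' \<in> Hhalf \<sigma>D" using tr(1) by (simp add: has_trace_def)
    show "AE x in \<sigma>D. q' x = p' x" using tr(3) by eventually_elim simp
  qed
  obtain v where v: "has_L2_gradient annulus p v" using c unfolding H1_def by blast
  obtain w where w: "has_L2_gradient annulus q w" using c unfolding H1_def by blast
  have f: "has_L2_laplacian annulus p (\<lambda>x. - of_real (\<kappa>\<^sup>2) * p x)" "has_L2_laplacian annulus q (\<lambda>x. of_real (\<kappa>\<^sup>2) * q x)"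
    using c by blast+
  have f1: "has_L2_laplacian annulus p (\<lambda>x. of_real (- (\<kappa>\<^sup>2)) * p x)"
    using f(1) unfolding of_real_minus .
  obtain lD mD where D: "has_weak_normal_derivative annulus \<sigma>D \<sigma>R p lD" "has_weak_normal_derivative annulus \<sigma>D \<sigma>R q mD"
    "\<forall>\<psi>\<in>Hhalf \<sigma>D. lD \<psi> - mD \<psi> = 0" using c by blast
  have lm: "\<forall>\<psi>\<in>Hhalf \<sigma>D. lD \<psi> = mD \<psi>" using D(3) unfolding right_minus_eq .
  obtain p0 lR where p0: "has_trace annulus \<sigma>R p p0" "has_weak_normal_derivative annulus \<sigma>R \<sigma>D p lR"
    "\<forall>\<psi>\<in>Hhalf \<sigma>R. lR \<psi> = T1 \<kappa> R p0 \<psi> - g1 \<kappa> \<alpha> R \<psi>" using c by blast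
  obtain q0 mR where q0: "has_trace annulus \<sigma>R q q0" "has_weak_normal_derivative annulus \<sigma>R \<sigma>D q mR"
    "\<forall>\<psi>\<in>Hhalf \<sigma>R. mR \<psi> = T2 \<kappa> R q0 \<psi>" using c by blast
  have "solution_data \<kappa> \<alpha> p q v w p' p0 q0 lD mD lR mR"
    unfolding solution_data_def
    by (intro conjI v w f1 f(2) tr(1) trq D(1,2) lm p0 q0)
  then show ?thesis by blast
qed

text \<open>Green's formula for the whole boundary, tested with the conjugate of \<open>\<phi>\<close> as the energies require.\<close>

lemma coupled_green:
  assumes "has_weak_normal_derivative annulus \<sigma>R \<sigma>D u lR" and "has_weak_normal_derivative annulus \<sigma>D \<sigma>R u lD"
    and "has_L2_gradient annulus u v" and "has_L2_laplacian annulus u f"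
    and "has_trace annulus \<sigma>R \<phi> g" and "has_trace annulus \<sigma>D \<phi> h" and "has_L2_gradient annulus \<phi> w"
  shows "lR (\<lambda>x. cnj (g x)) + lD (\<lambda>x. cnj (h x)) = green_form v f (\<lambda>x. \<chi> k. cnj (w x $ k)) (\<lambda>x. cnj (\<phi> x))"
proof -
  obtain m where m: "smooth m" "\<And>x. x \<in> space \<sigma>R \<Longrightarrow> m x = 1" "\<And>x. x \<in> space \<sigma>D \<Longrightarrow> m x = 0"
    using cutoff by blast
  show ?thesis
    by (rule green_identity[OF assms(1-4) has_trace_cnj[OF assms(5)] has_trace_cnj[OF assms(6)] has_L2_gradient_cnj[OF assms(7)] m])
qed

text \<open>Green's formula, which determines the functional on traces, only sees the gradient and the
  Laplacian almost everywhere.\<close>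

lemma normal_derivative_cong:
  assumes l: "has_weak_normal_derivative annulus \<sigma>D \<sigma>R u l" "has_L2_gradient annulus u v" "has_L2_laplacian annulus u f"
    and l': "has_weak_normal_derivative annulus \<sigma>D \<sigma>R u' l'" "has_L2_gradient annulus u' v'" "has_L2_laplacian annulus u' f'"
    and eq: "AE x in lebesgue_on annulus. v x = v' x" "AE x in lebesgue_on annulus. f x = f' x"
    and tr: "has_trace annulus \<sigma>D \<phi> g"
  shows "l (\<lambda>x. cnj (g x)) = l' (\<lambda>x. cnj (g x))"
proof -
  obtain m where m: "smooth m" "\<And>x. x \<in> space \<sigma>R \<Longrightarrow> m x = 1" "\<And>x. x \<in> space \<sigma>D \<Longrightarrow> m x = 0"
    using cutoff by blast
  let ?m = "\<lambda>x. 1 - m x" and ?\<phi> = "\<lambda>x. cnj (\<phi> x)"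
  note sm = smooth_one_minus[OF m(1)]
  have t: "has_trace annulus \<sigma>D (\<lambda>x. ?m x * ?\<phi> x) (\<lambda>x. cnj (g x))" "has_trace annulus \<sigma>R (\<lambda>x. ?m x * ?\<phi> x) (\<lambda>_. 0)"
    using has_trace_mult_one[OF has_trace_cnj[OF tr] sm] has_trace_mult_zero[OF has_trace_cnj[OF tr] sm] m by auto
  obtain W where W: "has_L2_gradient annulus (\<lambda>x. ?m x * ?\<phi> x) W" using t(1) by (auto simp: has_trace_def)
  have \<phi>L: "(\<lambda>x. ?m x * ?\<phi> x) \<in> L2 (lebesgue_on annulus)" using t(1) by (simp add: has_trace_def H1_def)
  have "l (\<lambda>x. cnj (g x)) = green_form v f W (\<lambda>x. ?m x * ?\<phi> x)" by (rule weak_normal_derivative_pairing[OF l t W])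
  also have "\<dots> = green_form v' f' W (\<lambda>x. ?m x * ?\<phi> x)"
    using l l' W \<phi>L eq by (intro green_form_cong_AE) (simp_all add: has_L2_gradient_def has_L2_laplacian_def)
  also have "\<dots> = l' (\<lambda>x. cnj (g x))" by (rule weak_normal_derivative_pairing[OF l' t W, symmetric])
  finally show ?thesis .
qed

text \<open>Take a test function \<open>\<phi>\<close> on the exterior of the cavity.  Green's formula with \<open>u\<close>
  differentiated and with \<open>\<phi>\<close> differentiated leaves two terms on the circle, the normal derivative
  of \<open>u\<close> against \<open>\<phi>\<close> and the trace of \<open>u\<close> against the normal derivative of \<open>\<phi>\<close>; both are the same for
  \<open>u 1\<close> and \<open>u 2\<close>.  So the difference, extended by zero, satisfies the equation across the circle.\<close>

lemma zero_extension_weak_helmholtz: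
  assumes l: "\<And>i. has_weak_normal_derivative annulus \<sigma>R \<sigma>D (u i) (l i)"
    and v: "\<And>i. has_L2_gradient annulus (u i) (v i)"
    and f: "\<And>i. has_L2_laplacian annulus (u i) (\<lambda>x. of_real c * u i x)"
    and g: "\<And>i. has_trace annulus \<sigma>R (u i) (g i)"
    and coeffs: "\<And>n. fourier_coeff R (g 1) n = fourier_coeff R (g 2) n"
    and ll: "\<And>\<psi>. \<psi> \<in> Hhalf \<sigma>R \<Longrightarrow> l 1 \<psi> = l 2 \<psi>"
  shows "weak_helmholtz (- closure D) (- of_real c) (\<lambda>x. indicator annulus x *\<^sub>R (u (1::nat) x - u 2 x))"
  unfolding weak_helmholtz_def
proof (intro conjI ballI)
  let ?M = "lebesgue_on annulus"
  have uL: "u i \<in> L2 ?M" for i using g[of i] by (simp add: has_trace_def H1_def)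
  have vL: "v i \<in> L2 ?M" for i using v[of i] by (rule has_L2_gradient_L2)
  have fL: "(\<lambda>x. of_real c * u i x) \<in> L2 ?M" for i using uL by (rule L2_cmult)
  have "integrable ?M (\<lambda>x. u 1 x - u 2 x)"
    by (intro L2_integrable[OF finite_measure_dom] L2_diff uL)
  then show "integrable lebesgue (\<lambda>x. indicator annulus x *\<^sub>R (u 1 x - u 2 x))"
    using sets_dom by (subst (asm) integrable_restrict_space) auto
  fix \<phi> assume \<phi>: "\<phi> \<in> test_functions (- closure D)"
  note sm = test_functions_smooth[OF \<phi>]
  obtain T where T: "compact T" "T \<subseteq> - closure D" "\<And>x. x \<notin> T \<Longrightarrow> \<phi> x = 0" "smooth \<phi>"
    using test_functionsE[OF \<phi>] by blast
  have \<phi>R: "\<phi> \<in> Hhalf \<sigma>R" using R_pos by (intro smooth_Hhalf_circle sm) auto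
  have trR: "has_trace annulus \<sigma>R \<phi> \<phi>" by (rule smooth_has_trace[OF sm \<phi>R]) simp
  have trD: "has_trace annulus \<sigma>D \<phi> (\<lambda>_. 0)"
  proof (rule smooth_has_trace[OF sm Hhalf_zero])
    fix x assume "x \<in> space \<sigma>D"
    then have "x \<in> closure D" unfolding arclength_def space_restrict_space by (auto simp: frontier_def)
    then show "\<phi> x = 0" using T(2,3) by blast
  qed
  have "l i \<phi> = green_form (v i) (\<lambda>x. of_real c * u i x) (grad \<phi>) \<phi>" for i
    by (rule weak_normal_derivative_pairing[OF l v f trR trD smooth_weak_gradient[OF sm]])
  then have E1: "green_form (v 1) (\<lambda>x. of_real c * u 1 x) (grad \<phi>) \<phi> = green_form (v 2) (\<lambda>x. of_real c * u 2 x) (grad \<phi>) \<phi>"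
    using ll[OF \<phi>R] by simp
  \<comment> \<open>an extension of the normal derivative of \<open>\<phi>\<close> from the circle to the plane\<close>
  define N where "N x = of_real (x $ 1 / R) * grad \<phi> x $ 1 + of_real (x $ 2 / R) * grad \<phi> x $ 2" for x
  have Nc: "continuous_on S N" for S
  proof -
    have "continuous_on S (\<lambda>x. grad \<phi> x $ j)" for j
      by (rule continuous_on_subset[OF smooth_continuous[OF smooth_grad[OF sm]]]) simp
    moreover have "continuous_on S (\<lambda>x. complex_of_real (x $ j / R))" for j
      using R_pos by (intro continuous_intros) auto
    ultimately show ?thesis
      unfolding N_def[abs_def] by (intro continuous_on_add continuous_on_mult)
  qed
  have N: "N (polar R \<theta>) = of_real (cos \<theta>) * grad \<phi> (polar R \<theta>) $ 1 + of_real (sin \<theta>) * grad \<phi> (polar R \<theta>) $ 2" for \<theta>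
    using R_pos by (simp add: N_def polar_def)
  have gL: "(\<lambda>\<theta>. g i (polar R \<theta>)) \<in> L2 circ" for i
    using g[of i] by (intro Hhalf_circle_L2[OF R_pos]) (simp add: has_trace_def)
  have polar_c: "continuous_on UNIV (\<lambda>\<theta>. N (polar R \<theta>))"
    by (rule continuous_on_compose2[OF Nc continuous_polar' subset_UNIV])
  have "(LINT \<theta>|circ. (g 1 (polar R \<theta>) - g 2 (polar R \<theta>)) * N (polar R \<theta>)) = 0"
  proof (rule zero_coefficients_annihilate_continuous[OF _ _ _ Nc])
    show "integrable circ (\<lambda>\<theta>. g 1 (polar R \<theta>) - g 2 (polar R \<theta>))"
      by (intro L2_integrable[OF finite_measure_circ] L2_diff gL)
    fix n
    have "integrable circ (\<lambda>\<theta>. g i (polar R \<theta>) * cis (- of_int n * \<theta>))" for i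
      by (intro L2_mult_integrable gL circ_continuous_L2 continuous_intros)
    then have "circ_coeff (\<lambda>\<theta>. g 1 (polar R \<theta>) - g 2 (polar R \<theta>)) n = fourier_coeff R (g 1) n - fourier_coeff R (g 2) n"
      by (simp add: fourier_coeff_eq circ_coeff_def left_diff_distrib right_diff_distrib diff_divide_distrib)
    then show "circ_coeff (\<lambda>\<theta>. g 1 (polar R \<theta>) - g 2 (polar R \<theta>)) n = 0" using coeffs by simp
  qed (use R_pos in auto)
  moreover have "integrable circ (\<lambda>\<theta>. g i (polar R \<theta>) * N (polar R \<theta>))" for i
    by (intro L2_mult_integrable gL circ_continuous_L2 polar_c)
  ultimately have "(LINT \<theta>|circ. g 1 (polar R \<theta>) * N (polar R \<theta>)) = (LINT \<theta>|circ. g 2 (polar R \<theta>) * N (polar R \<theta>))"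
    by (simp add: left_diff_distrib)
  then have E2: "green_form (v 1) (u 1) (grad \<phi>) (laplacian \<phi>) = green_form (v 2) (u 2) (grad \<phi>) (laplacian \<phi>)"
    unfolding trace_green[OF g v \<phi>] N by simp
  define a where "a i = (LINT x|?M. (\<Sum>j\<in>UNIV. v i x $ j * grad \<phi> x $ j))" for i
  define b where "b i = (LINT x|?M. u i x * \<phi> x)" for i
  define d where "d i = (LINT x|?M. u i x * laplacian \<phi> x)" for i
  have i1: "integrable ?M (\<lambda>x. \<Sum>j\<in>UNIV. v i x $ j * grad \<phi> x $ j)" for i
    by (intro Bochner_Integration.integrable_sum L2_mult_integrable L2_nth vL smooth_L2 smooth_grad sm)
  have i2: "integrable ?M (\<lambda>x. u i x * \<phi> x)" "integrable ?M (\<lambda>x. u i x * laplacian \<phi> x)" for i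
    by (intro L2_mult_integrable uL smooth_L2 smooth_laplacian sm)+
  have G1: "green_form (v i) (\<lambda>x. of_real c * u i x) (grad \<phi>) \<phi> = a i + of_real c * b i" for i
    using i1[of i] i2(1)[of i] by (simp add: green_form_def a_def b_def mult.assoc)
  have G2: "green_form (v i) (u i) (grad \<phi>) (laplacian \<phi>) = a i + d i" for i
    using i1[of i] i2(2)[of i] by (simp add: green_form_def a_def d_def)
  have "(LINT y|lebesgue. (indicator annulus y *\<^sub>R (u 1 y - u 2 y)) * (laplacian \<phi> y + - of_real c * \<phi> y))
      = (LINT y|?M. (u 1 y - u 2 y) * (laplacian \<phi> y + - of_real c * \<phi> y))"
    using sets_dom by (subst integral_restrict_space) auto
  also have "\<dots> = (LINT y|?M. (u 1 y * laplacian \<phi> y - u 2 y * laplacian \<phi> y) - (of_real c * (u 1 y * \<phi> y) - of_real c * (u 2 y * \<phi> y)))"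
    by (simp add: algebra_simps)
  also have "\<dots> = (d 1 - d 2) - (of_real c * b 1 - of_real c * b 2)"
    using i2 by (simp add: b_def d_def)
  also have "\<dots> = 0" using E1 E2 unfolding G1 G2 by (simp add: algebra_simps) algebra
  finally show "(LINT y|lebesgue. (indicator annulus y *\<^sub>R (u 1 y - u 2 y)) * (laplacian \<phi> y + - of_real c * \<phi> y)) = 0" .
qed

lemma zero_extension_vanishes:
  assumes u: "weak_helmholtz (- closure D) c (\<lambda>x. indicator annulus x *\<^sub>R h x)" and conn: "connected (- closure D)"
  shows "AE x in lebesgue_on annulus. h x = 0"
proof -
  define x0 where "x0 = polar (R + 1) 0"
  have nx: "norm x0 = R + 1" using R_pos by (simp add: x0_def norm_polar)
  have out: "y \<notin> annulus" if "y \<in> ball x0 1" for y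
    using that nx norm_triangle_sub[of x0 y] by (auto simp: dist_norm)
  have "AE y in lebesgue. y \<in> - closure D \<longrightarrow> indicator annulus y *\<^sub>R h y = 0"
  proof (rule weak_unique_continuation[OF u _ conn, of x0 1])
    show "x0 \<in> - closure D" using nx D_inside by (auto simp: subset_iff)
    show "AE y in lebesgue. y \<in> ball x0 1 \<longrightarrow> indicator annulus y *\<^sub>R h y = 0"
      using out by (intro AE_I2) auto
  qed auto
  then have "AE y in lebesgue. y \<in> annulus \<longrightarrow> h y = 0"
    by eventually_elim (auto simp: indicator_def)
  then show ?thesis using sets_dom by (subst AE_restrict_space_iff) auto
qed

theorem coupled_uniqueness:
  fixes p q :: "nat \<Rightarrow> real^2 \<Rightarrow> complex"
  assumes \<kappa>: "\<kappa> > 0" and conn: "connected (- closure D)"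
    and sol: "\<And>i. coupled_solution D R \<kappa> \<alpha> (p i) (q i)"
  shows "AE x in lebesgue_on annulus. p 1 x = p 2 x \<and> q 1 x = q 2 x"
proof -
  let ?M = "lebesgue_on annulus"
  have \<kappa>R: "\<kappa> * R > 0" using \<kappa> R_pos by simp
  have "\<forall>i. \<exists>v w g p0 q0 lD mD lR mR. solution_data \<kappa> \<alpha> (p i) (q i) v w g p0 q0 lD mD lR mR"
    using solution_data_exists[OF sol] by blast
  then obtain v w g p0 q0 lD mD lR mR where
    data: "\<And>i. solution_data \<kappa> \<alpha> (p i) (q i) (v i) (w i) (g i) (p0 i) (q0 i) (lD i) (mD i) (lR i) (mR i)"
    by metis
  have v: "has_L2_gradient annulus (p i) (v i)" and w: "has_L2_gradient annulus (q i) (w i)"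
    and fp: "has_L2_laplacian annulus (p i) (\<lambda>x. of_real (- (\<kappa>\<^sup>2)) * p i x)"
    and fq: "has_L2_laplacian annulus (q i) (\<lambda>x. of_real (\<kappa>\<^sup>2) * q i x)"
    and gp: "has_trace annulus \<sigma>D (p i) (g i)" and gq: "has_trace annulus \<sigma>D (q i) (g i)"
    and lD: "has_weak_normal_derivative annulus \<sigma>D \<sigma>R (p i) (lD i)" and mD: "has_weak_normal_derivative annulus \<sigma>D \<sigma>R (q i) (mD i)"
    and lm: "\<And>\<psi>. \<psi> \<in> Hhalf \<sigma>D \<Longrightarrow> lD i \<psi> = mD i \<psi>"
    and p0: "has_trace annulus \<sigma>R (p i) (p0 i)" and lR: "has_weak_normal_derivative annulus \<sigma>R \<sigma>D (p i) (lR i)"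
    and lT: "\<And>\<psi>. \<psi> \<in> Hhalf \<sigma>R \<Longrightarrow> lR i \<psi> = T1 \<kappa> R (p0 i) \<psi> - g1 \<kappa> \<alpha> R \<psi>"
    and q0: "has_trace annulus \<sigma>R (q i) (q0 i)" and mR: "has_weak_normal_derivative annulus \<sigma>R \<sigma>D (q i) (mR i)"
    and mT: "\<And>\<psi>. \<psi> \<in> Hhalf \<sigma>R \<Longrightarrow> mR i \<psi> = T2 \<kappa> R (q0 i) \<psi>" for i
    using data[of i] unfolding solution_data_def by simp_all
  have H: "p0 i \<in> Hhalf \<sigma>R" "q0 i \<in> Hhalf \<sigma>R" "g i \<in> Hhalf \<sigma>D" for i
    using p0[of i] q0[of i] gp[of i] by (simp_all add: has_trace_def)
  have L: "p i \<in> L2 ?M" "q i \<in> L2 ?M" "v i \<in> L2 ?M" "w i \<in> L2 ?M" for i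
    using p0[of i] q0[of i] v[of i] w[of i] by (simp_all add: has_trace_def H1_def has_L2_gradient_def)
  define A where "A i j = green_form (v i) (\<lambda>x. of_real (- (\<kappa>\<^sup>2)) * p i x) (\<lambda>x. \<chi> k. cnj (v j x $ k)) (\<lambda>x. cnj (p j x))" for i j
  define B where "B i j = green_form (w i) (\<lambda>x. of_real (\<kappa>\<^sup>2) * q i x) (\<lambda>x. \<chi> k. cnj (w j x $ k)) (\<lambda>x. cnj (q j x))" for i j
  define M where "M i j = mD i (\<lambda>x. cnj (g j x))" for i j
  define tp where "tp i j = dtn (\<lambda>n. h_symbol n (\<kappa> * R)) R (p0 i) (\<lambda>x. cnj (p0 j x))" for i j
  define tq where "tq i j = dtn (\<lambda>n. k_symbol n (\<kappa> * R)) R (q0 i) (\<lambda>x. cnj (q0 j x))" for i j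
  have A: "A i j = tp i j - g1 \<kappa> \<alpha> R (\<lambda>x. cnj (p0 j x)) + M i j" for i j
    using coupled_green[OF lR lD v fp p0 gp v, of i j] lT[OF Hhalf_cnj[OF H(1)], of i j] lm[OF Hhalf_cnj[OF H(3)], of i j]
    by (simp add: A_def M_def tp_def T1_def)
  have B: "B i j = tq i j + M i j" for i j
    using coupled_green[OF mR mD w fq q0 gq w, of i j] mT[OF Hhalf_cnj[OF H(2)], of i j]
    by (simp add: B_def M_def tq_def T2_def)
  define EA where "EA = (LINT x|?M. (norm (v 1 x - v 2 x))\<^sup>2 + (- (\<kappa>\<^sup>2)) * (norm (p 1 x - p 2 x))\<^sup>2)"
  define EB where "EB = (LINT x|?M. (norm (w 1 x - w 2 x))\<^sup>2 + \<kappa>\<^sup>2 * (norm (q 1 x - q 2 x))\<^sup>2)"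
  have EA: "A 1 1 - A 1 2 - A 2 1 + A 2 2 = of_real EA"
    unfolding A_def EA_def by (rule green_form_polarized) (rule L)+
  have EB: "B 1 1 - B 1 2 - B 2 1 + B 2 2 = of_real EB"
    unfolding B_def EB_def by (rule green_form_polarized) (rule L)+
  obtain C where C: "C \<ge> 0" "\<And>n. norm (h_symbol n (\<kappa> * R)) \<le> C * (1 + \<bar>of_int n\<bar>)"
    using h_symbol_bound[OF \<kappa>R] by blast
  obtain C' where C': "C' \<ge> 0" "\<And>n. norm (k_symbol n (\<kappa> * R)) \<le> C' * (1 + \<bar>of_int n\<bar>)"
    using k_symbol_bound[OF \<kappa>R] by blast
  define dp where "dp n = (norm (fourier_coeff R (p0 1) n - fourier_coeff R (p0 2) n))\<^sup>2" for n
  define dq where "dq n = (norm (fourier_coeff R (q0 1) n - fourier_coeff R (q0 2) n))\<^sup>2" for n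
  have sp: "(\<lambda>n. 2 * pi * (h_symbol n (\<kappa> * R) * of_real (dp n))) summable_on UNIV"
    "tp 1 1 - tp 1 2 - tp 2 1 + tp 2 2 = (\<Sum>\<^sub>\<infinity>n. 2 * pi * (h_symbol n (\<kappa> * R) * of_real (dp n)))"
    unfolding tp_def dp_def by (rule dtn_polarized[OF R_pos H(1) C(2,1)])+
  have sq: "(\<lambda>n. 2 * pi * (k_symbol n (\<kappa> * R) * of_real (dq n))) summable_on UNIV"
    "tq 1 1 - tq 1 2 - tq 2 1 + tq 2 2 = (\<Sum>\<^sub>\<infinity>n. 2 * pi * (k_symbol n (\<kappa> * R) * of_real (dq n)))"
    unfolding tq_def dq_def by (rule dtn_polarized[OF R_pos H(2) C'(2,1)])+
  define MM where "MM = M 1 1 - M 1 2 - M 2 1 + M 2 2"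
  have SA: "of_real EA = (\<Sum>\<^sub>\<infinity>n. 2 * pi * (h_symbol n (\<kappa> * R) * of_real (dp n))) + MM"
    unfolding EA[symmetric] sp(2)[symmetric] MM_def A by simp
  have SB: "of_real EB = (\<Sum>\<^sub>\<infinity>n. 2 * pi * (k_symbol n (\<kappa> * R) * of_real (dq n))) + MM"
    unfolding EB[symmetric] sq(2)[symmetric] MM_def B by simp
  have Im_sum: "Im (\<Sum>\<^sub>\<infinity>n. f n) = (\<Sum>\<^sub>\<infinity>n. Im (f n))" "(\<lambda>n. Im (f n)) summable_on UNIV"
    if "f summable_on UNIV" for f :: "int \<Rightarrow> complex"
    using has_sum_bounded_linear[OF bounded_linear_Im has_sum_infsum[OF that]]
    by (auto simp: infsumI has_sum_imp_summable)
  have Re_sum: "Re (\<Sum>\<^sub>\<infinity>n. f n) = (\<Sum>\<^sub>\<infinity>n. Re (f n))"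
    if "f summable_on UNIV" for f :: "int \<Rightarrow> complex"
    using has_sum_bounded_linear[OF bounded_linear_Re has_sum_infsum[OF that]] by (simp add: infsumI)
  \<comment> \<open>the real symbol of the modified problem makes the cavity term real\<close>
  have "Im (\<Sum>\<^sub>\<infinity>n. 2 * pi * (k_symbol n (\<kappa> * R) * of_real (dq n))) = 0"
    unfolding Im_sum(1)[OF sq(1)] by (simp add: k_symbol_Im)
  then have "Im MM = 0" using arg_cong[OF SB, of Im] by simp
  then have "Im (\<Sum>\<^sub>\<infinity>n. 2 * pi * (h_symbol n (\<kappa> * R) * of_real (dp n))) = 0"
    using arg_cong[OF SA, of Im] by simp
  then have "(\<Sum>\<^sub>\<infinity>n. Im (2 * pi * (h_symbol n (\<kappa> * R) * of_real (dp n)))) = 0"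
    unfolding Im_sum(1)[OF sp(1)] .
  then have le: "(\<Sum>\<^sub>\<infinity>n. Im (2 * pi * (h_symbol n (\<kappa> * R) * of_real (dp n)))) \<le> 0" by (rule eq_refl)
  have nonneg: "0 \<le> Im (2 * pi * (h_symbol n (\<kappa> * R) * of_real (dp n)))" for n
  proof -
    have "0 \<le> 2 * pi * (Im (h_symbol n (\<kappa> * R)) * dp n)"
      using h_symbol_Im_pos[OF \<kappa>R, of n] by (intro mult_nonneg_nonneg) (auto simp: dp_def)
    then show ?thesis by simp
  qed
  have term_zero: "Im (2 * pi * (h_symbol n (\<kappa> * R) * of_real (dp n))) = 0" for n
    by (rule nonneg_infsum_le_0D[OF le Im_sum(2)[OF sp(1)] nonneg UNIV_I])
  have "dp n = 0" for n
    using term_zero[of n] h_symbol_Im_pos[OF \<kappa>R, of n] by simp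
  then have coeffs: "fourier_coeff R (p0 1) n = fourier_coeff R (p0 2) n" for n
    by (simp add: dp_def)
  have same_T: "T1 \<kappa> R (p0 1) \<psi> = T1 \<kappa> R (p0 2) \<psi>" for \<psi>
    unfolding T1_def dtn_def coeffs ..
  \<comment> \<open>vanishing Cauchy data on the circle\<close>
  have "weak_helmholtz (- closure D) (- of_real (- (\<kappa>\<^sup>2))) (\<lambda>x. indicator annulus x *\<^sub>R (p 1 x - p 2 x))"
    by (rule zero_extension_weak_helmholtz[OF lR v fp p0 coeffs]) (simp only: lT same_T)
  from zero_extension_vanishes[OF this conn]
  have peq: "AE x in ?M. p 1 x = p 2 x" by simp
  have veq: "AE x in ?M. v 1 x = v 2 x"
    by (rule has_L2_gradient_unique[OF v v peq L(1) L(1)])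
  have feq: "AE x in ?M. of_real (- (\<kappa>\<^sup>2)) * p 1 x = of_real (- (\<kappa>\<^sup>2)) * p 2 x"
    using peq by eventually_elim simp
  \<comment> \<open>with the first components equal, the cavity terms drop out of the second identity\<close>
  have "lD 1 (\<lambda>x. cnj (g j x)) = lD 2 (\<lambda>x. cnj (g j x))" for j
    by (rule normal_derivative_cong[OF lD v fp lD v fp veq feq gp])
  then have "M 1 j = M 2 j" for j
    unfolding M_def using lm[OF Hhalf_cnj[OF H(3)]] by metis
  then have "MM = 0" by (simp add: MM_def)
  then have "EB = Re (\<Sum>\<^sub>\<infinity>n. 2 * pi * (k_symbol n (\<kappa> * R) * of_real (dq n)))"
    using arg_cong[OF SB, of Re] by simp
  also have "\<dots> = (\<Sum>\<^sub>\<infinity>n. Re (2 * pi * (k_symbol n (\<kappa> * R) * of_real (dq n))))"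
    by (rule Re_sum[OF sq(1)])
  also have "\<dots> \<le> 0"
  proof -
    have "0 \<le> 2 * pi * (- Re (k_symbol n (\<kappa> * R)) * dq n)" for n
      using k_symbol_Re_nonpos[OF \<kappa>R, of n] by (intro mult_nonneg_nonneg) (auto simp: dq_def)
    then have "0 \<le> (\<Sum>\<^sub>\<infinity>n. - Re (2 * pi * (k_symbol n (\<kappa> * R) * of_real (dq n))))"
      by (intro infsum_nonneg) simp
    then show ?thesis by (simp only: infsum_uminus neg_0_le_iff_le)
  qed
  finally have EB0: "EB \<le> 0" .
  let ?e = "\<lambda>x. (norm (w 1 x - w 2 x))\<^sup>2 + \<kappa>\<^sup>2 * (norm (q 1 x - q 2 x))\<^sup>2"
  have "integrable ?M ?e"
    using L2_diff[OF L(4) L(4), of 1 2] L2_diff[OF L(2) L(2), of 1 2] by (auto simp: L2_iff)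
  moreover have "(LINT x|?M. ?e x) = 0"
    using EB0 unfolding EB_def by (intro antisym) auto
  ultimately have "AE x in ?M. ?e x = 0"
    by (subst (asm) integral_nonneg_eq_0_iff_AE) auto
  then have "AE x in ?M. q 1 x = q 2 x"
    by eventually_elim (use \<kappa> in \<open>simp add: add_nonneg_eq_0_iff\<close>)
  with peq show ?thesis by eventually_elim simp
qed

end

theorem theorem4p2:
  fixes D :: "(real^2) set" and R \<kappa> \<alpha> :: real
    and p1 q1 p2 q2 :: "real^2 \<Rightarrow> complex"
  assumes "open D" and "bounded D" and "lipschitz_boundary D"
    and "R > 0" and "closure D \<subseteq> ball 0 R"
    and "connected (- closure D)" and "connected (ball 0 R - closure D)"
    and "\<kappa> > 0" and "\<alpha> \<in> {0..<2*pi}"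
    and "coupled_solution D R \<kappa> \<alpha> p1 q1"
    and "coupled_solution D R \<kappa> \<alpha> p2 q2"
  shows "AE x in lebesgue_on (ball 0 R - closure D). p1 x = p2 x \<and> q1 x = q2 x"
proof -
  interpret cavity D R by standard (use assms in auto)
  have "coupled_solution D R \<kappa> \<alpha> (if i = 1 then p1 else p2) (if i = 1 then q1 else q2)" for i :: nat
    using assms by simp
  from coupled_uniqueness[OF \<open>\<kappa> > 0\<close> \<open>connected (- closure D)\<close>, of \<alpha> "\<lambda>i. if i = 1 then p1 else p2" "\<lambda>i. if i = 1 then q1 else q2", OF this]
  show ?thesis by simp
qed

end
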